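(* There is an absolute constant $C_m>0$ such that for every $\varepsilon>0$ the estimator $\hat M$ of the minimum (constructed in the context) satisfies $$\mathbb E_f|\hat M-M(f)|<449\,\rho_m(\varepsilon;f)\le C_m\,R_m(\varepsilon;f)\qquad\text{for all } f\in\mathcal F.$$
   Context: $\mathcal F$ is the collection of convex functions $f:[0,1]\to\mathbb R$ with a unique minimizer $Z(f)=\arg\min_{0\le t\le1}f(t)$; $M(f)=f(Z(f))$. One observes the white noise model $dY(t)=f(t)\,dt+\varepsilon\,dW(t)$, $0\le t\le1$, $W$ a standard Brownian motion, $\varepsilon>0$; $\mathbb E_f$ is expectation under drift $f$ (including auxiliary randomness). Benchmark: $R_m(\varepsilon;f)=\sup_{g\in\mathcal F}\inf_{\hat M}\max_{h\in\{f,g\}}\mathbb E_h|\hat M-M(h)|$, infimum over all estimators based on $Y$. Geometric quantity: with $f_u(t)=\max\{f(t),u\}$ and $\|\cdot\|_2$ the $L_2[0,1]$ norm, $\rho_m(\varepsilon;f)=\sup\{u-M(f):\|f-f_u\|_2\le\varepsilon\}$. Construction of $\hat M$. Sample splitting: let $B_1,B_2$ be independent standard Brownian motions, independent of $Y$, and set $Y_l=Y+\frac{\sqrt2}{2}\varepsilon B_1+\frac{\sqrt6}{2}\varepsilon B_2$, $Y_s=Y+\frac{\sqrt2}{2}\varepsilon B_1-\frac{\sqrt6}{2}\varepsilon B_2$, $Y_e=Y-\sqrt2\,\varepsilon B_1$. Localization: $m_j=2^{-j}$, $t_{j,i}=i\,m_j$. For $j\ge0$, $1\le i\le2^j$ let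 $X_{j,i}=\int_{t_{j,i-1}}^{t_{j,i}}dY_l(t)$, $\tilde X_{j,i}=\int_{t_{j,i-1}}^{t_{j,i}}dY_s(t)$ and $\bar X_{j,i}=\int_{t_{j,i-1}}^{t_{j,i}}dY_e(t)$; for integers $i\notin\{1,\dots,2^j\}$ set $X_{j,i}=\tilde X_{j,i}=+\infty$. Let $\hat i_0=1$ and, for $j\ge1$, $\hat i_j=\arg\min_{2\hat i_{j-1}-2\le i\le2\hat i_{j-1}+1}X_{j,i}$. Stopping: $T_j=\min\{\tilde X_{j,\hat i_j+6}-\tilde X_{j,\hat i_j+5},\ \tilde X_{j,\hat i_j-6}-\tilde X_{j,\hat i_j-5}\}$, with the convention $+\infty-x=+\infty$ and $\min\{+\infty,x\}=x$ for all $-\infty\le x\le\infty$. Let $\sigma_j^2=6m_j\varepsilon^2$ and $\hat j=\min\{j:T_j/\sigma_j\le2\}$. Estimator: let $$\tilde i_{\hat j}=\hat i_{\hat j}+2\Big(\mathbf 1\{\tilde X_{\hat j,\hat i_{\hat j}+6}-\tilde X_{\hat j,\hat i_{\hat j}+5}\le2\sigma_{\hat j}\}-\mathbf 1\{\tilde X_{\hat j,\hat i_{\hat j}-6}-\tilde X_{\hat j,\hat i_{\hat j}-5}\le2\sigma_{\hat j}\}\Big),\qquad \hat M=\frac1{m_{\hat j}}\bar X_{\hat j,\tilde i_{\hat j}}.$$ *)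

theory Defs
  imports "HOL-Probability.Probability"
begin

section \<open>Convex functions on the unit interval\<close>

text \<open>Functions on \<open>[0,1]\<close> are represented by functions on the reals of which only the values on
  \<open>{0..1}\<close> are ever used.\<close>

definition convex_unique_min :: "(real \<Rightarrow> real) set" where
  "convex_unique_min =
     {f. convex_on {0..1} f \<and> (\<exists>!t. is_arg_min f (\<lambda>t. t \<in> {0..1}) t)}"

definition minimizer :: "(real \<Rightarrow> real) \<Rightarrow> real" where
  "minimizer f = arg_min_on f {0..1}"

definition minval :: "(real \<Rightarrow> real) \<Rightarrow> real" where
  "minval f = f (minimizer f)"

definition l2_norm :: "(real \<Rightarrow> real) \<Rightarrow> real" where
  "l2_norm h = sqrt (LINT t:{0..1}|lborel. (h t)\<^sup>2)"

text \<open>For \<open>f\<close> in \<^const>\<open>convex_unique_min\<close> the set below contains \<open>0\<close> and is bounded above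
  (a real-valued convex function is bounded on \<open>[0,1]\<close>), so the supremum in the reals is the
  genuine one.\<close>

definition rho_m :: "real \<Rightarrow> (real \<Rightarrow> real) \<Rightarrow> real" where
  "rho_m \<epsilon> f = Sup {u - minval f | u. l2_norm (\<lambda>t. f t - max (f t) u) \<le> \<epsilon>}"


section \<open>Brownian motion and the white noise model\<close>

definition brownian_fdd :: "'a measure \<Rightarrow> (real \<Rightarrow> 'a \<Rightarrow> real) \<Rightarrow> bool" where
  "brownian_fdd P W \<longleftrightarrow>
     prob_space P \<and>
     (\<forall>t\<in>{0..1}. W t \<in> borel_measurable P) \<and>
     (AE \<omega> in P. W 0 \<omega> = 0) \<and>
     (\<forall>s t. 0 \<le> s \<and> s < t \<and> t \<le> 1 \<longrightarrow>
        distributed P lborel (\<lambda>\<omega>. W t \<omega> - W s \<omega>) (normal_density 0 (sqrt (t - s)))) \<and>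
     (\<forall>n (\<tau> :: nat \<Rightarrow> real). \<tau> ` {..n} \<subseteq> {0..1} \<and> strict_mono_on {..n} \<tau> \<longrightarrow>
        prob_space.indep_vars P (\<lambda>_. borel)
          (\<lambda>i \<omega>. W (\<tau> (Suc i)) \<omega> - W (\<tau> i) \<omega>) {..<n})"

definition standard_brownian_motion :: "'a measure \<Rightarrow> (real \<Rightarrow> 'a \<Rightarrow> real) \<Rightarrow> bool" where
  "standard_brownian_motion P W \<longleftrightarrow>
     brownian_fdd P W \<and> (AE \<omega> in P. continuous_on {0..1} (\<lambda>t. W t \<omega>))"

abbreviation path_space :: "(real \<Rightarrow> real) measure" where
  "path_space \<equiv> PiM {0..1} (\<lambda>_. borel)"

definition independent_brownian_motions ::
    "'a measure \<Rightarrow> (real \<Rightarrow> 'a \<Rightarrow> real) \<Rightarrow> (real \<Rightarrow> 'a \<Rightarrow> real) \<Rightarrow> (real \<Rightarrow> 'a \<Rightarrow> real) \<Rightarrow> bool" where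
  "independent_brownian_motions P W B1 B2 \<longleftrightarrow>
     standard_brownian_motion P W \<and> standard_brownian_motion P B1 \<and>
     standard_brownian_motion P B2 \<and>
     prob_space.indep_vars P (\<lambda>_. path_space)
       (\<lambda>k \<omega>. \<lambda>t\<in>{0..1}. ([W, B1, B2] ! k) t \<omega>) {..<3}"

definition observation ::
    "real \<Rightarrow> (real \<Rightarrow> real) \<Rightarrow> (real \<Rightarrow> 'a \<Rightarrow> real) \<Rightarrow> real \<Rightarrow> 'a \<Rightarrow> real" where
  "observation \<epsilon> f W t \<omega> = (LINT x:{0..t}|lborel. f x) + \<epsilon> * W t \<omega>"

text \<open>The law of Brownian motion on the product sigma-algebra over \<open>[0,1]\<close>. It is uniquely
  determined by its finite-dimensional distributions, so the choice operator picks the only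
  candidate. Path continuity cannot be required here, since the set of continuous functions is
  not measurable in the product; nothing is lost, because by the Doob--Dynkin lemma the quantities
  measurable with respect to the observed process are exactly the product-measurable functions of
  its path, and the distribution of such a function depends on the finite-dimensional
  distributions only.\<close>

definition wiener_law :: "(real \<Rightarrow> real) measure" where
  "wiener_law = (SOME Q. sets Q = sets path_space \<and> brownian_fdd Q (\<lambda>t w. w t))"

definition white_noise_law :: "real \<Rightarrow> (real \<Rightarrow> real) \<Rightarrow> (real \<Rightarrow> real) measure" where
  "white_noise_law \<epsilon> f =
     distr wiener_law path_space (\<lambda>w. \<lambda>t\<in>{0..1}. observation \<epsilon> f (\<lambda>s v. v s) t w)"


section \<open>The benchmark\<close>

text \<open>A (possibly randomized) estimator is a Markov kernel sending the observed path to the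
  conditional distribution of the estimate; ordinary estimators are the kernels
  \<open>y \<mapsto> return borel (\<delta> y)\<close>. Expectations are nonnegative integrals with values in
  \<^typ>\<open>ennreal\<close>, so an infinite risk counts as \<open>\<infinity>\<close>.\<close>

definition estimators :: "((real \<Rightarrow> real) \<Rightarrow> real measure) set" where
  "estimators = path_space \<rightarrow>\<^sub>M prob_algebra borel"

definition min_risk ::
    "real \<Rightarrow> (real \<Rightarrow> real) \<Rightarrow> ((real \<Rightarrow> real) \<Rightarrow> real measure) \<Rightarrow> ennreal" where
  "min_risk \<epsilon> h K =
     (\<integral>\<^sup>+ y. (\<integral>\<^sup>+ m. ennreal \<bar>m - minval h\<bar> \<partial>K y) \<partial>white_noise_law \<epsilon> h)"

definition R_m :: "real \<Rightarrow> (real \<Rightarrow> real) \<Rightarrow> ennreal" where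
  "R_m \<epsilon> f =
     (SUP g\<in>convex_unique_min. INF K\<in>estimators. MAX h\<in>{f, g}. min_risk \<epsilon> h K)"


section \<open>The estimator of the minimum\<close>

text \<open>The construction is written as a functional of the paths \<open>yl\<close>, \<open>ys\<close>, \<open>ye\<close> of the three
  split processes, with noise level \<open>\<epsilon>\<close>.\<close>

definition mesh :: "nat \<Rightarrow> real" where
  "mesh j = 1 / 2 ^ j"

definition block_incr :: "(real \<Rightarrow> real) \<Rightarrow> nat \<Rightarrow> int \<Rightarrow> real" where
  "block_incr y j i = y (of_int i * mesh j) - y (of_int (i - 1) * mesh j)"

definition block_incr_ext :: "(real \<Rightarrow> real) \<Rightarrow> nat \<Rightarrow> int \<Rightarrow> ereal" where
  "block_incr_ext y j i = (if 1 \<le> i \<and> i \<le> 2 ^ j then ereal (block_incr y j i) else \<infinity>)"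

text \<open>Ties in the argmin, which have probability zero, are broken by the smallest index.\<close>

primrec loc_index :: "(real \<Rightarrow> real) \<Rightarrow> nat \<Rightarrow> int" where
  "loc_index yl 0 = 1"
| "loc_index yl (Suc j) =
     (let I = {2 * loc_index yl j - 2 .. 2 * loc_index yl j + 1} in
      Min {i \<in> I. \<forall>k\<in>I. block_incr_ext yl (Suc j) i \<le> block_incr_ext yl (Suc j) k})"

text \<open>Subtraction on \<^typ>\<open>ereal\<close> satisfies \<open>\<infinity> - x = \<infinity>\<close> for every \<open>x\<close>, including \<open>x = \<infinity>\<close>,
  as required for the out-of-range blocks.\<close>

definition right_gap :: "(real \<Rightarrow> real) \<Rightarrow> (real \<Rightarrow> real) \<Rightarrow> nat \<Rightarrow> ereal" where
  "right_gap yl ys j =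
     block_incr_ext ys j (loc_index yl j + 6) - block_incr_ext ys j (loc_index yl j + 5)"

definition left_gap :: "(real \<Rightarrow> real) \<Rightarrow> (real \<Rightarrow> real) \<Rightarrow> nat \<Rightarrow> ereal" where
  "left_gap yl ys j =
     block_incr_ext ys j (loc_index yl j - 6) - block_incr_ext ys j (loc_index yl j - 5)"

definition stop_stat :: "(real \<Rightarrow> real) \<Rightarrow> (real \<Rightarrow> real) \<Rightarrow> nat \<Rightarrow> ereal" where
  "stop_stat yl ys j = min (right_gap yl ys j) (left_gap yl ys j)"

definition sigma_level :: "real \<Rightarrow> nat \<Rightarrow> real" where
  "sigma_level \<epsilon> j = sqrt (6 * mesh j * \<epsilon>\<^sup>2)"

text \<open>A stopping level exists almost surely; otherwise the value is unspecified.\<close>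

definition stop_level :: "real \<Rightarrow> (real \<Rightarrow> real) \<Rightarrow> (real \<Rightarrow> real) \<Rightarrow> nat" where
  "stop_level \<epsilon> yl ys = (LEAST j. stop_stat yl ys j / ereal (sigma_level \<epsilon> j) \<le> 2)"

definition final_index :: "real \<Rightarrow> (real \<Rightarrow> real) \<Rightarrow> (real \<Rightarrow> real) \<Rightarrow> int" where
  "final_index \<epsilon> yl ys =
     (let j = stop_level \<epsilon> yl ys in
      loc_index yl j +
        2 * (of_bool (right_gap yl ys j \<le> ereal (2 * sigma_level \<epsilon> j))
           - of_bool (left_gap yl ys j \<le> ereal (2 * sigma_level \<epsilon> j))))"

definition min_estimate ::
    "real \<Rightarrow> (real \<Rightarrow> real) \<Rightarrow> (real \<Rightarrow> real) \<Rightarrow> (real \<Rightarrow> real) \<Rightarrow> real" where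
  "min_estimate \<epsilon> yl ys ye =
     (let j = stop_level \<epsilon> yl ys in
      1 / mesh j * block_incr ye j (final_index \<epsilon> yl ys))"

definition M_hat ::
    "real \<Rightarrow> (real \<Rightarrow> 'a \<Rightarrow> real) \<Rightarrow> (real \<Rightarrow> 'a \<Rightarrow> real) \<Rightarrow> (real \<Rightarrow> 'a \<Rightarrow> real) \<Rightarrow> 'a \<Rightarrow> real" where
  "M_hat \<epsilon> Y B1 B2 \<omega> =
     min_estimate \<epsilon>
       (\<lambda>t. Y t \<omega> + sqrt 2 / 2 * \<epsilon> * B1 t \<omega> + sqrt 6 / 2 * \<epsilon> * B2 t \<omega>)
       (\<lambda>t. Y t \<omega> + sqrt 2 / 2 * \<epsilon> * B1 t \<omega> - sqrt 6 / 2 * \<epsilon> * B2 t \<omega>)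
       (\<lambda>t. Y t \<omega> - sqrt 2 * \<epsilon> * B1 t \<omega>)"

end

theory Submission
  imports Defs
begin

text \<open>
  Upper bound. The three split processes carry independent noises, whose block averages at level \<open>n\<close>
  have standard deviation \<open>\<tau>\<^sub>n\<close>, with \<open>\<tau>\<^sub>n\<^sup>2\<close> doubling from level to level. Let \<open>J\<close> be the first level
  with \<open>13 m\<^sub>J \<rho>\<^sup>2 < \<epsilon>\<^sup>2\<close>; then \<open>\<tau>\<^sub>J \<le> sqrt 78 \<rho>\<close>. From level \<open>J\<close> on, and whenever the localized block is
  at least 7 blocks away from the block of the minimizer, one of the two monitored increments has a
  small mean, so that given the localization path the procedure goes on with probability at most
  \<open>1/16\<close>. Along a fixed path the monitored pieces of different levels are disjoint, so these
  probabilities multiply; as the distance to the minimizer at most doubles per level, being far off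
  is unlikely enough. By convexity the loss at the stopping level is bounded by noise terms with
  second moments of order \<open>\<tau>\<^sub>n\<^sup>2\<close>, whose growth is beaten by the factor \<open>1/16\<close>. The risk is thus at
  most \<open>50 \<tau>\<^sub>J\<close>, and \<open>50 sqrt 78 < 449\<close>.

  Lower bound. Filling \<open>f\<close> up to a level \<open>u\<close> changes it by at most \<open>\<epsilon>\<close> in \<open>L\<^sub>2\<close>, and a tilt by
  \<open>\<epsilon> (t - Z)\<^sup>2\<close> makes the minimizer unique. The Cauchy--Schwarz inequality for shifted Gaussian laws
  bounds \<open>P\<^sub>g(A)\<^sup>2\<close> by a constant times \<open>P\<^sub>f(A)\<close>, first on cylinder sets and then, by approximation, on
  all events, so that no estimator does well for both functions.
\<close>

section \<open>Independent families and normal laws\<close>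

text \<open>The explicit constant meets two obstacles: a block selected by the data has biased
  noise, and the loss can arise on any of infinitely many levels. The search window contains both
  halves of the current block, so the observed average can only decrease along the path. Hence the
  excess at a level with offset at least 2 is charged to the one level where the path left the
  neighbours of the minimizer, plus the noise of the block now selected. The bias of the latter is
  removed by summing over all far blocks, each weighted with a bound for the chance of still running
  at its offset. These weights are summable: a far level at most doubles the distance but costs a
  factor 1/16 < 1/4, so they decay like the inverse square of the offset. The error splits into four
  terms, bounded by 2 sqrt 39, 2 sqrt 29, 2 sqrt 32 and (8 sqrt 2 + 1) 32/29 times the noise level
  at J, together below 50. On the side of the benchmark, the \<open>SOME\<close> in
  \<open>wiener_law\<close> carries no information until a candidate is exhibited; this is why
  Levy's construction is carried out.\<close>

lemma (in prob_space) indep_vars_ungroup: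
  fixes Y :: "'i \<Rightarrow> 'c \<Rightarrow> 'a \<Rightarrow> 'b"
  assumes fin: "finite I" "finite C"
    and groups: "indep_vars (\<lambda>i. PiM C N) (\<lambda>i \<omega>. \<lambda>c\<in>C. Y i c \<omega>) I"
    and within: "\<And>i. i \<in> I \<Longrightarrow> indep_vars N (Y i) C"
  shows "indep_vars (\<lambda>p. N (snd p)) (\<lambda>p. Y (fst p) (snd p)) (I \<times> C)"
proof (cases "I = {} \<or> C = {}")
  case True
  then have "I \<times> C = {}" by auto
  then show ?thesis by (simp only:) (simp add: indep_vars_def2 indep_sets_def)
next
  case False
  have rv: "random_variable (N c) (Y i c)" if "i \<in> I" "c \<in> C" for i c
    using within[OF that(1)] that(2) by (auto simp: indep_vars_def2)
  have "prob (\<Inter>p\<in>I \<times> C. Y (fst p) (snd p) -` A p \<inter> space M) =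
      (\<Prod>p\<in>I \<times> C. prob (Y (fst p) (snd p) -` A p \<inter> space M))"
    if A: "A \<in> (\<Pi> p\<in>I \<times> C. sets (N (snd p)))" for A
  proof -
    have A': "A (i, c) \<in> sets (N c)" if "i \<in> I" "c \<in> C" for i c
      using A that by (auto simp: Pi_iff)
    \<comment> \<open>The rectangle of a group is a single event about the group vector, so a
      probability of rectangles factors first over the groups and then inside each group.\<close>
    let ?B = "\<lambda>i. \<Pi>\<^sub>E c\<in>C. A (i, c)"
    have B: "(\<lambda>\<omega>. \<lambda>c\<in>C. Y i c \<omega>) -` ?B i \<inter> space M = (\<Inter>c\<in>C. Y i c -` A (i, c) \<inter> space M)"
      if "i \<in> I" for i
      using False by (auto simp: PiE_iff)
    have "(\<Inter>p\<in>I \<times> C. Y (fst p) (snd p) -` A p \<inter> space M) =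
        (\<Inter>i\<in>I. (\<lambda>\<omega>. \<lambda>c\<in>C. Y i c \<omega>) -` ?B i \<inter> space M)"
      using False by (auto simp: B PiE_iff)
    also have "prob \<dots> = (\<Prod>i\<in>I. prob ((\<lambda>\<omega>. \<lambda>c\<in>C. Y i c \<omega>) -` ?B i \<inter> space M))"
      using False fin by (intro indep_varsD_finite[OF groups]) (auto intro!: sets_PiM_I_finite A')
    also have "\<dots> = (\<Prod>i\<in>I. \<Prod>c\<in>C. prob (Y i c -` A (i, c) \<inter> space M))"
    proof (intro prod.cong refl)
      fix i assume i: "i \<in> I"
      show "prob ((\<lambda>\<omega>. \<lambda>c\<in>C. Y i c \<omega>) -` ?B i \<inter> space M) = (\<Prod>c\<in>C. prob (Y i c -` A (i, c) \<inter> space M))"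
        unfolding B[OF i] by (rule indep_varsD_finite[OF within[OF i]]) (use False fin A' i in auto)
    qed
    also have "\<dots> = (\<Prod>p\<in>I \<times> C. prob (Y (fst p) (snd p) -` A p \<inter> space M))"
      by (simp add: prod.cartesian_product case_prod_beta)
    finally show ?thesis .
  qed
  then show ?thesis
    using False fin rv
    by (subst indep_vars_finite[where E = "\<lambda>p. sets (N (snd p))"])
       (auto simp: sets.sigma_sets_eq sets.Int_stable sets.space_closed)
qed

lemma (in prob_space) indep_vars_group_fst:
  assumes X: "indep_vars (\<lambda>p. N (snd p)) X (I \<times> C)"
  shows "indep_vars (\<lambda>i. PiM C N) (\<lambda>i \<omega>. \<lambda>c\<in>C. X (i, c) \<omega>) I"
proof -
  have "indep_vars (\<lambda>i. PiM ({i} \<times> C) (\<lambda>p. N (snd p))) (\<lambda>i \<omega>. restrict (\<lambda>p. X p \<omega>) ({i} \<times> C)) I"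
    by (intro indep_vars_restrict[OF X]) (auto simp: disjoint_family_on_def)
  moreover have "(\<lambda>v. \<lambda>c\<in>C. v (i, c)) \<in> measurable (PiM ({i} \<times> C) (\<lambda>p. N (snd p))) (PiM C N)" for i
    using measurable_component_singleton[of "(i, _)" "{i} \<times> C" "\<lambda>p. N (snd p)"]
    by (intro measurable_restrict) simp
  ultimately have "indep_vars (\<lambda>i. PiM C N) (\<lambda>i \<omega>. \<lambda>c\<in>C. restrict (\<lambda>p. X p \<omega>) ({i} \<times> C) (i, c)) I"
    by (rule indep_vars_compose2)
  then show ?thesis
    by (rule indep_vars_cong[THEN iffD1, rotated -1]) (auto simp: fun_eq_iff restrict_def)
qed

lemma (in prob_space) indep_vars_reindex:
  assumes X: "indep_vars N X (h ` I)" and h: "inj_on h I"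
  shows "indep_vars (\<lambda>i. N (h i)) (\<lambda>i. X (h i)) I"
  unfolding indep_vars_def2
proof (intro conjI ballI)
  fix i assume "i \<in> I" then show "random_variable (N (h i)) (X (h i))"
    using X by (auto simp: indep_vars_def2)
next
  have ind: "indep_sets (\<lambda>i. {X i -` A \<inter> space M |A. A \<in> sets (N i)}) (h ` I)"
    using X by (auto simp: indep_vars_def2)
  show "indep_sets (\<lambda>i. {X (h i) -` A \<inter> space M |A. A \<in> sets (N (h i))}) I"
  proof (rule indep_setsI)
    fix i assume "i \<in> I" then show "{X (h i) -` A \<inter> space M |A. A \<in> sets (N (h i))} \<subseteq> events"
      using ind by (auto simp: indep_sets_def)
  next
    fix A J assume J: "J \<noteq> {}" "J \<subseteq> I" "finite J"
      and A: "\<forall>j\<in>J. A j \<in> {X (h j) -` A \<inter> space M |A. A \<in> sets (N (h j))}"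
    have inj: "inj_on h J" using h J by (auto intro: inj_on_subset)
    have "prob (\<Inter>j\<in>h ` J. A (the_inv_into J h j)) = (\<Prod>j\<in>h ` J. prob (A (the_inv_into J h j)))"
      using J A inj by (intro indep_setsD[OF ind]) (auto simp: the_inv_into_f_f)
    then show "prob (\<Inter>j\<in>J. A j) = (\<Prod>j\<in>J. prob (A j))"
      using inj by (simp add: prod.reindex the_inv_into_f_f)
  qed
qed

lemma (in prob_space) indep_vars_group_snd:
  assumes X: "indep_vars (\<lambda>p. N (fst p)) X (I \<times> C)"
  shows "indep_vars (\<lambda>c. PiM I N) (\<lambda>c \<omega>. \<lambda>i\<in>I. X (i, c) \<omega>) C"
proof -
  have "indep_vars (\<lambda>p. N (fst (prod.swap p))) (\<lambda>p. X (prod.swap p)) (C \<times> I)"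
    by (rule indep_vars_reindex) (use X in \<open>auto simp: product_swap\<close>)
  then have "indep_vars (\<lambda>p. N (snd p)) (\<lambda>p. X (prod.swap p)) (C \<times> I)" by simp
  from indep_vars_group_fst[OF this] show ?thesis by simp
qed

text \<open>When each row is transformed on its own, the rows stay independent, so independence only
  has to be checked within a row. Levy's refinement step and the sample splitting are both of this
  kind.\<close>

lemma (in prob_space) indep_vars_blockwise:
  fixes X :: "'i \<times> 'c \<Rightarrow> 'a \<Rightarrow> 'b" and h :: "'i \<Rightarrow> 'd \<Rightarrow> ('c \<Rightarrow> 'b) \<Rightarrow> 'e"
  assumes fin: "finite I" "finite D"
    and X: "indep_vars (\<lambda>p. N (snd p)) X (I \<times> C)"
    and h: "\<And>i d. i \<in> I \<Longrightarrow> d \<in> D \<Longrightarrow> h i d \<in> measurable (PiM C N) (N' d)"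
    and within: "\<And>i. i \<in> I \<Longrightarrow> indep_vars N' (\<lambda>d \<omega>. h i d (\<lambda>c\<in>C. X (i, c) \<omega>)) D"
  shows "indep_vars (\<lambda>p. N' (snd p)) (\<lambda>p \<omega>. h (fst p) (snd p) (\<lambda>c\<in>C. X (fst p, c) \<omega>)) (I \<times> D)"
proof (rule indep_vars_ungroup[OF fin])
  show "indep_vars (\<lambda>i. PiM D N') (\<lambda>i \<omega>. \<lambda>d\<in>D. h i d (\<lambda>c\<in>C. X (i, c) \<omega>)) I"
    by (rule indep_vars_compose2[OF indep_vars_group_fst[OF X],
          where Y = "\<lambda>i v. \<lambda>d\<in>D. h i d v"]) (auto intro!: measurable_restrict h)
qed (rule within)

lemma (in prob_space) indep_var_of_indep_vars:
  assumes X: "indep_vars N X I" and ij: "i \<in> I" "j \<in> I" "i \<noteq> j"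
  shows "indep_var (N i) (X i) (N j) (X j)"
proof -
  have "indep_vars (\<lambda>b. N (if b then i else j)) (\<lambda>b. X (if b then i else j)) UNIV"
    by (rule indep_vars_reindex[where h="\<lambda>b. if b then i else j"])
       (use ij in \<open>auto intro!: indep_vars_subset[OF X] simp: inj_on_def\<close>)
  then show ?thesis
    unfolding indep_var_def
    by (rule indep_vars_cong[THEN iffD1, rotated -1]) (auto split: bool.split)
qed

lemma (in prob_space) nn_integral_indep_le:
  assumes ind: "indep_var N1 X N2 Y"
    and F[measurable]: "F \<in> borel_measurable (N1 \<Otimes>\<^sub>M N2)"
    and bd: "\<And>x. x \<in> space N1 \<Longrightarrow> (\<integral>\<^sup>+\<omega>. F (x, Y \<omega>) \<partial>M) \<le> w x"
    and w[measurable]: "w \<in> borel_measurable N1"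
  shows "(\<integral>\<^sup>+\<omega>. F (X \<omega>, Y \<omega>) \<partial>M) \<le> (\<integral>\<^sup>+\<omega>. w (X \<omega>) \<partial>M)"
proof -
  have X[measurable]: "random_variable N1 X" and Y[measurable]: "random_variable N2 Y"
    using ind by (blast dest: indep_var_rv1 indep_var_rv2)+
  interpret dX: prob_space "distr M N1 X" by (rule prob_space_distr) fact
  interpret dY: prob_space "distr M N2 Y" by (rule prob_space_distr) fact
  have "(\<integral>\<^sup>+\<omega>. F (X \<omega>, Y \<omega>) \<partial>M) = (\<integral>\<^sup>+p. F p \<partial>distr M (N1 \<Otimes>\<^sub>M N2) (\<lambda>\<omega>. (X \<omega>, Y \<omega>)))"
    by (simp add: nn_integral_distr)
  also have "\<dots> = (\<integral>\<^sup>+p. F p \<partial>(distr M N1 X \<Otimes>\<^sub>M distr M N2 Y))"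
    using ind by (simp add: indep_var_distribution_eq)
  also have "\<dots> = (\<integral>\<^sup>+x. \<integral>\<^sup>+y. F (x, y) \<partial>distr M N2 Y \<partial>distr M N1 X)"
    by (subst dY.nn_integral_fst[symmetric]) auto
  also have "\<dots> = (\<integral>\<^sup>+\<omega>. \<integral>\<^sup>+\<omega>'. F (X \<omega>, Y \<omega>') \<partial>M \<partial>M)"
    by (subst nn_integral_distr; simp add: nn_integral_distr cong: nn_integral_cong)
  also have "\<dots> \<le> (\<integral>\<^sup>+\<omega>. w (X \<omega>) \<partial>M)"
    using measurable_space[OF X] by (intro nn_integral_mono bd) auto
  finally show ?thesis .
qed

text \<open>For independent X, Y with deviations a and b the covariance of X + Y and X - c Y is a^2
  - c b^2, which this c makes vanish. The identity factors the joint density in the coordinates u =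
  x + y, v = x - c y, where y = (u - v) / (1 + c); the division by 1 + c is the Jacobian.\<close>

lemma normal_density_rotation:
  fixes a b u v :: real
  assumes "a > 0" "b > 0"
  defines "c \<equiv> a\<^sup>2 / b\<^sup>2"
  shows "normal_density 0 a (u - (u - v) / (1 + c)) * normal_density 0 b ((u - v) / (1 + c)) / (1 + c)
    = normal_density 0 (sqrt (a\<^sup>2 + b\<^sup>2)) u * normal_density 0 (sqrt (a\<^sup>2 + (c * b)\<^sup>2)) v"
proof -
  have c: "c > 0" using assms by simp
  have cb: "c * b\<^sup>2 = a\<^sup>2" using assms by simp
  have e1: "a\<^sup>2 + b\<^sup>2 = (1 + c) * b\<^sup>2" using cb by (simp add: algebra_simps)
  have e2: "a\<^sup>2 + (c * b)\<^sup>2 = (1 + c) * (c * b\<^sup>2)"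
    unfolding cb[symmetric] by (simp add: power2_eq_square algebra_simps)
  have e3: "a\<^sup>2 = c * b\<^sup>2" by (simp add: cb)
  let ?E = "\<lambda>x s. exp (- (x\<^sup>2 / (2 * s)))"
  have E: "normal_density 0 s x = 1 / sqrt (2 * pi * s\<^sup>2) * ?E x (s\<^sup>2)" for s x
    by (simp add: normal_density_def)
  have s1: "(sqrt (a\<^sup>2 + b\<^sup>2))\<^sup>2 = (1 + c) * b\<^sup>2" using e1 by (simp add: c less_imp_le)
  have s2: "(sqrt (a\<^sup>2 + (c * b)\<^sup>2))\<^sup>2 = (1 + c) * (c * b\<^sup>2)" using e2 by (simp add: c less_imp_le)
  have root: "sqrt (2 * pi * (c * b\<^sup>2)) * sqrt (2 * pi * b\<^sup>2) * (1 + c) =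
      sqrt (2 * pi * ((1 + c) * b\<^sup>2)) * sqrt (2 * pi * ((1 + c) * (c * b\<^sup>2)))"
  proof -
    have "sqrt (2 * pi * ((1 + c) * b\<^sup>2)) * sqrt (2 * pi * ((1 + c) * (c * b\<^sup>2))) =
        sqrt ((1 + c)\<^sup>2 * ((2 * pi * (c * b\<^sup>2)) * (2 * pi * b\<^sup>2)))"
      unfolding real_sqrt_mult[symmetric] by (rule arg_cong[where f = sqrt]) algebra
    also have "\<dots> = (1 + c) * (sqrt (2 * pi * (c * b\<^sup>2)) * sqrt (2 * pi * b\<^sup>2))"
      using c by (simp add: real_sqrt_mult)
    finally show ?thesis by (simp add: ac_simps)
  qed
  have "u - (u - v) / (1 + c) = (c * u + v) / (1 + c)"
    using c by (simp add: field_simps)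
  moreover have "((c * u + v) / (1 + c))\<^sup>2 / (2 * (c * b\<^sup>2)) + ((u - v) / (1 + c))\<^sup>2 / (2 * b\<^sup>2)
      = u\<^sup>2 / (2 * ((1 + c) * b\<^sup>2)) + v\<^sup>2 / (2 * ((1 + c) * (c * b\<^sup>2)))"
  proof -
    have *: "(X / d)\<^sup>2 / (2 * (c * B)) + (Y / d)\<^sup>2 / (2 * B) = (X\<^sup>2 + c * Y\<^sup>2) / (d\<^sup>2 * (2 * c * B))"
      for X Y d B :: real using c by (simp add: power_divide add_divide_distrib)
    have **: "d * (c * U + V) / (d\<^sup>2 * (2 * c * B)) = U / (2 * (d * B)) + V / (2 * (d * (c * B)))"
      if "d > 0" for U V d B :: real
      using c that by (simp add: add_divide_distrib power2_eq_square ac_simps distrib_left)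
    have "(c * u + v)\<^sup>2 + c * (u - v)\<^sup>2 = (1 + c) * (c * u\<^sup>2 + v\<^sup>2)"
      by (simp add: power2_eq_square algebra_simps)
    with c show ?thesis by (simp add: * **)
  qed
  ultimately have ex: "?E (u - (u - v) / (1 + c)) (c * b\<^sup>2) * ?E ((u - v) / (1 + c)) (b\<^sup>2) =
      ?E u ((1 + c) * b\<^sup>2) * ?E v ((1 + c) * (c * b\<^sup>2))"
    by (simp add: exp_add[symmetric])
  have "1 / r1 * x1 * (1 / r2 * x2) / d = 1 / r3 * x3 * (1 / r4 * x4)"
    if "r1 * r2 * d = r3 * r4" "x1 * x2 = x3 * x4" for r1 r2 r3 r4 x1 x2 x3 x4 d :: real
  proof -
    have "1 / r1 * x1 * (1 / r2 * x2) / d = x1 * x2 / (r1 * r2 * d)" by simp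
    also have "\<dots> = 1 / r3 * x3 * (1 / r4 * x4)" unfolding that by simp
    finally show ?thesis .
  qed
  from this[OF root ex] show ?thesis
    unfolding E s1 s2 by (simp add: cb)
qed

lemma (in prob_space) indep_normal_rotation:
  assumes ind: "indep_var borel X borel Y" and pos: "a > 0" "b > 0"
    and X: "distributed M lborel X (normal_density 0 a)"
    and Y: "distributed M lborel Y (normal_density 0 b)"
  defines "c \<equiv> a\<^sup>2 / b\<^sup>2"
  defines "U \<equiv> \<lambda>\<omega>. X \<omega> + Y \<omega>" and "V \<equiv> \<lambda>\<omega>. X \<omega> - c * Y \<omega>"
  shows "indep_var borel U borel V"
    and "distributed M lborel U (normal_density 0 (sqrt (a\<^sup>2 + b\<^sup>2)))"
    and "distributed M lborel V (normal_density 0 (sqrt (a\<^sup>2 + (c * b)\<^sup>2)))"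
proof -
  have c: "c > 0" using pos by (simp add: c_def)
  have [measurable]: "X \<in> borel_measurable M" "Y \<in> borel_measurable M"
    using distributed_measurable[OF X] distributed_measurable[OF Y] by auto
  show dU: "distributed M lborel U (normal_density 0 (sqrt (a\<^sup>2 + b\<^sup>2)))"
    using add_indep_normal[OF ind pos X Y] by (simp add: U_def)
  have cY: "distributed M lborel (\<lambda>\<omega>. 0 + c * Y \<omega>) (normal_density (0 + c * 0) (\<bar>c\<bar> * b))"
    using c by (intro normal_density_affine[OF Y]) (auto simp: pos)
  have ind': "indep_var borel X borel (\<lambda>\<omega>. c * Y \<omega>)"
    using indep_var_compose[OF ind, of id borel "\<lambda>y. c * y" borel] by (simp add: comp_def)
  show dV: "distributed M lborel V (normal_density 0 (sqrt (a\<^sup>2 + (c * b)\<^sup>2)))"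
    using diff_indep_normal[OF ind' pos(1) _ X, of "c * b" 0] cY c pos by (simp add: V_def)
  have [measurable]: "U \<in> borel_measurable M" "V \<in> borel_measurable M"
    by (simp_all add: U_def V_def)
  interpret dX: prob_space "distr M borel X" by (rule prob_space_distr) simp
  interpret dY: prob_space "distr M borel Y" by (rule prob_space_distr) simp
  interpret dU: prob_space "distr M borel U" by (rule prob_space_distr) simp
  interpret dV: prob_space "distr M borel V" by (rule prob_space_distr) simp
  have DX: "distr M borel X = density lborel (normal_density 0 a)"
    using X by (simp add: distributed_def cong: distr_cong)
  have DY: "distr M borel Y = density lborel (normal_density 0 b)"
    using Y by (simp add: distributed_def cong: distr_cong)
  have DU: "distr M borel U = density lborel (normal_density 0 (sqrt (a\<^sup>2 + b\<^sup>2)))"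
    using dU by (simp add: distributed_def cong: distr_cong)
  have DV: "distr M borel V = density lborel (normal_density 0 (sqrt (a\<^sup>2 + (c * b)\<^sup>2)))"
    using dV by (simp add: distributed_def cong: distr_cong)
  have "distr M borel U \<Otimes>\<^sub>M distr M borel V = distr M (borel \<Otimes>\<^sub>M borel) (\<lambda>\<omega>. (U \<omega>, V \<omega>))"
  proof (rule pair_measure_eqI)
    show "sigma_finite_measure (distr M borel U)" "sigma_finite_measure (distr M borel V)"
      by unfold_locales
    show "sets (distr M borel U \<Otimes>\<^sub>M distr M borel V) =
        sets (distr M (borel \<Otimes>\<^sub>M borel) (\<lambda>\<omega>. (U \<omega>, V \<omega>)))"
      by simp
  next
    fix A B assume "A \<in> sets (distr M borel U)" "B \<in> sets (distr M borel V)"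
    then have [measurable]: "A \<in> sets borel" "B \<in> sets borel" by auto
    let ?F = "\<lambda>u v. indicator A u * indicator B v :: ennreal"
    let ?\<phi> = "\<lambda>s x. ennreal (normal_density 0 s x)"
    have "emeasure (distr M (borel \<Otimes>\<^sub>M borel) (\<lambda>\<omega>. (U \<omega>, V \<omega>))) (A \<times> B)
        = (\<integral>\<^sup>+\<omega>. ?F (U \<omega>) (V \<omega>) \<partial>M)"
      by (subst nn_integral_indicator[symmetric])
         (auto simp: nn_integral_distr indicator_times simp del: nn_integral_indicator)
    also have "\<dots> = (\<integral>\<^sup>+p. ?F (fst p + snd p) (fst p - c * snd p)
        \<partial>distr M (borel \<Otimes>\<^sub>M borel) (\<lambda>\<omega>. (X \<omega>, Y \<omega>)))"
      by (simp add: nn_integral_distr U_def V_def)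
    also have "\<dots> = (\<integral>\<^sup>+p. ?F (fst p + snd p) (fst p - c * snd p) \<partial>(distr M borel X \<Otimes>\<^sub>M distr M borel Y))"
      using ind by (simp add: indep_var_distribution_eq)
    also have "\<dots> = (\<integral>\<^sup>+x. \<integral>\<^sup>+y. ?F (x + y) (x - c * y) \<partial>distr M borel Y \<partial>distr M borel X)"
      by (subst dY.nn_integral_fst[symmetric]) simp_all
    also have "\<dots> = (\<integral>\<^sup>+x. \<integral>\<^sup>+y. ?\<phi> a x * (?\<phi> b y * ?F (x + y) (x - c * y)) \<partial>lborel \<partial>lborel)"
      unfolding DX DY by (simp add: nn_integral_density nn_integral_cmult)
    also have "\<dots> = (\<integral>\<^sup>+y. \<integral>\<^sup>+x. ?\<phi> a x * (?\<phi> b y * ?F (x + y) (x - c * y)) \<partial>lborel \<partial>lborel)"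
      by (rule lborel_pair.Fubini') simp
    \<comment> \<open>Substitute u = x + y for fixed y, exchange the integrals, then substitute v =
      u - (1 + c) y for fixed u: two affine substitutions on the line replace one in the
      plane.\<close>
    also have "\<dots> = (\<integral>\<^sup>+y. \<integral>\<^sup>+u. ?\<phi> a (u - y) * (?\<phi> b y * ?F u (u - (1 + c) * y)) \<partial>lborel \<partial>lborel)"
    proof (rule nn_integral_cong)
      fix y :: real
      show "(\<integral>\<^sup>+x. ?\<phi> a x * (?\<phi> b y * ?F (x + y) (x - c * y)) \<partial>lborel) =
          (\<integral>\<^sup>+u. ?\<phi> a (u - y) * (?\<phi> b y * ?F u (u - (1 + c) * y)) \<partial>lborel)"
      proof -
        define G where "G x = ?\<phi> a x * (?\<phi> b y * ?F (x + y) (x - c * y))" for x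
        have t: "- y + u = u - y" "u - y + y = u" "u - y - c * y = u - (1 + c) * y" for u :: real
          by (simp_all add: algebra_simps)
        have "G \<in> borel_measurable borel" unfolding G_def by measurable
        then have "(\<integral>\<^sup>+x. G x \<partial>lborel) = ennreal \<bar>1\<bar> * (\<integral>\<^sup>+u. G (- y + 1 * u) \<partial>lborel)"
          by (rule nn_integral_real_affine) simp
        then show ?thesis by (simp only: G_def t abs_one ennreal_1 mult_1_left)
      qed
    qed
    also have "\<dots> = (\<integral>\<^sup>+u. \<integral>\<^sup>+y. ?\<phi> a (u - y) * (?\<phi> b y * ?F u (u - (1 + c) * y)) \<partial>lborel \<partial>lborel)"
      by (rule lborel_pair.Fubini') simp
    also have "\<dots> = (\<integral>\<^sup>+u. \<integral>\<^sup>+v. ?\<phi> (sqrt (a\<^sup>2 + b\<^sup>2)) u * indicator A u *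
        (?\<phi> (sqrt (a\<^sup>2 + (c * b)\<^sup>2)) v * indicator B v) \<partial>lborel \<partial>lborel)"
    proof (rule nn_integral_cong)
      fix u :: real
      have "(\<integral>\<^sup>+y. ?\<phi> a (u - y) * (?\<phi> b y * ?F u (u - (1 + c) * y)) \<partial>lborel) =
          ennreal (1 / (1 + c)) * (\<integral>\<^sup>+v. ?\<phi> a (u - (u - v) / (1 + c)) * (?\<phi> b ((u - v) / (1 + c)) * ?F u v) \<partial>lborel)"
      proof -
        have t: "u / (1 + c) + - 1 / (1 + c) * v = (u - v) / (1 + c)" "u - (1 + c) * ((u - v) / (1 + c)) = v" for v
          using c by (simp add: diff_divide_distrib, simp)
        define G where "G y = ?\<phi> a (u - y) * (?\<phi> b y * ?F u (u - (1 + c) * y))" for y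
        have "G \<in> borel_measurable borel" unfolding G_def by measurable
        then have "(\<integral>\<^sup>+y. G y \<partial>lborel) =
            ennreal \<bar>- 1 / (1 + c)\<bar> * (\<integral>\<^sup>+v. G (u / (1 + c) + - 1 / (1 + c) * v) \<partial>lborel)"
          by (rule nn_integral_real_affine) (use c in simp)
        also have "\<bar>- 1 / (1 + c)\<bar> = 1 / (1 + c)" using c by (simp add: abs_if)
        finally show ?thesis by (simp only: G_def t)
      qed
      also have "\<dots> = (\<integral>\<^sup>+v. ?\<phi> (sqrt (a\<^sup>2 + b\<^sup>2)) u * indicator A u *
          (?\<phi> (sqrt (a\<^sup>2 + (c * b)\<^sup>2)) v * indicator B v) \<partial>lborel)"
      proof (subst nn_integral_cmult[symmetric], simp, rule nn_integral_cong)
        fix v :: real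
        have "ennreal (1 / (1 + c)) * (?\<phi> a (u - (u - v) / (1 + c)) * ?\<phi> b ((u - v) / (1 + c))) =
            ?\<phi> (sqrt (a\<^sup>2 + b\<^sup>2)) u * ?\<phi> (sqrt (a\<^sup>2 + (c * b)\<^sup>2)) v"
        proof -
          have *: "ennreal (1 / (1 + c)) * (ennreal p * ennreal q) = ennreal (p * q / (1 + c))"
            if "p \<ge> 0" "q \<ge> 0" for p q
            using that c by (simp add: ennreal_mult[symmetric])
          show ?thesis
            by (subst *, simp, simp)
               (simp only: normal_density_rotation[OF pos, folded c_def] ennreal_mult normal_density_nonneg)
        qed
        then show "ennreal (1 / (1 + c)) * (?\<phi> a (u - (u - v) / (1 + c)) * (?\<phi> b ((u - v) / (1 + c)) * ?F u v)) =
            ?\<phi> (sqrt (a\<^sup>2 + b\<^sup>2)) u * indicator A u * (?\<phi> (sqrt (a\<^sup>2 + (c * b)\<^sup>2)) v * indicator B v)"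
          by (simp only: mult.assoc[symmetric]) (simp only: ac_simps)
      qed
      finally show "(\<integral>\<^sup>+y. ?\<phi> a (u - y) * (?\<phi> b y * ?F u (u - (1 + c) * y)) \<partial>lborel) = \<dots>" .
    qed
    also have "\<dots> = emeasure (distr M borel U) A * emeasure (distr M borel V) B"
      unfolding DU DV by (simp add: nn_integral_cmult nn_integral_multc emeasure_density)
    finally show "emeasure (distr M borel U) A * emeasure (distr M borel V) B =
        emeasure (distr M (borel \<Otimes>\<^sub>M borel) (\<lambda>\<omega>. (U \<omega>, V \<omega>))) (A \<times> B)" ..
  qed
  then show "indep_var borel U borel V"
    by (simp add: indep_var_distribution_eq)
qed

section \<open>Moments and tails of normal variables\<close>

lemma (in prob_space) normal_second_moment:
  assumes X: "distributed M lborel X (normal_density 0 s)" and s: "s > 0"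
  shows "(\<integral>\<^sup>+\<omega>. ennreal ((X \<omega>)\<^sup>2) \<partial>M) = ennreal (s\<^sup>2)"
proof -
  have "(\<integral>\<^sup>+\<omega>. ennreal ((X \<omega>)\<^sup>2) \<partial>M) = (\<integral>\<^sup>+x. ennreal (normal_density 0 s x) * ennreal (x\<^sup>2) \<partial>lborel)"
    by (rule distributed_nn_integral[OF X, symmetric]) simp
  also have "\<dots> = (\<integral>\<^sup>+x. ennreal (normal_density 0 s x * (x - 0)\<^sup>2) \<partial>lborel)"
    by (simp add: ennreal_mult'')
  also have "\<dots> = ennreal (\<integral>x. normal_density 0 s x * (x - 0)\<^sup>2 \<partial>lborel)"
    using s by (intro nn_integral_eq_integral integrable_normal_moment) auto
  also have "(\<integral>x. normal_density 0 s x * (x - 0)\<^sup>2 \<partial>lborel) = s\<^sup>2"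
    using integral_normal_moment_even[OF s, of 0 1] by (simp add: numeral_2_eq_2)
  finally show ?thesis .
qed

lemma (in prob_space) normal_neg:
  assumes X: "distributed M lborel X (normal_density 0 s)" and s: "s > 0"
  shows "distributed M lborel (\<lambda>\<omega>. - X \<omega>) (normal_density 0 s)"
  using normal_density_affine[OF X s, of "-1" 0] by simp

text \<open>By symmetry the positive and the negative part have equal second moments, and these add
  up to the variance. The factor 1/2 enters the final constant.\<close>

lemma (in prob_space) normal_second_moment_pos_part:
  assumes X: "distributed M lborel X (normal_density 0 s)" and s: "s > 0"
  shows "(\<integral>\<^sup>+\<omega>. ennreal ((max 0 (X \<omega>))\<^sup>2) \<partial>M) = ennreal (s\<^sup>2 / 2)"
proof -
  have [measurable]: "X \<in> borel_measurable M" using distributed_measurable[OF X] by simp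
  have "(\<integral>\<^sup>+\<omega>. ennreal ((max 0 (X \<omega>))\<^sup>2) \<partial>M) =
      (\<integral>\<^sup>+x. ennreal (normal_density 0 s x) * ennreal ((max 0 x)\<^sup>2) \<partial>lborel)"
    by (rule distributed_nn_integral[OF X, symmetric]) simp
  also have "\<dots> = (\<integral>\<^sup>+\<omega>. ennreal ((max 0 (- X \<omega>))\<^sup>2) \<partial>M)"
    by (rule distributed_nn_integral[OF normal_neg[OF X s]]) simp
  finally have eq: "(\<integral>\<^sup>+\<omega>. ennreal ((max 0 (- X \<omega>))\<^sup>2) \<partial>M) = (\<integral>\<^sup>+\<omega>. ennreal ((max 0 (X \<omega>))\<^sup>2) \<partial>M)" ..
  have "(\<integral>\<^sup>+\<omega>. ennreal ((max 0 (X \<omega>))\<^sup>2) \<partial>M) + (\<integral>\<^sup>+\<omega>. ennreal ((max 0 (- X \<omega>))\<^sup>2) \<partial>M) =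
      (\<integral>\<^sup>+\<omega>. ennreal ((max 0 (X \<omega>))\<^sup>2) + ennreal ((max 0 (- X \<omega>))\<^sup>2) \<partial>M)"
    by (rule nn_integral_add[symmetric]) auto
  also have "\<dots> = (\<integral>\<^sup>+\<omega>. ennreal ((X \<omega>)\<^sup>2) \<partial>M)"
    by (intro nn_integral_cong) (auto simp: max_def simp flip: ennreal_plus)
  finally have sum: "(\<integral>\<^sup>+\<omega>. ennreal ((max 0 (X \<omega>))\<^sup>2) \<partial>M) + (\<integral>\<^sup>+\<omega>. ennreal ((max 0 (X \<omega>))\<^sup>2) \<partial>M) = ennreal (s\<^sup>2)"
    using normal_second_moment[OF X s] eq by simp
  then obtain r where r: "(\<integral>\<^sup>+\<omega>. ennreal ((max 0 (X \<omega>))\<^sup>2) \<partial>M) = ennreal r" "r \<ge> 0"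
    by (cases "\<integral>\<^sup>+\<omega>. ennreal ((max 0 (X \<omega>))\<^sup>2) \<partial>M") auto
  then have "r + r = s\<^sup>2" using sum by (simp flip: ennreal_plus)
  then show ?thesis using r by simp
qed

text \<open>Mills' bound: beyond x the density is at most z / x times itself, and z times the
  standard normal density has an elementary antiderivative, the negative density.\<close>

lemma (in prob_space) normal_upper_tail:
  assumes X: "distributed M lborel X (normal_density 0 s)" and s: "s > 0" and x: "x > 0"
  shows "prob {\<omega>\<in>space M. X \<omega> > x * s} \<le> std_normal_density x / x"
proof -
  have Z: "distributed M lborel (\<lambda>\<omega>. X \<omega> / s) std_normal_density"
    using normal_standard_normal_convert[OF s, of X 0] X by simp
  have [measurable]: "X \<in> borel_measurable M" using distributed_measurable[OF X] by simp
  have "emeasure M {\<omega>\<in>space M. X \<omega> > x * s} = (\<integral>\<^sup>+\<omega>. indicator {x<..} (X \<omega> / s) \<partial>M)"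
    using s by (subst nn_integral_indicator[symmetric], simp, intro nn_integral_cong)
       (auto simp: indicator_def field_simps)
  also have "\<dots> = (\<integral>\<^sup>+z. ennreal (std_normal_density z) * indicator {x<..} z \<partial>lborel)"
    by (rule distributed_nn_integral[OF Z, symmetric]) simp
  also have "\<dots> \<le> (\<integral>\<^sup>+z. ennreal (z * std_normal_density z / x) * indicator {x..} z \<partial>lborel)"
  proof (intro nn_integral_mono)
    fix z :: real
    have "std_normal_density z \<le> z * std_normal_density z / x" if "z > x"
      using that x mult_right_mono[of 1 "z / x" "std_normal_density z"] by (simp add: field_simps)
    then show "ennreal (std_normal_density z) * indicator {x<..} z \<le>
        ennreal (z * std_normal_density z / x) * indicator {x..} z"
      by (auto split: split_indicator intro!: ennreal_leI)
  qed
  also have "\<dots> = ennreal (0 - (- std_normal_density x / x))"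
  proof (rule nn_integral_FTC_atLeast[where F = "\<lambda>z. - std_normal_density z / x" and T = 0])
    show "DERIV (\<lambda>z. - std_normal_density z / x) z :> z * std_normal_density z / x" if "x \<le> z" for z
      using x by (auto simp: std_normal_density_def intro!: derivative_eq_intros)
    show "0 \<le> z * std_normal_density z / x" if "x \<le> z" for z
      using that x by simp
    have "filterlim (\<lambda>z::real. z\<^sup>2) at_top at_top"
      by (rule filterlim_pow_at_top) (simp_all add: filterlim_ident)
    then have "filterlim (\<lambda>z::real. 1 / 2 * z\<^sup>2) at_top at_top"
      by (rule filterlim_tendsto_pos_mult_at_top[rotated 2]) auto
    then have lim: "filterlim (\<lambda>z::real. - z\<^sup>2 / 2) at_bot at_top"
      by (simp add: filterlim_uminus_at_top)
    have "((\<lambda>z. - (1 / sqrt (2 * pi) * exp (- z\<^sup>2 / 2)) / x) \<longlongrightarrow> - (1 / sqrt (2 * pi) * 0) / x) at_top"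
      by (intro tendsto_intros filterlim_compose[OF exp_at_bot] lim) (use x in simp)
    then show "((\<lambda>z. - std_normal_density z / x) \<longlongrightarrow> 0) at_top"
      using x by (simp add: std_normal_density_def)
  qed simp
  finally show ?thesis
    using x by (simp add: emeasure_eq_measure ennreal_le_iff)
qed

text \<open>9/5 is the stopping threshold 2 minus the slack 1/5 in \<open>easy_right\<close> and
  \<open>easy_left\<close>; 1/16 is the factor gained per easy level. The numerical input is 2 pi >=
  2.5^2 and exp (81/50) >= (1 + 81/200)^4 >= 3.8.\<close>

lemma std_normal_tail_bound: "std_normal_density (9/5) / (9/5) \<le> 1/16"
proof -
  have "(2.5::real)\<^sup>2 \<le> 2 * pi"
    using pi_approx by (simp add: power2_eq_square) 
  then have s: "2.5 \<le> sqrt (2 * pi)" by (rule real_le_rsqrt)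
  have "(1 + 81/50/4)^4 \<le> exp (81/50::real)"
    using exp_ge_one_plus_x_over_n_power_n[of 4 "81/50"] by simp
  moreover have "(3.8::real) \<le> (1 + 81/50/4)^4" by (simp add: power4_eq_xxxx)
  ultimately have e: "3.8 \<le> exp (81/50::real)" by linarith
  have "std_normal_density (9/5) = 1 / (sqrt (2 * pi) * exp (81/50))"
    by (simp add: std_normal_density_def exp_minus power2_eq_square field_simps)
  also have "\<dots> \<le> 1 / (2.5 * 3.8)"
    using mult_mono[OF s e] by (intro divide_left_mono) auto
  finally show ?thesis by simp
qed

section \<open>Limits of normal variables\<close>

lemma (in prob_space) normal_distributed_iff_char:
  assumes [measurable]: "X \<in> borel_measurable M" and s: "s > 0"
  shows "distributed M lborel X (normal_density 0 s) \<longleftrightarrow>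
    (\<forall>t. (CLINT \<omega>|M. iexp (t * X \<omega>)) = exp (- (t * s)\<^sup>2 / 2))"
proof -
  let ?Z = "\<lambda>\<omega>. X \<omega> / s"
  interpret D: real_distribution "distr M borel ?Z"
    by (rule real_distribution_distr) simp
  have ch: "char (distr M borel ?Z) t = (CLINT \<omega>|M. iexp (t / s * X \<omega>))" for t
    unfolding char_def by (subst integral_distr) auto
  have "distributed M lborel X (normal_density 0 s) \<longleftrightarrow> distributed M lborel ?Z std_normal_density"
    using normal_standard_normal_convert[OF s, of X 0] by simp
  also have "\<dots> \<longleftrightarrow> distr M borel ?Z = std_normal_distribution"
    by (auto simp: distributed_def cong: distr_cong)
  also have "\<dots> \<longleftrightarrow> char (distr M borel ?Z) = char std_normal_distribution"
    using Levy_uniqueness[OF D.real_distribution_axioms real_dist_normal_dist] by auto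
  also have "\<dots> \<longleftrightarrow> (\<forall>t. (CLINT \<omega>|M. iexp (t / s * X \<omega>)) = exp (- t\<^sup>2 / 2))"
    by (auto simp: fun_eq_iff ch char_std_normal_distribution)
  also have "\<dots> \<longleftrightarrow> (\<forall>t. (CLINT \<omega>|M. iexp (t * X \<omega>)) = exp (- (t * s)\<^sup>2 / 2))"
  proof (intro iffI allI)
    fix t assume "\<forall>t. (CLINT \<omega>|M. iexp (t / s * X \<omega>)) = exp (- t\<^sup>2 / 2)"
    from this[rule_format, of "t * s"] s show "(CLINT \<omega>|M. iexp (t * X \<omega>)) = exp (- (t * s)\<^sup>2 / 2)"
      by simp
  next
    fix t assume "\<forall>t. (CLINT \<omega>|M. iexp (t * X \<omega>)) = exp (- (t * s)\<^sup>2 / 2)"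
    from this[rule_format, of "t / s"] s show "(CLINT \<omega>|M. iexp (t / s * X \<omega>)) = exp (- t\<^sup>2 / 2)"
      by simp
  qed
  finally show ?thesis .
qed

text \<open>Almost sure convergence passes to characteristic functions by dominated convergence, and
  these determine the law.\<close>

lemma (in prob_space) normal_limit:
  assumes lim: "AE \<omega> in M. (\<lambda>n. X n \<omega>) \<longlonglongrightarrow> Y \<omega>"
    and Y[measurable]: "Y \<in> borel_measurable M"
    and law: "\<And>n. distributed M lborel (X n) (normal_density 0 (s n))" and s: "\<And>n. s n > 0"
    and s_lim: "s \<longlonglongrightarrow> \<sigma>" and \<sigma>: "\<sigma> > 0"
  shows "distributed M lborel Y (normal_density 0 \<sigma>)"
  unfolding normal_distributed_iff_char[OF Y \<sigma>]
proof
  fix t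
  have [measurable]: "X n \<in> borel_measurable M" for n
    using distributed_measurable[OF law] by simp
  have "(\<lambda>n. CLINT \<omega>|M. iexp (t * X n \<omega>)) \<longlonglongrightarrow> (CLINT \<omega>|M. iexp (t * Y \<omega>))"
  proof (rule integral_dominated_convergence[where w = "\<lambda>_. 1"])
    show "AE \<omega> in M. (\<lambda>n. iexp (t * X n \<omega>)) \<longlonglongrightarrow> iexp (t * Y \<omega>)"
      using lim by eventually_elim (intro tendsto_intros)
  qed auto
  moreover have "(CLINT \<omega>|M. iexp (t * X n \<omega>)) = exp (- (t * s n)\<^sup>2 / 2)" for n
    using law[of n] s[of n] by (simp add: normal_distributed_iff_char)
  moreover have "(\<lambda>n. complex_of_real (exp (- (t * s n)\<^sup>2 / 2))) \<longlonglongrightarrow> exp (- (t * \<sigma>)\<^sup>2 / 2)"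
    by (intro tendsto_intros s_lim) auto
  ultimately show "(CLINT \<omega>|M. iexp (t * Y \<omega>)) = exp (- (t * \<sigma>)\<^sup>2 / 2)"
    by (auto intro: LIMSEQ_unique)
qed

lemma (in prob_space) normal_no_atom:
  assumes "distributed M lborel X (normal_density 0 \<sigma>)"
  shows "AE \<omega> in M. X \<omega> \<noteq> a"
proof -
  have "AE x in lborel. x \<noteq> a" by (rule AE_lborel_singleton)
  then have "AE x in density lborel (normal_density 0 \<sigma>). x \<noteq> a"
    by (subst AE_density) auto
  moreover have "distr M lborel X = density lborel (normal_density 0 \<sigma>)"
    using assms by (simp add: distributed_def)
  ultimately have "AE x in distr M lborel X. x \<noteq> a" by metis
  then show ?thesis
    using distributed_measurable[OF assms] by (subst (asm) AE_distr_iff) auto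
qed

text \<open>The indicator of a half-line is discontinuous only at its endpoint, which the limit
  variables avoid almost surely as they have no atoms. So the probabilities of intersections of
  half-lines converge, and half-lines generate the Borel sets.\<close>

lemma (in prob_space) indep_normal_limit:
  fixes X :: "nat \<Rightarrow> 'i \<Rightarrow> 'a \<Rightarrow> real"
  assumes fin: "finite I"
    and lim: "\<And>i. i \<in> I \<Longrightarrow> AE \<omega> in M. (\<lambda>n. X n i \<omega>) \<longlonglongrightarrow> Y i \<omega>"
    and Y: "\<And>i. i \<in> I \<Longrightarrow> Y i \<in> borel_measurable M"
    and ind: "\<And>n. indep_vars (\<lambda>_. borel) (X n) I"
    and atoms: "\<And>i a. i \<in> I \<Longrightarrow> AE \<omega> in M. Y i \<omega> \<noteq> a"
  shows "indep_vars (\<lambda>_. borel) Y I"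
proof (cases "I = {}")
  case True
  then show ?thesis by (simp add: indep_vars_def2 indep_sets_def)
next
  case False
  have X: "X n i \<in> borel_measurable M" if "i \<in> I" for n i
    using ind[of n] that by (auto simp: indep_vars_def2)
  \<comment> \<open>The factorization is tested on the full index set only, so the generator has to
    contain the whole space in order to cover subfamilies.\<close>
  let ?E = "range atMost \<union> {UNIV} :: real set set"
  have conv: "(\<lambda>n. prob (\<Inter>j\<in>J. X n j -` A j \<inter> space M)) \<longlonglongrightarrow> prob (\<Inter>j\<in>J. Y j -` A j \<inter> space M)"
    if J: "J \<subseteq> I" "J \<noteq> {}" and A: "\<And>j. j \<in> J \<Longrightarrow> A j \<in> ?E" for J A
  proof -
    have finJ: "finite J" using J fin finite_subset by auto
    have AB: "A j \<in> sets borel" if "j \<in> J" for j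
      using A[OF that] by auto
    have meas: "(\<Inter>j\<in>J. Z j -` A j \<inter> space M) \<in> sets M"
      if "\<And>j. j \<in> J \<Longrightarrow> Z j \<in> borel_measurable M" for Z
      using that AB J finJ by (intro sets.finite_INT measurable_sets[where A = borel]) auto
    have "AE \<omega> in M. \<forall>j\<in>J. (\<lambda>n. X n j \<omega>) \<longlonglongrightarrow> Y j \<omega>"
      using lim J finJ by (subst AE_finite_all) auto
    moreover have "AE \<omega> in M. \<forall>j\<in>J. \<forall>a. A j = {..a} \<longrightarrow> Y j \<omega> \<noteq> a"
      unfolding AE_finite_all[OF finJ]
    proof
      fix j assume "j \<in> J"
      show "AE \<omega> in M. \<forall>a. A j = {..a} \<longrightarrow> Y j \<omega> \<noteq> a"
      proof (cases "\<exists>a. A j = {..a}")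
        case True
        then obtain a where a: "A j = {..a}" by auto
        have "AE \<omega> in M. Y j \<omega> \<noteq> a" using atoms J \<open>j \<in> J\<close> by auto
        then show ?thesis by eventually_elim (auto simp: a)
      qed auto
    qed
    ultimately have ae: "AE \<omega> in M. (\<lambda>n. indicator (\<Inter>j\<in>J. X n j -` A j \<inter> space M) \<omega> :: real) \<longlonglongrightarrow>
        indicator (\<Inter>j\<in>J. Y j -` A j \<inter> space M) \<omega>"
      using AE_space
    proof eventually_elim
      case (elim \<omega>)
      have "eventually (\<lambda>n. X n j \<omega> \<in> A j \<longleftrightarrow> Y j \<omega> \<in> A j) sequentially" if j: "j \<in> J" for j
      proof -
        consider "A j = UNIV" | a where "A j = {..a}" "Y j \<omega> < a" | a where "A j = {..a}" "a < Y j \<omega>"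
          using A[OF j] elim(2) j by (auto simp: neq_iff)
        then show ?thesis
        proof cases
          case 2
          have "eventually (\<lambda>n. X n j \<omega> < a) sequentially"
            using elim(1) j 2 by (auto intro: order_tendstoD)
          then show ?thesis by eventually_elim (use 2 in auto)
        next
          case 3
          have "eventually (\<lambda>n. X n j \<omega> > a) sequentially"
            using elim(1) j 3 by (auto intro: order_tendstoD)
          then show ?thesis by eventually_elim (use 3 in auto)
        qed auto
      qed
      then have "eventually (\<lambda>n. \<forall>j\<in>J. X n j \<omega> \<in> A j \<longleftrightarrow> Y j \<omega> \<in> A j) sequentially"
        by (simp add: eventually_ball_finite_distrib finJ)
      then have "eventually (\<lambda>n. indicator (\<Inter>j\<in>J. X n j -` A j \<inter> space M) \<omega> =
          (indicator (\<Inter>j\<in>J. Y j -` A j \<inter> space M) \<omega> :: real)) sequentially"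
        by eventually_elim (auto simp: indicator_def)
      then show ?case by (rule tendsto_eventually)
    qed
    have "(\<lambda>n. \<integral>\<omega>. indicator (\<Inter>j\<in>J. X n j -` A j \<inter> space M) \<omega> \<partial>M) \<longlonglongrightarrow>
        (\<integral>\<omega>. indicator (\<Inter>j\<in>J. Y j -` A j \<inter> space M) \<omega> \<partial>M :: real)"
      using J X Y ae meas
      by (intro integral_dominated_convergence[where w = "\<lambda>_. 1"]) (auto simp: subset_eq)
    moreover have "(\<Inter>j\<in>J. Z j -` A j \<inter> space M) \<inter> space M = (\<Inter>j\<in>J. Z j -` A j \<inter> space M)" for Z
      using J by auto
    ultimately show ?thesis by simp
  qed
  have "prob (\<Inter>j\<in>I. Y j -` A j \<inter> space M) = (\<Prod>j\<in>I. prob (Y j -` A j \<inter> space M))"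
    if A: "A \<in> (\<Pi> i\<in>I. ?E)" for A
  proof (rule LIMSEQ_unique)
    show "(\<lambda>n. prob (\<Inter>j\<in>I. X n j -` A j \<inter> space M)) \<longlonglongrightarrow> prob (\<Inter>j\<in>I. Y j -` A j \<inter> space M)"
      using A False by (intro conv) auto
    have "(\<lambda>n. \<Prod>j\<in>I. prob (X n j -` A j \<inter> space M)) \<longlonglongrightarrow> (\<Prod>j\<in>I. prob (Y j -` A j \<inter> space M))"
    proof (intro tendsto_prod)
      fix j assume "j \<in> I"
      then show "(\<lambda>n. prob (X n j -` A j \<inter> space M)) \<longlonglongrightarrow> prob (Y j -` A j \<inter> space M)"
        using conv[of "{j}" A] A by (auto simp: Pi_iff)
    qed
    moreover have "prob (\<Inter>j\<in>I. X n j -` A j \<inter> space M) = (\<Prod>j\<in>I. prob (X n j -` A j \<inter> space M))" for n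
    proof (rule indep_varsD_finite[OF ind False fin])
      fix j assume "j \<in> I"
      then have "A j \<in> ?E" using A by blast
      then show "A j \<in> sets borel" by auto
    qed
    ultimately show "(\<lambda>n. prob (\<Inter>j\<in>I. X n j -` A j \<inter> space M)) \<longlonglongrightarrow> (\<Prod>j\<in>I. prob (Y j -` A j \<inter> space M))"
      by simp
  qed
  moreover have "sets borel = sigma_sets (space borel) ?E"
  proof (rule antisym)
    show "sets borel \<subseteq> sigma_sets (space borel) ?E"
      by (subst borel_eq_atMost) (auto simp: sets_measure_of intro!: sigma_sets_mono')
    show "sigma_sets (space borel) ?E \<subseteq> sets (borel :: real measure)"
      by (intro sets.sigma_sets_subset) auto
  qed
  moreover have "Int_stable ?E"
    by (auto simp: Int_stable_def)
  ultimately show ?thesis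
    using False fin Y by (subst indep_vars_finite[where E = "\<lambda>_. ?E"]) auto
qed


lemma (in prob_space) indep_vars_distr_finite:
  assumes g[measurable]: "g \<in> measurable M N" and I: "finite I"
    and X: "\<And>i. i \<in> I \<Longrightarrow> X i \<in> measurable N (M' i)"
    and ind: "indep_vars M' (\<lambda>i \<omega>. X i (g \<omega>)) I"
  shows "prob_space.indep_vars (distr M N g) M' X I"
proof (cases "I = {}")
  case True
  interpret D: prob_space "distr M N g" by (rule prob_space_distr) fact
  show ?thesis using True by (simp add: D.indep_vars_def2 D.indep_sets_def)
next
  case False
  interpret D: prob_space "distr M N g" by (rule prob_space_distr) fact
  have eq: "D.prob (\<Inter>j\<in>J. X j -` A j \<inter> space N) = prob (\<Inter>j\<in>J. (\<lambda>\<omega>. X j (g \<omega>)) -` A j \<inter> space M)"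
    if "finite J" "J \<noteq> {}" "J \<subseteq> I" "\<And>j. j \<in> J \<Longrightarrow> A j \<in> sets (M' j)" for J A
    using that X measurable_space[OF g]
    by (subst measure_distr[OF g])
       (auto intro!: sets.finite_INT measurable_sets arg_cong[where f = prob] simp: subset_eq)
  show ?thesis
  proof (subst D.indep_vars_finite[where E = "\<lambda>i. sets (M' i)"])
    show "\<forall>A\<in>Pi I (\<lambda>i. sets (M' i)). D.prob (\<Inter>j\<in>I. X j -` A j \<inter> space (distr M N g)) =
        (\<Prod>j\<in>I. D.prob (X j -` A j \<inter> space (distr M N g)))"
    proof
      fix A assume A: "A \<in> Pi I (\<lambda>i. sets (M' i))"
      have "D.prob (X j -` A j \<inter> space N) = prob ((\<lambda>\<omega>. X j (g \<omega>)) -` A j \<inter> space M)" if "j \<in> I" for j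
        using eq[of "{j}" A] A that by auto
      then show "D.prob (\<Inter>j\<in>I. X j -` A j \<inter> space (distr M N g)) =
        (\<Prod>j\<in>I. D.prob (X j -` A j \<inter> space (distr M N g)))"
        using eq[of I A] A I False indep_varsD_finite[OF ind, of A] by (auto simp: Pi_iff)
    qed
  qed (use False I X in \<open>auto simp: sets.sigma_sets_eq sets.Int_stable sets.space_closed\<close>)
qed

lemma (in prob_space) indep_vars_two:
  assumes "indep_var N U N V" and ij: "i \<noteq> j"
  shows "indep_vars (\<lambda>_. N) (\<lambda>k. if k = i then U else V) {i, j}"
proof -
  have "indep_vars (\<lambda>k. case_bool N N (k = i)) (\<lambda>k. case_bool U V (k = i)) {i, j}"
    by (rule indep_vars_reindex)
       (use assms in \<open>auto simp: indep_var_def inj_on_def intro: indep_vars_subset\<close>)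
  then show ?thesis
    by (rule indep_vars_cong[THEN iffD1, rotated -1]) (auto split: bool.split)
qed

lemma (in prob_space) indep_vars_singleton:
  assumes "X i \<in> measurable M (N i)"
  shows "indep_vars N X {i}"
  unfolding indep_vars_def2
proof (intro conjI ballI indep_setsI)
  fix A J assume "J \<noteq> {}" "J \<subseteq> {i}"
  then have "J = {i}" by auto
  then show "prob (\<Inter>j\<in>J. A j) = (\<Prod>j\<in>J. prob (A j))" by simp
qed (use assms in \<open>auto intro: measurable_sets\<close>)

section \<open>Existence of the Wiener law\<close>

text \<open>Coordinate (0, 0) is the increment over the unit interval; coordinate (Suc n, k)
  perturbs the midpoint of the k-th dyadic interval of level n.\<close>

definition gauss_space :: "(nat \<times> nat \<Rightarrow> real) measure" where
  "gauss_space = PiM UNIV (\<lambda>_. std_normal_distribution)"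

interpretation gauss_space: prob_space gauss_space
  unfolding gauss_space_def
  using real_dist_normal_dist by (intro prob_space_PiM) (simp add: real_distribution_def)

lemma sets_gauss_space[measurable_cong]: "sets gauss_space = sets (PiM UNIV (\<lambda>_. borel))"
  unfolding gauss_space_def by (rule sets_PiM_cong) auto

lemma gauss_space_coord: "distributed gauss_space lborel (\<lambda>\<xi>. \<xi> p) std_normal_density"
proof -
  interpret product_prob_space "\<lambda>_ :: nat \<times> nat. std_normal_distribution" UNIV
    using real_dist_normal_dist
    by (intro product_prob_spaceI) (simp add: real_distribution_def)
  have "distr gauss_space std_normal_distribution (\<lambda>\<xi>. \<xi> p) = std_normal_distribution"
    unfolding gauss_space_def by (rule PiM_component) simp
  moreover have "distr gauss_space lborel (\<lambda>\<xi>. \<xi> p) = distr gauss_space std_normal_distribution (\<lambda>\<xi>. \<xi> p)"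
    by (rule distr_cong) auto
  ultimately show ?thesis by (simp add: distributed_def)
qed

lemma gauss_space_indep: "gauss_space.indep_vars (\<lambda>_. borel) (\<lambda>p \<xi>. \<xi> p) UNIV"
proof -
  have "distr gauss_space borel (\<lambda>\<xi>. \<xi> p) = std_normal_distribution" for p
    using gauss_space_coord[of p] by (simp add: distributed_def cong: distr_cong)
  moreover have "distr gauss_space (PiM UNIV (\<lambda>_. borel)) (\<lambda>\<xi>. \<xi>) = gauss_space"
  proof -
    have "distr gauss_space (PiM UNIV (\<lambda>_. borel)) (\<lambda>\<xi>. \<xi>) = distr gauss_space gauss_space (\<lambda>\<xi>. \<xi>)"
      by (rule distr_cong) (simp_all add: sets_gauss_space)
    also have "\<dots> = gauss_space" using distr_id[of gauss_space] by (simp add: id_def)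
    finally show ?thesis .
  qed
  ultimately show ?thesis
    by (subst gauss_space.indep_vars_iff_distr_eq_PiM) (auto simp: restrict_UNIV gauss_space_def)
qed

text \<open>Levy's construction: the increment over the \<open>k\<close>-th dyadic interval of level \<open>n\<close> is split
  into its two halves by an independent Gaussian perturbation.\<close>

primrec levy_incr :: "nat \<Rightarrow> nat \<Rightarrow> (nat \<times> nat \<Rightarrow> real) \<Rightarrow> real" where
  "levy_incr 0 k \<xi> = \<xi> (0, 0)"
| "levy_incr (Suc n) k \<xi> = levy_incr n (k div 2) \<xi> / 2
     + (if even k then 1 else - 1) * (1 / (2 * sqrt (2 ^ n)) * \<xi> (Suc n, k div 2))"

lemma levy_incr_cong: "(\<And>m k. m \<le> n \<Longrightarrow> \<xi> (m, k) = \<xi>' (m, k)) \<Longrightarrow> levy_incr n k \<xi> = levy_incr n k \<xi>'"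
  by (induction n arbitrary: k) auto

lemma measurable_levy_incr_PiM: "{..n} \<times> UNIV \<subseteq> I \<Longrightarrow> levy_incr n k \<in> borel_measurable (PiM I (\<lambda>_. borel))"
proof (induction n arbitrary: k)
  case 0
  have "levy_incr 0 k = (\<lambda>\<xi>. \<xi> (0, 0))" by auto
  then show ?case using 0 by (auto simp: subset_eq intro!: measurable_component_singleton)
next
  case (Suc n)
  have [measurable]: "levy_incr n k \<in> borel_measurable (PiM I (\<lambda>_. borel))" for k
    using Suc.prems by (intro Suc.IH) auto
  have [simp]: "(Suc n, k) \<in> I" for k using Suc.prems by auto
  show ?case by simp measurable
qed

lemma measurable_levy_incr[measurable]: "levy_incr n k \<in> borel_measurable gauss_space"
  using measurable_levy_incr_PiM[of n UNIV k] by (simp add: measurable_cong_sets[OF sets_gauss_space refl])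

lemma levy_incr_double: "levy_incr (Suc n) (2 * k) \<xi> + levy_incr (Suc n) (Suc (2 * k)) \<xi> = levy_incr n k \<xi>"
  by simp

lemma levy_incr_normal_indep:
  "gauss_space.indep_vars (\<lambda>_. borel) (levy_incr n) {..<2 ^ n} \<and>
   (\<forall>k<2 ^ n. distributed gauss_space lborel (levy_incr n k) (normal_density 0 (1 / sqrt (2 ^ n))))"
proof (induction n)
  case 0
  have "gauss_space.indep_vars (\<lambda>_. borel) (levy_incr 0) {0}"
    by (rule gauss_space.indep_vars_singleton) measurable
  moreover have "levy_incr 0 = (\<lambda>k \<xi>. \<xi> (0, 0))" by (simp add: fun_eq_iff)
  ultimately show ?case using gauss_space_coord by (simp add: lessThan_Suc)
next
  case (Suc n)
  let ?I = "{..<2 ^ n} :: nat set"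
  \<comment> \<open>The standard deviation of half a level n increment. The perturbation is scaled
    to the same s, so the rotation has c = 1 and the two halves, a sum and a difference, are
    independent.\<close>
  define s :: real where "s = 1 / (2 * sqrt (2 ^ n))"
  have s: "s > 0" by (simp add: s_def)
  define X where "X p = (if snd p = 0 then levy_incr n (fst p) else (\<lambda>\<xi>. \<xi> (Suc n, fst p)))" for p :: "nat \<times> nat"
  \<comment> \<open>Group 0 sees the coordinates of levels up to n, group 1 the fresh ones of level
    n + 1; disjoint coordinate sets make the groups independent.\<close>
  define K where "K c = (if c = 0 then {..n} \<times> UNIV else {Suc n} \<times> UNIV :: (nat \<times> nat) set)" for c :: nat
  have "gauss_space.indep_vars (\<lambda>c. PiM (K c) (\<lambda>_. borel)) (\<lambda>c \<xi>. restrict \<xi> (K c)) {0, 1}"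
    by (rule gauss_space.indep_vars_restrict[OF gauss_space_indep])
       (auto simp: K_def disjoint_family_on_def)
  then have "gauss_space.indep_vars (\<lambda>c. PiM ?I (\<lambda>_. borel)) (\<lambda>c \<xi>. \<lambda>k\<in>?I. X (k, c) (restrict \<xi> (K c))) {0, 1}"
  proof (rule gauss_space.indep_vars_compose2)
    fix c :: nat
    have "X (k, c) \<in> borel_measurable (PiM (K c) (\<lambda>_. borel))" for k
      unfolding X_def K_def
      by (auto intro!: measurable_levy_incr_PiM measurable_component_singleton)
    then show "(\<lambda>v. \<lambda>k\<in>?I. X (k, c) v) \<in> PiM (K c) (\<lambda>_. borel) \<rightarrow>\<^sub>M PiM ?I (\<lambda>_. borel)"
      by (rule measurable_restrict)
  qed
  then have groups: "gauss_space.indep_vars (\<lambda>c. PiM ?I (\<lambda>_. borel)) (\<lambda>c \<xi>. \<lambda>k\<in>?I. X (k, c) \<xi>) {0, 1}"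
    by (rule gauss_space.indep_vars_cong[THEN iffD1, rotated -1])
       (auto simp: X_def K_def fun_eq_iff intro!: levy_incr_cong)
  have "gauss_space.indep_vars (\<lambda>_. borel) (\<lambda>k. X (k, c)) ?I" if "c \<in> {0, 1}" for c
  proof (cases "c = 0")
    case True
    with Suc show ?thesis by (simp add: X_def)
  next
    case False
    have "gauss_space.indep_vars (\<lambda>_. borel) (\<lambda>k \<xi>. \<xi> (Suc n, k)) ?I"
      by (rule gauss_space.indep_vars_reindex[where h = "\<lambda>k. (Suc n, k)"])
         (auto intro: gauss_space.indep_vars_subset[OF gauss_space_indep] simp: inj_on_def)
    with False show ?thesis by (simp add: X_def)
  qed
  then have "gauss_space.indep_vars (\<lambda>_. borel) (\<lambda>p. X (snd p, fst p)) ({0, 1} \<times> ?I)"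
    using gauss_space.indep_vars_ungroup[OF _ _ groups] by simp
  then have "gauss_space.indep_vars (\<lambda>_. borel) (\<lambda>p. X (snd (prod.swap p), fst (prod.swap p))) (?I \<times> {0, 1})"
    by (intro gauss_space.indep_vars_reindex[where h = prod.swap]) (auto simp: product_swap)
  then have X: "gauss_space.indep_vars (\<lambda>p. borel) X (?I \<times> {0, 1})" by simp
  define h where "h i d v = v 0 / 2 + (if d = 0 then 1 else - 1) * (s * v 1)" for i d :: nat and v :: "nat \<Rightarrow> real"
  define Y where "Y k d \<xi> = levy_incr n k \<xi> / 2 + (if d = 0 then 1 else - 1) * (s * \<xi> (Suc n, k))" for k d :: nat and \<xi>
  have Yh: "(\<lambda>\<xi>. h k d (\<lambda>c\<in>{0, 1}. X (k, c) \<xi>)) = Y k d" for k d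
    by (auto simp: h_def X_def Y_def)
  have Y: "gauss_space.indep_vars (\<lambda>_. borel) (Y k) {0, 1} \<and>
      (\<forall>d\<in>{0,1}. distributed gauss_space lborel (Y k d) (normal_density 0 (1 / sqrt (2 ^ Suc n))))"
    if k: "k \<in> ?I" for k
  proof -
    let ?A = "\<lambda>\<xi>. levy_incr n k \<xi> / 2" and ?B = "\<lambda>\<xi>. s * \<xi> (Suc n, k)"
    have "gauss_space.indep_var borel (X (k, 0)) borel (X (k, 1))"
      using gauss_space.indep_var_of_indep_vars[OF X, of "(k, 0)" "(k, 1)"] k by simp
    from gauss_space.indep_var_compose[OF this, of "\<lambda>x. x / 2" borel "\<lambda>x. s * x" borel]
    have ind: "gauss_space.indep_var borel ?A borel ?B" by (simp add: comp_def X_def)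
    have dA: "distributed gauss_space lborel ?A (normal_density 0 s)"
      using gauss_space.normal_density_affine[of "levy_incr n k" 0 "1 / sqrt (2 ^ n)" "1/2" 0] Suc k
      by (simp add: s_def)
    have dB: "distributed gauss_space lborel ?B (normal_density 0 s)"
      using gauss_space.normal_density_affine[OF gauss_space_coord, of s 0 "(Suc n, k)"] s by simp
    note rot = gauss_space.indep_normal_rotation[OF ind s s dA dB]
    have sq: "sqrt (s\<^sup>2 + s\<^sup>2) = 1 / sqrt (2 ^ Suc n)"
      by (rule real_sqrt_unique) (auto simp: s_def power_divide power_mult_distrib field_simps)
    have eq: "Y k = (\<lambda>d. if d = 0 then (\<lambda>\<xi>. ?A \<xi> + ?B \<xi>) else (\<lambda>\<xi>. ?A \<xi> - ?B \<xi>))"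
      by (auto simp: Y_def fun_eq_iff)
    show ?thesis
      unfolding eq using rot s sq
      by (auto intro!: gauss_space.indep_vars_two)
  qed
  have h: "h i d \<in> borel_measurable (PiM {0, 1} (\<lambda>_. borel))" for i d
    unfolding h_def by measurable
  have "gauss_space.indep_vars (\<lambda>_. borel) (\<lambda>p. Y (fst p) (snd p)) (?I \<times> {0, 1})"
    using gauss_space.indep_vars_blockwise[OF _ _ X, where h = h and N' = "\<lambda>_. borel" and D = "{0, 1}"] Y
    h unfolding Yh by simp
  then have "gauss_space.indep_vars (\<lambda>_. borel) (\<lambda>k. Y (fst (k div 2, k mod 2)) (snd (k div 2, k mod 2))) {..<2 ^ Suc n}"
  proof (intro gauss_space.indep_vars_reindex[where h = "\<lambda>k. (k div 2, k mod 2)"])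
    show "inj_on (\<lambda>k. (k div 2, k mod 2)) {..<2 ^ Suc n :: nat}"
      by (rule inj_onI) (metis div_mult_mod_eq prod.inject)
  next
    assume Y: "gauss_space.indep_vars (\<lambda>_. borel) (\<lambda>p. Y (fst p) (snd p)) (?I \<times> {0, 1})"
    show "gauss_space.indep_vars (\<lambda>_. borel) (\<lambda>p. Y (fst p) (snd p)) ((\<lambda>k. (k div 2, k mod 2)) ` {..<2 ^ Suc n})"
      by (rule gauss_space.indep_vars_subset[OF Y]) auto
  qed
  moreover have L: "levy_incr (Suc n) k = Y (k div 2) (k mod 2)" for k
    by (auto simp: Y_def s_def fun_eq_iff even_iff_mod_2_eq_zero)
  moreover have "distributed gauss_space lborel (Y (k div 2) (k mod 2)) (normal_density 0 (1 / sqrt (2 ^ Suc n)))"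
    if "k < 2 ^ Suc n" for k
  proof -
    have "k div 2 \<in> ?I" "k mod 2 \<in> {0, 1}" using that by auto
    then show ?thesis by (rule Y[THEN conjunct2, rule_format])
  qed
  ultimately show ?case unfolding L fst_conv snd_conv by simp
qed


section \<open>Convergence of Levy's approximations\<close>

definition levy_path :: "nat \<Rightarrow> real \<Rightarrow> (nat \<times> nat \<Rightarrow> real) \<Rightarrow> real" where
  "levy_path n t \<xi> = (\<Sum>k<nat \<lfloor>2 ^ n * t\<rfloor>. levy_incr n k \<xi>)"

definition levy_limit :: "real \<Rightarrow> (nat \<times> nat \<Rightarrow> real) \<Rightarrow> real" where
  "levy_limit t \<xi> = lim (\<lambda>n. levy_path n t \<xi>)"

lemma measurable_levy_path[measurable]: "levy_path n t \<in> borel_measurable gauss_space"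
  unfolding levy_path_def by measurable

lemma measurable_levy_limit[measurable]: "levy_limit t \<in> borel_measurable gauss_space"
  unfolding levy_limit_def by measurable

text \<open>Two children sum up to their parent, so refinement changes the value at t by at most one
  fine increment, present when the finer floor is odd. At t = 1 no further interval exists, which is
  the reason for the case distinction.\<close>

lemma levy_path_Suc:
  assumes t: "0 \<le> t" "t \<le> 1"
  shows "\<bar>levy_path (Suc n) t \<xi> - levy_path n t \<xi>\<bar> \<le>
    (if 2 * nat \<lfloor>2 ^ n * t\<rfloor> < 2 ^ Suc n then \<bar>levy_incr (Suc n) (2 * nat \<lfloor>2 ^ n * t\<rfloor>) \<xi>\<bar> else 0)"
proof -
  let ?q = "nat \<lfloor>2 ^ n * t\<rfloor>" and ?q' = "nat \<lfloor>2 ^ Suc n * t\<rfloor>"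
  have sum: "(\<Sum>k<2 * q. levy_incr (Suc n) k \<xi>) = (\<Sum>k<q. levy_incr n k \<xi>)" for q
  proof (induction q)
    case (Suc q)
    have "(\<Sum>k<2 * Suc q. levy_incr (Suc n) k \<xi>) =
        (\<Sum>k<2 * q. levy_incr (Suc n) k \<xi>) + (levy_incr (Suc n) (2 * q) \<xi> + levy_incr (Suc n) (Suc (2 * q)) \<xi>)"
      by (simp del: levy_incr.simps)
    then show ?case unfolding levy_incr_double Suc.IH by simp
  qed simp
  have q0: "\<lfloor>2 ^ n * t\<rfloor> \<ge> 0" using t by simp
  have "\<lfloor>2 ^ Suc n * t\<rfloor> = 2 * \<lfloor>2 ^ n * t\<rfloor> \<or> \<lfloor>2 ^ Suc n * t\<rfloor> = 2 * \<lfloor>2 ^ n * t\<rfloor> + 1"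
  proof -
    have "2 ^ Suc n * t = 2 * (2 ^ n * t)" by simp
    then show ?thesis by linarith
  qed
  then consider "?q' = 2 * ?q" | "?q' = Suc (2 * ?q)" using q0 by linarith
  then show ?thesis
  proof cases
    case 1
    then show ?thesis by (simp add: levy_path_def sum del: levy_incr.simps power_Suc)
  next
    case 2
    have "real ?q' \<le> 2 ^ Suc n * t" using t by simp
    also have "\<dots> \<le> 2 ^ Suc n" using t by (simp add: mult_le_cancel_left1)
    finally have "?q' \<le> 2 ^ Suc n" by (metis of_nat_le_iff of_nat_numeral of_nat_power)
    with 2 show ?thesis by (simp add: levy_path_def sum del: levy_incr.simps power_Suc)
  qed
qed

lemma (in prob_space) normal_abs_moment_le:
  assumes X: "distributed M lborel X (normal_density 0 s)" and s: "s > 0"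
  shows "(\<integral>\<^sup>+\<omega>. ennreal \<bar>X \<omega>\<bar> \<partial>M) \<le> ennreal s"
proof -
  have [measurable]: "X \<in> borel_measurable M" using distributed_measurable[OF X] by simp
  have "\<bar>x\<bar> \<le> s / 2 + 1 / (2 * s) * x\<^sup>2" for x :: real
  proof -
    have "0 \<le> (\<bar>x\<bar> - s)\<^sup>2" by simp
    then have "2 * s * \<bar>x\<bar> \<le> s\<^sup>2 + x\<^sup>2" by (simp add: power2_diff ac_simps)
    then show ?thesis using s by (simp add: field_simps power2_eq_square)
  qed
  then have "(\<integral>\<^sup>+\<omega>. ennreal \<bar>X \<omega>\<bar> \<partial>M) \<le> (\<integral>\<^sup>+\<omega>. ennreal (s / 2) + ennreal (1 / (2 * s)) * ennreal ((X \<omega>)\<^sup>2) \<partial>M)"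
    using s by (intro nn_integral_mono) (simp add: ennreal_mult[symmetric] ennreal_plus[symmetric] del: ennreal_plus)
  also have "\<dots> = ennreal (s / 2) + ennreal (1 / (2 * s)) * ennreal (s\<^sup>2)"
    by (simp add: nn_integral_add nn_integral_cmult normal_second_moment[OF X s] emeasure_space_1)
  also have "\<dots> = ennreal s"
    using s by (simp add: ennreal_mult[symmetric] ennreal_plus[symmetric] power2_eq_square del: ennreal_plus)
  finally show ?thesis .
qed

text \<open>The expected changes between consecutive levels are dominated by a geometric series with
  ratio 1 / sqrt 2, so almost surely the changes are absolutely summable.\<close>

lemma levy_path_tendsto:
  assumes t: "0 \<le> t" "t \<le> 1"
  shows "AE \<xi> in gauss_space. (\<lambda>n. levy_path n t \<xi>) \<longlonglongrightarrow> levy_limit t \<xi>"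
proof -
  define D where "D n \<xi> = (if 2 * nat \<lfloor>2 ^ n * t\<rfloor> < 2 ^ Suc n
    then \<bar>levy_incr (Suc n) (2 * nat \<lfloor>2 ^ n * t\<rfloor>) \<xi>\<bar> else 0)" for n \<xi>
  have [measurable]: "D n \<in> borel_measurable gauss_space" for n
    unfolding D_def by (cases "2 * nat \<lfloor>2 ^ n * t\<rfloor> < 2 ^ Suc n") (simp_all del: levy_incr.simps)
  have D0: "D n \<xi> \<ge> 0" for n \<xi> by (simp add: D_def)
  have D: "(\<integral>\<^sup>+\<xi>. ennreal (D n \<xi>) \<partial>gauss_space) \<le> ennreal ((1 / sqrt 2) ^ Suc n)" for n
  proof (cases "2 * nat \<lfloor>2 ^ n * t\<rfloor> < 2 ^ Suc n")
    case True
    then have "distributed gauss_space lborel (levy_incr (Suc n) (2 * nat \<lfloor>2 ^ n * t\<rfloor>))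
        (normal_density 0 (1 / sqrt (2 ^ Suc n)))"
      using levy_incr_normal_indep by blast
    moreover have "1 / sqrt (2 ^ Suc n) = (1 / sqrt 2) ^ Suc n"
      by (simp only: real_sqrt_power power_one_over)
    ultimately have "(\<integral>\<^sup>+\<xi>. ennreal \<bar>levy_incr (Suc n) (2 * nat \<lfloor>2 ^ n * t\<rfloor>) \<xi>\<bar> \<partial>gauss_space)
        \<le> ennreal ((1 / sqrt 2) ^ Suc n)"
      by (intro gauss_space.normal_abs_moment_le) (simp_all only:, simp)
    with True show ?thesis by (simp only: D_def if_True)
  qed (simp add: D_def)
  have sm: "summable (\<lambda>n. (1 / sqrt 2 :: real) ^ Suc n)"
    unfolding summable_Suc_iff by (rule summable_geometric) simp
  have "(\<integral>\<^sup>+\<xi>. (\<Sum>n. ennreal (D n \<xi>)) \<partial>gauss_space) = (\<Sum>n. \<integral>\<^sup>+\<xi>. ennreal (D n \<xi>) \<partial>gauss_space)"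
    by (rule nn_integral_suminf) simp
  also have "\<dots> \<le> (\<Sum>n. ennreal ((1 / sqrt 2) ^ Suc n))"
    by (intro suminf_le D summableI)
  also have "\<dots> = ennreal (\<Sum>n. (1 / sqrt 2) ^ Suc n)"
    by (rule suminf_ennreal2[OF _ sm]) simp
  finally have "(\<integral>\<^sup>+\<xi>. (\<Sum>n. ennreal (D n \<xi>)) \<partial>gauss_space) \<noteq> \<infinity>"
    unfolding infinity_ennreal_def by (rule neq_top_trans[OF ennreal_neq_top])
  then have "AE \<xi> in gauss_space. (\<Sum>n. ennreal (D n \<xi>)) \<noteq> \<infinity>"
    by (intro nn_integral_noteq_infinite) simp_all
  then show ?thesis
  proof eventually_elim
    case (elim \<xi>)
    then have "summable (\<lambda>n. D n \<xi>)"
      by (intro summable_suminf_not_top D0) simp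
    then have "summable (\<lambda>n. levy_path (Suc n) t \<xi> - levy_path n t \<xi>)"
    proof (rule summable_comparison_test')
      show "norm (levy_path (Suc n) t \<xi> - levy_path n t \<xi>) \<le> D n \<xi>" for n
        using levy_path_Suc[OF t, of n \<xi>] by (simp only: D_def real_norm_def)
    qed
    from summable_LIMSEQ[OF this, unfolded sum_lessThan_telescope[of "\<lambda>n. levy_path n t \<xi>"]]
    obtain c where "(\<lambda>n. levy_path n t \<xi> - levy_path 0 t \<xi>) \<longlonglongrightarrow> c"
      by blast
    from tendsto_add[OF this tendsto_const[of "levy_path 0 t \<xi>"]]
    have "convergent (\<lambda>n. levy_path n t \<xi>)"
      by (auto simp: convergent_def)
    then show ?case
      unfolding levy_limit_def by (simp add: convergent_LIMSEQ_iff)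
  qed
qed

lemma levy_path_zero: "levy_path n 0 \<xi> = 0"
  by (simp add: levy_path_def)

text \<open>Increments between dyadic floors of the given times are sums of independent normals over
  disjoint index sets; their laws and their independence survive the limit.\<close>

lemma levy_increments:
  assumes \<tau>: "\<tau> ` {..N} \<subseteq> {0..1}" "strict_mono_on {..N} \<tau>"
  shows "gauss_space.indep_vars (\<lambda>_. borel) (\<lambda>i \<xi>. levy_limit (\<tau> (Suc i)) \<xi> - levy_limit (\<tau> i) \<xi>) {..<N}"
    and "\<And>i. i < N \<Longrightarrow> distributed gauss_space lborel (\<lambda>\<xi>. levy_limit (\<tau> (Suc i)) \<xi> - levy_limit (\<tau> i) \<xi>)
      (normal_density 0 (sqrt (\<tau> (Suc i) - \<tau> i)))"
proof -
  define q where "q n i = nat \<lfloor>2 ^ n * \<tau> i\<rfloor>" for n i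
  have \<tau>01: "0 \<le> \<tau> i" "\<tau> i \<le> 1" if "i \<le> N" for i using \<tau> that by (auto simp: image_subset_iff)
  have \<tau>_less: "\<tau> i < \<tau> (Suc i)" if "i < N" for i
    using \<tau>(2) that by (auto simp: strict_mono_on_def)
  have \<tau>_mono: "\<tau> i \<le> \<tau> j" if "i \<le> j" "j \<le> N" for i j
    using \<tau>(2) that by (cases "i = j") (auto simp: strict_mono_on_def less_imp_le)
  have q_mono: "q n i \<le> q n j" if "i \<le> j" "j \<le> N" for n i j
    using \<tau>_mono[OF that] unfolding q_def by (intro nat_mono floor_mono mult_left_mono) auto
  have q_le: "q n i \<le> 2 ^ n" if "i \<le> N" for n i
  proof -
    have "real (q n i) \<le> 2 ^ n * \<tau> i" using \<tau>01[OF that] by (simp add: q_def)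
    also have "\<dots> \<le> 2 ^ n" using \<tau>01[OF that] by (simp add: mult_le_cancel_left1)
    finally show ?thesis by (metis of_nat_le_iff of_nat_numeral of_nat_power)
  qed
  have lim: "(\<lambda>n. real (q n i) / 2 ^ n) \<longlonglongrightarrow> \<tau> i" if "i \<le> N" for i
  proof (rule tendsto_sandwich)
    have *: "2 ^ n * \<tau> i - 1 \<le> real (q n i)" "real (q n i) \<le> 2 ^ n * \<tau> i" for n
      using \<tau>01[OF that] by (auto simp: q_def)
    show "eventually (\<lambda>n. \<tau> i - 1 / 2 ^ n \<le> real (q n i) / 2 ^ n) sequentially"
    proof (intro always_eventually allI)
      fix n show "\<tau> i - 1 / 2 ^ n \<le> real (q n i) / 2 ^ n"
        using divide_right_mono[OF *(1)[of n], of "2 ^ n"] by (simp add: diff_divide_distrib)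
    qed
    show "eventually (\<lambda>n. real (q n i) / 2 ^ n \<le> \<tau> i) sequentially"
    proof (intro always_eventually allI)
      fix n show "real (q n i) / 2 ^ n \<le> \<tau> i"
        using divide_right_mono[OF *(2)[of n], of "2 ^ n"] by simp
    qed
    have "(\<lambda>n. (1 / 2 :: real) ^ n) \<longlonglongrightarrow> 0" by (rule LIMSEQ_power_zero) simp
    then show "(\<lambda>n. \<tau> i - 1 / 2 ^ n) \<longlonglongrightarrow> \<tau> i"
      using tendsto_diff[OF tendsto_const[of "\<tau> i"]] by (fastforce simp: power_one_over)
  qed simp
  define s where "s n i = real (q n (Suc i)) / 2 ^ n - real (q n i) / 2 ^ n" for n i
  have s_lim: "(\<lambda>n. s n i) \<longlonglongrightarrow> \<tau> (Suc i) - \<tau> i" if "i < N" for i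
    unfolding s_def using that by (intro tendsto_diff lim) auto
  have "eventually (\<lambda>n. \<forall>i\<in>{..<N}. s n i > 0) sequentially"
    using s_lim \<tau>_less
    by (intro eventually_ball_finite ballI order_tendstoD(1)[OF s_lim]) auto
  \<comment> \<open>From level n0 on every floor interval is nonempty, so all standard deviations
    are positive, as needed for \<open>normal_limit\<close>.\<close>
  then obtain n0 where n0: "\<And>n i. n \<ge> n0 \<Longrightarrow> i < N \<Longrightarrow> s n i > 0"
    by (auto simp: eventually_sequentially)
  define X where "X n i \<xi> = levy_path (n + n0) (\<tau> (Suc i)) \<xi> - levy_path (n + n0) (\<tau> i) \<xi>" for n i \<xi>
  have X_eq: "X n i = (\<lambda>\<xi>. \<Sum>k\<in>{q (n + n0) i..<q (n + n0) (Suc i)}. levy_incr (n + n0) k \<xi>)" if "i < N" for n i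
  proof
    fix \<xi>
    have "q (n + n0) i \<le> q (n + n0) (Suc i)" using that by (intro q_mono) auto
    then show "X n i \<xi> = (\<Sum>k\<in>{q (n + n0) i..<q (n + n0) (Suc i)}. levy_incr (n + n0) k \<xi>)"
      by (simp add: X_def levy_path_def q_def[symmetric] lessThan_atLeast0 sum_diff_nat_ivl)
  qed
  have sub: "{q n i..<q n (Suc i)} \<subseteq> {..<2 ^ n}" if "i < N" for n i
    using q_le[of "Suc i" n] that by auto
  have ind_incr: "gauss_space.indep_vars (\<lambda>_. borel) (levy_incr n) {..<2 ^ n}" for n
    using levy_incr_normal_indep by blast
  have ind: "gauss_space.indep_vars (\<lambda>_. borel) (X n) {..<N}" for n
  proof -
    let ?n = "n + n0"
    let ?K = "\<lambda>i. {q ?n i..<q ?n (Suc i)}"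
    have disj: "disjoint_family_on ?K {..<N}"
      unfolding disjoint_family_on_def
    proof (intro ballI impI)
      fix i j assume "i \<in> {..<N}" "j \<in> {..<N}" "i \<noteq> j"
      then have "q ?n (Suc i) \<le> q ?n j \<or> q ?n (Suc j) \<le> q ?n i"
        using q_mono[of "Suc i" j ?n] q_mono[of "Suc j" i ?n] by force
      then show "?K i \<inter> ?K j = {}" by auto
    qed
    have "gauss_space.indep_vars (\<lambda>i. PiM (?K i) (\<lambda>_. borel)) (\<lambda>i \<xi>. restrict (\<lambda>k. levy_incr ?n k \<xi>) (?K i)) {..<N}"
      using sub disj by (intro gauss_space.indep_vars_restrict[OF ind_incr]) auto
    then have "gauss_space.indep_vars (\<lambda>_. borel)
        (\<lambda>i \<xi>. \<Sum>k\<in>?K i. restrict (\<lambda>k. levy_incr ?n k \<xi>) (?K i) k) {..<N}"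
      by (rule gauss_space.indep_vars_compose2) measurable
    then show ?thesis
      by (rule gauss_space.indep_vars_cong[THEN iffD1, rotated -1]) (auto simp: X_eq)
  qed
  have law: "distributed gauss_space lborel (X n i) (normal_density 0 (sqrt (s (n + n0) i)))" if i: "i < N" for n i
  proof -
    let ?K = "{q (n + n0) i..<q (n + n0) (Suc i)}"
    have pos: "s (n + n0) i > 0" using n0 i by simp
    then have qq: "q (n + n0) i < q (n + n0) (Suc i)" by (simp add: s_def divide_less_cancel)
    then have "distributed gauss_space lborel (\<lambda>\<xi>. \<Sum>k\<in>?K. levy_incr (n + n0) k \<xi>)
      (normal_density (\<Sum>k\<in>?K. 0) (sqrt (\<Sum>k\<in>?K. (1 / sqrt (2 ^ (n + n0)))\<^sup>2)))"
      using sub[OF i, of "n + n0"] levy_incr_normal_indep[of "n + n0"]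
      by (intro gauss_space.sum_indep_normal gauss_space.indep_vars_subset[OF ind_incr]) auto
    moreover have "(\<Sum>k\<in>?K. (1 / sqrt (2 ^ (n + n0)))\<^sup>2) = s (n + n0) i"
      using qq by (simp add: s_def power_divide of_nat_diff diff_divide_distrib)
    ultimately show ?thesis by (simp add: X_eq[OF i])
  qed
  have ae: "AE \<xi> in gauss_space. (\<lambda>n. X n i \<xi>) \<longlonglongrightarrow> levy_limit (\<tau> (Suc i)) \<xi> - levy_limit (\<tau> i) \<xi>"
    if i: "i < N" for i
  proof -
    have "AE \<xi> in gauss_space. (\<lambda>n. levy_path n (\<tau> (Suc i)) \<xi>) \<longlonglongrightarrow> levy_limit (\<tau> (Suc i)) \<xi>"
      using \<tau>01 i by (intro levy_path_tendsto) auto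
    moreover have "AE \<xi> in gauss_space. (\<lambda>n. levy_path n (\<tau> i) \<xi>) \<longlonglongrightarrow> levy_limit (\<tau> i) \<xi>"
      using \<tau>01 i by (intro levy_path_tendsto) auto
    ultimately show ?thesis
      unfolding X_def by eventually_elim (intro tendsto_diff LIMSEQ_ignore_initial_segment)
  qed
  show normal: "distributed gauss_space lborel (\<lambda>\<xi>. levy_limit (\<tau> (Suc i)) \<xi> - levy_limit (\<tau> i) \<xi>)
      (normal_density 0 (sqrt (\<tau> (Suc i) - \<tau> i)))" if i: "i < N" for i
  proof (rule gauss_space.normal_limit[OF ae[OF i] _ law[OF i]])
    show "(\<lambda>n. sqrt (s (n + n0) i)) \<longlonglongrightarrow> sqrt (\<tau> (Suc i) - \<tau> i)"
      by (intro tendsto_intros LIMSEQ_ignore_initial_segment[OF s_lim[OF i]])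
  qed (use n0 i \<tau>_less[OF i] in auto)
  show "gauss_space.indep_vars (\<lambda>_. borel) (\<lambda>i \<xi>. levy_limit (\<tau> (Suc i)) \<xi> - levy_limit (\<tau> i) \<xi>) {..<N}"
    by (rule gauss_space.indep_normal_limit[OF _ ae _ ind gauss_space.normal_no_atom[OF normal]]) auto
qed


lemma (in prob_space) distributed_distr:
  assumes "g \<in> measurable M N" "X \<in> borel_measurable N"
    and "distributed M lborel (\<lambda>\<omega>. X (g \<omega>)) f"
  shows "distributed (distr M N g) lborel X f"
  using assms by (simp add: distributed_def distr_distr comp_def)

text \<open>This gives the choice in \<open>wiener_law\<close> a meaning: the limit process,
  restricted to the unit interval, is pushed forward to path space.\<close>

lemma wiener_law_exists: "\<exists>Q. sets Q = sets path_space \<and> brownian_fdd Q (\<lambda>t w. w t)"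
proof -
  define g where "g \<xi> = (\<lambda>t\<in>{0..1}. levy_limit t \<xi>)" for \<xi>
  have g[measurable]: "g \<in> measurable gauss_space path_space"
    unfolding g_def by measurable
  have gt: "g \<xi> t = levy_limit t \<xi>" if "t \<in> {0..1}" for t \<xi> using that by (simp add: g_def)
  let ?Q = "distr gauss_space path_space g"
  interpret Q: prob_space ?Q by (rule gauss_space.prob_space_distr) (rule g)
  have coord: "(\<lambda>w. w t) \<in> borel_measurable path_space" if "t \<in> {0..1}" for t
    using that by measurable
  have diff: "(\<lambda>w. w t - w s) \<in> borel_measurable path_space" if "t \<in> {0..1}" "s \<in> {0..1}" for s t
    using that by (intro borel_measurable_diff coord)
  have "brownian_fdd ?Q (\<lambda>t w. w t)"
    unfolding brownian_fdd_def
  proof (intro conjI ballI allI impI)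
    show "prob_space ?Q" by (rule Q.prob_space_axioms)
    show "(\<lambda>w. w t) \<in> borel_measurable ?Q" if "t \<in> {0..1}" for t
      using coord[OF that] by simp
    have "AE \<xi> in gauss_space. g \<xi> 0 = 0"
      by (simp add: gt levy_limit_def levy_path_zero)
    then show "AE w in ?Q. w 0 = 0"
      using coord[of 0] by (subst AE_distr_iff) auto
  next
    fix s t :: real assume st: "0 \<le> s \<and> s < t \<and> t \<le> 1"
    define \<tau> where "\<tau> = (\<lambda>i::nat. if i = 0 then s else t)"
    have "distributed gauss_space lborel (\<lambda>\<xi>. levy_limit (\<tau> (Suc 0)) \<xi> - levy_limit (\<tau> 0) \<xi>)
        (normal_density 0 (sqrt (\<tau> (Suc 0) - \<tau> 0)))"
      using st by (intro levy_increments(2)[where N = 1]) (auto simp: \<tau>_def strict_mono_on_def)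
    then have "distributed gauss_space lborel (\<lambda>\<xi>. g \<xi> t - g \<xi> s) (normal_density 0 (sqrt (t - s)))"
      using st by (simp add: \<tau>_def gt)
    then show "distributed ?Q lborel (\<lambda>w. w t - w s) (normal_density 0 (sqrt (t - s)))"
      using st by (intro gauss_space.distributed_distr g diff) auto
  next
    fix n and \<tau> :: "nat \<Rightarrow> real" assume \<tau>: "\<tau> ` {..n} \<subseteq> {0..1} \<and> strict_mono_on {..n} \<tau>"
    then have \<tau>01: "\<tau> i \<in> {0..1}" if "i \<le> n" for i using that by auto
    have "gauss_space.indep_vars (\<lambda>_. borel) (\<lambda>i \<xi>. levy_limit (\<tau> (Suc i)) \<xi> - levy_limit (\<tau> i) \<xi>) {..<n}"
      using levy_increments(1) \<tau> by blast
    then have "gauss_space.indep_vars (\<lambda>_. borel) (\<lambda>i \<xi>. g \<xi> (\<tau> (Suc i)) - g \<xi> (\<tau> i)) {..<n}"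
      by (rule gauss_space.indep_vars_cong[THEN iffD1, rotated -1]) (use \<tau>01 in \<open>auto simp: gt\<close>)
    then show "Q.indep_vars (\<lambda>_. borel) (\<lambda>i w. w (\<tau> (Suc i)) - w (\<tau> i)) {..<n}"
      using \<tau>01 by (intro gauss_space.indep_vars_distr_finite g diff) auto
  qed
  then show ?thesis by (intro exI[of _ ?Q]) simp
qed

lemma wiener_law: "sets wiener_law = sets path_space" "brownian_fdd wiener_law (\<lambda>t w. w t)"
  using someI_ex[OF wiener_law_exists] unfolding wiener_law_def by auto

section \<open>Convex functions on the unit interval\<close>

lemma minimizer:
  assumes "f \<in> convex_unique_min"
  shows "minimizer f \<in> {0..1}" and "\<And>t. t \<in> {0..1} \<Longrightarrow> minval f \<le> f t"
proof -
  have "\<exists>t. is_arg_min f (\<lambda>t. t \<in> {0..1}) t"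
    using assms by (auto simp: convex_unique_min_def)
  then have "is_arg_min f (\<lambda>t. t \<in> {0..1}) (minimizer f)"
    unfolding minimizer_def arg_min_on_def arg_min_def by (rule someI_ex)
  then show "minimizer f \<in> {0..1}" "\<And>t. t \<in> {0..1} \<Longrightarrow> minval f \<le> f t"
    by (auto simp: is_arg_min_def minval_def not_less)
qed

lemma minimizer_eqI:
  assumes "z \<in> {0..1}" "\<And>t. t \<in> {0..1} \<Longrightarrow> t \<noteq> z \<Longrightarrow> f z < f t"
  shows "minimizer f = z" and "\<exists>!t. is_arg_min f (\<lambda>t. t \<in> {0..1}) t"
proof -
  have am: "is_arg_min f (\<lambda>t. t \<in> {0..1}) t \<longleftrightarrow> t = z" for t
    using assms by (force simp: is_arg_min_def)
  show "minimizer f = z"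
    unfolding minimizer_def arg_min_on_def arg_min_def am by simp
  show "\<exists>!t. is_arg_min f (\<lambda>t. t \<in> {0..1}) t" unfolding am by simp
qed

lemma convex_upper_bound:
  assumes "convex_on {0..1} f" "t \<in> {0..1}"
  shows "f t \<le> max (f 0) (f (1::real))"
proof -
  have "f ((1 - t) * 0 + t * 1) \<le> (1 - t) * f 0 + t * f 1"
    using assms convex_onD[OF assms(1), of t 0 1] by simp
  also have "\<dots> \<le> (1 - t) * max (f 0) (f 1) + t * max (f 0) (f 1)"
    using assms(2) by (intro add_mono mult_left_mono) auto
  finally show ?thesis by (simp add: algebra_simps)
qed

text \<open>Outside the unit interval f is arbitrary, so f itself need not be Borel; measurability
  arguments go through this modification.\<close>

definition ext01 :: "(real \<Rightarrow> real) \<Rightarrow> real \<Rightarrow> real" where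
  "ext01 f t = (if t \<in> {0..1} then f t else 0)"

lemma ext01_eq[simp]: "t \<in> {0..1} \<Longrightarrow> ext01 f t = f t"
  by (simp add: ext01_def)

text \<open>A convex function is continuous inside the interval but may jump at the endpoints, which
  are therefore added as separate points.\<close>

lemma measurable_ext01:
  assumes "convex_on {0..1} f"
  shows "ext01 f \<in> borel_measurable borel"
proof -
  have "continuous_on {0<..<1} f"
    using assms by (intro convex_on_continuous convex_on_subset[OF assms]) auto
  then have "(\<lambda>t. indicator {0<..<1} t *\<^sub>R f t) \<in> borel_measurable borel"
    by (intro borel_measurable_continuous_on_indicator) auto
  moreover have "ext01 f = (\<lambda>t. indicator {0<..<1} t *\<^sub>R f t + indicator {0} t * f 0 + indicator {1} t * f 1)"
    by (auto simp: ext01_def fun_eq_iff indicator_def)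
  ultimately show ?thesis by simp
qed

lemma bounded_integrable_on_unit:
  fixes h :: "real \<Rightarrow> real"
  assumes h: "h \<in> borel_measurable borel" and A: "A \<in> sets borel" "A \<subseteq> {0..1}"
    and bd: "\<And>t. t \<in> A \<Longrightarrow> \<bar>h t\<bar> \<le> B"
  shows "set_integrable lborel A h"
proof -
  have "emeasure lborel A \<le> emeasure lborel {0..1::real}"
    using A by (intro emeasure_mono) auto
  then have fin: "emeasure lborel A < \<infinity>" by (auto simp: less_top[symmetric] top_unique)
  show ?thesis unfolding set_integrable_def
  proof (rule Bochner_Integration.integrable_bound)
    show "integrable lborel (\<lambda>t. indicator A t *\<^sub>R B)"
      using fin A by (intro integrable_scaleR_left integrable_real_indicator) auto
    show "AE t in lborel. norm (indicator A t *\<^sub>R h t) \<le> norm (indicator A t *\<^sub>R B)"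
    proof (intro AE_I2)
      fix t show "norm (indicator A t *\<^sub>R h t) \<le> norm (indicator A t *\<^sub>R B)"
        using bd[of t] by (auto simp: indicator_def)
    qed
  qed (use h A in measurable)
qed

text \<open>The variance of h on the interval is nonnegative. This will bound squared increments of
  the drift by the integral of its square.\<close>

lemma set_integral_square_le:
  fixes h :: "real \<Rightarrow> real"
  assumes a: "a < b" and h: "set_integrable lborel {a..b} h" "set_integrable lborel {a..b} (\<lambda>t. (h t)\<^sup>2)"
  shows "(LINT t:{a..b}|lborel. h t)\<^sup>2 / (b - a) \<le> (LINT t:{a..b}|lborel. (h t)\<^sup>2)"
proof -
  let ?I = "LINT t:{a..b}|lborel. h t" and ?c = "(LINT t:{a..b}|lborel. h t) / (b - a)"
  have c: "set_integrable lborel {a..b} (\<lambda>_. r :: real)" for r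
    unfolding set_integrable_def using a
    by (intro integrable_scaleR_left integrable_real_indicator) auto
  have i1: "set_integrable lborel {a..b} (\<lambda>t. 2 * ?c * h t)"
    using h(1) by (rule set_integrable_mult_right)
  have "0 \<le> (LINT t:{a..b}|lborel. (h t - ?c)\<^sup>2)"
    by (auto simp: set_lebesgue_integral_def intro!: integral_nonneg_AE)
  also have "(\<lambda>t. (h t - ?c)\<^sup>2) = (\<lambda>t. (h t)\<^sup>2 - 2 * ?c * h t + ?c\<^sup>2)"
    by (auto simp: power2_diff)
  also have "(LINT t:{a..b}|lborel. (h t)\<^sup>2 - 2 * ?c * h t + ?c\<^sup>2) =
      (LINT t:{a..b}|lborel. (h t)\<^sup>2) - 2 * ?c * ?I + ?c\<^sup>2 * (b - a)"
    using a by (subst set_integral_add set_integral_diff; (intro set_integral_diff h i1 c)?)+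
      (simp add: set_integral_const measure_def)
  finally have "2 * ?c * ?I - ?c\<^sup>2 * (b - a) \<le> (LINT t:{a..b}|lborel. (h t)\<^sup>2)" by linarith
  moreover have "?c\<^sup>2 * (b - a) = ?I\<^sup>2 / (b - a)" "2 * ?c * ?I = 2 * (?I\<^sup>2 / (b - a))"
    using a by (simp_all add: power2_eq_square)
  ultimately show ?thesis by linarith
qed

section \<open>Gaussian shifts\<close>

text \<open>The exponential is the likelihood ratio of the normal laws with means d and 0.\<close>

lemma nn_integral_normal_tilt:
  assumes s: "s > 0" and g[measurable]: "g \<in> borel_measurable borel"
  shows "(\<integral>\<^sup>+x. ennreal (exp (x * d / s\<^sup>2 - d\<^sup>2 / (2 * s\<^sup>2))) * g x \<partial>density lborel (normal_density 0 s)) =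
    (\<integral>\<^sup>+x. g x \<partial>density lborel (normal_density d s))"
proof -
  have eq: "normal_density 0 s x * exp (x * d / s\<^sup>2 - d\<^sup>2 / (2 * s\<^sup>2)) = normal_density d s x" for x
  proof -
    have "- (x\<^sup>2 / (2 * s\<^sup>2)) + (x * d / s\<^sup>2 - d\<^sup>2 / (2 * s\<^sup>2)) = - ((x - d)\<^sup>2 / (2 * s\<^sup>2))"
      using s by (simp add: power2_diff field_simps)
    then show ?thesis by (simp add: normal_density_def exp_add[symmetric])
  qed
  show ?thesis
    by (simp add: nn_integral_density mult.assoc[symmetric] ennreal_mult[symmetric] eq)
qed

text \<open>The shifted law has a density L with respect to P. Cauchy--Schwarz, applied to L times
  the indicator of Y, leaves the second moment of L, which is the exponential factor.\<close>

lemma gaussian_shift: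
  fixes s d :: "'i \<Rightarrow> real"
  assumes I[simp]: "finite I" and s: "\<And>i. i \<in> I \<Longrightarrow> s i > 0"
    and Y[measurable]: "Y \<in> sets (PiM I (\<lambda>_. borel))"
  defines "P \<equiv> PiM I (\<lambda>i. density lborel (normal_density 0 (s i)))"
  shows "(emeasure P {x\<in>space P. (\<lambda>i\<in>I. x i + d i) \<in> Y})\<^sup>2 \<le>
    ennreal (exp (\<Sum>i\<in>I. (d i)\<^sup>2 / (s i)\<^sup>2)) * emeasure P Y"
proof -
  \<comment> \<open>The interpretation of \<open>product_prob_space\<close> asks for a probability
    measure at every index, so the scale is set to 1 outside I.\<close>
  define \<sigma> where "\<sigma> i = (if i \<in> I then s i else 1)" for i
  have \<sigma>: "\<sigma> i > 0" for i using s by (simp add: \<sigma>_def)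
  define N where "N i = density lborel (normal_density 0 (\<sigma> i))" for i
  define N' where "N' i = density lborel (normal_density (d i) (\<sigma> i))" for i
  have P: "P = PiM I N" unfolding P_def N_def by (rule PiM_cong) (auto simp: \<sigma>_def)
  have pN: "prob_space (N i)" "prob_space (N' i)" for i
    unfolding N_def N'_def using \<sigma> by (auto intro: prob_space_normal_density)
  have sN[measurable_cong]: "sets (N i) = sets borel" "sets (N' i) = sets borel" for i
    by (simp_all add: N_def N'_def)
  interpret N: product_prob_space N I using pN by (intro product_prob_spaceI)
  interpret N': product_prob_space N' I using pN by (intro product_prob_spaceI)
  have sP[measurable_cong]: "sets P = sets (PiM I (\<lambda>_. borel))"
    unfolding P by (rule sets_PiM_cong) (auto simp: sN)
  define l where "l i x = exp (x * d i / (\<sigma> i)\<^sup>2 - (d i)\<^sup>2 / (2 * (\<sigma> i)\<^sup>2))" for i x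
  have [measurable]: "l i \<in> borel_measurable borel" for i unfolding l_def by measurable
  define L where "L x = (\<Prod>i\<in>I. ennreal (l i (x i)))" for x
  have L[measurable]: "L \<in> borel_measurable (PiM I (\<lambda>_. borel))"
    unfolding L_def by measurable
  have tilt: "(\<integral>\<^sup>+x. ennreal (l i x) * g x \<partial>N i) = (\<integral>\<^sup>+x. g x \<partial>N' i)"
    if "g \<in> borel_measurable borel" for g i
    unfolding l_def N_def N'_def by (rule nn_integral_normal_tilt[OF \<sigma> that])
  let ?T = "\<lambda>x. \<lambda>i\<in>I. x i + d i"
  have T[measurable]: "?T \<in> measurable P (PiM I (\<lambda>_. borel))"
    by measurable
  have N'_eq: "N' i = distr (N i) borel (\<lambda>x. x + d i)" for i
  proof -
    have "distributed (N i) lborel (\<lambda>x. x) (normal_density 0 (\<sigma> i))"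
      by (simp add: distributed_def N_def distr_cong[OF refl sets_lborel[symmetric]] distr_id2)
    from prob_space.normal_density_affine[OF pN(1) this \<sigma>, of 1 "d i"]
    have "distr (N i) lborel (\<lambda>x. d i + x) = N' i"
      by (simp add: distributed_def N'_def)
    then show ?thesis by (simp add: add.commute cong: distr_cong)
  qed
  \<comment> \<open>The image under the translation and the measure with density L are both
    identified with the product of the shifted normals, by comparison on boxes.\<close>
  have shift: "distr P (PiM I (\<lambda>_. borel)) ?T = PiM I N'"
  proof (rule N'.PiM_eqI)
    show "sets (distr P (PiM I (\<lambda>_. borel)) ?T) = sets (PiM I N')"
      by (simp add: sN cong: sets_PiM_cong)
  next
    fix A assume A: "\<And>i. i \<in> I \<Longrightarrow> A i \<in> sets (N' i)"
    then have A': "\<And>i. i \<in> I \<Longrightarrow> A i \<in> sets borel" by (simp add: sN)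
    have "emeasure (distr P (PiM I (\<lambda>_. borel)) ?T) (Pi\<^sub>E I A) = emeasure P (?T -` Pi\<^sub>E I A \<inter> space P)"
      using A' by (intro emeasure_distr T sets_PiM_I_finite) auto
    also have "?T -` Pi\<^sub>E I A \<inter> space P = (\<Pi>\<^sub>E i\<in>I. (\<lambda>x. x + d i) -` A i)"
      by (auto simp: P space_PiM N_def PiE_iff)
    also have "emeasure P \<dots> = (\<Prod>i\<in>I. emeasure (N i) ((\<lambda>x. x + d i) -` A i))"
      unfolding P using measurable_sets[of "\<lambda>x. x + d _" borel borel, OF _ A']
      by (intro N.emeasure_PiM) (auto simp: sN)
    also have "\<dots> = (\<Prod>i\<in>I. emeasure (N' i) (A i))"
      unfolding N'_eq using A' by (intro prod.cong refl, subst emeasure_distr) (auto simp: sN N_def)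
    finally show "emeasure (distr P (PiM I (\<lambda>_. borel)) ?T) (Pi\<^sub>E I A) = \<dots>" .
  qed simp
  have dens: "density P L = PiM I N'"
  proof (rule N'.PiM_eqI)
    show "sets (density P L) = sets (PiM I N')"
      by (simp add: sP sN cong: sets_PiM_cong)
  next
    fix A assume A: "\<And>i. i \<in> I \<Longrightarrow> A i \<in> sets (N' i)"
    then have A'[measurable]: "\<And>i. i \<in> I \<Longrightarrow> A i \<in> sets borel" by (simp add: sN)
    have "emeasure (density P L) (Pi\<^sub>E I A) = (\<integral>\<^sup>+x. L x * indicator (Pi\<^sub>E I A) x \<partial>P)"
      using A' by (intro emeasure_density) (auto simp: sP intro!: sets_PiM_I_finite)
    also have "\<dots> = (\<integral>\<^sup>+x. (\<Prod>i\<in>I. ennreal (l i (x i)) * indicator (A i) (x i)) \<partial>P)"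
    proof (rule nn_integral_cong)
      fix x assume "x \<in> space P"
      then have "x \<in> extensional I" by (auto simp: P space_PiM PiE_iff)
      then have "indicator (Pi\<^sub>E I A) x = (\<Prod>i\<in>I. indicator (A i) (x i) :: ennreal)"
        by (auto simp: indicator_def PiE_iff prod_zero)
      then show "L x * indicator (Pi\<^sub>E I A) x = (\<Prod>i\<in>I. ennreal (l i (x i)) * indicator (A i) (x i))"
        by (simp add: L_def prod.distrib)
    qed
    also have "\<dots> = (\<Prod>i\<in>I. \<integral>\<^sup>+x. ennreal (l i x) * indicator (A i) x \<partial>N i)"
      unfolding P using A' by (intro N.product_nn_integral_prod) (auto simp: sN)
    also have "\<dots> = (\<Prod>i\<in>I. emeasure (N' i) (A i))"
      using A' by (intro prod.cong refl) (simp add: tilt sN)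
    finally show "emeasure (density P L) (Pi\<^sub>E I A) = \<dots>" .
  qed simp
  have "(\<integral>\<^sup>+x. (L x)\<^sup>2 \<partial>P) = (\<integral>\<^sup>+x. (\<Prod>i\<in>I. ennreal (l i (x i)) * ennreal (l i (x i))) \<partial>P)"
    by (simp add: L_def power2_eq_square prod.distrib)
  also have "\<dots> = (\<Prod>i\<in>I. \<integral>\<^sup>+x. ennreal (l i x) * ennreal (l i x) \<partial>N i)"
    unfolding P by (intro N.product_nn_integral_prod) auto
  also have "\<dots> = (\<Prod>i\<in>I. ennreal (exp ((d i)\<^sup>2 / (s i)\<^sup>2)))"
  proof (intro prod.cong refl)
    fix i assume i: "i \<in> I"
    interpret Q: prob_space "density lborel (normal_density (2 * d i) (\<sigma> i))"
      using \<sigma> by (intro prob_space_normal_density)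
    \<comment> \<open>The square of a likelihood ratio is a constant times the ratio for the doubled
      shift, and the latter integrates to 1.\<close>
    have "ennreal (l i x) * ennreal (l i x) = ennreal (exp ((d i)\<^sup>2 / (\<sigma> i)\<^sup>2)) *
        (ennreal (exp (x * (2 * d i) / (\<sigma> i)\<^sup>2 - (2 * d i)\<^sup>2 / (2 * (\<sigma> i)\<^sup>2))) * 1)" for x
      using \<sigma>[of i] by (simp add: l_def ennreal_mult[symmetric] exp_add[symmetric] field_simps)
    then have "(\<integral>\<^sup>+x. ennreal (l i x) * ennreal (l i x) \<partial>N i) = ennreal (exp ((d i)\<^sup>2 / (\<sigma> i)\<^sup>2)) *
        (\<integral>\<^sup>+x. ennreal (exp (x * (2 * d i) / (\<sigma> i)\<^sup>2 - (2 * d i)\<^sup>2 / (2 * (\<sigma> i)\<^sup>2))) * 1 \<partial>N i)"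
      by (simp only:) (rule nn_integral_cmult, simp add: N_def)
    also have "(\<integral>\<^sup>+x. ennreal (exp (x * (2 * d i) / (\<sigma> i)\<^sup>2 - (2 * d i)\<^sup>2 / (2 * (\<sigma> i)\<^sup>2))) * 1 \<partial>N i) = 1"
      unfolding N_def by (subst nn_integral_normal_tilt[OF \<sigma>]) (auto simp: Q.emeasure_space_1[simplified])
    finally show "(\<integral>\<^sup>+x. ennreal (l i x) * ennreal (l i x) \<partial>N i) = ennreal (exp ((d i)\<^sup>2 / (s i)\<^sup>2))"
      using i by (simp add: \<sigma>_def)
  qed
  also have "\<dots> = ennreal (exp (\<Sum>i\<in>I. (d i)\<^sup>2 / (s i)\<^sup>2))"
    by (simp add: prod_ennreal exp_sum)
  finally have L2: "(\<integral>\<^sup>+x. (L x)\<^sup>2 \<partial>P) = ennreal (exp (\<Sum>i\<in>I. (d i)\<^sup>2 / (s i)\<^sup>2))" .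
  have "{x\<in>space P. ?T x \<in> Y} = ?T -` Y \<inter> space P" by auto
  then have "emeasure P {x\<in>space P. ?T x \<in> Y} = emeasure (distr P (PiM I (\<lambda>_. borel)) ?T) Y"
    using emeasure_distr[OF T Y] by simp
  also have "\<dots> = (\<integral>\<^sup>+x. L x * indicator Y x \<partial>P)"
    unfolding shift dens[symmetric] by (rule emeasure_density) (simp_all add: sP)
  finally have "(emeasure P {x\<in>space P. ?T x \<in> Y})\<^sup>2 = (\<integral>\<^sup>+x. L x * indicator Y x \<partial>P)\<^sup>2" by simp
  also have "\<dots> \<le> (\<integral>\<^sup>+x. (L x)\<^sup>2 \<partial>P) * (\<integral>\<^sup>+x. (indicator Y x)\<^sup>2 \<partial>P)"
    by (rule Cauchy_Schwarz_nn_integral) auto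
  also have "(\<integral>\<^sup>+x. (indicator Y x :: ennreal)\<^sup>2 \<partial>P) = (\<integral>\<^sup>+x. indicator Y x \<partial>P)"
    by (intro nn_integral_cong) (auto simp: indicator_def)
  also have "\<dots> = emeasure P Y" using Y by (simp add: sP)
  finally show ?thesis unfolding L2 .
qed

section \<open>Splitting of integrals and approximation of events\<close>

lemma set_integral_split:
  fixes h :: "real \<Rightarrow> real"
  assumes h: "set_integrable lborel {0..1} h" and ab: "0 \<le> a" "a \<le> b" "b \<le> 1"
  shows "(LINT t:{0..b}|lborel. h t) - (LINT t:{0..a}|lborel. h t) = (LINT t:{a..b}|lborel. h t)"
proof -
  have i: "set_integrable lborel S h" if "S \<in> sets borel" "S \<subseteq> {0..1}" for S
    using set_integrable_subset[OF h] that by auto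
  have "(LINT t:{0..a}|lborel. h t) + (LINT t:{a..b}|lborel. h t) =
      (\<integral>t. indicator {0..a} t *\<^sub>R h t + indicator {a..b} t *\<^sub>R h t \<partial>lborel)"
    unfolding set_lebesgue_integral_def
    using i[of "{0..a}"] i[of "{a..b}"] ab
    by (intro Bochner_Integration.integral_add[symmetric]) (auto simp: set_integrable_def)
  also have "\<dots> = (LINT t:{0..b}|lborel. h t)"
    unfolding set_lebesgue_integral_def
  proof (rule integral_cong_AE)
    show "(\<lambda>t. indicator {0..a} t *\<^sub>R h t + indicator {a..b} t *\<^sub>R h t) \<in> borel_measurable lborel"
      using i[of "{0..a}"] i[of "{a..b}"] ab
      by (intro borel_measurable_add) (auto simp: set_integrable_def)
    show "(\<lambda>t. indicator {0..b} t *\<^sub>R h t) \<in> borel_measurable lborel"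
      using i[of "{0..b}"] ab by (auto simp: set_integrable_def)
    have "AE t in lborel. t \<noteq> a" by (rule AE_lborel_singleton)
    then show "AE t in lborel. indicator {0..a} t *\<^sub>R h t + indicator {a..b} t *\<^sub>R h t = indicator {0..b} t *\<^sub>R h t"
      by eventually_elim (use ab in \<open>auto simp: indicator_def\<close>)
  qed
  finally show ?thesis by simp
qed

lemma finite_real_set_enum:
  fixes S :: "real set"
  assumes "finite S" "S \<noteq> {}"
  obtains n and \<tau> :: "nat \<Rightarrow> real" where "strict_mono_on {..n} \<tau>" "\<tau> ` {..n} = S"
proof -
  let ?xs = "sorted_list_of_set S"
  have len: "length ?xs = card S" "card S > 0" using assms by (auto simp: card_gt_0_iff)
  have "strict_mono_on {..card S - 1} (\<lambda>i. ?xs ! i)"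
    using len strict_sorted_list_of_set[of S] by (auto simp: strict_mono_on_def sorted_wrt_nth_less)
  moreover have "(\<lambda>i. ?xs ! i) ` {..card S - 1} = S"
  proof -
    have "{..card S - 1} = {..<length ?xs}" using len by auto
    then have "(\<lambda>i. ?xs ! i) ` {..card S - 1} = set ?xs"
      by (auto simp: set_conv_nth simp del: set_sorted_list_of_set)
    then show ?thesis using assms by simp
  qed
  ultimately show ?thesis using that by blast
qed

text \<open>One B has to serve both measures, so the induction runs on their sum. A countable union
  is first cut to finitely many sets, which uses half of the tolerance; the rest is divided among
  the pieces.\<close>

lemma sets_approx_algebra:
  fixes M1 M2 :: "'a measure"
  assumes fin: "finite_measure M1" "finite_measure M2"
    and G: "algebra \<Omega> G" and s1: "sets M1 = sigma_sets \<Omega> G" and s2: "sets M2 = sigma_sets \<Omega> G"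
    and A: "A \<in> sets M1"
  shows "\<forall>\<delta>>0. \<exists>B\<in>G. measure M1 (sym_diff A B) + measure M2 (sym_diff A B) < \<delta>"
proof -
  interpret M1: finite_measure M1 by fact
  interpret M2: finite_measure M2 by fact
  interpret G: algebra \<Omega> G by fact
  have sub: "B \<in> sets M1" "B \<in> sets M2" if "B \<in> G" for B using that s1 s2 by auto
  define \<mu> where "\<mu> B = measure M1 B + measure M2 B" for B
  have \<mu>_mono: "\<mu> B \<le> \<mu> C" if "B \<subseteq> C" "C \<in> sets M1" for B C
    unfolding \<mu>_def using that s1 s2 by (intro add_mono M1.finite_measure_mono M2.finite_measure_mono) auto
  have \<mu>_Un: "\<mu> (B \<union> C) \<le> \<mu> B + \<mu> C" if "B \<in> sets M1" "C \<in> sets M1" for B C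
    unfolding \<mu>_def using measure_Un_le[of B M1 C] measure_Un_le[of B M2 C] that s1 s2 by auto
  have "A \<in> sigma_sets \<Omega> G" using A s1 by simp
  then have "\<forall>\<delta>>0. \<exists>B\<in>G. \<mu> (sym_diff A B) < \<delta>"
  proof (induction A)
    case (Basic a)
    then show ?case by (auto simp: \<mu>_def intro!: bexI[of _ a])
  next
    case Empty
    then show ?case by (auto simp: \<mu>_def intro!: bexI[of _ "{}"])
  next
    case (Compl a)
    show ?case
    proof (intro allI impI)
      fix \<delta> :: real assume "\<delta> > 0"
      then obtain B where B: "B \<in> G" "\<mu> (sym_diff a B) < \<delta>" using Compl.IH by auto
      have "a \<subseteq> \<Omega>" using Compl.hyps sigma_sets_into_sp[OF G.space_closed] by auto
      then have "sym_diff (\<Omega> - a) (\<Omega> - B) = sym_diff a B" using G.sets_into_space[OF B(1)] by auto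
      with B show "\<exists>B\<in>G. \<mu> (sym_diff (\<Omega> - a) B) < \<delta>" by (intro bexI[of _ "\<Omega> - B"]) auto
    qed
  next
    case (Union a)
    show ?case
    proof (intro allI impI)
      fix \<delta> :: real assume \<delta>: "\<delta> > 0"
      have am: "a i \<in> sets M1" "a i \<in> sets M2" for i using Union.hyps s1 s2 by auto
      let ?U = "\<Union>i. a i"
      have "(\<lambda>n. measure M (\<Union>i<n. a i)) \<longlonglongrightarrow> measure M ?U"
        if "finite_measure M" "\<And>i. a i \<in> sets M" for M
      proof -
        have "(\<lambda>n. measure M (\<Union>i<n. a i)) \<longlonglongrightarrow> measure M (\<Union>n. \<Union>i<n. a i)"
          using that by (intro finite_measure.finite_Lim_measure_incseq) (auto simp: incseq_def intro: less_le_trans)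
        also have "(\<Union>n. \<Union>i<n. a i) = ?U" by auto
        finally show ?thesis .
      qed
      then have "(\<lambda>n. \<mu> (\<Union>i<n. a i)) \<longlonglongrightarrow> \<mu> ?U"
        unfolding \<mu>_def using fin am by (intro tendsto_add) auto
      then have "eventually (\<lambda>n. \<mu> (\<Union>i<n. a i) > \<mu> ?U - \<delta> / 2) sequentially"
        using \<delta> by (intro order_tendstoD) auto
      then obtain n where n: "\<mu> (\<Union>i<n. a i) > \<mu> ?U - \<delta> / 2"
        by (auto simp: eventually_sequentially)
      have "\<exists>B\<in>G. \<mu> (sym_diff (a i) B) < \<delta> / (2 * real (Suc n))" for i
        using Union.IH \<delta> by auto
      then obtain B where B: "\<And>i. B i \<in> G" "\<And>i. \<mu> (sym_diff (a i) (B i)) < \<delta> / (2 * real (Suc n))"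
        by metis
      have Bn: "(\<Union>i<n. B i) \<in> G" using B by auto
      have d: "sym_diff (a i) (B i) \<in> sets M1" for i using am sub B by auto
      have "sym_diff ?U (\<Union>i<n. B i) \<subseteq> (?U - (\<Union>i<n. a i)) \<union> (\<Union>i<n. sym_diff (a i) (B i))"
        by auto
      then have "\<mu> (sym_diff ?U (\<Union>i<n. B i)) \<le> \<mu> ((?U - (\<Union>i<n. a i)) \<union> (\<Union>i<n. sym_diff (a i) (B i)))"
        using am d by (intro \<mu>_mono) auto
      also have "\<dots> \<le> \<mu> (?U - (\<Union>i<n. a i)) + \<mu> (\<Union>i<n. sym_diff (a i) (B i))"
        using am d by (intro \<mu>_Un) auto
      also have "\<mu> (?U - (\<Union>i<n. a i)) = \<mu> ?U - \<mu> (\<Union>i<n. a i)"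
        unfolding \<mu>_def using am
        by (subst M1.finite_measure_Diff, auto, subst M2.finite_measure_Diff) auto
      also have "\<mu> (\<Union>i<n. sym_diff (a i) (B i)) \<le> (\<Sum>i<n. \<mu> (sym_diff (a i) (B i)))"
      proof (induction n)
        case (Suc n)
        have "(\<Union>i<Suc n. sym_diff (a i) (B i)) = (\<Union>i<n. sym_diff (a i) (B i)) \<union> sym_diff (a n) (B n)"
          by (auto simp: lessThan_Suc)
        then show ?case using \<mu>_Un[of "\<Union>i<n. sym_diff (a i) (B i)" "sym_diff (a n) (B n)"] d Suc by auto
      qed (simp add: \<mu>_def)
      also have "\<dots> \<le> (\<Sum>i<n. \<delta> / (2 * real (Suc n)))"
        using B by (intro sum_mono) (auto intro: less_imp_le)
      also have "\<dots> \<le> \<delta> / 2"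
        using \<delta> by (simp add: field_simps)
      finally have "\<mu> (sym_diff ?U (\<Union>i<n. B i)) < \<delta>" using n by linarith
      then show "\<exists>B\<in>G. \<mu> (sym_diff ?U B) < \<delta>" using Bn by auto
    qed
  qed
  then show ?thesis by (simp add: \<mu>_def)
qed

section \<open>Comparing white noise laws\<close>

lemma white_noise_map_measurable:
  "(\<lambda>w. \<lambda>t\<in>{0..1}. observation \<epsilon> f (\<lambda>s v. v s) t w) \<in> measurable wiener_law path_space"
  unfolding measurable_cong_sets[OF wiener_law(1) refl] observation_def
  by (intro measurable_restrict borel_measurable_add borel_measurable_times measurable_component_singleton) auto

lemma prob_space_wiener_law: "prob_space wiener_law"
  using wiener_law(2) by (simp add: brownian_fdd_def)

lemma prob_space_white_noise_law: "prob_space (white_noise_law \<epsilon> f)"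
  unfolding white_noise_law_def
  by (rule prob_space.prob_space_distr[OF prob_space_wiener_law white_noise_map_measurable])

lemma sets_white_noise_law: "sets (white_noise_law \<epsilon> f) = sets path_space"
  by (simp add: white_noise_law_def)

text \<open>A cylinder event is decided by finitely many independent normal increments, and
  replacing the drift f by g translates them. The exponent of \<open>gaussian_shift\<close> is then
  a sum over a partition, which \<open>set_integral_square_le\<close> bounds by the
  integral.\<close>

lemma white_noise_cylinder_le:
  assumes \<epsilon>: "\<epsilon> > 0" and J: "finite J" "J \<subseteq> {0..1}" and X: "X \<in> sets (PiM J (\<lambda>_. borel))"
    and f: "set_integrable lborel {0..1} f" and g: "set_integrable lborel {0..1} g"
    and h2: "set_integrable lborel {0..1} (\<lambda>t. (g t - f t)\<^sup>2)"
  defines "B \<equiv> prod_emb {0..1} (\<lambda>_. borel :: real measure) J X"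
  shows "(emeasure (white_noise_law \<epsilon> g) B)\<^sup>2 \<le>
    ennreal (exp ((LINT t:{0..1}|lborel. (g t - f t)\<^sup>2) / \<epsilon>\<^sup>2)) * emeasure (white_noise_law \<epsilon> f) B"
proof -
  interpret Q: prob_space wiener_law by (rule prob_space_wiener_law)
  \<comment> \<open>Adding 0 makes path values sums of increments from time 0; adding 1 guarantees
    at least one increment.\<close>
  obtain n and \<tau> :: "nat \<Rightarrow> real" where \<tau>: "strict_mono_on {..n} \<tau>" "\<tau> ` {..n} = insert 0 (insert 1 J)"
    using finite_real_set_enum[of "insert 0 (insert 1 J)"] J by auto
  have \<tau>01: "\<tau> i \<in> {0..1}" if "i \<le> n" for i
  proof -
    have "\<tau> i \<in> insert 0 (insert 1 J)" using that by (subst \<tau>(2)[symmetric]) auto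
    then show ?thesis using J by auto
  qed
  have \<tau>_less: "\<tau> i < \<tau> j" if "i < j" "j \<le> n" for i j using \<tau>(1) that by (auto simp: strict_mono_on_def)
  have \<tau>0: "\<tau> 0 = 0"
  proof -
    obtain k where "k \<le> n" "\<tau> k = 0" using \<tau>(2) by (metis atMost_iff imageE insertI1)
    then show ?thesis using \<tau>_less[of 0 k] \<tau>01[of 0] by (cases "k = 0") auto
  qed
  have n: "n > 0"
  proof (rule ccontr)
    assume "\<not> n > 0"
    then have "\<tau> ` {..n} = {0}" using \<tau>0 by auto
    with \<tau>(2) show False by auto
  qed
  have "\<exists>k\<le>n. \<tau> k = t" if "t \<in> J" for t using \<tau>(2) that by (metis atMost_iff imageE insertI1 insertI2)
  then obtain idx where idx: "\<And>t. t \<in> J \<Longrightarrow> idx t \<le> n" "\<And>t. t \<in> J \<Longrightarrow> \<tau> (idx t) = t" by metis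
  let ?I = "{..<n}"
  let ?E = "PiM ?I (\<lambda>_. borel) :: (nat \<Rightarrow> real) measure"
  define inc where "inc w = (\<lambda>i\<in>?I. w (\<tau> (Suc i)) - w (\<tau> i))" for w :: "real \<Rightarrow> real"
  define s where "s i = sqrt (\<tau> (Suc i) - \<tau> i)" for i
  have s: "s i > 0" if "i \<in> ?I" for i using \<tau>_less that by (auto simp: s_def)
  define P where "P = PiM ?I (\<lambda>i. density lborel (normal_density 0 (s i)))"
  have sP: "sets P = sets ?E" unfolding P_def by (rule sets_PiM_cong) auto
  then have spP: "space P = space ?E" by (rule sets_eq_imp_space_eq)
  have mw: "(\<lambda>w. w (\<tau> (Suc i)) - w (\<tau> i)) \<in> borel_measurable wiener_law" if "i \<in> ?I" for i
    unfolding measurable_cong_sets[OF wiener_law(1) refl] using that \<tau>01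
    by (intro borel_measurable_diff measurable_component_singleton) auto
  have incm: "inc \<in> measurable wiener_law ?E"
    unfolding inc_def by (intro measurable_restrict mw)
  have "distr wiener_law ?E inc = PiM ?I (\<lambda>i. distr wiener_law borel (\<lambda>w. w (\<tau> (Suc i)) - w (\<tau> i)))"
    unfolding inc_def
  proof (subst Q.indep_vars_iff_distr_eq_PiM'[symmetric])
    show "Q.indep_vars (\<lambda>_. borel) (\<lambda>i w. w (\<tau> (Suc i)) - w (\<tau> i)) ?I"
    proof -
      have "\<tau> ` {..n} \<subseteq> {0..1} \<and> strict_mono_on {..n} \<tau>" using \<tau> J by auto
      then show ?thesis using wiener_law(2) unfolding brownian_fdd_def by blast
    qed
  qed (use n mw in auto)
  also have "\<dots> = P"
    unfolding P_def
  proof (rule PiM_cong)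
    fix i assume i: "i \<in> ?I"
    then have "distributed wiener_law lborel (\<lambda>w. w (\<tau> (Suc i)) - w (\<tau> i)) (normal_density 0 (s i))"
      using wiener_law(2) \<tau>01[of i] \<tau>01[of "Suc i"] \<tau>_less[of i "Suc i"] unfolding brownian_fdd_def s_def by auto
    then show "distr wiener_law borel (\<lambda>w. w (\<tau> (Suc i)) - w (\<tau> i)) = density lborel (normal_density 0 (s i))"
      by (simp add: distributed_def cong: distr_cong)
  qed simp
  finally have incP: "distr wiener_law ?E inc = P" .
  define F where "F h t = (LINT x:{0..t}|lborel. h x)" for h :: "real \<Rightarrow> real" and t :: real
  define \<Psi> where "\<Psi> h x = (\<lambda>t\<in>J. F h t + \<epsilon> * (\<Sum>i<idx t. x i))" for h and x :: "nat \<Rightarrow> real"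
  have \<Psi>m: "\<Psi> h \<in> measurable ?E (PiM J (\<lambda>_. borel))" for h
    unfolding \<Psi>_def
    by (intro measurable_restrict borel_measurable_add borel_measurable_times borel_measurable_sum
        measurable_component_singleton) (auto dest: idx(1))
  define Y where "Y h = {x\<in>space ?E. \<Psi> h x \<in> X}" for h
  have Ym: "Y h \<in> sets ?E" for h
  proof -
    have "Y h = \<Psi> h -` X \<inter> space ?E" by (auto simp: Y_def)
    then show ?thesis using measurable_sets[OF \<Psi>m X] by simp
  qed
  have Bm: "B \<in> sets path_space" unfolding B_def using J X by (intro sets_PiM_I_finite measurable_prod_emb) auto
  have wn: "emeasure (white_noise_law \<epsilon> h) B = emeasure P (Y h)" for h
  proof -
    let ?T = "\<lambda>w. \<lambda>t\<in>{0..1}. observation \<epsilon> h (\<lambda>s v. v s) t w"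
    have "emeasure (white_noise_law \<epsilon> h) B = emeasure wiener_law (?T -` B \<inter> space wiener_law)"
      unfolding white_noise_law_def by (rule emeasure_distr[OF white_noise_map_measurable Bm])
    also have "\<dots> = emeasure wiener_law (inc -` Y h \<inter> space wiener_law)"
    \<comment> \<open>The sum of the increments is the path value only if the path starts at 0,
      which holds almost surely.\<close>
    proof (rule emeasure_eq_AE)
      have "AE w in wiener_law. w 0 = 0" using wiener_law(2) by (simp add: brownian_fdd_def)
      then show "AE w in wiener_law. (w \<in> ?T -` B \<inter> space wiener_law) = (w \<in> inc -` Y h \<inter> space wiener_law)"
        using AE_space
      proof eventually_elim
        case (elim w)
        have "restrict (?T w) J = \<Psi> h (inc w)"
        proof
          fix t show "restrict (?T w) J t = \<Psi> h (inc w) t"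
          proof (cases "t \<in> J")
            case True
            have "(\<Sum>i<idx t. inc w i) = (\<Sum>i<idx t. w (\<tau> (Suc i)) - w (\<tau> i))"
              using idx(1)[OF True] by (intro sum.cong) (auto simp: inc_def)
            also have "\<dots> = w t" using idx(2)[OF True] elim \<tau>0
              by (simp add: sum_lessThan_telescope[of "\<lambda>i. w (\<tau> i)"])
            finally show ?thesis using True J by (auto simp: \<Psi>_def F_def observation_def)
          qed (auto simp: \<Psi>_def)
        qed
        moreover have "inc w \<in> space ?E" using measurable_space[OF incm] elim by auto
        moreover have "?T w \<in> space path_space"
          using measurable_space[OF white_noise_map_measurable] elim by auto
        ultimately show ?case using elim(2)
          by (auto simp: B_def prod_emb_def Y_def space_PiM)
      qed
    qed (use measurable_sets[OF white_noise_map_measurable Bm] measurable_sets[OF incm Ym] in auto)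
    also have "\<dots> = emeasure P (Y h)"
      unfolding incP[symmetric] by (rule emeasure_distr[OF incm Ym, symmetric])
    finally show ?thesis .
  qed
  let ?h = "\<lambda>t. g t - f t"
  have hi: "set_integrable lborel {0..1} ?h" using f g by (intro set_integral_diff)
  have F_diff: "F ?h t = F g t - F f t" if "t \<in> {0..1}" for t
    unfolding F_def using set_integrable_subset[OF f, of "{0..t}"] set_integrable_subset[OF g, of "{0..t}"] that
    by (intro set_integral_diff) auto
  have F0: "F h 0 = 0" for h
  proof -
    have "AE t in lborel. t \<noteq> (0::real)" by (rule AE_lborel_singleton)
    then have "AE t in lborel. indicator {0..0} t *\<^sub>R h t = 0"
      by eventually_elim (auto simp: indicator_def)
    then show ?thesis unfolding F_def set_lebesgue_integral_def by (rule integral_eq_zero_AE)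
  qed
  define d where "d i = (F ?h (\<tau> (Suc i)) - F ?h (\<tau> i)) / \<epsilon>" for i
  have "Y g = {x\<in>space P. (\<lambda>i\<in>?I. x i + d i) \<in> Y f}"
  proof -
    have "\<Psi> f (\<lambda>i\<in>?I. x i + d i) = \<Psi> g x" for x
    proof
      fix t show "\<Psi> f (\<lambda>i\<in>?I. x i + d i) t = \<Psi> g x t"
      proof (cases "t \<in> J")
        case True
        have "\<epsilon> * (\<Sum>i<idx t. (\<lambda>i\<in>?I. x i + d i) i) = \<epsilon> * (\<Sum>i<idx t. x i + d i)"
          using idx(1)[OF True] by (intro arg_cong2[where f = "(*)"] sum.cong) auto
        also have "\<dots> = \<epsilon> * (\<Sum>i<idx t. x i) + (\<Sum>i<idx t. F ?h (\<tau> (Suc i)) - F ?h (\<tau> i))"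
          using \<epsilon> by (simp add: sum.distrib distrib_left sum_distrib_left d_def)
        also have "(\<Sum>i<idx t. F ?h (\<tau> (Suc i)) - F ?h (\<tau> i)) = F ?h t"
          using idx(2)[OF True] \<tau>0 F0 by (simp add: sum_lessThan_telescope[of "\<lambda>i. F ?h (\<tau> i)"])
        also have "F ?h t = F g t - F f t" using True J by (intro F_diff) auto
        finally show ?thesis using True by (simp add: \<Psi>_def)
      qed (simp add: \<Psi>_def)
    qed
    moreover have "(\<lambda>i\<in>?I. x i + d i) \<in> space ?E" for x by (auto simp: space_PiM)
    ultimately show ?thesis by (auto simp: Y_def spP)
  qed
  then have "(emeasure P (Y g))\<^sup>2 \<le> ennreal (exp (\<Sum>i<n. (d i)\<^sup>2 / (s i)\<^sup>2)) * emeasure P (Y f)"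
    using gaussian_shift[of ?I s "Y f" d, folded P_def] s Ym[of f] by simp
  also have "\<dots> \<le> ennreal (exp ((LINT t:{0..1}|lborel. (?h t)\<^sup>2) / \<epsilon>\<^sup>2)) * emeasure P (Y f)"
  proof (intro mult_right_mono ennreal_leI)
    have "(d i)\<^sup>2 / (s i)\<^sup>2 \<le> (F (\<lambda>t. (?h t)\<^sup>2) (\<tau> (Suc i)) - F (\<lambda>t. (?h t)\<^sup>2) (\<tau> i)) / \<epsilon>\<^sup>2" if "i < n" for i
    proof -
      have le: "\<tau> i < \<tau> (Suc i)" and r: "0 \<le> \<tau> i" "\<tau> (Suc i) \<le> 1"
        using \<tau>_less[of i "Suc i"] \<tau>01[of i] \<tau>01[of "Suc i"] that by auto
      have "(d i)\<^sup>2 / (s i)\<^sup>2 = (LINT t:{\<tau> i..\<tau> (Suc i)}|lborel. ?h t)\<^sup>2 / (\<tau> (Suc i) - \<tau> i) / \<epsilon>\<^sup>2"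
        unfolding d_def F_def using set_integral_split[OF hi r(1) _ r(2)] le
        by (simp add: s_def power_divide)
      also have "\<dots> \<le> (LINT t:{\<tau> i..\<tau> (Suc i)}|lborel. (?h t)\<^sup>2) / \<epsilon>\<^sup>2"
        using le r
        by (intro divide_right_mono set_integral_square_le set_integrable_subset[OF hi] set_integrable_subset[OF h2]) auto
      also have "\<dots> = (F (\<lambda>t. (?h t)\<^sup>2) (\<tau> (Suc i)) - F (\<lambda>t. (?h t)\<^sup>2) (\<tau> i)) / \<epsilon>\<^sup>2"
        unfolding F_def using set_integral_split[OF h2 r(1) _ r(2)] le by simp
      finally show ?thesis .
    qed
    then have "(\<Sum>i<n. (d i)\<^sup>2 / (s i)\<^sup>2) \<le>
        (\<Sum>i<n. (F (\<lambda>t. (?h t)\<^sup>2) (\<tau> (Suc i)) - F (\<lambda>t. (?h t)\<^sup>2) (\<tau> i)) / \<epsilon>\<^sup>2)"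
      by (intro sum_mono) auto
    also have "\<dots> = (F (\<lambda>t. (?h t)\<^sup>2) (\<tau> n) - F (\<lambda>t. (?h t)\<^sup>2) 0) / \<epsilon>\<^sup>2"
      unfolding sum_divide_distrib[symmetric] sum_lessThan_telescope[of "\<lambda>i. F (\<lambda>t. (?h t)\<^sup>2) (\<tau> i)"] \<tau>0 ..
    also have "\<dots> \<le> F (\<lambda>t. (?h t)\<^sup>2) 1 / \<epsilon>\<^sup>2"
    proof (rule divide_right_mono)
      have "0 \<le> (LINT t:{\<tau> n..1}|lborel. (?h t)\<^sup>2)"
        by (auto simp: set_lebesgue_integral_def intro!: integral_nonneg_AE)
      also have "\<dots> = F (\<lambda>t. (?h t)\<^sup>2) 1 - F (\<lambda>t. (?h t)\<^sup>2) (\<tau> n)"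
        unfolding F_def using \<tau>01[of n] by (intro set_integral_split[OF h2, symmetric]) auto
      finally show "F (\<lambda>t. (?h t)\<^sup>2) (\<tau> n) - F (\<lambda>t. (?h t)\<^sup>2) 0 \<le> F (\<lambda>t. (?h t)\<^sup>2) 1" by (simp add: F0)
    qed simp
    finally show "exp (\<Sum>i<n. (d i)\<^sup>2 / (s i)\<^sup>2) \<le> exp ((LINT t:{0..1}|lborel. (?h t)\<^sup>2) / \<epsilon>\<^sup>2)"
      by (simp add: F_def)
  qed simp
  finally show ?thesis unfolding wn .
qed

text \<open>The inequality need not survive complements, so it cannot be carried directly through
  the generation of the sigma-algebra. The event is instead approximated by one cylinder set in both
  laws at once.\<close>

lemma white_noise_shift_le:
  assumes \<epsilon>: "\<epsilon> > 0" and A: "A \<in> sets path_space"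
    and f: "set_integrable lborel {0..1} f" and g: "set_integrable lborel {0..1} g"
    and h2: "set_integrable lborel {0..1} (\<lambda>t. (g t - f t)\<^sup>2)"
  shows "(measure (white_noise_law \<epsilon> g) A)\<^sup>2 \<le>
    exp ((LINT t:{0..1}|lborel. (g t - f t)\<^sup>2) / \<epsilon>\<^sup>2) * measure (white_noise_law \<epsilon> f) A"
proof -
  define C where "C = exp ((LINT t:{0..1}|lborel. (g t - f t)\<^sup>2) / \<epsilon>\<^sup>2)"
  have C: "C > 0" by (simp add: C_def)
  let ?Pf = "white_noise_law \<epsilon> f" and ?Pg = "white_noise_law \<epsilon> g"
  interpret Pf: prob_space ?Pf by (rule prob_space_white_noise_law)
  interpret Pg: prob_space ?Pg by (rule prob_space_white_noise_law)
  let ?M = "\<lambda>_::real. borel :: real measure"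
  let ?D = "\<lambda>J. distr ?Pf (PiM J ?M) (\<lambda>w. restrict w J)"
  have rs: "(\<lambda>w. restrict w J) \<in> measurable ?Pf (PiM J ?M)" if "J \<subseteq> {0..1}" for J
    unfolding measurable_cong_sets[OF sets_white_noise_law refl]
    by (rule measurable_restrict_subset[OF that])
  interpret proj: projective_family "{0..1}" ?D ?M
  proof (rule projective_family.intro)
    fix J H :: "real set" assume JH: "J \<subseteq> H" "finite H" "H \<subseteq> {0..1}"
    have "distr (?D H) (PiM J ?M) (\<lambda>w. restrict w J) = distr ?Pf (PiM J ?M) ((\<lambda>w. restrict w J) \<circ> (\<lambda>w. restrict w H))"
      using JH by (intro distr_distr rs) (auto intro!: measurable_restrict_subset)
    also have "(\<lambda>w::real \<Rightarrow> real. restrict w J) \<circ> (\<lambda>w. restrict w H) = (\<lambda>w. restrict w J)"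
      using JH by (auto simp: fun_eq_iff Int_absorb1 Int_absorb2)
    finally show "?D J = distr (?D H) (PiM J ?M) (\<lambda>w. restrict w J)" ..
  next
    fix J :: "real set" assume "finite J" "J \<subseteq> {0..1}"
    then show "prob_space (?D J)" by (intro Pf.prob_space_distr rs)
  qed
  have sp: "sets ?Pf = sigma_sets (space path_space) proj.generator"
    "sets ?Pg = sigma_sets (space path_space) proj.generator"
    unfolding sets_white_noise_law by (rule proj.sets_PiM_generator)+
  have cyl: "(Pg.prob B)\<^sup>2 \<le> C * Pf.prob B" if "B \<in> proj.generator" for B
    using that
  proof cases
    case (1 J X)
    have "(emeasure ?Pg B)\<^sup>2 \<le> ennreal C * emeasure ?Pf B"
      unfolding C_def 1(1) by (rule white_noise_cylinder_le[OF \<epsilon> _ _ _ f g h2]) (use 1 in auto)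
    then show ?thesis
      using C by (simp add: Pf.emeasure_eq_measure Pg.emeasure_eq_measure ennreal_power ennreal_mult[symmetric])
  qed
  have approx: "\<forall>\<delta>>0. \<exists>B\<in>proj.generator. Pf.prob (sym_diff A B) + Pg.prob (sym_diff A B) < \<delta>"
    using A by (intro sets_approx_algebra[OF _ _ proj.algebra_generator sp])
      (auto simp: sets_white_noise_law Pf.finite_measure_axioms Pg.finite_measure_axioms)
  have "(Pg.prob A)\<^sup>2 \<le> C * Pf.prob A"
  proof (rule field_le_epsilon)
    fix e :: real assume e: "e > 0"
    \<comment> \<open>Replacing A by B costs C times the tolerance on the right and at most three
      times the tolerance in the square on the left: two from the mixed term and one from the square
      of the tolerance.\<close>
    define \<delta> where "\<delta> = min 1 (e / (C + 3))"
    have "(C + 3) * \<delta> \<le> (C + 3) * (e / (C + 3))"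
      using C by (intro mult_left_mono) (auto simp: \<delta>_def)
    then have \<delta>: "\<delta> > 0" "\<delta> \<le> 1" "(C + 3) * \<delta> \<le> e"
      using e C by (auto simp: \<delta>_def)
    obtain B where B: "B \<in> proj.generator" "Pf.prob (sym_diff A B) + Pg.prob (sym_diff A B) < \<delta>"
      using approx \<delta>(1) by auto
    have BA: "A \<in> sets path_space" "B \<in> sets path_space"
      using A B(1) sp(1) by (auto simp: sets_white_noise_law)
    have l: "Pf.prob (sym_diff A B) < \<delta>" "Pg.prob (sym_diff A B) < \<delta>"
      using B(2) measure_nonneg[of ?Pf "sym_diff A B"] measure_nonneg[of ?Pg "sym_diff A B"] by linarith+
    have "Pg.prob A \<le> Pg.prob (B \<union> sym_diff A B)"
      using BA by (intro Pg.finite_measure_mono) (auto simp: sets_white_noise_law)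
    also have "\<dots> \<le> Pg.prob B + Pg.prob (sym_diff A B)"
      using BA by (intro measure_Un_le) (auto simp: sets_white_noise_law)
    finally have 1: "Pg.prob A \<le> Pg.prob B + \<delta>" using l by linarith
    have "Pf.prob B \<le> Pf.prob (A \<union> sym_diff A B)"
      using BA by (intro Pf.finite_measure_mono) (auto simp: sets_white_noise_law)
    also have "\<dots> \<le> Pf.prob A + Pf.prob (sym_diff A B)"
      using BA by (intro measure_Un_le) (auto simp: sets_white_noise_law)
    finally have 2: "Pf.prob B \<le> Pf.prob A + \<delta>" using l by linarith
    have "(Pg.prob A)\<^sup>2 \<le> (Pg.prob B + \<delta>)\<^sup>2" using 1 by (intro power_mono) auto
    also have "\<dots> = (Pg.prob B)\<^sup>2 + 2 * Pg.prob B * \<delta> + \<delta> * \<delta>" by (simp add: power2_eq_square algebra_simps)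
    also have "\<dots> \<le> C * Pf.prob B + 2 * 1 * \<delta> + 1 * \<delta>"
      using cyl[OF B(1)] \<delta> by (intro add_mono mult_right_mono mult_left_mono) auto
    also have "\<dots> \<le> C * (Pf.prob A + \<delta>) + 2 * 1 * \<delta> + 1 * \<delta>"
      using 2 C by (intro add_mono mult_left_mono) auto
    also have "\<dots> = C * Pf.prob A + (C + 3) * \<delta>" by (simp add: algebra_simps)
    finally show "(Pg.prob A)\<^sup>2 \<le> C * Pf.prob A + e" using \<delta> by linarith
  qed
  then show ?thesis by (simp add: C_def)
qed

section \<open>The lower bound on the benchmark\<close>

text \<open>Two-point argument for randomized estimators: A collects the paths whose kernel puts at
  least half of its mass on or above the midpoint c. On A the loss at f is at least a quarter of the
  gap, off A the loss at g is.\<close>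

lemma two_point_bound:
  assumes K: "K \<in> estimators" and gap: "minval f < minval g" and C: "C \<ge> 1"
    and le: "\<And>A. A \<in> sets path_space \<Longrightarrow>
      (measure (white_noise_law \<epsilon> g) A)\<^sup>2 \<le> C * measure (white_noise_law \<epsilon> f) A"
  shows "ennreal ((minval g - minval f) / (16 * C)) \<le> (MAX h\<in>{f, g}. min_risk \<epsilon> h K)"
proof -
  let ?Pf = "white_noise_law \<epsilon> f" and ?Pg = "white_noise_law \<epsilon> g"
  interpret Pf: prob_space ?Pf by (rule prob_space_white_noise_law)
  interpret Pg: prob_space ?Pg by (rule prob_space_white_noise_law)
  define \<Delta> where "\<Delta> = minval g - minval f"
  have \<Delta>: "\<Delta> > 0" using gap by (simp add: \<Delta>_def)
  define c where "c = (minval f + minval g) / 2"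
  have far: "\<Delta> / 2 \<le> \<bar>m - minval f\<bar>" if "c \<le> m" for m
    using that gap unfolding c_def \<Delta>_def by (simp add: abs_if field_simps)
  have far': "\<Delta> / 2 \<le> \<bar>m - minval g\<bar>" if "m < c" for m
    using that gap unfolding c_def \<Delta>_def by (simp add: abs_if field_simps)
  have K': "K \<in> measurable path_space (subprob_algebra borel)"
    using K unfolding estimators_def by (rule measurable_prob_algebraD)
  have pK: "prob_space (K y)" "sets (K y) = sets borel" if "y \<in> space path_space" for y
    using measurable_space[OF K[unfolded estimators_def] that] by (auto simp: space_prob_algebra)
  define A where "A = {y\<in>space path_space. measure (K y) {c..} \<ge> 1/2}"
  have A: "A \<in> sets path_space"
  proof -
    have "(\<lambda>y. emeasure (K y) {c..}) \<in> borel_measurable path_space"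
      by (rule measurable_emeasure_kernel[OF K']) simp
    then have "(\<lambda>y. measure (K y) {c..}) \<in> borel_measurable path_space"
      unfolding measure_def by measurable
    then have "{y\<in>space path_space. 1/2 \<le> measure (K y) {c..}} \<in> sets path_space"
      by (rule borel_measurable_le[rotated]) simp
    then show ?thesis by (simp add: A_def)
  qed
  have sp: "space ?Pf = space path_space" "space ?Pg = space path_space"
    by (auto intro!: sets_eq_imp_space_eq simp: sets_white_noise_law)
  have in_max: "min_risk \<epsilon> f K \<le> (MAX h\<in>{f, g}. min_risk \<epsilon> h K)" "min_risk \<epsilon> g K \<le> (MAX h\<in>{f, g}. min_risk \<epsilon> h K)"
    by auto
  have rf: "ennreal (\<Delta> / 4) * emeasure ?Pf A \<le> min_risk \<epsilon> f K"
  proof -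
    have "ennreal (\<Delta> / 4) * emeasure ?Pf A = (\<integral>\<^sup>+y. ennreal (\<Delta> / 4) * indicator A y \<partial>?Pf)"
      using A by (simp add: nn_integral_cmult_indicator sets_white_noise_law)
    also have "\<dots> \<le> (\<integral>\<^sup>+y. (\<integral>\<^sup>+m. ennreal \<bar>m - minval f\<bar> \<partial>K y) \<partial>?Pf)"
    proof (rule nn_integral_mono)
      fix y assume y: "y \<in> space ?Pf"
      then have s: "{c..} \<in> sets (K y)" using pK(2) sp by simp
      show "ennreal (\<Delta> / 4) * indicator A y \<le> (\<integral>\<^sup>+m. ennreal \<bar>m - minval f\<bar> \<partial>K y)"
      proof (cases "y \<in> A")
        case True
        interpret Ky: prob_space "K y" using pK(1) y sp by simp
        have "1/2 \<le> Ky.prob {c..}"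
          using True by (simp add: A_def)
        then have "ennreal (\<Delta> / 4) * indicator A y \<le> ennreal (\<Delta> / 2) * emeasure (K y) {c..}"
          using mult_left_mono[of "1/2" "Ky.prob {c..}" "\<Delta> / 2"] \<Delta> True
          by (simp add: Ky.emeasure_eq_measure ennreal_mult[symmetric] ennreal_leI)
        also have "\<dots> = (\<integral>\<^sup>+m. ennreal (\<Delta> / 2) * indicator {c..} m \<partial>K y)"
          using s by (simp add: nn_integral_cmult_indicator)
        also have "\<dots> \<le> (\<integral>\<^sup>+m. ennreal \<bar>m - minval f\<bar> \<partial>K y)"
          by (intro nn_integral_mono) (use far in \<open>simp add: indicator_def ennreal_leI\<close>)
        finally show ?thesis .
      qed simp
    qed
    finally show ?thesis by (simp add: min_risk_def)
  qed
  have rg: "ennreal (\<Delta> / 4) * emeasure ?Pg (space path_space - A) \<le> min_risk \<epsilon> g K"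
  proof -
    have "ennreal (\<Delta> / 4) * emeasure ?Pg (space path_space - A) =
        (\<integral>\<^sup>+y. ennreal (\<Delta> / 4) * indicator (space path_space - A) y \<partial>?Pg)"
      using A by (simp add: nn_integral_cmult_indicator sets_white_noise_law)
    also have "\<dots> \<le> (\<integral>\<^sup>+y. (\<integral>\<^sup>+m. ennreal \<bar>m - minval g\<bar> \<partial>K y) \<partial>?Pg)"
    proof (rule nn_integral_mono)
      fix y assume y: "y \<in> space ?Pg"
      then have s: "sets (K y) = sets borel" using pK(2) sp by simp
      interpret Ky: prob_space "K y" using pK(1) y sp by simp
      show "ennreal (\<Delta> / 4) * indicator (space path_space - A) y \<le> (\<integral>\<^sup>+m. ennreal \<bar>m - minval g\<bar> \<partial>K y)"
      proof (cases "y \<in> A")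
        case False
        then have "Ky.prob {c..} < 1/2"
          using y sp by (auto simp: A_def not_le)
        moreover have "Ky.prob {..<c} = 1 - Ky.prob {c..}"
        proof -
          have "space (K y) - {c..} = {..<c}"
            using sets_eq_imp_space_eq[OF s] by auto
          then show ?thesis using Ky.prob_compl[of "{c..}"] s by simp
        qed
        ultimately have "1/2 \<le> Ky.prob {..<c}" by linarith
        then have "ennreal (\<Delta> / 4) * indicator (space path_space - A) y \<le> ennreal (\<Delta> / 2) * emeasure (K y) {..<c}"
          using mult_left_mono[of "1/2" "Ky.prob {..<c}" "\<Delta> / 2"] \<Delta> y sp False
          by (auto simp: Ky.emeasure_eq_measure ennreal_mult[symmetric] intro!: ennreal_leI)
        also have "\<dots> = (\<integral>\<^sup>+m. ennreal (\<Delta> / 2) * indicator {..<c} m \<partial>K y)"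
          using s by (simp add: nn_integral_cmult_indicator)
        also have "\<dots> \<le> (\<integral>\<^sup>+m. ennreal \<bar>m - minval g\<bar> \<partial>K y)"
          by (intro nn_integral_mono) (use far' in \<open>simp add: indicator_def ennreal_leI\<close>)
        finally show ?thesis .
      qed simp
    qed
    finally show ?thesis by (simp add: min_risk_def)
  qed
  show ?thesis
  \<comment> \<open>Below this threshold the hypothesis bounds the squared probability of A under g
    by 1/4, so the complement of A has probability at least 1/2 there.\<close>
  proof (cases "Pf.prob A \<ge> 1 / (4 * C)")
    case True
    have "\<Delta> / (16 * C) = \<Delta> / 4 * (1 / (4 * C))" by simp
    also have "\<dots> \<le> \<Delta> / 4 * Pf.prob A" using True \<Delta> by (intro mult_left_mono) auto
    finally have "ennreal (\<Delta> / (16 * C)) \<le> ennreal (\<Delta> / 4) * emeasure ?Pf A"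
      using \<Delta> by (simp add: Pf.emeasure_eq_measure ennreal_mult[symmetric] ennreal_leI)
    then show ?thesis using rf in_max(1) unfolding \<Delta>_def by (meson order_trans)
  next
    case False
    have "(Pg.prob A)\<^sup>2 \<le> C * Pf.prob A" by (rule le[OF A])
    also have "\<dots> \<le> C * (1 / (4 * C))" using False C by (intro mult_left_mono) auto
    also have "\<dots> = (1/2)\<^sup>2" using C by (simp add: power2_eq_square)
    finally have "Pg.prob A \<le> 1/2" by (rule power2_le_imp_le) simp
    moreover have "Pg.prob (space path_space - A) = 1 - Pg.prob A"
      using Pg.prob_compl[of A] A sp by (simp add: sets_white_noise_law)
    ultimately have p: "1/2 \<le> Pg.prob (space path_space - A)" by linarith
    have "\<Delta> / (16 * C) \<le> \<Delta> / 4 * (1/2)" using C \<Delta> by (simp add: field_simps)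
    also have "\<dots> \<le> \<Delta> / 4 * Pg.prob (space path_space - A)" using p \<Delta> by (intro mult_left_mono) auto
    finally have "ennreal (\<Delta> / (16 * C)) \<le> ennreal (\<Delta> / 4) * emeasure ?Pg (space path_space - A)"
      using \<Delta> by (simp add: Pg.emeasure_eq_measure ennreal_mult[symmetric] ennreal_leI)
    then show ?thesis using rg in_max(2) unfolding \<Delta>_def by (meson order_trans)
  qed
qed

lemma set_integrable_ext01_cong:
  fixes B :: real
  assumes "ext01 f \<in> borel_measurable borel" "\<phi> \<in> borel_measurable (borel \<Otimes>\<^sub>M borel)"
    and "\<And>t. t \<in> {0..1} \<Longrightarrow> \<bar>\<phi> (t, f t)\<bar> \<le> B"
  shows "set_integrable lborel {0..1} (\<lambda>t. \<phi> (t, f t))"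
proof -
  have "set_integrable lborel {0..1} (\<lambda>t. \<phi> (t, ext01 f t))"
    using assms by (intro bounded_integrable_on_unit[where B = B] measurable_compose[OF _ assms(2)]) auto
  then show ?thesis
    by (rule set_integrable_cong[THEN iffD1, rotated -1]) auto
qed

lemma convex_unique_minD:
  assumes "f \<in> convex_unique_min"
  shows "convex_on {0..1} f"
  using assms by (auto simp: convex_unique_min_def)

lemma convex_unique_min_bound:
  assumes "f \<in> convex_unique_min"
  obtains B :: real where "\<And>t. t \<in> {0..1} \<Longrightarrow> \<bar>f t\<bar> \<le> B"
proof
  fix t :: real assume t: "t \<in> {0..1}"
  have "f t \<le> max (f 0) (f 1)" by (rule convex_upper_bound[OF convex_unique_minD[OF assms] t])
  moreover have "minval f \<le> f t" by (rule minimizer(2)[OF assms t])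
  ultimately show "\<bar>f t\<bar> \<le> \<bar>minval f\<bar> + \<bar>f 0\<bar> + \<bar>f 1\<bar>" by linarith
qed

lemma convex_unique_min_integrable:
  assumes "f \<in> convex_unique_min"
  shows "set_integrable lborel {0..1} f"
proof -
  obtain B where "\<And>t. t \<in> {0..1} \<Longrightarrow> \<bar>f t\<bar> \<le> B" using convex_unique_min_bound[OF assms] by blast
  then show ?thesis
    using set_integrable_ext01_cong[of f snd B] measurable_ext01[OF convex_unique_minD[OF assms]] by simp
qed

lemma truncation_integrable:
  assumes "f \<in> convex_unique_min"
  shows "set_integrable lborel {0..1} (\<lambda>t. (f t - max (f t) u)\<^sup>2)"
proof -
  obtain B where B: "\<And>t. t \<in> {0..1} \<Longrightarrow> \<bar>f t\<bar> \<le> B" using convex_unique_min_bound[OF assms] by blast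
  have "\<bar>(f t - max (f t) u)\<^sup>2\<bar> \<le> (B + \<bar>u\<bar>)\<^sup>2" if "t \<in> {0..1}" for t
  proof -
    have "\<bar>f t - max (f t) u\<bar> \<le> B + \<bar>u\<bar>" using B[OF that] by linarith
    from power_mono[OF this abs_ge_zero, of 2] show ?thesis by (simp only: power2_abs abs_power2)
  qed
  then show ?thesis
    using set_integrable_ext01_cong[of f "\<lambda>p. (snd p - max (snd p) u)\<^sup>2" "(B + \<bar>u\<bar>)\<^sup>2"]
      measurable_ext01[OF convex_unique_minD[OF assms]] by simp
qed

text \<open>In the constant, 16 exp 4 comes from \<open>two_point_bound\<close> and a further factor
  2 from choosing a level u that reaches more than half of a supremum which need not be
  attained.\<close>

lemma rho_m_le_R_m:
  assumes \<epsilon>: "\<epsilon> > 0" and f: "f \<in> convex_unique_min"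
  shows "ennreal (449 * rho_m \<epsilon> f) \<le> ennreal (449 * (32 * exp 4)) * R_m \<epsilon> f"
proof (cases "rho_m \<epsilon> f > 0")
  case False
  then show ?thesis by (simp add: ennreal_neg)
next
  case True
  let ?S = "{u - minval f | u. l2_norm (\<lambda>t. f t - max (f t) u) \<le> \<epsilon>}"
  have "l2_norm (\<lambda>t. f t - max (f t) (minval f)) = 0"
  proof -
    have z: "indicator {0..1} t *\<^sub>R (f t - max (f t) (minval f))\<^sup>2 = 0" for t
      using minimizer(2)[OF f, of t] by (simp add: indicator_def max_absorb1)
    show ?thesis unfolding l2_norm_def set_lebesgue_integral_def z by simp
  qed
  then have "l2_norm (\<lambda>t. f t - max (f t) (minval f)) \<le> \<epsilon>" using \<epsilon> by simp
  then have ne: "?S \<noteq> {}" by blast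
  have "rho_m \<epsilon> f / 2 < Sup ?S" using True by (simp add: rho_m_def)
  then obtain x where x: "x \<in> ?S" "rho_m \<epsilon> f / 2 < x"
    using ne by (rule less_cSupE)
  then obtain u where u: "l2_norm (\<lambda>t. f t - max (f t) u) \<le> \<epsilon>" "rho_m \<epsilon> f / 2 < u - minval f"
    by blast
  define Z where "Z = minimizer f"
  have Z: "Z \<in> {0..1}" "f Z = minval f" using minimizer(1)[OF f] by (auto simp: Z_def minval_def)
  have uM: "u > minval f" using u(2) True by simp
  define g where "g t = max (f t) u + \<epsilon> * (t - Z)\<^sup>2" for t
  have gZ: "g Z = u" using uM Z by (simp add: g_def)
  have gt: "g Z < g t" if "t \<in> {0..1}" "t \<noteq> Z" for t
  proof -
    have "0 < \<epsilon> * (t - Z)\<^sup>2" using \<epsilon> that by simp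
    then show ?thesis unfolding gZ unfolding g_def by linarith
  qed
  have cvx: "convex_on {0..1} g"
  proof (rule convex_onI)
    fix t x y :: real assume t: "0 < t" "t < 1" and xy: "x \<in> {0..1}" "y \<in> {0..1}"
    have "f ((1 - t) *\<^sub>R x + t *\<^sub>R y) \<le> (1 - t) * f x + t * f y"
      using convex_onD[OF convex_unique_minD[OF f], of t x y] t xy by auto
    also have "\<dots> \<le> (1 - t) * max (f x) u + t * max (f y) u"
      using t by (intro add_mono mult_left_mono) auto
    finally have 1: "f ((1 - t) *\<^sub>R x + t *\<^sub>R y) \<le> (1 - t) * max (f x) u + t * max (f y) u" .
    have "u = (1 - t) * u + t * u" by (simp add: algebra_simps)
    also have "\<dots> \<le> (1 - t) * max (f x) u + t * max (f y) u"
      using t by (intro add_mono mult_left_mono) auto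
    finally have 2: "max (f ((1 - t) *\<^sub>R x + t *\<^sub>R y)) u \<le> (1 - t) * max (f x) u + t * max (f y) u"
      using 1 by simp
    have "(1 - t) * (x - Z)\<^sup>2 + t * (y - Z)\<^sup>2 - ((1 - t) *\<^sub>R x + t *\<^sub>R y - Z)\<^sup>2 = t * (1 - t) * (x - y)\<^sup>2"
      by (simp add: power2_eq_square algebra_simps)
    moreover have "0 \<le> t * (1 - t) * (x - y)\<^sup>2" using t by simp
    ultimately have "((1 - t) *\<^sub>R x + t *\<^sub>R y - Z)\<^sup>2 \<le> (1 - t) * (x - Z)\<^sup>2 + t * (y - Z)\<^sup>2" by linarith
    then have "\<epsilon> * ((1 - t) *\<^sub>R x + t *\<^sub>R y - Z)\<^sup>2 \<le> \<epsilon> * ((1 - t) * (x - Z)\<^sup>2 + t * (y - Z)\<^sup>2)"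
      using \<epsilon> by (intro mult_left_mono) auto
    with 2 show "g ((1 - t) *\<^sub>R x + t *\<^sub>R y) \<le> (1 - t) * g x + t * g y"
      unfolding g_def by (simp add: algebra_simps)
  qed simp
  have minZ: "minimizer g = Z" using minimizer_eqI(1)[of Z g, OF Z(1) gt] by simp
  have g: "g \<in> convex_unique_min"
    using minimizer_eqI(2)[of Z g, OF Z(1) gt] cvx by (simp add: convex_unique_min_def)
  have mg: "minval g = u" by (simp add: minval_def minZ gZ)
  \<comment> \<open>On the unit interval (t - Z)^2 <= 1, so truncation and tilt contribute at most
    \<epsilon> each in norm; with (a + b)^2 <= 2 a^2 + 2 b^2 this yields the exponent 4.\<close>
  have dec: "(g t - f t)\<^sup>2 \<le> 2 * (f t - max (f t) u)\<^sup>2 + 2 * \<epsilon>\<^sup>2" if "t \<in> {0..1}" for t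
  proof -
    have "\<bar>t - Z\<bar> \<le> 1" using that Z by auto
    then have "(t - Z)\<^sup>2 \<le> 1" by (simp add: abs_square_le_1)
    then have "(\<epsilon> * (t - Z)\<^sup>2)\<^sup>2 \<le> (\<epsilon> * 1)\<^sup>2" using \<epsilon> by (intro power_mono mult_left_mono) auto
    moreover have "(a + b)\<^sup>2 \<le> 2 * a\<^sup>2 + 2 * b\<^sup>2" for a b :: real
      using sum_squares_bound[of a b] by (simp add: power2_sum)
    from this[of "max (f t) u - f t" "\<epsilon> * (t - Z)\<^sup>2"]
    have "(g t - f t)\<^sup>2 \<le> 2 * (f t - max (f t) u)\<^sup>2 + 2 * (\<epsilon> * (t - Z)\<^sup>2)\<^sup>2"
      by (simp add: g_def power2_commute add_diff_eq diff_add_eq)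
    ultimately show ?thesis by simp
  qed
  note ti = truncation_integrable[OF f, of u]
  have h2: "set_integrable lborel {0..1} (\<lambda>t. (g t - f t)\<^sup>2)"
  proof -
    obtain B where B: "\<And>t. t \<in> {0..1} \<Longrightarrow> \<bar>f t\<bar> \<le> B" using convex_unique_min_bound[OF f] by blast
    have "(g t - f t)\<^sup>2 \<le> 2 * (B + \<bar>u\<bar>)\<^sup>2 + 2 * \<epsilon>\<^sup>2" if "t \<in> {0..1}" for t
    proof -
      have "\<bar>f t - max (f t) u\<bar> \<le> B + \<bar>u\<bar>" using B[OF that] by linarith
      from power_mono[OF this abs_ge_zero, of 2] have "(f t - max (f t) u)\<^sup>2 \<le> (B + \<bar>u\<bar>)\<^sup>2" by (simp only: power2_abs)
      with dec[OF that] show ?thesis by linarith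
    qed
    then show ?thesis
      using set_integrable_ext01_cong[of f "\<lambda>p. (max (snd p) u + \<epsilon> * (fst p - Z)\<^sup>2 - snd p)\<^sup>2" "2 * (B + \<bar>u\<bar>)\<^sup>2 + 2 * \<epsilon>\<^sup>2"]
        measurable_ext01[OF convex_unique_minD[OF f]] by (simp add: g_def)
  qed
  have c: "set_integrable lborel {0..1::real} (\<lambda>_. 2 * \<epsilon>\<^sup>2 :: real)"
    by (rule bounded_integrable_on_unit[where B = "2 * \<epsilon>\<^sup>2"]) auto
  have "(LINT t:{0..1}|lborel. (g t - f t)\<^sup>2) \<le> (LINT t:{0..1}|lborel. 2 * (f t - max (f t) u)\<^sup>2 + 2 * \<epsilon>\<^sup>2)"
    using dec by (intro set_integral_mono h2 set_integral_add(1) set_integrable_mult_right ti c) auto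
  also have "\<dots> = 2 * (LINT t:{0..1}|lborel. (f t - max (f t) u)\<^sup>2) + 2 * \<epsilon>\<^sup>2"
    by (subst set_integral_add(2)[OF set_integrable_mult_right[OF ti] c])
       (simp add: set_lebesgue_integral_def)
  also have "(LINT t:{0..1}|lborel. (f t - max (f t) u)\<^sup>2) \<le> \<epsilon>\<^sup>2"
    using u(1) unfolding l2_norm_def by (rule sqrt_le_D)
  finally have "(LINT t:{0..1}|lborel. (g t - f t)\<^sup>2) / \<epsilon>\<^sup>2 \<le> 4" using \<epsilon> by (simp add: field_simps)
  then have "exp ((LINT t:{0..1}|lborel. (g t - f t)\<^sup>2) / \<epsilon>\<^sup>2) \<le> exp 4" by simp
  then have le: "(measure (white_noise_law \<epsilon> g) A)\<^sup>2 \<le> exp 4 * measure (white_noise_law \<epsilon> f) A"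
    if "A \<in> sets path_space" for A
    using white_noise_shift_le[OF \<epsilon> that convex_unique_min_integrable[OF f] convex_unique_min_integrable[OF g] h2]
    by (meson measure_nonneg mult_right_mono order_trans)
  have "ennreal ((minval g - minval f) / (16 * exp 4)) \<le> (INF K\<in>estimators. MAX h\<in>{f, g}. min_risk \<epsilon> h K)"
    using uM mg by (intro INF_greatest two_point_bound le) auto
  also have "\<dots> \<le> R_m \<epsilon> f" unfolding R_m_def by (rule SUP_upper[OF g])
  finally have "ennreal ((u - minval f) / (16 * exp 4)) \<le> R_m \<epsilon> f" using mg by simp
  then have "ennreal (449 * (32 * exp 4)) * ennreal ((u - minval f) / (16 * exp 4)) \<le>
      ennreal (449 * (32 * exp 4)) * R_m \<epsilon> f"
    by (rule mult_left_mono) simp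
  moreover have "ennreal (449 * rho_m \<epsilon> f) \<le> ennreal (449 * (32 * exp 4)) * ennreal ((u - minval f) / (16 * exp 4))"
    using u(2) uM by (simp add: ennreal_mult[symmetric] ennreal_leI)
  ultimately show ?thesis by (rule order_trans[rotated])
qed

section \<open>Block averages of convex functions\<close>

text \<open>Both slopes are compared with that of the chord from x to y', moving one endpoint at a
  time.\<close>

lemma convex_slope_le:
  fixes f :: "real \<Rightarrow> real"
  assumes f: "convex_on {0..1} f" and "0 \<le> x" "x < y" "x' < y'" "y' \<le> 1" "x \<le> x'" "y \<le> y'"
  shows "(f y - f x) / (y - x) \<le> (f y' - f x') / (y' - x')"
proof -
  have sym: "(f x - f y) / (x - y) = (f y - f x) / (y - x)" for x y
    by (metis minus_diff_eq minus_divide_divide)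
  have s1: "(f y - f x) / (y - x) \<le> (f y' - f x) / (y' - x)"
  proof (cases "y = y'")
    case False
    have "(f x - f y) / (x - y) \<le> (f x - f y') / (x - y')"
      by (rule convex_on_slope_le[OF f]) (use assms False in auto)
    then show ?thesis by (simp only: sym)
  qed simp
  have s2: "(f y' - f x) / (y' - x) \<le> (f y' - f x') / (y' - x')"
  proof (cases "x = x'")
    case False
    have "(f x - f y') / (x - y') \<le> (f x' - f y') / (x' - y')"
      by (rule convex_on_slope_le[OF f]) (use assms False in auto)
    then show ?thesis by (simp only: sym)
  qed simp
  from s1 s2 show ?thesis by simp
qed

locale convex_min =
  fixes f :: "real \<Rightarrow> real"
  assumes f: "f \<in> convex_unique_min"
begin

abbreviation "Z \<equiv> minimizer f"
abbreviation "M \<equiv> minval f"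

lemma convex: "convex_on {0..1} f" by (rule convex_unique_minD[OF f])

lemma Z01: "0 \<le> Z" "Z \<le> 1" using minimizer(1)[OF f] by auto

lemma M_le: "0 \<le> t \<Longrightarrow> t \<le> 1 \<Longrightarrow> M \<le> f t" using minimizer(2)[OF f] by auto

text \<open>The chord from the minimizer to x has nonnegative slope, and chords further right are at
  least as steep.\<close>

lemma incr: assumes "Z \<le> x" "x \<le> y" "y \<le> 1" shows "f x \<le> f y"
proof (cases "Z < x \<and> x < y")
  case True
  then have "(f x - f Z) / (x - Z) \<le> (f y - f x) / (y - x)"
    using assms Z01 by (intro convex_slope_le[OF convex]) auto
  moreover have "0 \<le> (f x - f Z) / (x - Z)"
    using True assms M_le[of x] Z01 by (auto simp: minval_def)
  ultimately have "0 \<le> (f y - f x) / (y - x)" by linarith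
  then show ?thesis using True by (simp add: zero_le_divide_iff)
next
  case False
  then show ?thesis using assms M_le[of y] Z01 by (cases "x = y") (auto simp: minval_def)
qed

lemma decr: assumes "0 \<le> x" "x \<le> y" "y \<le> Z" shows "f y \<le> f x"
proof (cases "x < y \<and> y < Z")
  case True
  then have "(f y - f x) / (y - x) \<le> (f Z - f y) / (Z - y)"
    using assms Z01 by (intro convex_slope_le[OF convex]) auto
  moreover have "(f Z - f y) / (Z - y) \<le> 0"
    using True assms M_le[of y] Z01 by (auto simp: minval_def divide_le_0_iff)
  ultimately have "(f y - f x) / (y - x) \<le> 0" by linarith
  then show ?thesis using True by (simp add: divide_le_0_iff)
next
  case False
  then show ?thesis using assms M_le[of x] Z01 by (cases "x = y") (auto simp: minval_def)
qed

text \<open>The slope from Z to t is at most the slope over the later interval from s to s + m, and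
  t is at most c m away from Z. So one increment over a mesh width controls the excess over the
  minimum.\<close>

lemma excess_right:
  assumes "Z \<le> t" "t \<le> s" "0 < m" "s + m \<le> 1" "t - Z \<le> c * m"
  shows "f t - M \<le> c * (f (s + m) - f s)"
proof (cases "t = Z")
  case True
  have "0 \<le> c * m" using assms True by simp
  then have "0 \<le> c" using assms by (simp add: zero_le_mult_iff)
  moreover have "f s \<le> f (s + m)" using assms by (intro incr) auto
  ultimately show ?thesis using True by (simp add: minval_def)
next
  case False
  then have tZ: "t > Z" using assms by simp
  have "(f t - f Z) / (t - Z) \<le> (f (s + m) - f s) / (s + m - s)"
    using assms tZ Z01 by (intro convex_slope_le[OF convex]) auto
  then have "f t - f Z \<le> (f (s + m) - f s) / m * (t - Z)"
    using tZ by (simp add: pos_divide_le_eq)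
  also have "\<dots> \<le> (f (s + m) - f s) / m * (c * m)"
    using assms incr[of s "s + m"] by (intro mult_left_mono) auto
  also have "\<dots> = c * (f (s + m) - f s)" using assms by simp
  finally show ?thesis by (simp add: minval_def)
qed

lemma excess_left:
  assumes "t \<le> Z" "s \<le> t" "0 < m" "0 \<le> s - m" "Z - t \<le> c * m"
  shows "f t - M \<le> c * (f (s - m) - f s)"
proof (cases "t = Z")
  case True
  have "0 \<le> c * m" using assms True by simp
  then have "0 \<le> c" using assms by (simp add: zero_le_mult_iff)
  moreover have "f s \<le> f (s - m)" using assms by (intro decr) auto
  ultimately show ?thesis using True by (simp add: minval_def)
next
  case False
  then have tZ: "t < Z" using assms by simp
  have *: "(f s - f (s - m)) / (s - (s - m)) \<le> (f Z - f t) / (Z - t)"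
    using assms tZ Z01 by (intro convex_slope_le[OF convex]) auto
  have "(f t - f Z) / (Z - t) \<le> (f (s - m) - f s) / m"
  proof -
    have "(f t - f Z) / (Z - t) = - ((f Z - f t) / (Z - t))" "(f (s - m) - f s) / m = - ((f s - f (s - m)) / (s - (s - m)))"
      by (simp_all only: minus_divide_left minus_diff_eq) simp
    then show ?thesis using * by linarith
  qed
  then have "f t - f Z \<le> (f (s - m) - f s) / m * (Z - t)"
    using tZ by (simp add: pos_divide_le_eq)
  also have "\<dots> \<le> (f (s - m) - f s) / m * (c * m)"
    using assms decr[of "s - m" s] by (intro mult_left_mono) auto
  also have "\<dots> = c * (f (s - m) - f s)" using assms by simp
  finally show ?thesis by (simp add: minval_def)
qed

end

section \<open>Dyadic blocks and averages over them\<close>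

lemma mesh_pos[simp]: "mesh j > 0" by (simp add: mesh_def)

text \<open>All blocks of a level share the relative position \<theta> in the unit interval.
  Inequalities between averages over different blocks then follow from pointwise ones at equal
  \<theta>.\<close>

definition block_pt :: "nat \<Rightarrow> int \<Rightarrow> real \<Rightarrow> real" where
  "block_pt j i \<theta> = (of_int i - 1 + \<theta>) * mesh j"

definition block_avg :: "(real \<Rightarrow> real) \<Rightarrow> nat \<Rightarrow> int \<Rightarrow> real" where
  "block_avg f j i = (LINT \<theta>:{0..1}|lborel. f (block_pt j i \<theta>))"

definition in_range :: "nat \<Rightarrow> int \<Rightarrow> bool" where
  "in_range j i \<longleftrightarrow> 1 \<le> i \<and> i \<le> 2 ^ j"

lemma mesh_scale: "(2 :: real) ^ j * mesh j = 1" by (simp add: mesh_def)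

lemma of_int_mesh_le_one: "i \<le> 2 ^ j \<Longrightarrow> of_int i * mesh j \<le> 1"
proof -
  assume "i \<le> 2 ^ j"
  then have "of_int i * mesh j \<le> of_int (2 ^ j) * mesh j" by (intro mult_right_mono) (auto simp: less_imp_le)
  then show ?thesis by (simp add: mesh_scale)
qed

lemma block_pt_bounds:
  assumes "\<theta> \<in> {0..1}"
  shows "(of_int i - 1) * mesh j \<le> block_pt j i \<theta>" "block_pt j i \<theta> \<le> of_int i * mesh j"
  using assms by (auto simp: block_pt_def intro!: mult_right_mono less_imp_le[OF mesh_pos])

lemma block_pt_01:
  assumes "in_range j i" "\<theta> \<in> {0..1}"
  shows "0 \<le> block_pt j i \<theta>" "block_pt j i \<theta> \<le> 1"
proof -
  have "0 \<le> (of_int i - 1) * mesh j" using assms by (auto simp: in_range_def less_imp_le)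
  then show "0 \<le> block_pt j i \<theta>" by (rule order_trans[OF _ block_pt_bounds(1)[OF assms(2)]])
  show "block_pt j i \<theta> \<le> 1"
    using block_pt_bounds(2)[OF assms(2)] of_int_mesh_le_one[of i j] assms(1)
    by (auto simp: in_range_def intro: order_trans)
qed

context convex_min begin

lemma block_integrable:
  assumes "in_range j i"
  shows "set_integrable lborel {0..1} (\<lambda>\<theta>. f (block_pt j i \<theta>))"
proof -
  obtain B where B: "\<And>t. t \<in> {0..1} \<Longrightarrow> \<bar>f t\<bar> \<le> B" using convex_unique_min_bound[OF f] by blast
  have [measurable]: "ext01 f \<in> borel_measurable borel" by (rule measurable_ext01[OF convex])
  have "set_integrable lborel {0..1} (\<lambda>\<theta>. ext01 f (block_pt j i \<theta>))"
  proof (rule bounded_integrable_on_unit[where B = B])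
    show "(\<lambda>\<theta>. ext01 f (block_pt j i \<theta>)) \<in> borel_measurable borel"
      unfolding block_pt_def by measurable
    show "\<bar>ext01 f (block_pt j i \<theta>)\<bar> \<le> B" if "\<theta> \<in> {0..1}" for \<theta>
      using B[of "block_pt j i \<theta>"] block_pt_01[OF assms that] by simp
  qed auto
  then show ?thesis
    by (rule set_integrable_cong[THEN iffD1, rotated -1]) (auto simp: block_pt_01[OF assms])
qed

lemma unit_const: "set_integrable lborel {0..1::real} (\<lambda>_. c :: real)" "(LINT \<theta>:{0..1::real}|lborel. c) = (c :: real)"
  by (rule bounded_integrable_on_unit[where B = "\<bar>c\<bar>"]) (auto simp: set_lebesgue_integral_def)

text \<open>Integration of a pointwise inequality at a common relative position. Four blocks on the
  right are needed in \<open>loss_both\<close>; the other uses pad with zero coefficients.\<close>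

lemma block_avg_le:
  assumes r: "in_range j i0" "in_range j i1" "in_range j i2" "in_range j i3" "in_range j i4"
    and le: "\<And>\<theta>. \<theta> \<in> {0..1} \<Longrightarrow> f (block_pt j i0 \<theta>) \<le> c + a1 * f (block_pt j i1 \<theta>)
      + a2 * f (block_pt j i2 \<theta>) + a3 * f (block_pt j i3 \<theta>) + a4 * f (block_pt j i4 \<theta>)"
  shows "block_avg f j i0 \<le> c + a1 * block_avg f j i1 + a2 * block_avg f j i2
      + a3 * block_avg f j i3 + a4 * block_avg f j i4"
proof -
  note I = block_integrable[OF r(1)] block_integrable[OF r(2)] block_integrable[OF r(3)]
    block_integrable[OF r(4)] block_integrable[OF r(5)]
  note J = set_integrable_mult_right[OF I(2), of a1] set_integrable_mult_right[OF I(3), of a2]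
    set_integrable_mult_right[OF I(4), of a3] set_integrable_mult_right[OF I(5), of a4]
  have s1: "set_integrable lborel {0..1} (\<lambda>\<theta>. c + a1 * f (block_pt j i1 \<theta>))"
    by (intro set_integral_add(1) unit_const J)
  have s2: "set_integrable lborel {0..1} (\<lambda>\<theta>. c + a1 * f (block_pt j i1 \<theta>) + a2 * f (block_pt j i2 \<theta>))"
    by (intro set_integral_add(1) s1 J)
  have s3: "set_integrable lborel {0..1} (\<lambda>\<theta>. c + a1 * f (block_pt j i1 \<theta>) + a2 * f (block_pt j i2 \<theta>)
      + a3 * f (block_pt j i3 \<theta>))"
    by (intro set_integral_add(1) s2 J)
  have "block_avg f j i0 \<le> (LINT \<theta>:{0..1}|lborel. c + a1 * f (block_pt j i1 \<theta>)
      + a2 * f (block_pt j i2 \<theta>) + a3 * f (block_pt j i3 \<theta>) + a4 * f (block_pt j i4 \<theta>))"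
    unfolding block_avg_def by (intro set_integral_mono set_integral_add(1) I s3 J le)
  also have "\<dots> = c + a1 * block_avg f j i1 + a2 * block_avg f j i2
      + a3 * block_avg f j i3 + a4 * block_avg f j i4"
    unfolding block_avg_def set_integral_add(2)[OF s3 J(4)] set_integral_add(2)[OF s2 J(3)]
      set_integral_add(2)[OF s1 J(2)] set_integral_add(2)[OF unit_const(1) J(1)]
    by (simp add: unit_const(2))
  finally show ?thesis .
qed

lemma M_le_block_avg:
  assumes "in_range j i" shows "M \<le> block_avg f j i"
proof -
  have "(LINT \<theta>:{0..1::real}|lborel. M) \<le> block_avg f j i"
    unfolding block_avg_def using block_pt_01[OF assms]
    by (intro set_integral_mono unit_const block_integrable[OF assms] M_le) auto
  then show ?thesis by (simp add: unit_const)
qed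

end

section \<open>Averages around the block of the minimizer\<close>

locale convex_block = convex_min +
  fixes j :: nat and k :: int
  assumes k: "in_range j k" "(of_int k - 1) * mesh j \<le> Z" "Z \<le> of_int k * mesh j"
begin

abbreviation "A \<equiv> block_avg f j"
abbreviation "m \<equiv> mesh j"
abbreviation "pt \<equiv> block_pt j"

lemma pt_right:
  assumes "\<theta> \<in> {0..1}" "k + 1 \<le> i"
  shows "Z \<le> pt i \<theta>" 
proof -
  have "of_int k * m \<le> (of_int i - 1) * m" using assms by (intro mult_right_mono less_imp_le[OF mesh_pos]) linarith
  then show ?thesis using k block_pt_bounds(1)[OF assms(1), where i = i and j = j] by linarith
qed

lemma pt_left:
  assumes "\<theta> \<in> {0..1}" "i \<le> k - 1"
  shows "pt i \<theta> \<le> Z"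
proof -
  have "of_int i * m \<le> (of_int k - 1) * m" using assms by (intro mult_right_mono less_imp_le[OF mesh_pos]) linarith
  then show ?thesis using k block_pt_bounds(2)[OF assms(1), where i = i and j = j] by linarith
qed

lemma pt_dist:
  assumes "\<theta> \<in> {0..1}"
  shows "pt i \<theta> - Z \<le> (of_int (i - k) + 1) * m" "Z - pt i \<theta> \<le> (of_int (k - i) + 1) * m"
  using block_pt_bounds[OF assms, where i = i and j = j] k by (simp_all add: algebra_simps)

lemma pt_mono: "i \<le> i' \<Longrightarrow> pt i \<theta> \<le> pt i' \<theta>"
  by (auto simp: block_pt_def intro!: mult_right_mono less_imp_le[OF mesh_pos])

lemma avg_mono_right:
  assumes "k + 1 \<le> i" "i \<le> i'" "i' \<le> 2 ^ j"
  shows "A i \<le> A i'"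
proof -
  have r: "in_range j i" "in_range j i'" using assms k by (auto simp: in_range_def)
  have "A i \<le> 0 + 1 * A i' + 0 * A i + 0 * A i + 0 * A i"
    using assms pt_right block_pt_01[OF r(2)] by (intro block_avg_le r) (auto intro!: incr pt_mono)
  then show ?thesis by simp
qed

lemma avg_mono_left:
  assumes "i' \<le> k - 1" "i \<le> i'" "1 \<le> i"
  shows "A i' \<le> A i"
proof -
  have r: "in_range j i" "in_range j i'" using assms k by (auto simp: in_range_def)
  have "A i' \<le> 0 + 1 * A i + 0 * A i + 0 * A i + 0 * A i"
    using assms pt_left block_pt_01[OF r(1)] by (intro block_avg_le r) (auto intro!: decr pt_mono)
  then show ?thesis by simp
qed

text \<open>A point of block k + 1 is within two mesh widths of the minimizer, so its excess is at
  most twice the increment to the next block, beyond which f only increases. It will be applied when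
  the block at offset D was preferred to the neighbour k + 1.\<close>

lemma entry_right:
  assumes "2 \<le> D" "k + D \<le> 2 ^ j"
  shows "A (k + 1) - M \<le> 2 * (A (k + D) - A (k + 1))"
proof -
  have r: "in_range j (k + 1)" "in_range j (k + D)" using assms k by (auto simp: in_range_def)
  have "A (k + 1) \<le> M + 2 * A (k + D) + (- 2) * A (k + 1) + 0 * A k + 0 * A k"
  proof (intro block_avg_le r k)
    fix \<theta> :: real assume \<theta>: "\<theta> \<in> {0..1}"
    have "pt (k + 2) \<theta> \<le> pt (k + D) \<theta>" using assms by (intro pt_mono) auto
    moreover have "pt (k + D) \<theta> \<le> 1" by (rule block_pt_01[OF r(2) \<theta>])
    moreover have e: "pt (k + 2) \<theta> = pt (k + 1) \<theta> + m" by (simp add: block_pt_def algebra_simps)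
    ultimately have "f (pt (k + 1) \<theta>) - M \<le> 2 * (f (pt (k + 1) \<theta> + m) - f (pt (k + 1) \<theta>))"
      using pt_right[OF \<theta>, of "k + 1"] pt_dist(1)[OF \<theta>, of "k + 1"] by (intro excess_right) auto
    moreover have "f (pt (k + 2) \<theta>) \<le> f (pt (k + D) \<theta>)"
      using assms \<theta> pt_right block_pt_01[OF r(2)] by (intro incr pt_mono) auto
    ultimately show "f (pt (k + 1) \<theta>) \<le> M + 2 * f (pt (k + D) \<theta>) + - 2 * f (pt (k + 1) \<theta>)
        + 0 * f (pt k \<theta>) + 0 * f (pt k \<theta>)"
      unfolding e[symmetric] by (simp add: algebra_simps)
  qed
  then show ?thesis by (simp add: algebra_simps)
qed

lemma entry_left:
  assumes "2 \<le> D" "1 \<le> k - D"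
  shows "A (k - 1) - M \<le> 2 * (A (k - D) - A (k - 1))"
proof -
  have r: "in_range j (k - 1)" "in_range j (k - D)" using assms k by (auto simp: in_range_def)
  have "A (k - 1) \<le> M + 2 * A (k - D) + (- 2) * A (k - 1) + 0 * A k + 0 * A k"
  proof (intro block_avg_le r k)
    fix \<theta> :: real assume \<theta>: "\<theta> \<in> {0..1}"
    have "pt (k - D) \<theta> \<le> pt (k - 2) \<theta>" using assms by (intro pt_mono) auto
    moreover have "0 \<le> pt (k - D) \<theta>" by (rule block_pt_01[OF r(2) \<theta>])
    moreover have e: "pt (k - 2) \<theta> = pt (k - 1) \<theta> - m" by (simp add: block_pt_def algebra_simps)
    ultimately have "f (pt (k - 1) \<theta>) - M \<le> 2 * (f (pt (k - 1) \<theta> - m) - f (pt (k - 1) \<theta>))"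
      using pt_left[OF \<theta>, of "k - 1"] pt_dist(2)[OF \<theta>, of "k - 1"] by (intro excess_left) auto
    moreover have "f (pt (k - 2) \<theta>) \<le> f (pt (k - D) \<theta>)"
      using assms \<theta> pt_left block_pt_01[OF r(2)] by (intro decr pt_mono) auto
    ultimately show "f (pt (k - 1) \<theta>) \<le> M + 2 * f (pt (k - D) \<theta>) + - 2 * f (pt (k - 1) \<theta>)
        + 0 * f (pt k \<theta>) + 0 * f (pt k \<theta>)"
      unfolding e[symmetric] by (simp add: algebra_simps)
  qed
  then show ?thesis by (simp add: algebra_simps)
qed

end

context convex_block begin

lemma pt_add: "pt (i + of_nat d) \<theta> = pt i \<theta> + of_nat d * m"
  by (simp add: block_pt_def algebra_simps)

lemma pt_diff: "pt (i - of_nat d) \<theta> = pt i \<theta> - of_nat d * m"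
  by (simp add: block_pt_def algebra_simps)

lemma excess_right_pt:
  assumes \<theta>: "\<theta> \<in> {0..1}" and "Z \<le> pt i \<theta>" "i \<le> i'" "i' + 1 \<le> 2 ^ j" "1 \<le> i" "of_int (i - k) + 1 \<le> c"
  shows "f (pt i \<theta>) - M \<le> c * (f (pt (i' + 1) \<theta>) - f (pt i' \<theta>))"
proof -
  have e: "pt (i' + 1) \<theta> = pt i' \<theta> + m" using pt_add[of i' 1] by simp
  have "pt (i' + 1) \<theta> \<le> 1" using assms by (intro block_pt_01) (auto simp: in_range_def)
  moreover have "pt i \<theta> - Z \<le> c * m"
  proof -
    have "(of_int (i - k) + 1) * m \<le> c * m" using assms by (intro mult_right_mono) (auto simp: less_imp_le)
    then show ?thesis using pt_dist(1)[OF \<theta>, of i] by linarith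
  qed
  ultimately show ?thesis
    unfolding e using assms by (intro excess_right) (auto intro: pt_mono)
qed

lemma excess_left_pt:
  assumes \<theta>: "\<theta> \<in> {0..1}" and "pt i \<theta> \<le> Z" "i' \<le> i" "1 \<le> i' - 1" "i \<le> 2 ^ j" "of_int (k - i) + 1 \<le> c"
  shows "f (pt i \<theta>) - M \<le> c * (f (pt (i' - 1) \<theta>) - f (pt i' \<theta>))"
proof -
  have e: "pt (i' - 1) \<theta> = pt i' \<theta> - m" using pt_diff[of i' 1] by simp
  have "0 \<le> pt (i' - 1) \<theta>" using assms by (intro block_pt_01) (auto simp: in_range_def)
  moreover have "Z - pt i \<theta> \<le> c * m"
  proof -
    have "(of_int (k - i) + 1) * m \<le> c * m" using assms by (intro mult_right_mono) (auto simp: less_imp_le)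
    then show ?thesis using pt_dist(2)[OF \<theta>, of i] by linarith
  qed
  ultimately show ?thesis
    unfolding e using assms by (intro excess_left) (auto intro: pt_mono)
qed

lemma pt_incr:
  assumes "\<theta> \<in> {0..1}" "k \<le> i - 1" "i \<le> i'" "i' \<le> 2 ^ j"
  shows "f (pt i \<theta>) \<le> f (pt i' \<theta>)"
  using assms k by (intro incr pt_mono pt_right block_pt_01) (auto simp: in_range_def)

lemma pt_decr:
  assumes "\<theta> \<in> {0..1}" "i' \<le> k - 1" "i \<le> i'" "1 \<le> i"
  shows "f (pt i' \<theta>) \<le> f (pt i \<theta>)"
  using assms k by (intro decr pt_mono pt_left block_pt_01) (auto simp: in_range_def)

text \<open>A small increment on the right means that f is nearly flat there, so moving two blocks
  to the right is cheap. The factor 4 arises for |i - k| <= 1, where block i + 2 reaches up to four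
  mesh widths past the minimizer. If i is at least two blocks off, its own excess is kept as a
  separate term.\<close>

lemma loss_right:
  assumes i: "in_range j i" and i6: "i + 6 \<le> 2 ^ j"
  shows "A (i + 2) - M \<le> (if 2 \<le> \<bar>i - k\<bar> then A i - M else 0) + 4 * max 0 (A (i + 6) - A (i + 5))"
proof -
  have r: "in_range j (i + 2)" "in_range j (i + 5)" "in_range j (i + 6)" using i i6 by (auto simp: in_range_def)
  consider "i - k \<ge> 2" | "\<bar>i - k\<bar> \<le> 1" | "i - k = - 2" | "i - k \<le> - 3" by linarith
  then show ?thesis
  proof cases
    case 1
    have "A (i + 2) \<le> 0 + 1 * A i + 2 * A (i + 6) + (- 2) * A (i + 5) + 0 * A i"
    proof (intro block_avg_le r i)
      fix \<theta> :: real assume \<theta>: "\<theta> \<in> {0..1}"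
      have e: "pt (i + 2) \<theta> = pt i \<theta> + 2 * m" "pt (i + 6) \<theta> = pt i \<theta> + 6 * m" "pt (i + 5) \<theta> = pt i \<theta> + 5 * m"
        using pt_add[of i 2] pt_add[of i 6] pt_add[of i 5] by simp_all
      have "(f (pt (i + 2) \<theta>) - f (pt i \<theta>)) / (pt (i + 2) \<theta> - pt i \<theta>) \<le>
          (f (pt (i + 6) \<theta>) - f (pt (i + 5) \<theta>)) / (pt (i + 6) \<theta> - pt (i + 5) \<theta>)"
        using block_pt_01[OF i \<theta>] block_pt_01[OF r(3) \<theta>]
        by (intro convex_slope_le[OF convex]) (simp_all add: e less_imp_le)
      then have "(f (pt (i + 2) \<theta>) - f (pt i \<theta>)) / (2 * m) \<le> (f (pt (i + 6) \<theta>) - f (pt (i + 5) \<theta>)) / m"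
        by (simp only: e) (simp add: algebra_simps)
      then have "f (pt (i + 2) \<theta>) - f (pt i \<theta>) \<le> 2 * (f (pt (i + 6) \<theta>) - f (pt (i + 5) \<theta>))"
        using mesh_pos[of j] by (simp add: divide_simps)
      then show "f (pt (i + 2) \<theta>) \<le> 0 + 1 * f (pt i \<theta>) + 2 * f (pt (i + 6) \<theta>) + - 2 * f (pt (i + 5) \<theta>) + 0 * f (pt i \<theta>)"
        by (simp add: algebra_simps)
    qed
    then have "A (i + 2) - M \<le> A i - M + 2 * (A (i + 6) - A (i + 5))" by (simp add: algebra_simps)
    with 1 show ?thesis by (simp add: max_def)
  next
    case 2
    have "A (i + 2) \<le> M + 4 * A (i + 6) + (- 4) * A (i + 5) + 0 * A i + 0 * A i"
    proof (intro block_avg_le r i)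
      fix \<theta> :: real assume \<theta>: "\<theta> \<in> {0..1}"
      have "f (pt (i + 2) \<theta>) - M \<le> 4 * (f (pt (i + 5 + 1) \<theta>) - f (pt (i + 5) \<theta>))"
      proof (rule excess_right_pt[OF \<theta>])
        show "Z \<le> pt (i + 2) \<theta>" using 2 by (intro pt_right \<theta>) auto
        have "i + 2 - k \<le> 3" using 2 by linarith
        then have "real_of_int (i + 2 - k) \<le> 3" by linarith
        then show "real_of_int (i + 2 - k) + 1 \<le> 4" by linarith
      qed (use i i6 in \<open>auto simp: in_range_def\<close>)
      then show "f (pt (i + 2) \<theta>) \<le> M + 4 * f (pt (i + 6) \<theta>) + - 4 * f (pt (i + 5) \<theta>) + 0 * f (pt i \<theta>) + 0 * f (pt i \<theta>)"
        by (simp add: algebra_simps)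
    qed
    then have "A (i + 2) - M \<le> 4 * (A (i + 6) - A (i + 5))" by (simp add: algebra_simps)
    with 2 show ?thesis by (simp add: max_def)
  next
    \<comment> \<open>Block i + 2 is the block of the minimizer: at points left of Z the value has
      decreased since block i, at points right of Z the excess is at most one increment.\<close>
    case 3
    have "A (i + 2) \<le> 0 + 1 * A i + 1 * A (i + 6) + (- 1) * A (i + 5) + 0 * A i"
    proof (intro block_avg_le r i)
      fix \<theta> :: real assume \<theta>: "\<theta> \<in> {0..1}"
      have le: "f (pt (i + 5) \<theta>) \<le> f (pt (i + 6) \<theta>)" using 3 i6 by (intro pt_incr \<theta>) auto
      show "f (pt (i + 2) \<theta>) \<le> 0 + 1 * f (pt i \<theta>) + 1 * f (pt (i + 6) \<theta>) + - 1 * f (pt (i + 5) \<theta>) + 0 * f (pt i \<theta>)"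
      proof (cases "pt (i + 2) \<theta> \<le> Z")
        case True
        then have "f (pt (i + 2) \<theta>) \<le> f (pt i \<theta>)"
          using block_pt_01[OF i \<theta>] by (intro decr) (auto intro: pt_mono)
        then show ?thesis using le by simp
      next
        case False
        have "f (pt (i + 2) \<theta>) - M \<le> 1 * (f (pt (i + 5 + 1) \<theta>) - f (pt (i + 5) \<theta>))"
          using False i i6 3 by (intro excess_right_pt \<theta>) (auto simp: in_range_def)
        moreover have "M \<le> f (pt i \<theta>)" using block_pt_01[OF i \<theta>] by (intro M_le) auto
        ultimately show ?thesis by (simp add: algebra_simps)
      qed
    qed
    then have "A (i + 2) - M \<le> A i - M + (A (i + 6) - A (i + 5))" by (simp add: algebra_simps)
    with 3 show ?thesis by (simp add: max_def)
  next
    case 4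
    have "A (i + 2) \<le> A i" using 4 i by (intro avg_mono_left) (auto simp: in_range_def)
    with 4 show ?thesis by (simp add: max_def)
  qed
qed

lemma loss_left:
  assumes i: "in_range j i" and i6: "1 \<le> i - 6"
  shows "A (i - 2) - M \<le> (if 2 \<le> \<bar>i - k\<bar> then A i - M else 0) + 4 * max 0 (A (i - 6) - A (i - 5))"
proof -
  have r: "in_range j (i - 2)" "in_range j (i - 5)" "in_range j (i - 6)" using i i6 by (auto simp: in_range_def)
  consider "i - k \<le> - 2" | "\<bar>i - k\<bar> \<le> 1" | "i - k = 2" | "i - k \<ge> 3" by linarith
  then show ?thesis
  proof cases
    case 1
    have "A (i - 2) \<le> 0 + 1 * A i + 2 * A (i - 6) + (- 2) * A (i - 5) + 0 * A i"
    proof (intro block_avg_le r i)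
      fix \<theta> :: real assume \<theta>: "\<theta> \<in> {0..1}"
      have e: "pt (i - 2) \<theta> = pt i \<theta> - 2 * m" "pt (i - 6) \<theta> = pt i \<theta> - 6 * m" "pt (i - 5) \<theta> = pt i \<theta> - 5 * m"
        using pt_diff[of i 2] pt_diff[of i 6] pt_diff[of i 5] by simp_all
      have "(f (pt (i - 5) \<theta>) - f (pt (i - 6) \<theta>)) / (pt (i - 5) \<theta> - pt (i - 6) \<theta>) \<le>
          (f (pt i \<theta>) - f (pt (i - 2) \<theta>)) / (pt i \<theta> - pt (i - 2) \<theta>)"
        using block_pt_01[OF i \<theta>] block_pt_01[OF r(3) \<theta>]
        by (intro convex_slope_le[OF convex]) (simp_all add: e less_imp_le)
      then have "(f (pt (i - 5) \<theta>) - f (pt (i - 6) \<theta>)) / m \<le> (f (pt i \<theta>) - f (pt (i - 2) \<theta>)) / (2 * m)"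
        by (simp only: e) (simp add: algebra_simps)
      then have "f (pt (i - 2) \<theta>) - f (pt i \<theta>) \<le> 2 * (f (pt (i - 6) \<theta>) - f (pt (i - 5) \<theta>))"
        using mesh_pos[of j] by (simp add: divide_simps)
      then show "f (pt (i - 2) \<theta>) \<le> 0 + 1 * f (pt i \<theta>) + 2 * f (pt (i - 6) \<theta>) + - 2 * f (pt (i - 5) \<theta>) + 0 * f (pt i \<theta>)"
        by (simp add: algebra_simps)
    qed
    then have "A (i - 2) - M \<le> A i - M + 2 * (A (i - 6) - A (i - 5))" by (simp add: algebra_simps)
    with 1 show ?thesis by (simp add: max_def)
  next
    case 2
    have "A (i - 2) \<le> M + 4 * A (i - 6) + (- 4) * A (i - 5) + 0 * A i + 0 * A i"
    proof (intro block_avg_le r i)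
      fix \<theta> :: real assume \<theta>: "\<theta> \<in> {0..1}"
      have "f (pt (i - 2) \<theta>) - M \<le> 4 * (f (pt (i - 5 - 1) \<theta>) - f (pt (i - 5) \<theta>))"
      proof (rule excess_left_pt[OF \<theta>])
        show "pt (i - 2) \<theta> \<le> Z" using 2 by (intro pt_left \<theta>) auto
        have "k - (i - 2) \<le> 3" using 2 by linarith
        then have "real_of_int (k - (i - 2)) \<le> 3" by linarith
        then show "real_of_int (k - (i - 2)) + 1 \<le> 4" by linarith
      qed (use i i6 in \<open>auto simp: in_range_def\<close>)
      then show "f (pt (i - 2) \<theta>) \<le> M + 4 * f (pt (i - 6) \<theta>) + - 4 * f (pt (i - 5) \<theta>) + 0 * f (pt i \<theta>) + 0 * f (pt i \<theta>)"
        by (simp add: algebra_simps)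
    qed
    then have "A (i - 2) - M \<le> 4 * (A (i - 6) - A (i - 5))" by (simp add: algebra_simps)
    with 2 show ?thesis by (simp add: max_def)
  next
    case 3
    have "A (i - 2) \<le> 0 + 1 * A i + 1 * A (i - 6) + (- 1) * A (i - 5) + 0 * A i"
    proof (intro block_avg_le r i)
      fix \<theta> :: real assume \<theta>: "\<theta> \<in> {0..1}"
      have le: "f (pt (i - 5) \<theta>) \<le> f (pt (i - 6) \<theta>)" using 3 i6 by (intro pt_decr \<theta>) auto
      show "f (pt (i - 2) \<theta>) \<le> 0 + 1 * f (pt i \<theta>) + 1 * f (pt (i - 6) \<theta>) + - 1 * f (pt (i - 5) \<theta>) + 0 * f (pt i \<theta>)"
      proof (cases "Z \<le> pt (i - 2) \<theta>")
        case True
        then have "f (pt (i - 2) \<theta>) \<le> f (pt i \<theta>)"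
          using block_pt_01[OF i \<theta>] by (intro incr) (auto intro: pt_mono)
        then show ?thesis using le by simp
      next
        case False
        have "f (pt (i - 2) \<theta>) - M \<le> 1 * (f (pt (i - 5 - 1) \<theta>) - f (pt (i - 5) \<theta>))"
          using False i i6 3 by (intro excess_left_pt \<theta>) (auto simp: in_range_def)
        moreover have "M \<le> f (pt i \<theta>)" using block_pt_01[OF i \<theta>] by (intro M_le) auto
        ultimately show ?thesis by (simp add: algebra_simps)
      qed
    qed
    then have "A (i - 2) - M \<le> A i - M + (A (i - 6) - A (i - 5))" by (simp add: algebra_simps)
    with 3 show ?thesis by (simp add: max_def)
  next
    case 4
    have "A (i - 2) \<le> A i" using 4 i by (intro avg_mono_right) (auto simp: in_range_def)
    with 4 show ?thesis by (simp add: max_def)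
  qed
qed

text \<open>Without a move, a neighbour of the minimizer's block is controlled by the increment on
  the side away from the minimizer, and the minimizer's block itself by the increment on the side of
  Z on which the point lies.\<close>

lemma loss_both:
  assumes i: "in_range j i" and i6: "1 \<le> i - 6" "i + 6 \<le> 2 ^ j"
  shows "A i - M \<le> (if 2 \<le> \<bar>i - k\<bar> then A i - M else 0) +
    4 * max (max 0 (A (i + 6) - A (i + 5))) (max 0 (A (i - 6) - A (i - 5)))"
proof -
  have r: "in_range j (i - 5)" "in_range j (i - 6)" "in_range j (i + 5)" "in_range j (i + 6)"
    using i i6 by (auto simp: in_range_def)
  consider "2 \<le> \<bar>i - k\<bar>" | "i - k = 1" | "i - k = - 1" | "i = k" by linarith
  then show ?thesis
  proof cases
    case 1
    then show ?thesis by (simp add: max_def)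
  next
    case 2
    have "A i \<le> M + 2 * A (i + 6) + (- 2) * A (i + 5) + 0 * A i + 0 * A i"
    proof (intro block_avg_le r i)
      fix \<theta> :: real assume \<theta>: "\<theta> \<in> {0..1}"
      have "f (pt i \<theta>) - M \<le> 2 * (f (pt (i + 5 + 1) \<theta>) - f (pt (i + 5) \<theta>))"
        using 2 i i6 by (intro excess_right_pt \<theta> pt_right) (auto simp: in_range_def)
      then show "f (pt i \<theta>) \<le> M + 2 * f (pt (i + 6) \<theta>) + - 2 * f (pt (i + 5) \<theta>) + 0 * f (pt i \<theta>) + 0 * f (pt i \<theta>)"
        by (simp add: algebra_simps)
    qed
    then have "A i - M \<le> 2 * (A (i + 6) - A (i + 5))" by (simp add: algebra_simps)
    with 2 show ?thesis by (simp add: max_def)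
  next
    case 3
    have "A i \<le> M + 2 * A (i - 6) + (- 2) * A (i - 5) + 0 * A i + 0 * A i"
    proof (intro block_avg_le r i)
      fix \<theta> :: real assume \<theta>: "\<theta> \<in> {0..1}"
      have "f (pt i \<theta>) - M \<le> 2 * (f (pt (i - 5 - 1) \<theta>) - f (pt (i - 5) \<theta>))"
        using 3 i i6 by (intro excess_left_pt \<theta> pt_left) (auto simp: in_range_def)
      then show "f (pt i \<theta>) \<le> M + 2 * f (pt (i - 6) \<theta>) + - 2 * f (pt (i - 5) \<theta>) + 0 * f (pt i \<theta>) + 0 * f (pt i \<theta>)"
        by (simp add: algebra_simps)
    qed
    then have "A i - M \<le> 2 * (A (i - 6) - A (i - 5))" by (simp add: algebra_simps)
    with 3 show ?thesis by (simp add: max_def)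
  next
    case 4
    have "A i \<le> M + 1 * A (i + 6) + (- 1) * A (i + 5) + 1 * A (i - 6) + (- 1) * A (i - 5)"
    proof (intro block_avg_le r i)
      fix \<theta> :: real assume \<theta>: "\<theta> \<in> {0..1}"
      have R: "f (pt (i + 5) \<theta>) \<le> f (pt (i + 6) \<theta>)" using 4 i6 by (intro pt_incr \<theta>) auto
      have L: "f (pt (i - 5) \<theta>) \<le> f (pt (i - 6) \<theta>)" using 4 i6 by (intro pt_decr \<theta>) auto
      show "f (pt i \<theta>) \<le> M + 1 * f (pt (i + 6) \<theta>) + - 1 * f (pt (i + 5) \<theta>) + 1 * f (pt (i - 6) \<theta>) + - 1 * f (pt (i - 5) \<theta>)"
      proof (cases "Z \<le> pt i \<theta>")
        case True
        have "f (pt i \<theta>) - M \<le> 1 * (f (pt (i + 5 + 1) \<theta>) - f (pt (i + 5) \<theta>))"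
          using True 4 i i6 by (intro excess_right_pt \<theta>) (auto simp: in_range_def)
        then show ?thesis using L by (simp add: algebra_simps)
      next
        case False
        have "f (pt i \<theta>) - M \<le> 1 * (f (pt (i - 5 - 1) \<theta>) - f (pt (i - 5) \<theta>))"
          using False 4 i i6 by (intro excess_left_pt \<theta>) (auto simp: in_range_def)
        then show ?thesis using R by (simp add: algebra_simps)
      qed
    qed
    then have "A i - M \<le> (A (i + 6) - A (i + 5)) + (A (i - 6) - A (i - 5))" by (simp add: algebra_simps)
    with 4 show ?thesis by (simp add: max_def)
  qed
qed

text \<open>7 = 6 + 1: both monitored blocks on the inner side still lie strictly beyond the block
  of the minimizer, where averages are monotone.\<close>

lemma gap_far:
  assumes "in_range j i"
  shows "i - k \<ge> 7 \<Longrightarrow> 1 \<le> i - 6 \<and> A (i - 6) - A (i - 5) \<le> 0"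
    and "i - k \<le> - 7 \<Longrightarrow> i + 6 \<le> 2 ^ j \<and> A (i + 6) - A (i + 5) \<le> 0"
  using assms k avg_mono_right[of "i - 6" "i - 5"] avg_mono_left[of "i + 6" "i + 5"]
  by (auto simp: in_range_def)

text \<open>If both increments exceed \<rho>, then the blocks i + 6 and i - 6 each contain a point
  beyond the minimizer with value above M + \<rho>. This confines the sublevel set to the 13 blocks
  from i - 6 to i + 6.\<close>

lemma gap_fine:
  assumes i: "in_range j i" and \<rho>: "\<rho> \<ge> 0"
    and L: "13 * m < measure lborel {t\<in>{0..1}. f t < M + \<rho>}" (is "_ < measure lborel ?S")
  shows "(i + 6 \<le> 2 ^ j \<and> A (i + 6) - A (i + 5) \<le> \<rho>) \<or> (1 \<le> i - 6 \<and> A (i - 6) - A (i - 5) \<le> \<rho>)"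
proof (rule ccontr)
  assume neg: "\<not> ?thesis"
  have up: "t \<le> (of_int i + 6) * m" if t: "t \<in> ?S" for t
  proof (cases "i + 6 \<le> 2 ^ j")
    \<comment> \<open>When block i + 6 does not exist, the end of the unit interval takes over as
      the bound.\<close>
    case False
    then have "2 ^ j \<le> of_int i + (6 :: real)"
      by (metis le_less_linear less_imp_le of_int_add of_int_le_iff of_int_numeral of_int_power)
    then have "2 ^ j * m \<le> (of_int i + 6) * m" by (intro mult_right_mono) (auto simp: less_imp_le)
    then show ?thesis using t by (simp add: mesh_scale)
  next
    case True
    have r: "in_range j (i + 6)" "in_range j (i + 5)" using i True by (auto simp: in_range_def)
    have "\<exists>\<theta>\<in>{0..1}. f (pt (i + 6) \<theta>) > \<rho> + f (pt (i + 5) \<theta>)"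
    proof (rule ccontr)
      assume "\<not> ?thesis"
      then have "A (i + 6) \<le> \<rho> + 1 * A (i + 5) + 0 * A i + 0 * A i + 0 * A i"
        by (intro block_avg_le r i) (auto simp: not_less)
      with neg True show False by auto
    qed
    then obtain \<theta> where \<theta>: "\<theta> \<in> {0..1}" "f (pt (i + 6) \<theta>) > \<rho> + f (pt (i + 5) \<theta>)" by blast
    let ?q = "pt (i + 6) \<theta>"
    have q01: "0 \<le> pt (i + 5) \<theta>" "?q \<le> 1" using block_pt_01 r \<theta>(1) by auto
    have "M \<le> f (pt (i + 5) \<theta>)" using block_pt_01[OF r(2) \<theta>(1)] by (intro M_le)
    then have fq: "M + \<rho> < f ?q" using \<theta>(2) by linarith
    have "Z < ?q"
    proof (rule ccontr)
      assume "\<not> Z < ?q"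
      then have "f ?q \<le> f (pt (i + 5) \<theta>)" using q01 by (intro decr) (auto intro: pt_mono)
      then show False using \<theta>(2) \<rho> by linarith
    qed
    then have "t \<le> ?q" using t fq incr[of ?q t] by (cases "t \<le> ?q") auto
    also have "?q \<le> of_int (i + 6) * m" by (rule block_pt_bounds(2)[OF \<theta>(1)])
    finally show ?thesis by simp
  qed
  have low: "(of_int i - 7) * m \<le> t" if t: "t \<in> ?S" for t
  proof (cases "1 \<le> i - 6")
    case False
    then have "of_int i - (7 :: real) \<le> 0" by linarith
    then have "(of_int i - 7) * m \<le> 0" by (simp add: mult_le_0_iff less_imp_le)
    then show ?thesis using t by simp
  next
    case True
    have r: "in_range j (i - 6)" "in_range j (i - 5)" using i True by (auto simp: in_range_def)
    have "\<exists>\<theta>\<in>{0..1}. f (pt (i - 6) \<theta>) > \<rho> + f (pt (i - 5) \<theta>)"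
    proof (rule ccontr)
      assume "\<not> ?thesis"
      then have "A (i - 6) \<le> \<rho> + 1 * A (i - 5) + 0 * A i + 0 * A i + 0 * A i"
        by (intro block_avg_le r i) (auto simp: not_less)
      with neg True show False by auto
    qed
    then obtain \<theta> where \<theta>: "\<theta> \<in> {0..1}" "f (pt (i - 6) \<theta>) > \<rho> + f (pt (i - 5) \<theta>)" by blast
    let ?q = "pt (i - 6) \<theta>"
    have q01: "0 \<le> ?q" "pt (i - 5) \<theta> \<le> 1" using block_pt_01 r \<theta>(1) by auto
    have "M \<le> f (pt (i - 5) \<theta>)" using block_pt_01[OF r(2) \<theta>(1)] by (intro M_le)
    then have fq: "M + \<rho> < f ?q" using \<theta>(2) by linarith
    have "?q < Z"
    proof (rule ccontr)
      assume "\<not> ?q < Z"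
      then have "f ?q \<le> f (pt (i - 5) \<theta>)" using q01 by (intro incr) (auto intro: pt_mono)
      then show False using \<theta>(2) \<rho> by linarith
    qed
    then have "?q \<le> t" using t fq decr[of t ?q] by (cases "?q \<le> t") auto
    moreover have "(of_int (i - 6) - 1) * m \<le> ?q" by (rule block_pt_bounds(1)[OF \<theta>(1)])
    ultimately show ?thesis by simp
  qed
  have "?S \<subseteq> {(of_int i - 7) * m .. (of_int i + 6) * m}" using up low by auto
  then have "emeasure lborel ?S \<le> emeasure lborel {(of_int i - 7) * m .. (of_int i + 6) * m}"
    by (intro emeasure_mono) auto
  also have "\<dots> = ennreal ((of_int i + 6) * m - (of_int i - 7) * m)"
    by (subst emeasure_lborel_Icc) (auto intro!: mult_right_mono less_imp_le[OF mesh_pos])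
  also have "(of_int i + 6) * m - (of_int i - 7) * m = 13 * m" by (simp add: algebra_simps)
  finally have "measure lborel ?S \<le> 13 * m"
    unfolding measure_def using enn2real_mono[of "emeasure lborel ?S" "ennreal (13 * m)"]
    by (simp add: less_imp_le)
  with L show False by linarith
qed

end

section \<open>The modulus of continuity\<close>

context convex_min begin

text \<open>If the inequality failed, the level could be raised slightly beyond M + \<rho>: this
  costs (\<rho> + \<delta>)^2 on the sublevel set and at most \<delta>^2 elsewhere, against the
  choice of \<rho> as a supremum. Positivity follows since \<epsilon> > 0.\<close>

lemma rho_m_facts:
  assumes \<epsilon>: "\<epsilon> > 0"
  shows "\<epsilon>\<^sup>2 \<le> (rho_m \<epsilon> f)\<^sup>2 * measure lborel {t\<in>{0..1}. f t < M + rho_m \<epsilon> f}" and "rho_m \<epsilon> f > 0"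
proof -
  define \<rho> where "\<rho> = rho_m \<epsilon> f"
  let ?T = "{u - M | u. l2_norm (\<lambda>t. f t - max (f t) u) \<le> \<epsilon>}"
  define S where "S = {t\<in>{0..1}. f t < M + \<rho>}"
  \<comment> \<open>A level more than \<epsilon> above both endpoint values changes f by more than
    \<epsilon> at every point.\<close>
  have bdd: "u - M \<le> max (f 0) (f 1) + \<epsilon> - M" if u: "l2_norm (\<lambda>t. f t - max (f t) u) \<le> \<epsilon>" for u
  proof (rule ccontr)
    let ?B = "max (f 0) (f 1)"
    assume "\<not> ?thesis"
    then have uB: "u - ?B > \<epsilon>" by linarith
    have "(u - ?B)\<^sup>2 = (LINT t:{0..1::real}|lborel. (u - ?B)\<^sup>2)" by (rule unit_const(2)[symmetric])
    also have "\<dots> \<le> (LINT t:{0..1}|lborel. (f t - max (f t) u)\<^sup>2)"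
    proof (intro set_integral_mono unit_const truncation_integrable[OF f])
      fix t :: real assume "t \<in> {0..1}"
      then have "f t \<le> ?B" by (rule convex_upper_bound[OF convex])
      then have "0 \<le> u - ?B" "u - ?B \<le> max (f t) u - f t" using uB \<epsilon> by linarith+
      then have "(u - ?B)\<^sup>2 \<le> (max (f t) u - f t)\<^sup>2" by (rule power_mono[rotated])
      then show "(u - ?B)\<^sup>2 \<le> (f t - max (f t) u)\<^sup>2" by (simp only: power2_commute)
    qed
    also have "\<dots> \<le> \<epsilon>\<^sup>2" using u unfolding l2_norm_def by (rule sqrt_le_D)
    finally have "u - ?B \<le> \<epsilon>" using \<epsilon> by (simp add: power2_le_iff_abs_le)
    with uB show False by linarith
  qed
  have bT: "bdd_above ?T"
    using bdd by (intro bdd_aboveI[of _ "max (f 0) (f 1) + \<epsilon> - M"]) blast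
  have z: "indicator {0..1} t *\<^sub>R (f t - max (f t) M)\<^sup>2 = 0" for t
    using M_le[of t] by (simp add: indicator_def max_absorb1)
  have "l2_norm (\<lambda>t. f t - max (f t) M) \<le> \<epsilon>"
    using \<epsilon> unfolding l2_norm_def set_lebesgue_integral_def z by simp
  then have "M - M \<in> ?T" by blast
  then have \<rho>0: "\<rho> \<ge> 0" unfolding \<rho>_def rho_m_def using cSup_upper[OF _ bT] by fastforce
  have [measurable]: "ext01 f \<in> borel_measurable borel" by (rule measurable_ext01[OF convex])
  have "{t\<in>{0..1}. f t < M + \<rho>} = {t\<in>space borel. ext01 f t < M + \<rho>} \<inter> {0..1}"
    by (auto simp: ext01_def)
  moreover have "\<dots> \<in> sets borel" by measurable
  ultimately have S: "S \<in> sets borel" by (simp add: S_def)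
  have "S \<subseteq> {0..1}" by (auto simp: S_def)
  then have S1: "measure lborel S \<le> 1"
    using measure_mono_fmeasurable[of S "{0..1}" lborel] S by (auto simp: fmeasurable_def)
  have main: "\<epsilon>\<^sup>2 \<le> \<rho>\<^sup>2 * measure lborel S"
  proof (rule ccontr)
    assume "\<not> ?thesis"
    then have gap: "\<epsilon>\<^sup>2 - \<rho>\<^sup>2 * measure lborel S > 0" by linarith
    define g where "g = \<epsilon>\<^sup>2 - \<rho>\<^sup>2 * measure lborel S"
    have g: "g > 0" using gap by (simp add: g_def)
    \<comment> \<open>The raised level costs at most 2 \<rho> \<delta> + 2 \<delta>^2 more than
      \<rho>^2 times the measure, hence at most (2 \<rho> + 2) \<delta> for \<delta> <= 1.\<close>
    define \<delta> where "\<delta> = min 1 (g / (2 * \<rho> + 2))"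
    have "(2 * \<rho> + 2) * \<delta> \<le> (2 * \<rho> + 2) * (g / (2 * \<rho> + 2))"
      using \<rho>0 unfolding \<delta>_def by (intro mult_left_mono min.cobounded2) simp
    then have \<delta>: "\<delta> > 0" "\<delta> \<le> 1" "(2 * \<rho> + 2) * \<delta> \<le> g"
      using g \<rho>0 by (simp_all add: \<delta>_def)
    let ?u = "M + \<rho> + \<delta>"
    have si: "set_integrable lborel {0..1} (\<lambda>t. (\<rho> + \<delta>)\<^sup>2 * indicator S t + \<delta>\<^sup>2)"
      using S by (intro bounded_integrable_on_unit[where B = "(\<rho> + \<delta>)\<^sup>2 + \<delta>\<^sup>2"]) (auto simp: indicator_def)
    have iS: "set_integrable lborel {0..1} (\<lambda>t. (\<rho> + \<delta>)\<^sup>2 * indicator S t)"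
      using S by (intro bounded_integrable_on_unit[where B = "(\<rho> + \<delta>)\<^sup>2"]) (auto simp: indicator_def)
    have "(LINT t:{0..1}|lborel. (f t - max (f t) ?u)\<^sup>2) \<le> (LINT t:{0..1}|lborel. (\<rho> + \<delta>)\<^sup>2 * indicator S t + \<delta>\<^sup>2)"
    proof (intro set_integral_mono truncation_integrable[OF f] si)
      fix t :: real assume t: "t \<in> {0..1}"
      have "\<bar>f t - max (f t) ?u\<bar> \<le> (if t \<in> S then \<rho> + \<delta> else \<delta>)"
        using M_le[of t] t \<rho>0 \<delta> by (auto simp: S_def)
      from power_mono[OF this abs_ge_zero, of 2]
      have pm: "(f t - max (f t) ?u)\<^sup>2 \<le> (if t \<in> S then \<rho> + \<delta> else \<delta>)\<^sup>2"
        by (simp only: power2_abs)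
      show "(f t - max (f t) ?u)\<^sup>2 \<le> (\<rho> + \<delta>)\<^sup>2 * indicator S t + \<delta>\<^sup>2"
      proof (cases "t \<in> S")
        case True
        then have "(f t - max (f t) ?u)\<^sup>2 \<le> (\<rho> + \<delta>)\<^sup>2" using pm by (simp only: if_True)
        also have "\<dots> \<le> (\<rho> + \<delta>)\<^sup>2 * indicator S t + \<delta>\<^sup>2" using True by simp
        finally show ?thesis .
      next
        case False
        then show ?thesis using pm by (simp only: if_False) simp
      qed
    qed
    also have "\<dots> = (\<rho> + \<delta>)\<^sup>2 * measure lborel S + \<delta>\<^sup>2"
    proof -
      have e: "indicator {0..1} t *\<^sub>R ((\<rho> + \<delta>)\<^sup>2 * indicator S t) = (\<rho> + \<delta>)\<^sup>2 * indicator S t" for t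
        by (auto simp: indicator_def S_def)
      have "(LINT t:{0..1}|lborel. (\<rho> + \<delta>)\<^sup>2 * indicator S t) = (\<rho> + \<delta>)\<^sup>2 * measure lborel S"
        unfolding set_lebesgue_integral_def e using S by simp
      then show ?thesis by (simp add: set_integral_add(2)[OF iS unit_const(1)] unit_const(2))
    qed
    also have "\<dots> = \<rho>\<^sup>2 * measure lborel S + (2 * \<rho> * \<delta> + \<delta> * \<delta>) * measure lborel S + \<delta> * \<delta>"
      by (simp add: power2_eq_square algebra_simps)
    also have "\<dots> \<le> \<rho>\<^sup>2 * measure lborel S + (2 * \<rho> * \<delta> + \<delta> * \<delta>) * 1 + \<delta> * \<delta>"
      using S1 \<rho>0 \<delta> by (intro add_mono mult_left_mono order_refl) auto
    also have "\<dots> \<le> \<rho>\<^sup>2 * measure lborel S + (2 * \<rho> * \<delta> + \<delta> * 1) * 1 + \<delta> * 1"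
      using \<delta> by (intro add_mono mult_left_mono mult_right_mono order_refl) auto
    also have "\<dots> = \<rho>\<^sup>2 * measure lborel S + (2 * \<rho> + 2) * \<delta>" by (simp add: algebra_simps)
    also have "\<dots> \<le> \<epsilon>\<^sup>2" using \<delta>(3) unfolding g_def by linarith
    finally have "l2_norm (\<lambda>t. f t - max (f t) ?u) \<le> \<epsilon>"
      unfolding l2_norm_def using \<epsilon> by (simp add: real_le_lsqrt)
    then have "?u - M \<in> ?T" by blast
    then have "?u - M \<le> \<rho>" unfolding \<rho>_def rho_m_def by (rule cSup_upper[OF _ bT])
    with \<delta> show False by linarith
  qed
  then show "\<epsilon>\<^sup>2 \<le> (rho_m \<epsilon> f)\<^sup>2 * measure lborel {t\<in>{0..1}. f t < M + rho_m \<epsilon> f}"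
    by (simp add: \<rho>_def S_def)
  have "\<rho> \<noteq> 0"
  proof
    assume "\<rho> = 0"
    with main \<epsilon> show False by simp
  qed
  with \<rho>0 show "rho_m \<epsilon> f > 0" by (simp add: \<rho>_def)
qed

end

section \<open>The localization path\<close>

lemma mesh_Suc: "mesh (Suc j) = mesh j / 2"
  by (simp add: mesh_def)

lemma mesh_nz[simp]: "mesh j \<noteq> 0" "0 \<le> mesh j" "\<not> mesh j \<le> 0"
  using mesh_pos[of j] by linarith+

lemma block_incr_children:
  "block_incr y (Suc j) (2 * i - 1) + block_incr y (Suc j) (2 * i) = block_incr y j i"
proof -
  have "of_int (2 * i) * mesh (Suc j) = of_int i * mesh j"
    "of_int (2 * i - 1 - 1) * mesh (Suc j) = of_int (i - 1) * mesh j"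
    by (simp_all add: mesh_Suc algebra_simps)
  then show ?thesis unfolding block_incr_def by (simp only:)
qed

lemma in_range_children: "in_range j i \<Longrightarrow> in_range (Suc j) (2 * i - 1) \<and> in_range (Suc j) (2 * i)"
  by (auto simp: in_range_def)

lemma block_incr_ext_in_range: "in_range j i \<Longrightarrow> block_incr_ext y j i = ereal (block_incr y j i)"
  by (simp add: block_incr_ext_def in_range_def)

lemma block_incr_ext_out: "\<not> in_range j i \<Longrightarrow> block_incr_ext y j i = \<infinity>"
  by (auto simp: block_incr_ext_def in_range_def)

definition argmin_set :: "int set \<Rightarrow> (int \<Rightarrow> ereal) \<Rightarrow> int set" where
  "argmin_set I X = {i \<in> I. \<forall>k\<in>I. X i \<le> X k}"

lemma loc_index_Suc_argmin:
  "loc_index y (Suc j) = Min (argmin_set {2 * loc_index y j - 2 .. 2 * loc_index y j + 1} (block_incr_ext y (Suc j)))"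
  by (simp add: argmin_set_def Let_def)

lemma loc_index_Suc_mem:
  "loc_index y (Suc j) \<in> argmin_set {2 * loc_index y j - 2 .. 2 * loc_index y j + 1} (block_incr_ext y (Suc j))"
proof -
  let ?I = "{2 * loc_index y j - 2 .. 2 * loc_index y j + 1}"
  let ?X = "block_incr_ext y (Suc j)"
  have "Min (?X ` ?I) \<in> ?X ` ?I" by (intro Min_in) auto
  then obtain i where i: "i \<in> ?I" "?X i = Min (?X ` ?I)" by (auto simp: image_iff)
  then have "i \<in> argmin_set ?I ?X" by (auto simp: argmin_set_def)
  then have "argmin_set ?I ?X \<noteq> {}" by auto
  moreover have "finite (argmin_set ?I ?X)"
    by (rule finite_subset[of _ ?I]) (auto simp: argmin_set_def)
  ultimately show ?thesis unfolding loc_index_Suc_argmin by (intro Min_in)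
qed

text \<open>The child 2 i of a block in range is in range, so the minimum over the window is finite
  and attained in range.\<close>

lemma loc_index_step:
  assumes "in_range j (loc_index y j)"
  shows "in_range (Suc j) (loc_index y (Suc j))"
    and "2 * loc_index y j - 2 \<le> loc_index y (Suc j)" "loc_index y (Suc j) \<le> 2 * loc_index y j + 1"
    and "\<And>k. 2 * loc_index y j - 2 \<le> k \<Longrightarrow> k \<le> 2 * loc_index y j + 1 \<Longrightarrow> in_range (Suc j) k \<Longrightarrow>
      block_incr y (Suc j) (loc_index y (Suc j)) \<le> block_incr y (Suc j) k"
proof -
  let ?i = "loc_index y j" and ?i' = "loc_index y (Suc j)"
  have mem: "?i' \<in> {2 * ?i - 2 .. 2 * ?i + 1}"
    and le: "\<And>k. k \<in> {2 * ?i - 2 .. 2 * ?i + 1} \<Longrightarrow> block_incr_ext y (Suc j) ?i' \<le> block_incr_ext y (Suc j) k"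
    using loc_index_Suc_mem[of y j] by (auto simp: argmin_set_def simp del: loc_index.simps)
  show "2 * ?i - 2 \<le> ?i'" "?i' \<le> 2 * ?i + 1" using mem by auto
  have child: "in_range (Suc j) (2 * ?i)" using in_range_children[OF assms] by simp
  show r: "in_range (Suc j) ?i'"
    using le[of "2 * ?i"] block_incr_ext_in_range[OF child, of y] block_incr_ext_out[of "Suc j" ?i' y]
    by (cases "in_range (Suc j) ?i'") auto
  show "block_incr y (Suc j) ?i' \<le> block_incr y (Suc j) k"
    if "2 * ?i - 2 \<le> k" "k \<le> 2 * ?i + 1" "in_range (Suc j) k" for k
    using le[of k] that block_incr_ext_in_range[OF r, of y] block_incr_ext_in_range[OF that(3), of y] by auto
qed

lemma loc_index_in_range: "in_range j (loc_index y j)"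
proof (induction j)
  case 0
  then show ?case by (simp add: in_range_def)
next
  case (Suc j)
  then show ?case by (rule loc_index_step(1))
qed

lemmas loc_index_bounds = loc_index_step(2,3)[OF loc_index_in_range]
lemmas loc_index_le = loc_index_step(4)[OF loc_index_in_range]

definition observed :: "(real \<Rightarrow> real) \<Rightarrow> nat \<Rightarrow> real" where
  "observed y j = block_incr y j (loc_index y j) / mesh j"

text \<open>Both children of the selected block belong to the window, and the smaller of their
  averages is at most that of the parent.\<close>

lemma observed_Suc_le: "observed y (Suc j) \<le> observed y j"
proof -
  let ?i = "loc_index y j"
  have "2 * block_incr y (Suc j) (loc_index y (Suc j)) \<le> block_incr y (Suc j) (2 * ?i - 1) + block_incr y (Suc j) (2 * ?i)"
    using loc_index_le[of y j "2 * ?i - 1"] loc_index_le[of y j "2 * ?i"]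
      in_range_children[OF loc_index_in_range[of j y]] by auto
  also have "\<dots> = block_incr y j ?i" by (rule block_incr_children)
  finally show ?thesis
    using mesh_pos[of j] by (simp add: observed_def mesh_Suc divide_simps del: loc_index.simps mesh_pos)
qed

text \<open>The \<open>max\<close> matters only for a minimizer at 0, where the ceiling is 0. A
  minimizer at an inner grid point is attributed to the block on its left.\<close>

definition min_block :: "(real \<Rightarrow> real) \<Rightarrow> nat \<Rightarrow> int" where
  "min_block f j = max 1 \<lceil>minimizer f * 2 ^ j\<rceil>"

lemma min_block_Suc: "min_block f (Suc j) = 2 * min_block f j - 1 \<or> min_block f (Suc j) = 2 * min_block f j"
proof -
  have "minimizer f * 2 ^ Suc j = 2 * (minimizer f * 2 ^ j)" by simp
  then have "\<lceil>minimizer f * 2 ^ Suc j\<rceil> = 2 * \<lceil>minimizer f * 2 ^ j\<rceil> - 1 \<or>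
      \<lceil>minimizer f * 2 ^ Suc j\<rceil> = 2 * \<lceil>minimizer f * 2 ^ j\<rceil>" by linarith
  then show ?thesis by (auto simp: min_block_def max_def)
qed

definition offset :: "(real \<Rightarrow> real) \<Rightarrow> (real \<Rightarrow> real) \<Rightarrow> nat \<Rightarrow> int" where
  "offset f y j = loc_index y j - min_block f j"

lemma offset_0: "minimizer f \<in> {0..1} \<Longrightarrow> offset f y 0 = 0"
  by (auto simp: offset_def min_block_def max_def ceiling_le_one le_ceiling_iff) linarith

lemma offset_Suc: "2 * offset f y j - 2 \<le> offset f y (Suc j)" "offset f y (Suc j) \<le> 2 * offset f y j + 2"
proof -
  show "2 * offset f y j - 2 \<le> offset f y (Suc j)"
    using min_block_Suc[of f j] loc_index_bounds[of y j] unfolding offset_def by arith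
  show "offset f y (Suc j) \<le> 2 * offset f y j + 2"
    using min_block_Suc[of f j] loc_index_bounds[of y j] unfolding offset_def by arith
qed

definition far_count :: "(real \<Rightarrow> real) \<Rightarrow> (real \<Rightarrow> real) \<Rightarrow> nat \<Rightarrow> nat" where
  "far_count f y n = card {j. j < n \<and> 7 \<le> \<bar>offset f y j\<bar>}"

lemma far_count_Suc: "far_count f y (Suc n) = far_count f y n + (if 7 \<le> \<bar>offset f y n\<bar> then 1 else 0)"
proof -
  have "{j. j < Suc n \<and> 7 \<le> \<bar>offset f y j\<bar>} =
      (if 7 \<le> \<bar>offset f y n\<bar> then insert n {j. j < n \<and> 7 \<le> \<bar>offset f y j\<bar>} else {j. j < n \<and> 7 \<le> \<bar>offset f y j\<bar>})"
    by (auto simp: less_Suc_eq)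
  then show ?thesis by (simp add: far_count_def)
qed

text \<open>A step takes an offset d to at most 2 |d| + 2 in absolute value, so |d| + 2 at most
  doubles; after a step from |d| <= 6 it is at most 16. Hence only the far levels need to be
  counted.\<close>

lemma offset_growth:
  assumes "minimizer f \<in> {0..1}"
  shows "\<bar>offset f y n\<bar> + 2 \<le> 16 * 2 ^ far_count f y n"
proof (induction n)
  case 0
  then show ?case by (simp add: offset_0[OF assms] far_count_def)
next
  case (Suc n)
  show ?case
  proof (cases "7 \<le> \<bar>offset f y n\<bar>")
    case True
    have "\<bar>offset f y (Suc n)\<bar> + 2 \<le> 2 * (\<bar>offset f y n\<bar> + 2)"
      using offset_Suc[where f = f and y = y and j = n] by arith
    also have "\<dots> \<le> 16 * 2 ^ far_count f y (Suc n)"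
      using Suc True by (simp add: far_count_Suc)
    finally show ?thesis .
  next
    case False
    have "\<bar>offset f y (Suc n)\<bar> + 2 \<le> 16 * 1"
      using offset_Suc[where f = f and y = y and j = n] False by arith
    also have "\<dots> \<le> 16 * 2 ^ far_count f y (Suc n)"
      by (intro mult_left_mono) auto
    finally show ?thesis .
  qed
qed

definition drift :: "(real \<Rightarrow> real) \<Rightarrow> real \<Rightarrow> real" where
  "drift f t = (LINT x:{0..t}|lborel. f x)"

definition noise_avg :: "(real \<Rightarrow> real) \<Rightarrow> nat \<Rightarrow> int \<Rightarrow> real" where
  "noise_avg w j i = block_incr w j i / mesh j"

text \<open>The excess observed value on entering a bad state, where the selected block is at offset
  \<open>\<plusminus>d\<close> from the block of the minimizer although the neighbour at \<open>\<plusminus>1\<close> was available.\<close>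

definition entry_excess :: "(real \<Rightarrow> real) \<Rightarrow> (real \<Rightarrow> real) \<Rightarrow> nat \<Rightarrow> real" where
  "entry_excess f w j = sqrt (\<Sum>p\<in>{1, - 1} \<times> {2, 3, 4}.
     if in_range j (min_block f j + fst p) \<and> in_range j (min_block f j + fst p * snd p)
     then (max 0 (3 * noise_avg w j (min_block f j + fst p) - 2 * noise_avg w j (min_block f j + fst p * snd p)))\<^sup>2
     else 0)"

text \<open>A Euclidean norm dominates every single case and, unlike a maximum, has a second moment
  that is a plain sum. Offsets beyond 4 = 2 * 1 + 2 cannot occur on entry.\<close>

lemma entry_excess_ge:
  assumes p: "s \<in> {1, - 1}" "d \<in> {2, 3, 4}"
    and r: "in_range j (min_block f j + s)" "in_range j (min_block f j + s * d)"
  shows "3 * noise_avg w j (min_block f j + s) - 2 * noise_avg w j (min_block f j + s * d) \<le> entry_excess f w j"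
proof -
  let ?x = "3 * noise_avg w j (min_block f j + s) - 2 * noise_avg w j (min_block f j + s * d)"
  let ?g = "\<lambda>p. if in_range j (min_block f j + fst p) \<and> in_range j (min_block f j + fst p * snd p)
     then (max 0 (3 * noise_avg w j (min_block f j + fst p) - 2 * noise_avg w j (min_block f j + fst p * snd p)))\<^sup>2
     else 0"
  have "?g (s, d) \<le> (\<Sum>p\<in>{1, - 1} \<times> {2, 3, 4}. ?g p)"
    by (rule member_le_sum) (use p in auto)
  then have "(max 0 ?x)\<^sup>2 \<le> (\<Sum>p\<in>{1, - 1} \<times> {2, 3, 4}. ?g p)" using r by simp
  then have "max 0 ?x \<le> entry_excess f w j" unfolding entry_excess_def by (rule real_le_rsqrt)
  then show ?thesis by linarith
qed

lemma entry_excess_nonneg: "0 \<le> entry_excess f w j"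
  unfolding entry_excess_def by (intro real_sqrt_ge_zero sum_nonneg) auto

text \<open>Read a1, a2 as the true averages of the neighbour and of the selected block, e1, e2 as
  their noises, b as the observed average and c as the minimum. The selection gives a2 - a1 <= e1 -
  e2, so b - c <= 2 (a2 - a1) + e1 <= 2 (e1 - e2) + e1.\<close>

lemma entry_arith:
  fixes a1 a2 b c e1 e2 :: real
  assumes "a1 - c \<le> 2 * (a2 - a1)" "b \<le> a1 + e1" "a2 + e2 \<le> a1 + e1"
  shows "b - c \<le> 3 * e1 - 2 * e2"
  using assms by argo

context convex_min begin

lemma convex_block_min_block: "convex_block f j (min_block f j)"
proof unfold_locales
  have Z: "0 \<le> Z * 2 ^ j" "Z * 2 ^ j \<le> 2 ^ j" using Z01 by (auto simp: mult_le_cancel_right1)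
  have "\<lceil>Z * 2 ^ j\<rceil> \<le> 2 ^ j" using Z(2) by (simp add: ceiling_le_iff)
  then show "in_range j (min_block f j)" by (simp add: in_range_def min_block_def)
  have "of_int \<lceil>Z * 2 ^ j\<rceil> - 1 \<le> Z * 2 ^ j" by linarith
  then have "(of_int (min_block f j) - 1) \<le> Z * 2 ^ j"
    using Z(1) by (simp add: min_block_def max_def)
  then have "(of_int (min_block f j) - 1) * mesh j \<le> Z * 2 ^ j * mesh j" by (intro mult_right_mono) (auto simp: less_imp_le)
  then show "(of_int (min_block f j) - 1) * mesh j \<le> Z" by (simp add: mesh_def)
  have "Z * 2 ^ j \<le> of_int \<lceil>Z * 2 ^ j\<rceil>" by linarith
  then have "Z * 2 ^ j \<le> of_int (min_block f j)" unfolding min_block_def by linarith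
  then have "Z * 2 ^ j * mesh j \<le> of_int (min_block f j) * mesh j" by (intro mult_right_mono) (auto simp: less_imp_le)
  then show "Z \<le> of_int (min_block f j) * mesh j" by (simp add: mesh_def)
qed

lemma block_incr_drift:
  assumes "in_range j i"
  shows "block_incr (drift f) j i = mesh j * block_avg f j i"
proof -
  let ?a = "of_int (i - 1) * mesh j" and ?b = "of_int i * mesh j"
  have a: "0 \<le> ?a" "?a \<le> ?b" "?b \<le> 1"
    using assms of_int_mesh_le_one[of i j] by (auto simp: in_range_def less_imp_le intro!: mult_right_mono)
  have "block_incr (drift f) j i = (LINT t:{?a..?b}|lborel. f t)"
    unfolding block_incr_def drift_def by (rule set_integral_split[OF convex_unique_min_integrable[OF f] a])
  also have "\<dots> = \<bar>mesh j\<bar> *\<^sub>R (\<integral>\<theta>. indicator {?a..?b} (?a + mesh j * \<theta>) *\<^sub>R f (?a + mesh j * \<theta>) \<partial>lborel)"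
    unfolding set_lebesgue_integral_def by (rule lborel_integral_real_affine) (use mesh_pos[of j] in simp)
  also have "(\<lambda>\<theta>. indicator {?a..?b} (?a + mesh j * \<theta>) *\<^sub>R f (?a + mesh j * \<theta>)) =
      (\<lambda>\<theta>. indicator {0..1} \<theta> *\<^sub>R f (block_pt j i \<theta>))"
  proof
    fix \<theta>
    have "?a + mesh j * \<theta> = block_pt j i \<theta>" by (simp add: block_pt_def algebra_simps)
    moreover have "?a + mesh j * \<theta> \<in> {?a..?b} \<longleftrightarrow> \<theta> \<in> {0..1}"
    proof -
      have b: "?b = ?a + mesh j * 1" by (simp add: algebra_simps)
      have "0 \<le> mesh j * \<theta> \<longleftrightarrow> 0 \<le> \<theta>" using mesh_pos[of j] by (simp add: zero_le_mult_iff)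
      moreover have "mesh j * \<theta> \<le> mesh j * 1 \<longleftrightarrow> \<theta> \<le> 1" using mesh_pos[of j] by (intro mult_le_cancel_left_pos)
      ultimately show ?thesis unfolding b by simp
    qed
    ultimately show "indicator {?a..?b} (?a + mesh j * \<theta>) *\<^sub>R f (?a + mesh j * \<theta>) =
      indicator {0..1} \<theta> *\<^sub>R f (block_pt j i \<theta>)"
      by (simp add: indicator_def)
  qed
  finally show ?thesis using mesh_pos[of j] by (simp add: block_avg_def set_lebesgue_integral_def less_imp_le)
qed

lemma block_incr_observation:
  assumes "in_range j i" and "\<And>t. y t = drift f t + w t"
  shows "block_incr y j i / mesh j = block_avg f j i + noise_avg w j i"
proof -
  have "block_incr y j i = block_incr (drift f) j i + block_incr w j i"
    using assms(2) by (simp add: block_incr_def)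
  then show ?thesis
    using block_incr_drift[OF assms(1)] mesh_pos[of j] by (simp add: noise_avg_def add_divide_distrib less_imp_neq[symmetric])
qed

text \<open>Either the previous level was bad already and the observed average has not increased
  since, or the path moves away at this level, where a worse block beat an available neighbour of
  the minimizer.\<close>

lemma observed_bad:
  assumes y: "\<And>t. y t = drift f t + w t" and bad: "2 \<le> \<bar>offset f y n\<bar>"
  shows "\<exists>e\<le>n. observed y n - M \<le> entry_excess f w e"
  using bad
proof (induction n)
  case 0
  then show ?case using offset_0[OF minimizer(1)[OF f], of y] by simp
next
  case (Suc n)
  show ?case
  proof (cases "2 \<le> \<bar>offset f y n\<bar>")
    case True
    then obtain e where e: "e \<le> n" "observed y n - M \<le> entry_excess f w e" using Suc.IH by blast
    then show ?thesis using observed_Suc_le[of y n] by (intro exI[of _ e]) linarith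
  next
    case False
    let ?j = "Suc n"
    let ?k = "min_block f ?j" and ?i = "loc_index y ?j"
    interpret convex_block f ?j ?k by (rule convex_block_min_block)
    have ri: "in_range ?j ?i" by (rule loc_index_in_range)
    define s :: int where "s = (if offset f y ?j \<ge> 0 then 1 else - 1)"
    define d where "d = \<bar>offset f y ?j\<bar>"
    have d: "d \<in> {2, 3, 4}" using offset_Suc[where f = f and y = y and j = n] False Suc.prems unfolding d_def by auto
    have near: "loc_index y n \<le> min_block f n + 1" "min_block f n \<le> loc_index y n + 1"
      using False by (auto simp: offset_def)
    have s: "s \<in> {1, - 1}" by (simp add: s_def)
    have i_eq: "?i = ?k + s * d" by (simp add: offset_def s_def d_def)
    have r: "in_range ?j (?k + s)" "in_range ?j (?k + s * d)"
      using ri k(1) d i_eq unfolding in_range_def s_def by (auto split: if_splits)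
    have D: "2 \<le> d" using d by auto
    \<comment> \<open>After an offset of at most 1 the neighbour \<open>?k + s\<close>, which lies
      between the minimizer's block and the selected one, is inside the window and took part in the
      comparison.\<close>
    have "block_incr y ?j ?i \<le> block_incr y ?j (?k + s)"
    proof (rule loc_index_le[OF _ _ r(1)])
      show "2 * loc_index y n - 2 \<le> ?k + s" "?k + s \<le> 2 * loc_index y n + 1"
        using s near min_block_Suc[of f n] loc_index_bounds[of y n] D i_eq
        by (elim insertE emptyE; simp only:; arith)+
    qed
    then have "block_incr y ?j ?i / mesh ?j \<le> block_incr y ?j (?k + s) / mesh ?j"
      by (intro divide_right_mono) (auto simp: less_imp_le)
    then have obs: "observed y ?j \<le> A (?k + s) + noise_avg w ?j (?k + s)"
      "A (?k + s * d) + noise_avg w ?j (?k + s * d) \<le> A (?k + s) + noise_avg w ?j (?k + s)"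
      using block_incr_observation[OF r(1) y] block_incr_observation[OF r(2) y] i_eq
      by (simp_all add: observed_def del: loc_index.simps)
    have "A (?k + s) - M \<le> 2 * (A (?k + s * d) - A (?k + s))"
      using d r entry_right[of d] entry_left[of d] unfolding s_def in_range_def by (auto split: if_splits)
    from entry_arith[OF this obs]
    have "observed y ?j - M \<le> 3 * noise_avg w ?j (?k + s) - 2 * noise_avg w ?j (?k + s * d)" .
    also have "\<dots> \<le> entry_excess f w ?j" by (rule entry_excess_ge[OF s d r])
    finally show ?thesis by (intro exI[of _ ?j]) auto
  qed
qed

end

section \<open>The stopping rule\<close>

text \<open>The standard deviation of a block average of a split process. Each split process has
  noise variance 3 \<epsilon>^2 per unit of time, as 1 + 1/2 + 3/2 = 1 + 2 = 3.\<close>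

definition noise_sd :: "real \<Rightarrow> nat \<Rightarrow> real" where
  "noise_sd \<epsilon> j = sqrt 3 * \<epsilon> / sqrt (mesh j)"

lemma noise_sd_pos: "\<epsilon> > 0 \<Longrightarrow> noise_sd \<epsilon> j > 0"
  by (simp add: noise_sd_def)

text \<open>A gap is a difference of two independent block increments, whence the factor sqrt
  2.\<close>

lemma sigma_level_eq:
  assumes "\<epsilon> > 0" shows "sigma_level \<epsilon> j = sqrt 2 * noise_sd \<epsilon> j * mesh j"
proof -
  have "sigma_level \<epsilon> j = sqrt (2 * 3) * sqrt (mesh j) * \<epsilon>"
    using assms by (simp add: sigma_level_def real_sqrt_mult)
  also have "sqrt (2 * 3) = sqrt 2 * sqrt 3" by (rule real_sqrt_mult)
  also have "sqrt 2 * sqrt 3 * sqrt (mesh j) * \<epsilon> = sqrt 2 * (sqrt 3 * \<epsilon> / sqrt (mesh j)) * (sqrt (mesh j) * sqrt (mesh j))"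
    using mesh_pos[of j] by (simp only: times_divide_eq_left times_divide_eq_right nonzero_mult_div_cancel_right real_sqrt_eq_zero_cancel_iff mesh_nz(1) not_False_eq_True
        mult.assoc[symmetric]) (simp del: real_sqrt_mult_self add: field_simps)
  also have "sqrt (mesh j) * sqrt (mesh j) = mesh j" by simp
  finally show ?thesis by (simp add: noise_sd_def)
qed

lemma sigma_level_pos: "\<epsilon> > 0 \<Longrightarrow> sigma_level \<epsilon> j > 0"
  using noise_sd_pos[of \<epsilon> j] by (simp add: sigma_level_eq)

text \<open>Real-valued form of the test: a gap reaching outside the unit interval is infinite and
  never triggers, which the range condition expresses.\<close>

definition right_stop :: "real \<Rightarrow> (real \<Rightarrow> real) \<Rightarrow> (real \<Rightarrow> real) \<Rightarrow> nat \<Rightarrow> bool" where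
  "right_stop \<epsilon> yl ys j \<longleftrightarrow> loc_index yl j + 6 \<le> 2 ^ j \<and>
     block_incr ys j (loc_index yl j + 6) - block_incr ys j (loc_index yl j + 5) \<le> 2 * sigma_level \<epsilon> j"

definition left_stop :: "real \<Rightarrow> (real \<Rightarrow> real) \<Rightarrow> (real \<Rightarrow> real) \<Rightarrow> nat \<Rightarrow> bool" where
  "left_stop \<epsilon> yl ys j \<longleftrightarrow> 1 \<le> loc_index yl j - 6 \<and>
     block_incr ys j (loc_index yl j - 6) - block_incr ys j (loc_index yl j - 5) \<le> 2 * sigma_level \<epsilon> j"

lemma right_gap_le_iff: "right_gap yl ys j \<le> ereal (2 * sigma_level \<epsilon> j) \<longleftrightarrow> right_stop \<epsilon> yl ys j"
  using loc_index_in_range[of j yl]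
  by (auto simp: right_gap_def right_stop_def block_incr_ext_def in_range_def simp del: loc_index.simps)

lemma left_gap_le_iff: "left_gap yl ys j \<le> ereal (2 * sigma_level \<epsilon> j) \<longleftrightarrow> left_stop \<epsilon> yl ys j"
  using loc_index_in_range[of j yl]
  by (auto simp: left_gap_def left_stop_def block_incr_ext_def in_range_def simp del: loc_index.simps)

lemma stop_iff:
  assumes "\<epsilon> > 0"
  shows "stop_stat yl ys j / ereal (sigma_level \<epsilon> j) \<le> 2 \<longleftrightarrow> right_stop \<epsilon> yl ys j \<or> left_stop \<epsilon> yl ys j"
proof -
  have "stop_stat yl ys j / ereal (sigma_level \<epsilon> j) \<le> 2 \<longleftrightarrow> stop_stat yl ys j \<le> ereal (2 * sigma_level \<epsilon> j)"
    using sigma_level_pos[OF assms, of j]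
    by (cases "stop_stat yl ys j") (auto simp: pos_divide_le_eq)
  also have "\<dots> \<longleftrightarrow> right_stop \<epsilon> yl ys j \<or> left_stop \<epsilon> yl ys j"
    unfolding right_gap_le_iff[symmetric] left_gap_le_iff[symmetric] stop_stat_def by (rule min_le_iff_disj)
  finally show ?thesis .
qed

text \<open>Only noise that makes a gap look smaller than it is matters. The Euclidean norm
  dominates the deviations on both sides and keeps second moments additive.\<close>

definition gap_deviation :: "(real \<Rightarrow> real) \<Rightarrow> nat \<Rightarrow> int \<Rightarrow> real" where
  "gap_deviation w j i = sqrt
     ((if i + 6 \<le> 2 ^ j then (max 0 (noise_avg w j (i + 5) - noise_avg w j (i + 6)))\<^sup>2 else 0) +
      (if 1 \<le> i - 6 then (max 0 (noise_avg w j (i - 5) - noise_avg w j (i - 6)))\<^sup>2 else 0))"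

lemma gap_deviation_ge:
  "i + 6 \<le> 2 ^ j \<Longrightarrow> noise_avg w j (i + 5) - noise_avg w j (i + 6) \<le> gap_deviation w j i"
  "1 \<le> i - 6 \<Longrightarrow> noise_avg w j (i - 5) - noise_avg w j (i - 6) \<le> gap_deviation w j i"
  "0 \<le> gap_deviation w j i"
proof -
  have *: "x \<le> gap_deviation w j i" if "(max 0 x)\<^sup>2 \<le> (gap_deviation w j i)\<^sup>2" for x
  proof -
    have "max 0 x \<le> gap_deviation w j i"
      by (rule power2_le_imp_le[OF that]) (simp add: gap_deviation_def)
    then show ?thesis by linarith
  qed
  show "i + 6 \<le> 2 ^ j \<Longrightarrow> noise_avg w j (i + 5) - noise_avg w j (i + 6) \<le> gap_deviation w j i"
    "1 \<le> i - 6 \<Longrightarrow> noise_avg w j (i - 5) - noise_avg w j (i - 6) \<le> gap_deviation w j i"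
    by (rule *, simp add: gap_deviation_def)+
  show "0 \<le> gap_deviation w j i" by (simp add: gap_deviation_def)
qed

definition selected :: "real \<Rightarrow> (real \<Rightarrow> real) \<Rightarrow> (real \<Rightarrow> real) \<Rightarrow> nat \<Rightarrow> int" where
  "selected \<epsilon> yl ys j = loc_index yl j + 2 * (of_bool (right_stop \<epsilon> yl ys j) - of_bool (left_stop \<epsilon> yl ys j))"

context convex_min begin

lemma observation_gap:
  assumes "in_range j i" "in_range j i'" "\<And>t. y t = drift f t + w t"
  shows "block_incr y j i - block_incr y j i' =
    mesh j * ((block_avg f j i - block_avg f j i') + (noise_avg w j i - noise_avg w j i'))"
proof -
  have "block_incr y j i = mesh j * (block_avg f j i + noise_avg w j i)"
    using block_incr_observation[OF assms(1,3)] by (simp add: field_simps)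
  moreover have "block_incr y j i' = mesh j * (block_avg f j i' + noise_avg w j i')"
    using block_incr_observation[OF assms(2,3)] by (simp add: field_simps)
  ultimately show ?thesis by (simp add: algebra_simps)
qed

lemma gap_of_stop:
  fixes j :: nat and yl ys ws :: "real \<Rightarrow> real"
  assumes \<epsilon>: "\<epsilon> > 0" and ys: "\<And>t. ys t = drift f t + ws t"
  defines "i \<equiv> loc_index yl j"
  shows "right_stop \<epsilon> yl ys j \<Longrightarrow>
      block_avg f j (i + 6) - block_avg f j (i + 5) \<le> 2 * sqrt 2 * noise_sd \<epsilon> j + gap_deviation ws j i"
    and "left_stop \<epsilon> yl ys j \<Longrightarrow>
      block_avg f j (i - 6) - block_avg f j (i - 5) \<le> 2 * sqrt 2 * noise_sd \<epsilon> j + gap_deviation ws j i"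
proof -
  have i: "in_range j i" unfolding i_def by (rule loc_index_in_range)
  have *: "g \<le> 2 * sqrt 2 * noise_sd \<epsilon> j - d" if "mesh j * (g + d) \<le> 2 * sigma_level \<epsilon> j" for g d
  proof -
    have "mesh j * (g + d) \<le> mesh j * (2 * sqrt 2 * noise_sd \<epsilon> j)"
      using that by (simp add: sigma_level_eq[OF \<epsilon>] ac_simps)
    then show ?thesis by (simp add: mult_le_cancel_left_pos)
  qed
  show "block_avg f j (i + 6) - block_avg f j (i + 5) \<le> 2 * sqrt 2 * noise_sd \<epsilon> j + gap_deviation ws j i"
    if "right_stop \<epsilon> yl ys j"
  proof -
    have r: "in_range j (i + 6)" "in_range j (i + 5)" and i6: "i + 6 \<le> 2 ^ j"
      using that i by (auto simp: right_stop_def in_range_def i_def)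
    have "block_incr ys j (i + 6) - block_incr ys j (i + 5) \<le> 2 * sigma_level \<epsilon> j"
      using that by (simp add: right_stop_def i_def)
    then show ?thesis
      unfolding observation_gap[OF r ys] using *[of "block_avg f j (i + 6) - block_avg f j (i + 5)"]
        gap_deviation_ge(1)[OF i6, of ws] by fastforce
  qed
  show "block_avg f j (i - 6) - block_avg f j (i - 5) \<le> 2 * sqrt 2 * noise_sd \<epsilon> j + gap_deviation ws j i"
    if "left_stop \<epsilon> yl ys j"
  proof -
    have r: "in_range j (i - 6)" "in_range j (i - 5)" and i6: "1 \<le> i - 6"
      using that i by (auto simp: left_stop_def in_range_def i_def)
    have "block_incr ys j (i - 6) - block_incr ys j (i - 5) \<le> 2 * sigma_level \<epsilon> j"
      using that by (simp add: left_stop_def i_def)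
    then show ?thesis
      unfolding observation_gap[OF r ys] using *[of "block_avg f j (i - 6) - block_avg f j (i - 5)"]
        gap_deviation_ge(2)[OF i6, of ws j] by fastforce
  qed
qed

text \<open>A stop bounds the true gap, in terms of averages, by 2 sqrt 2 times the noise level plus
  the deviation; the three loss lemmas multiply this by 4.\<close>

lemma selected_loss:
  fixes j :: nat and yl ys ws :: "real \<Rightarrow> real"
  assumes \<epsilon>: "\<epsilon> > 0" and ys: "\<And>t. ys t = drift f t + ws t"
    and stop: "right_stop \<epsilon> yl ys j \<or> left_stop \<epsilon> yl ys j"
  defines "i \<equiv> loc_index yl j"
  shows "in_range j (selected \<epsilon> yl ys j)"
    and "block_avg f j (selected \<epsilon> yl ys j) - M \<le>
      (if 2 \<le> \<bar>offset f yl j\<bar> then block_avg f j i - M else 0) +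
      8 * sqrt 2 * noise_sd \<epsilon> j + 4 * gap_deviation ws j i"
proof -
  interpret convex_block f j "min_block f j" by (rule convex_block_min_block)
  have i: "in_range j i" unfolding i_def by (rule loc_index_in_range)
  have off: "offset f yl j = i - min_block f j" by (simp add: offset_def i_def)
  let ?B = "if 2 \<le> \<bar>i - min_block f j\<bar> then A i - M else 0"
  let ?g = "2 * sqrt 2 * noise_sd \<epsilon> j + gap_deviation ws j i"
  have g0: "0 \<le> ?g" using noise_sd_pos[OF \<epsilon>, of j] gap_deviation_ge(3)[of ws j i] by simp
  note gap = gap_of_stop[OF \<epsilon> ys, where yl = yl and j = j, folded i_def]
  have rng: "right_stop \<epsilon> yl ys j \<Longrightarrow> i + 6 \<le> 2 ^ j" "left_stop \<epsilon> yl ys j \<Longrightarrow> 1 \<le> i - 6"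
    by (simp_all add: right_stop_def left_stop_def i_def)
  consider "right_stop \<epsilon> yl ys j" "left_stop \<epsilon> yl ys j" | "right_stop \<epsilon> yl ys j" "\<not> left_stop \<epsilon> yl ys j"
    | "\<not> right_stop \<epsilon> yl ys j" "left_stop \<epsilon> yl ys j" using stop by blast
  then have "in_range j (selected \<epsilon> yl ys j) \<and> A (selected \<epsilon> yl ys j) - M \<le> ?B + 4 * ?g"
  proof cases
    case 1
    then have "selected \<epsilon> yl ys j = i" by (simp add: selected_def i_def)
    moreover have "max (max 0 (A (i + 6) - A (i + 5))) (max 0 (A (i - 6) - A (i - 5))) \<le> ?g"
      using gap 1 g0 by (intro max.boundedI) auto
    then have "A i - M \<le> ?B + 4 * ?g"
      by (intro order_trans[OF loss_both[OF i rng(2)[OF 1(2)] rng(1)[OF 1(1)]] add_left_mono]) (erule mult_left_mono, simp)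
    ultimately show ?thesis using i by simp
  next
    case 2
    then have "selected \<epsilon> yl ys j = i + 2" by (simp add: selected_def i_def)
    moreover have "max 0 (A (i + 6) - A (i + 5)) \<le> ?g" using gap(1) 2 g0 by (intro max.boundedI) auto
    then have "A (i + 2) - M \<le> ?B + 4 * ?g"
      by (intro order_trans[OF loss_right[OF i rng(1)[OF 2(1)]] add_left_mono]) (erule mult_left_mono, simp)
    moreover have "in_range j (i + 2)" using i rng(1)[OF 2(1)] by (auto simp: in_range_def)
    ultimately show ?thesis by simp
  next
    case 3
    then have "selected \<epsilon> yl ys j = i - 2" by (simp add: selected_def i_def)
    moreover have "max 0 (A (i - 6) - A (i - 5)) \<le> ?g" using gap(2) 3 g0 by (intro max.boundedI) auto
    then have "A (i - 2) - M \<le> ?B + 4 * ?g"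
      by (intro order_trans[OF loss_left[OF i rng(2)[OF 3(2)]] add_left_mono]) (erule mult_left_mono, simp)
    moreover have "in_range j (i - 2)" using i rng(2)[OF 3(2)] by (auto simp: in_range_def)
    ultimately show ?thesis by simp
  qed
  then show "in_range j (selected \<epsilon> yl ys j)" "A (selected \<epsilon> yl ys j) - M \<le>
      (if 2 \<le> \<bar>offset f yl j\<bar> then A i - M else 0) + 8 * sqrt 2 * noise_sd \<epsilon> j + 4 * gap_deviation ws j i"
    unfolding off by (auto simp: algebra_simps)
qed

lemma bad_block_excess:
  assumes y: "\<And>t. y t = drift f t + w t" and bad: "2 \<le> \<bar>offset f y n\<bar>"
  shows "\<exists>e\<le>n. block_avg f n (loc_index y n) - M \<le> entry_excess f w e + max 0 (- noise_avg w n (loc_index y n))"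
proof -
  obtain e where e: "e \<le> n" "observed y n - M \<le> entry_excess f w e" using observed_bad[OF y bad] by blast
  have "observed y n = block_avg f n (loc_index y n) + noise_avg w n (loc_index y n)"
    unfolding observed_def by (rule block_incr_observation[OF loc_index_in_range y])
  with e show ?thesis by (intro exI[of _ e]) auto
qed

end

text \<open>A level is easy for a position if on one of the two sides the true gap is small compared to the
  noise; the process then stops there with high probability.\<close>

definition easy_right :: "real \<Rightarrow> (real \<Rightarrow> real) \<Rightarrow> nat \<Rightarrow> int \<Rightarrow> bool" where
  "easy_right \<epsilon> f j i \<longleftrightarrow> i + 6 \<le> 2 ^ j \<and> block_avg f j (i + 6) - block_avg f j (i + 5) \<le> sqrt 2 * noise_sd \<epsilon> j / 5"

definition easy_left :: "real \<Rightarrow> (real \<Rightarrow> real) \<Rightarrow> nat \<Rightarrow> int \<Rightarrow> bool" where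
  "easy_left \<epsilon> f j i \<longleftrightarrow> 1 \<le> i - 6 \<and> block_avg f j (i - 6) - block_avg f j (i - 5) \<le> sqrt 2 * noise_sd \<epsilon> j / 5"

text \<open>One gap is watched per level, the right one if both are easy, so that a path attaches a
  single piece of noise to each easy level.\<close>

definition easy_noise :: "real \<Rightarrow> (real \<Rightarrow> real) \<Rightarrow> (real \<Rightarrow> real) \<Rightarrow> nat \<Rightarrow> int \<Rightarrow> real" where
  "easy_noise \<epsilon> f w j i = (if easy_right \<epsilon> f j i then block_incr w j (i + 6) - block_incr w j (i + 5)
     else block_incr w j (i - 6) - block_incr w j (i - 5))"

context convex_min begin

text \<open>An easy gap has mean at most a fifth of \<open>sigma_level\<close>, so staying above the
  threshold 2 requires noise above 2 - 1/5 = 9/5.\<close>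

lemma easy_not_stopped:
  assumes \<epsilon>: "\<epsilon> > 0" and ys: "\<And>t. ys t = drift f t + ws t"
    and nostop: "\<not> right_stop \<epsilon> yl ys j" "\<not> left_stop \<epsilon> yl ys j"
    and easy: "easy_right \<epsilon> f j (loc_index yl j) \<or> easy_left \<epsilon> f j (loc_index yl j)"
  shows "easy_noise \<epsilon> f ws j (loc_index yl j) > 9/5 * sigma_level \<epsilon> j"
proof -
  let ?i = "loc_index yl j"
  have i: "in_range j ?i" by (rule loc_index_in_range)
  have *: "mesh j * d > 9/5 * sigma_level \<epsilon> j"
    if "\<not> mesh j * (g + d) \<le> 2 * sigma_level \<epsilon> j" "g \<le> sqrt 2 * noise_sd \<epsilon> j / 5" for g d
  proof -
    have "mesh j * g \<le> mesh j * (sqrt 2 * noise_sd \<epsilon> j / 5)" using that(2) by (intro mult_left_mono) auto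
    also have "\<dots> = sigma_level \<epsilon> j / 5" by (simp add: sigma_level_eq[OF \<epsilon>])
    finally show ?thesis using that(1) by (simp add: distrib_left)
  qed
  have nm: "mesh j * (noise_avg ws j a - noise_avg ws j b) = block_incr ws j a - block_incr ws j b" for a b
    by (simp add: noise_avg_def right_diff_distrib)
  show ?thesis
  proof (cases "easy_right \<epsilon> f j ?i")
    case True
    then have r: "in_range j (?i + 6)" "in_range j (?i + 5)" using i by (auto simp: easy_right_def in_range_def)
    have "\<not> block_incr ys j (?i + 6) - block_incr ys j (?i + 5) \<le> 2 * sigma_level \<epsilon> j"
      using nostop True by (simp add: right_stop_def easy_right_def)
    from *[OF this[unfolded observation_gap[OF r ys]]] True show ?thesis
      by (simp add: easy_noise_def nm easy_right_def)
  next
    case False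
    then have l: "easy_left \<epsilon> f j ?i" using easy by simp
    then have r: "in_range j (?i - 6)" "in_range j (?i - 5)" using i by (auto simp: easy_left_def in_range_def)
    have "\<not> block_incr ys j (?i - 6) - block_incr ys j (?i - 5) \<le> 2 * sigma_level \<epsilon> j"
      using nostop l by (simp add: left_stop_def easy_left_def)
    from *[OF this[unfolded observation_gap[OF r ys]]] l False show ?thesis
      by (simp add: easy_noise_def nm easy_left_def)
  qed
qed

lemma easy_far:
  assumes "\<epsilon> > 0" "7 \<le> \<bar>offset f y j\<bar>"
  shows "easy_right \<epsilon> f j (loc_index y j) \<or> easy_left \<epsilon> f j (loc_index y j)"
proof -
  interpret convex_block f j "min_block f j" by (rule convex_block_min_block)
  have "0 \<le> sqrt 2 * noise_sd \<epsilon> j / 5" using noise_sd_pos[OF assms(1), of j] by simp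
  moreover have "loc_index y j - min_block f j \<ge> 7 \<or> loc_index y j - min_block f j \<le> - 7"
    using assms(2) by (auto simp: offset_def)
  ultimately show ?thesis
    using gap_far[OF loc_index_in_range, of y] unfolding easy_right_def easy_left_def by fastforce
qed

text \<open>By \<open>rho_m_facts\<close> a mesh this fine makes the sublevel set longer than the 13
  blocks of \<open>gap_fine\<close>, so one gap is at most \<rho>; and 1/13 <= 6/25 puts \<rho>
  below the bound for an easy gap.\<close>

lemma easy_fine:
  assumes \<epsilon>: "\<epsilon> > 0" and j: "13 * mesh j * (rho_m \<epsilon> f)\<^sup>2 < \<epsilon>\<^sup>2" and i: "in_range j i"
  shows "easy_right \<epsilon> f j i \<or> easy_left \<epsilon> f j i"
proof -
  interpret convex_block f j "min_block f j" by (rule convex_block_min_block)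
  let ?\<rho> = "rho_m \<epsilon> f"
  have \<rho>: "?\<rho> > 0" by (rule rho_m_facts(2)[OF \<epsilon>])
  have "13 * m * ?\<rho>\<^sup>2 < ?\<rho>\<^sup>2 * measure lborel {t\<in>{0..1}. f t < M + ?\<rho>}"
    using j rho_m_facts(1)[OF \<epsilon>] by linarith
  then have "13 * m < measure lborel {t\<in>{0..1}. f t < M + ?\<rho>}" using \<rho> by (simp add: ac_simps)
  note g = gap_fine[OF i less_imp_le[OF \<rho>] this]
  have "?\<rho> \<le> sqrt 2 * noise_sd \<epsilon> j / 5"
  proof (rule power2_le_imp_le)
    have "(sqrt 2 * noise_sd \<epsilon> j / 5)\<^sup>2 = 6 * \<epsilon>\<^sup>2 / (25 * m)"
      by (simp add: noise_sd_def power_divide power_mult_distrib)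
    moreover have "?\<rho>\<^sup>2 \<le> \<epsilon>\<^sup>2 / (13 * m)" using j by (simp add: pos_le_divide_eq ac_simps less_imp_le)
    moreover have "\<epsilon>\<^sup>2 / (13 * m) \<le> 6 * \<epsilon>\<^sup>2 / (25 * m)"
      by (simp add: field_simps)
    ultimately show "?\<rho>\<^sup>2 \<le> (sqrt 2 * noise_sd \<epsilon> j / 5)\<^sup>2" by linarith
    show "0 \<le> sqrt 2 * noise_sd \<epsilon> j / 5" using noise_sd_pos[OF \<epsilon>, of j] by simp
  qed
  with g show ?thesis unfolding easy_right_def easy_left_def by auto
qed

end

section \<open>Dependence on the increments of one level\<close>

lemma block_incr_sum:
  assumes "j \<le> n"
  shows "block_incr y j i = (\<Sum>b\<in>{(i - 1) * 2 ^ (n - j) + 1 .. i * 2 ^ (n - j)}. block_incr y n b)"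
proof -
  have tele: "(\<Sum>b\<in>{a + 1 .. a + int d}. block_incr y n b) = y (of_int (a + int d) * mesh n) - y (of_int a * mesh n)" for a d
  proof (induction d)
    case (Suc d)
    have "{a + 1 .. a + int (Suc d)} = insert (a + int (Suc d)) {a + 1 .. a + int d}" by auto
    then show ?case using Suc by (simp add: block_incr_def algebra_simps)
  qed simp
  have "(2 :: real) ^ n = 2 ^ (n - j) * 2 ^ j" using assms by (simp flip: power_add)
  then have m: "of_int (2 ^ (n - j)) * mesh n = mesh j" by (simp add: mesh_def)
  have e: "i * 2 ^ (n - j) = (i - 1) * 2 ^ (n - j) + int (2 ^ (n - j))" by (simp add: algebra_simps)
  have x: "of_int (c * 2 ^ (n - j)) * mesh n = of_int c * mesh j" for c
    using m by (simp add: mult.assoc)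
  show ?thesis
    unfolding e tele unfolding e[symmetric] x by (simp add: block_incr_def)
qed

text \<open>A step path with prescribed increments over the blocks of level n. It turns all that the
  procedure does up to level n into a function of a finite vector, to which independence and product
  measurability apply.\<close>

definition rebuild :: "nat \<Rightarrow> (int \<Rightarrow> real) \<Rightarrow> real \<Rightarrow> real" where
  "rebuild n v t = (\<Sum>b\<in>{1..\<lfloor>t * 2 ^ n\<rfloor>} \<inter> {1..2 ^ n}. v b)"

lemma block_incr_rebuild: "b \<in> {1..2 ^ n} \<Longrightarrow> block_incr (rebuild n v) n b = v b"
proof -
  assume b: "b \<in> {1..2 ^ n}"
  have x: "of_int c * mesh n * 2 ^ n = of_int c" for c by (simp add: mesh_def)
  have "{1..b} \<inter> {1..2 ^ n} = insert b ({1..b - 1} \<inter> {1..2 ^ n})" using b by auto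
  then show ?thesis by (simp add: block_incr_def rebuild_def x del: of_int_diff)
qed

lemma block_incr_rebuild_eq:
  assumes v: "\<And>b. b \<in> {1..2 ^ n} \<Longrightarrow> v b = block_incr w n b" and "j \<le> n" "in_range j i"
  shows "block_incr (rebuild n v) j i = block_incr w j i"
  unfolding block_incr_sum[OF assms(2)]
proof (rule sum.cong[OF refl])
  fix b assume b: "b \<in> {(i - 1) * 2 ^ (n - j) + 1 .. i * 2 ^ (n - j)}"
  have "i * 2 ^ (n - j) \<le> 2 ^ j * 2 ^ (n - j)" using assms(3) by (intro mult_right_mono) (auto simp: in_range_def)
  also have "\<dots> = (2 :: int) ^ n" using assms(2) by (simp flip: power_add)
  finally have "b \<le> 2 ^ n" using b by auto
  moreover have "0 \<le> (i - 1) * 2 ^ (n - j)" using assms(3) by (auto simp: in_range_def)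
  then have "1 \<le> b" using b by auto
  ultimately show "block_incr (rebuild n v) n b = block_incr w n b"
    using v by (simp add: block_incr_rebuild)
qed

lemma loc_index_cong:
  assumes "\<And>j i. j \<le> n \<Longrightarrow> in_range j i \<Longrightarrow> block_incr y j i = block_incr y' j i" and "j \<le> n"
  shows "loc_index y j = loc_index y' j"
  using assms(2)
proof (induction j)
  case (Suc j)
  have "block_incr_ext y (Suc j) = block_incr_ext y' (Suc j)"
    using assms(1)[OF Suc.prems] by (auto simp: block_incr_ext_def in_range_def fun_eq_iff)
  with Suc show ?case unfolding loc_index_Suc_argmin by simp
qed simp

lemma block_incr_plus: "block_incr (\<lambda>t. g t + w t) j i = block_incr g j i + block_incr w j i"
  by (simp add: block_incr_def)

section \<open>Measurability\<close>

lemma measurable_block_incr: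
  assumes "\<And>t. (\<lambda>s. y s t) \<in> borel_measurable S"
  shows "(\<lambda>s. block_incr (y s) j i) \<in> borel_measurable S"
  unfolding block_incr_def using assms by (intro borel_measurable_diff)

lemma measurable_block_incr_at:
  assumes y: "\<And>t. (\<lambda>s. y s t) \<in> borel_measurable S" and K: "K \<in> measurable S (count_space UNIV)"
  shows "(\<lambda>s. block_incr (y s) j (K s)) \<in> borel_measurable S"
  by (rule measurable_compose_countable[OF measurable_block_incr[OF y] K])

lemma measurable_argmin:
  fixes X :: "int \<Rightarrow> 's \<Rightarrow> ereal"
  assumes I: "finite I" and X: "\<And>i. i \<in> I \<Longrightarrow> X i \<in> borel_measurable S"
  shows "(\<lambda>s. Min (argmin_set I (\<lambda>i. X i s))) \<in> measurable S (count_space UNIV)"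
proof -
  let ?A = "\<lambda>s. argmin_set I (\<lambda>i. X i s)"
  have "?A \<in> measurable S (count_space (Pow I))"
  proof (subst measurable_count_space_eq2)
    show "finite (Pow I)" using I by simp
    show "?A \<in> space S \<rightarrow> Pow I \<and> (\<forall>B\<in>Pow I. ?A -` {B} \<inter> space S \<in> sets S)"
    proof (intro conjI ballI)
      show "?A \<in> space S \<rightarrow> Pow I" by (auto simp: argmin_set_def)
      fix B assume "B \<in> Pow I"
      have le: "{s\<in>space S. X i s \<le> X k s} \<in> sets S" if "i \<in> I" "k \<in> I" for i k
        using X that by measurable
      have "?A -` {B} \<inter> space S = {s\<in>space S. \<forall>i\<in>I. (i \<in> B \<longleftrightarrow> (\<forall>k\<in>I. X i s \<le> X k s))}"
        using \<open>B \<in> Pow I\<close> by (auto simp: argmin_set_def)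
      also have "\<dots> \<in> sets S"
      proof (rule sets.sets_Collect_finite_All[OF _ I])
        fix i assume i: "i \<in> I"
        have "{s\<in>space S. \<forall>k\<in>I. X i s \<le> X k s} \<in> sets S"
          by (rule sets.sets_Collect_finite_All[OF le[OF i] I])
        then show "{s\<in>space S. i \<in> B \<longleftrightarrow> (\<forall>k\<in>I. X i s \<le> X k s)} \<in> sets S"
          by (cases "i \<in> B") (simp_all only: simp_thms sets.sets_Collect_neg)
      qed
      finally show "?A -` {B} \<inter> space S \<in> sets S" .
    qed
  qed
  then show ?thesis by (rule measurable_compose) simp
qed

lemma measurable_loc_index:
  assumes y: "\<And>t. (\<lambda>s. y s t) \<in> borel_measurable S"
  shows "(\<lambda>s. loc_index (y s) j) \<in> measurable S (count_space UNIV)"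
proof (induction j)
  case (Suc j)
  have [measurable]: "(\<lambda>s. block_incr_ext (y s) (Suc j) i) \<in> borel_measurable S" for i
    unfolding block_incr_ext_def using measurable_block_incr[OF y]
    by (cases "1 \<le> i \<and> i \<le> 2 ^ Suc j") (auto simp del: power_Suc)
  have "(\<lambda>s. Min (argmin_set {2 * l - 2 .. 2 * l + 1} (\<lambda>i. block_incr_ext (y s) (Suc j) i))) \<in> measurable S (count_space UNIV)" for l
    by (rule measurable_argmin) auto
  from measurable_compose_countable[OF this Suc]
  show ?case unfolding loc_index_Suc_argmin .
qed simp

lemma measurable_rebuild:
  assumes "v \<in> measurable S (PiM {1..2 ^ n} (\<lambda>_. borel))"
  shows "(\<lambda>s. rebuild n (v s) t) \<in> borel_measurable S"
  unfolding rebuild_def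
  by (intro borel_measurable_sum measurable_compose[OF assms measurable_component_singleton]) auto

section \<open>Three independent noise processes\<close>

text \<open>Processes 0, 1 and 2 carry the noise for localization, stopping and estimation; a pair
  (b, c) stands for block b of process c.\<close>

locale split_noise = prob_space P for P :: "'a measure" +
  fixes \<epsilon> :: real and w :: "nat \<Rightarrow> real \<Rightarrow> 'a \<Rightarrow> real"
  assumes \<epsilon>: "\<epsilon> > 0"
    and ind: "\<And>n. indep_vars (\<lambda>_. borel) (\<lambda>p \<omega>. block_incr (\<lambda>t. w (snd p) t \<omega>) n (fst p)) ({1..2 ^ n} \<times> {0, 1, 2})"
    and law: "\<And>c n b. c \<in> {0, 1, 2} \<Longrightarrow> b \<in> {1..2 ^ n} \<Longrightarrow>
      distributed P lborel (\<lambda>\<omega>. block_incr (\<lambda>t. w c t \<omega>) n b) (normal_density 0 (sqrt (3 * mesh n) * \<epsilon>))"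
begin

abbreviation "traj c \<omega> \<equiv> (\<lambda>t. w c t \<omega>)"
abbreviation "\<tau> \<equiv> noise_sd \<epsilon>"
abbreviation "E n \<equiv> PiM {1..2 ^ n :: int} (\<lambda>_. borel :: real measure)"

definition V :: "nat \<Rightarrow> nat \<Rightarrow> 'a \<Rightarrow> int \<Rightarrow> real" where
  "V c n \<omega> = (\<lambda>b\<in>{1..2 ^ n}. block_incr (traj c \<omega>) n b)"

lemma \<tau>: "\<tau> n > 0" by (rule noise_sd_pos[OF \<epsilon>])

lemma V_ind: "indep_vars (\<lambda>_. E n) (\<lambda>c. V c n) {0, 1, 2}"
  using indep_vars_group_snd[of "\<lambda>_. borel", OF ind[of n]] by (simp add: V_def[abs_def])

lemma V_meas: "c \<in> {0, 1, 2} \<Longrightarrow> V c n \<in> measurable P (E n)"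
  using V_ind[of n] by (auto simp: indep_vars_def2)

lemma ind01: "indep_var (E n) (V 0 n) (E n) (V 1 n)"
  by (rule indep_var_of_indep_vars[OF V_ind]) auto

lemma ind012: "indep_var (PiM {0, 1} (\<lambda>_. E n)) (\<lambda>\<omega>. \<lambda>c\<in>{0, 1}. V c n \<omega>)
    (PiM {2} (\<lambda>_. E n)) (\<lambda>\<omega>. \<lambda>c\<in>{2}. V c n \<omega>)"
  by (rule indep_var_restrict[OF V_ind]) auto

lemma V_block:
  assumes "j \<le> n" "in_range j i"
  shows "block_incr (rebuild n (V c n \<omega>)) j i = block_incr (traj c \<omega>) j i"
  by (rule block_incr_rebuild_eq[OF _ assms]) (simp add: V_def)

lemma V_noise_avg:
  assumes "j \<le> n" "in_range j i"
  shows "noise_avg (rebuild n (V c n \<omega>)) j i = noise_avg (traj c \<omega>) j i"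
  by (simp add: noise_avg_def V_block[OF assms])

lemma block_law:
  assumes "c \<in> {0, 1, 2}" "in_range n b"
  shows "distributed P lborel (\<lambda>\<omega>. block_incr (traj c \<omega>) n b) (normal_density 0 (sqrt (3 * mesh n) * \<epsilon>))"
  using law assms by (simp add: in_range_def)

lemma avg_law:
  assumes "c \<in> {0, 1, 2}" "in_range n b"
  shows "distributed P lborel (\<lambda>\<omega>. noise_avg (traj c \<omega>) n b) (normal_density 0 (\<tau> n))"
proof -
  have "distributed P lborel (\<lambda>\<omega>. 0 + 1 / mesh n * block_incr (traj c \<omega>) n b)
      (normal_density (0 + 1 / mesh n * 0) (\<bar>1 / mesh n\<bar> * (sqrt (3 * mesh n) * \<epsilon>)))"
    using \<epsilon> by (intro normal_density_affine[OF block_law[OF assms]]) auto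
  moreover have "\<bar>1 / mesh n\<bar> * (sqrt (3 * mesh n) * \<epsilon>) = \<tau> n"
    using mesh_pos[of n] by (simp add: noise_sd_def real_sqrt_mult real_div_sqrt field_simps)
  ultimately show ?thesis by (simp add: noise_avg_def)
qed

lemma avg_indep:
  assumes "c \<in> {0, 1, 2}" "in_range n b" "in_range n b'" "b \<noteq> b'"
  shows "indep_var borel (\<lambda>\<omega>. \<alpha> * noise_avg (traj c \<omega>) n b) borel (\<lambda>\<omega>. \<beta> * noise_avg (traj c \<omega>) n b')"
proof -
  have "indep_var borel (\<lambda>\<omega>. block_incr (traj c \<omega>) n b) borel (\<lambda>\<omega>. block_incr (traj c \<omega>) n b')"
    using indep_var_of_indep_vars[OF ind[of n], of "(b, c)" "(b', c)"] assms by (auto simp: in_range_def)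
  from indep_var_compose[OF this, of "\<lambda>x. \<alpha> * (x / mesh n)" borel "\<lambda>x. \<beta> * (x / mesh n)" borel]
  show ?thesis by (simp add: comp_def noise_avg_def)
qed

lemma avg_measurable: "c \<in> {0, 1, 2} \<Longrightarrow> in_range n b \<Longrightarrow> (\<lambda>\<omega>. noise_avg (traj c \<omega>) n b) \<in> borel_measurable P"
  using distributed_measurable[OF avg_law] by simp

lemma avg_comb_second_moment:
  assumes "c \<in> {0, 1, 2}" "in_range n b" "in_range n b'" "b \<noteq> b'" "\<alpha> > 0" "\<beta> > 0"
  shows "(\<integral>\<^sup>+\<omega>. ennreal ((max 0 (\<alpha> * noise_avg (traj c \<omega>) n b - \<beta> * noise_avg (traj c \<omega>) n b'))\<^sup>2) \<partial>P)
    = ennreal ((\<alpha>\<^sup>2 + \<beta>\<^sup>2) * (\<tau> n)\<^sup>2 / 2)"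
proof -
  have sc: "distributed P lborel (\<lambda>\<omega>. a * noise_avg (traj c \<omega>) n x) (normal_density 0 (a * \<tau> n))"
    if "a > 0" "in_range n x" for a x
    using normal_density_affine[OF avg_law[OF assms(1) that(2)] \<tau>, of a 0] that by simp
  have "distributed P lborel (\<lambda>\<omega>. \<alpha> * noise_avg (traj c \<omega>) n b - \<beta> * noise_avg (traj c \<omega>) n b')
      (normal_density (0 - 0) (sqrt ((\<alpha> * \<tau> n)\<^sup>2 + (\<beta> * \<tau> n)\<^sup>2)))"
    using assms \<tau> by (intro diff_indep_normal avg_indep sc) auto
  moreover have "(\<alpha> * \<tau> n)\<^sup>2 + (\<beta> * \<tau> n)\<^sup>2 > 0" using assms \<tau>[of n] by (intro add_pos_pos) auto
  ultimately have "(\<integral>\<^sup>+\<omega>. ennreal ((max 0 (\<alpha> * noise_avg (traj c \<omega>) n b - \<beta> * noise_avg (traj c \<omega>) n b'))\<^sup>2) \<partial>P)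
    = ennreal ((sqrt ((\<alpha> * \<tau> n)\<^sup>2 + (\<beta> * \<tau> n)\<^sup>2))\<^sup>2 / 2)"
    by (intro normal_second_moment_pos_part) auto
  then show ?thesis by (simp add: power_mult_distrib distrib_right)
qed

lemma avg_neg_second_moment:
  assumes "c \<in> {0, 1, 2}" "in_range n b"
  shows "(\<integral>\<^sup>+\<omega>. ennreal ((max 0 (- noise_avg (traj c \<omega>) n b))\<^sup>2) \<partial>P) = ennreal ((\<tau> n)\<^sup>2 / 2)"
  by (rule normal_second_moment_pos_part[OF normal_neg[OF avg_law[OF assms] \<tau>] \<tau>])

lemma entry_excess_measurable: "(\<lambda>\<omega>. entry_excess f (traj 0 \<omega>) n) \<in> borel_measurable P"
proof -
  define g where "g p \<omega> = (if in_range n (min_block f n + fst p) \<and> in_range n (min_block f n + fst p * snd p)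
     then (max 0 (3 * noise_avg (traj 0 \<omega>) n (min_block f n + fst p)
       - 2 * noise_avg (traj 0 \<omega>) n (min_block f n + fst p * snd p)))\<^sup>2 else 0)" for p :: "int \<times> int" and \<omega>
  have [measurable]: "g p \<in> borel_measurable P" for p
    unfolding g_def
    by (cases "in_range n (min_block f n + fst p) \<and> in_range n (min_block f n + fst p * snd p)")
       (auto intro!: borel_measurable_power borel_measurable_max borel_measurable_diff borel_measurable_times avg_measurable)
  show ?thesis unfolding entry_excess_def g_def[symmetric] by measurable
qed

text \<open>There are at most six admissible pairs, each contributing (3^2 + 2^2) / 2 = 13/2
  variances.\<close>

lemma entry_excess_second_moment:
  "(\<integral>\<^sup>+\<omega>. ennreal ((entry_excess f (traj 0 \<omega>) n)\<^sup>2) \<partial>P) \<le> ennreal (39 * (\<tau> n)\<^sup>2)"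
proof -
  let ?k = "min_block f n"
  let ?g = "\<lambda>p \<omega>. if in_range n (?k + fst p) \<and> in_range n (?k + fst p * snd p)
     then (max 0 (3 * noise_avg (traj 0 \<omega>) n (?k + fst p) - 2 * noise_avg (traj 0 \<omega>) n (?k + fst p * snd p)))\<^sup>2
     else 0"
  let ?S = "{1, - 1} \<times> {2, 3, 4} :: (int \<times> int) set"
  have g0: "0 \<le> ?g p \<omega>" for p \<omega> by simp
  have gm: "?g p \<in> borel_measurable P" for p
    by (cases "in_range n (?k + fst p) \<and> in_range n (?k + fst p * snd p)")
       (auto intro!: borel_measurable_power borel_measurable_max borel_measurable_diff borel_measurable_times avg_measurable)
  have b: "(\<integral>\<^sup>+\<omega>. ennreal (?g p \<omega>) \<partial>P) \<le> ennreal (13 / 2 * (\<tau> n)\<^sup>2)" if "p \<in> ?S" for p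
  proof (cases "in_range n (?k + fst p) \<and> in_range n (?k + fst p * snd p)")
    case True
    have "?k + fst p \<noteq> ?k + fst p * snd p" using that by auto
    then show ?thesis
      using True avg_comb_second_moment[of 0 n "?k + fst p" "?k + fst p * snd p" 3 2] by simp
  next
    case False
    then show ?thesis by (simp only: if_False ennreal_0 nn_integral_const mult_zero_left zero_le)
  qed
  have "(\<integral>\<^sup>+\<omega>. ennreal ((entry_excess f (traj 0 \<omega>) n)\<^sup>2) \<partial>P) = (\<integral>\<^sup>+\<omega>. (\<Sum>p\<in>?S. ennreal (?g p \<omega>)) \<partial>P)"
    unfolding entry_excess_def
    by (intro nn_integral_cong) (subst real_sqrt_pow2, auto intro!: sum_nonneg simp: sum_ennreal)
  also have "\<dots> = (\<Sum>p\<in>?S. \<integral>\<^sup>+\<omega>. ennreal (?g p \<omega>) \<partial>P)"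
    by (rule nn_integral_sum) (use gm in measurable)
  also have "\<dots> \<le> (\<Sum>p\<in>?S. ennreal (13 / 2 * (\<tau> n)\<^sup>2))" by (intro sum_mono b)
  also have "\<dots> = ennreal (39 * (\<tau> n)\<^sup>2)"
  proof -
    have "(\<Sum>p\<in>?S. ennreal (13 / 2 * (\<tau> n)\<^sup>2)) = ennreal (\<Sum>p\<in>?S. 13 / 2 * (\<tau> n)\<^sup>2)"
      by (rule sum_ennreal) simp
    also have "(\<Sum>p\<in>?S. 13 / 2 * (\<tau> n)\<^sup>2) = 39 * (\<tau> n)\<^sup>2"
      by (simp add: card_cartesian_product)
    finally show ?thesis .
  qed
  finally show ?thesis .
qed

subsection \<open>Stopping probabilities along a fixed path\<close>

text \<open>The level n blocks that make up the two monitored blocks of level j: i + 5 and i + 6 on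
  the right, i - 6 and i - 5 on the left.\<close>

definition region :: "nat \<Rightarrow> nat \<Rightarrow> int \<Rightarrow> bool \<Rightarrow> int set" where
  "region n j i right = (if right then {(i + 4) * 2 ^ (n - j) + 1 .. (i + 6) * 2 ^ (n - j)}
     else {(i - 7) * 2 ^ (n - j) + 1 .. (i - 5) * 2 ^ (n - j)})"

text \<open>Let h j be the number of level n blocks in a block of level j. Along an admissible path
  the intervals from (\<pi> j - 2) h j to (\<pi> j + 1) h j are nested. A region of level j begins 3
  h j outside its interval, while one of a later level j' ends at most 5 h j' <= (5/2) h j outside
  its own.\<close>

lemma region_disjoint:
  fixes \<pi> :: "nat \<Rightarrow> int"
  assumes step: "\<And>j. j < n \<Longrightarrow> 2 * \<pi> j - 2 \<le> \<pi> (Suc j) \<and> \<pi> (Suc j) \<le> 2 * \<pi> j + 1"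
    and jj: "j < j'" "j' \<le> n"
  shows "region n j (\<pi> j) s \<inter> region n j' (\<pi> j') s' = {}"
proof -
  define h where "h j = (2 :: int) ^ (n - j)" for j
  have hS: "h j = 2 * h (Suc j)" if "j < n" for j
  proof -
    have "n - j = Suc (n - Suc j)" using that by simp
    then show ?thesis by (simp add: h_def)
  qed
  have h1: "h j \<ge> 1" for j by (simp add: h_def)
  have up: "(\<pi> j' + 1) * h j' \<le> (\<pi> j + 1) * h j \<and> (\<pi> j - 2) * h j \<le> (\<pi> j' - 2) * h j' \<and> 2 * h j' \<le> h j"
    if "Suc j \<le> j'" "j' \<le> n" for j'
    using that
  proof (induction j' rule: dec_induct)
    case base
    then have j: "j < n" by simp
    have "(\<pi> (Suc j) + 1) * h (Suc j) \<le> (2 * \<pi> j + 2) * h (Suc j)"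
      using step[OF j] h1[of "Suc j"] by (intro mult_right_mono) auto
    moreover have "(2 * \<pi> j - 4) * h (Suc j) \<le> (\<pi> (Suc j) - 2) * h (Suc j)"
      using step[OF j] h1[of "Suc j"] by (intro mult_right_mono) auto
    ultimately show ?case using hS[OF j] by (simp add: algebra_simps)
  next
    case (step l)
    then have l: "l < n" by simp
    have "(\<pi> (Suc l) + 1) * h (Suc l) \<le> (2 * \<pi> l + 2) * h (Suc l)"
      using assms(1)[OF l] h1[of "Suc l"] by (intro mult_right_mono) auto
    moreover have "(2 * \<pi> l - 4) * h (Suc l) \<le> (\<pi> (Suc l) - 2) * h (Suc l)"
      using assms(1)[OF l] h1[of "Suc l"] by (intro mult_right_mono) auto
    moreover have "(2 * \<pi> l + 2) * h (Suc l) = (\<pi> l + 1) * h l" "(2 * \<pi> l - 4) * h (Suc l) = (\<pi> l - 2) * h l"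
      using hS[OF l] by (simp_all add: algebra_simps)
    moreover have "(\<pi> l + 1) * h l \<le> (\<pi> j + 1) * h j" "(\<pi> j - 2) * h j \<le> (\<pi> l - 2) * h l" "2 * h l \<le> h j"
      using step by auto
    ultimately show ?case using hS[OF l] h1[of "Suc l"] by linarith
  qed
  from up[of j'] jj have u: "(\<pi> j' + 1) * h j' \<le> (\<pi> j + 1) * h j" "(\<pi> j - 2) * h j \<le> (\<pi> j' - 2) * h j'" "2 * h j' \<le> h j"
    by auto
  have e: "(\<pi> j + 4) * h j = (\<pi> j + 1) * h j + 3 * h j" "(\<pi> j + 6) * h j = (\<pi> j + 1) * h j + 5 * h j"
    "(\<pi> j - 7) * h j = (\<pi> j - 2) * h j - 5 * h j" "(\<pi> j - 5) * h j = (\<pi> j - 2) * h j - 3 * h j"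
    "(\<pi> j + 1) * h j = (\<pi> j - 2) * h j + 3 * h j" for j
    by (simp_all add: algebra_simps)
  show ?thesis
    unfolding region_def h_def[symmetric] e(1-4)
    using u e(5)[of j] e(5)[of j'] h1[of j] h1[of j'] by (auto simp: disjoint_iff split: if_splits)
qed

lemma easy_noise_tail:
  assumes i: "in_range j i" and easy: "easy_right \<epsilon> f j i \<or> easy_left \<epsilon> f j i"
  shows "prob {\<omega>\<in>space P. easy_noise \<epsilon> f (traj 1 \<omega>) j i > 9/5 * sigma_level \<epsilon> j} \<le> 1/16"
    and "(\<lambda>\<omega>. easy_noise \<epsilon> f (traj 1 \<omega>) j i) \<in> borel_measurable P"
proof -
  obtain a b where ab: "in_range j a" "in_range j b" "a \<noteq> b"
    "\<And>\<omega>. easy_noise \<epsilon> f (traj 1 \<omega>) j i = block_incr (traj 1 \<omega>) j a - block_incr (traj 1 \<omega>) j b"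
  proof (cases "easy_right \<epsilon> f j i")
    case True
    then show ?thesis using that[of "i + 6" "i + 5"] i by (auto simp: easy_right_def in_range_def easy_noise_def)
  next
    case False
    then show ?thesis using that[of "i - 6" "i - 5"] i easy by (auto simp: easy_left_def in_range_def easy_noise_def)
  qed
  have ind': "indep_var borel (\<lambda>\<omega>. block_incr (traj 1 \<omega>) j a) borel (\<lambda>\<omega>. block_incr (traj 1 \<omega>) j b)"
    using indep_var_of_indep_vars[OF ind[of j], of "(a, 1)" "(b, 1)"] ab by (auto simp: in_range_def)
  let ?s = "sqrt (3 * mesh j) * \<epsilon>"
  have s: "?s > 0" using \<epsilon> by simp
  have "distributed P lborel (\<lambda>\<omega>. block_incr (traj 1 \<omega>) j a - block_incr (traj 1 \<omega>) j b)
      (normal_density (0 - 0) (sqrt (?s\<^sup>2 + ?s\<^sup>2)))"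
    using ab s by (intro diff_indep_normal ind' block_law) auto
  moreover have "sqrt (?s\<^sup>2 + ?s\<^sup>2) = sigma_level \<epsilon> j"
    by (simp add: sigma_level_def power_mult_distrib)
  ultimately have D: "distributed P lborel (\<lambda>\<omega>. easy_noise \<epsilon> f (traj 1 \<omega>) j i) (normal_density 0 (sigma_level \<epsilon> j))"
    by (simp only: ab(4) diff_0_right)
  have "prob {\<omega>\<in>space P. easy_noise \<epsilon> f (traj 1 \<omega>) j i > 9/5 * sigma_level \<epsilon> j} \<le> std_normal_density (9/5) / (9/5)"
    by (rule normal_upper_tail[OF D sigma_level_pos[OF \<epsilon>]]) simp
  then show "prob {\<omega>\<in>space P. easy_noise \<epsilon> f (traj 1 \<omega>) j i > 9/5 * sigma_level \<epsilon> j} \<le> 1/16"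
    using std_normal_tail_bound by linarith
  show "(\<lambda>\<omega>. easy_noise \<epsilon> f (traj 1 \<omega>) j i) \<in> borel_measurable P"
    using distributed_measurable[OF D] by simp
qed

lemma easy_noise_path_tail:
  fixes \<pi> :: "nat \<Rightarrow> int"
  assumes \<pi>: "\<And>j. in_range j (\<pi> j)"
    and step: "\<And>j. 2 * \<pi> j - 2 \<le> \<pi> (Suc j) \<and> \<pi> (Suc j) \<le> 2 * \<pi> j + 1"
    and H: "H \<subseteq> {..<n}" and easy: "\<And>j. j \<in> H \<Longrightarrow> easy_right \<epsilon> f j (\<pi> j) \<or> easy_left \<epsilon> f j (\<pi> j)"
  shows "prob {\<omega>\<in>space P. \<forall>j\<in>H. easy_noise \<epsilon> f (traj 1 \<omega>) j (\<pi> j) > 9/5 * sigma_level \<epsilon> j} \<le> (1/16) ^ card H"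
proof (cases "H = {}")
  case True
  then show ?thesis by simp
next
  case False
  have finH: "finite H" using H finite_subset by auto
  let ?K = "\<lambda>j. region n j (\<pi> j) (easy_right \<epsilon> f j (\<pi> j))"
  define h where "h j = (2 :: int) ^ (n - j)" for j
  have h1: "h j \<ge> 1" for j by (simp add: h_def)
  have hj: "2 ^ j * h j = 2 ^ n" if "j \<le> n" for j
    using that by (simp add: h_def flip: power_add)
  have Ksub: "?K j \<subseteq> {1..2 ^ n}" if "j \<in> H" for j
  proof -
    have j: "j \<le> n" using H that by auto
    show ?thesis
    proof (cases "easy_right \<epsilon> f j (\<pi> j)")
      case True
      then have "(\<pi> j + 6) * h j \<le> 2 ^ j * h j" using h1[of j] by (intro mult_right_mono) (auto simp: easy_right_def)
      moreover have "0 \<le> (\<pi> j + 4) * h j" using \<pi>[of j] h1[of j] by (auto simp: in_range_def)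
      ultimately show ?thesis using True hj[OF j] by (auto simp: region_def h_def[symmetric])
    next
      case False
      then have "1 \<le> \<pi> j - 6" using easy[OF that] by (auto simp: easy_left_def)
      then have "0 \<le> (\<pi> j - 7) * h j" using h1[of j] by auto
      moreover have "(\<pi> j - 5) * h j \<le> 2 ^ j * h j" using \<pi>[of j] h1[of j] by (intro mult_right_mono) (auto simp: in_range_def)
      ultimately show ?thesis using False hj[OF j] by (auto simp: region_def h_def[symmetric])
    qed
  qed
  have disj: "disjoint_family_on ?K H"
    unfolding disjoint_family_on_def
  proof (intro ballI impI)
    fix j j' assume "j \<in> H" "j' \<in> H" "j \<noteq> j'"
    then have jn: "j \<le> n" "j' \<le> n" and "j < j' \<or> j' < j" using H by auto
    from this(3) show "?K j \<inter> ?K j' = {}"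
    proof
      assume "j < j'" then show ?thesis using step jn(2) by (intro region_disjoint) auto
    next
      assume "j' < j" then show ?thesis using step jn(1) by (subst Int_commute, intro region_disjoint) auto
    qed
  qed
  have ind1: "indep_vars (\<lambda>_. borel) (\<lambda>b \<omega>. block_incr (traj 1 \<omega>) n b) {1..2 ^ n}"
  proof -
    have "indep_vars (\<lambda>_. borel) (\<lambda>p \<omega>. block_incr (\<lambda>t. w (snd p) t \<omega>) n (fst p)) ((\<lambda>b. (b, 1)) ` {1..2 ^ n})"
      by (rule indep_vars_subset[OF ind]) auto
    from indep_vars_reindex[OF this] show ?thesis by (simp add: inj_on_def)
  qed
  have Kind: "indep_vars (\<lambda>j. PiM (?K j) (\<lambda>_. borel)) (\<lambda>j \<omega>. restrict (\<lambda>b. block_incr (traj 1 \<omega>) n b) (?K j)) H"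
    by (rule indep_vars_restrict[OF ind1 Ksub disj])
  define sub where "sub j i = {(i - 1) * 2 ^ (n - j) + 1 .. i * 2 ^ (n - j)}" for j and i :: int
  \<comment> \<open>The gap is written as a function of the restricted vector: block increments of
    level j become sums over level n blocks inside the region.\<close>
  define g where "g j v = (if easy_right \<epsilon> f j (\<pi> j)
      then (\<Sum>b\<in>sub j (\<pi> j + 6) \<inter> ?K j. v b) - (\<Sum>b\<in>sub j (\<pi> j + 5) \<inter> ?K j. v b)
      else (\<Sum>b\<in>sub j (\<pi> j - 6) \<inter> ?K j. v b) - (\<Sum>b\<in>sub j (\<pi> j - 5) \<inter> ?K j. v b))" for j and v :: "int \<Rightarrow> real"
  have gm: "g j \<in> borel_measurable (PiM (?K j) (\<lambda>_. borel))" for j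
    unfolding g_def by (cases "easy_right \<epsilon> f j (\<pi> j)") (auto intro!: borel_measurable_diff borel_measurable_sum measurable_component_singleton)
  have ge: "g j (restrict (\<lambda>b. block_incr (traj 1 \<omega>) n b) (?K j)) = easy_noise \<epsilon> f (traj 1 \<omega>) j (\<pi> j)" if "j \<in> H" for j \<omega>
  proof -
    have j: "j \<le> n" using H that by auto
    have hp: "h j > 0" by (simp add: h_def)
    have inc: "sub j (\<pi> j + 6) \<subseteq> region n j (\<pi> j) True" "sub j (\<pi> j + 5) \<subseteq> region n j (\<pi> j) True"
      "sub j (\<pi> j - 6) \<subseteq> region n j (\<pi> j) False" "sub j (\<pi> j - 5) \<subseteq> region n j (\<pi> j) False"
      unfolding sub_def region_def h_def[symmetric] using hp by (auto simp: algebra_simps)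
    have s: "(\<Sum>b\<in>sub j i \<inter> K. restrict (block_incr u n) K b) = block_incr u j i"
      if "sub j i \<subseteq> K" for i K u
      unfolding block_incr_sum[OF j, of u i] sub_def[symmetric]
      using that by (intro sum.cong) auto
    show ?thesis
      using inc by (cases "easy_right \<epsilon> f j (\<pi> j)") (simp_all only: g_def easy_noise_def s if_True if_False)
  qed
  have I: "indep_vars (\<lambda>_. borel) (\<lambda>j \<omega>. easy_noise \<epsilon> f (traj 1 \<omega>) j (\<pi> j)) H"
    by (rule indep_vars_cong[THEN iffD1, OF _ _ _ indep_vars_compose2[OF Kind gm]]) (auto simp: ge fun_eq_iff simp del: One_nat_def)
  let ?A = "\<lambda>j. {9/5 * sigma_level \<epsilon> j <..}"
  have "{\<omega>\<in>space P. \<forall>j\<in>H. easy_noise \<epsilon> f (traj 1 \<omega>) j (\<pi> j) > 9/5 * sigma_level \<epsilon> j} =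
      (\<Inter>j\<in>H. (\<lambda>\<omega>. easy_noise \<epsilon> f (traj 1 \<omega>) j (\<pi> j)) -` ?A j \<inter> space P)"
    using False by auto
  also have "prob \<dots> = (\<Prod>j\<in>H. prob ((\<lambda>\<omega>. easy_noise \<epsilon> f (traj 1 \<omega>) j (\<pi> j)) -` ?A j \<inter> space P))"
    by (rule indep_varsD_finite[OF I False finH]) auto
  also have "\<dots> \<le> (\<Prod>j\<in>H. 1/16)"
  proof (intro prod_mono conjI)
    fix j assume j: "j \<in> H"
    have "(\<lambda>\<omega>. easy_noise \<epsilon> f (traj 1 \<omega>) j (\<pi> j)) -` ?A j \<inter> space P =
        {\<omega>\<in>space P. easy_noise \<epsilon> f (traj 1 \<omega>) j (\<pi> j) > 9/5 * sigma_level \<epsilon> j}" by auto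
    then show "prob ((\<lambda>\<omega>. easy_noise \<epsilon> f (traj 1 \<omega>) j (\<pi> j)) -` ?A j \<inter> space P) \<le> 1/16"
      using easy_noise_tail(1)[OF \<pi> easy[OF j]] by simp
  qed simp
  finally show ?thesis by simp
qed

end

section \<open>Congruence and measurability of the stopping test, and sums of weights\<close>

lemma right_stop_cong:
  assumes l: "\<And>j i. j \<le> n \<Longrightarrow> in_range j i \<Longrightarrow> block_incr yl j i = block_incr yl' j i"
    and s: "\<And>j i. j \<le> n \<Longrightarrow> in_range j i \<Longrightarrow> block_incr ys j i = block_incr ys' j i" and j: "j \<le> n"
  shows "right_stop \<epsilon> yl ys j \<longleftrightarrow> right_stop \<epsilon> yl' ys' j" "left_stop \<epsilon> yl ys j \<longleftrightarrow> left_stop \<epsilon> yl' ys' j"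
  using loc_index_cong[of n yl yl', OF l j] loc_index_in_range[of j yl] s[OF j]
  by (auto simp: right_stop_def left_stop_def in_range_def simp del: loc_index.simps)

lemma measurable_right_stop:
  assumes yl: "\<And>t. (\<lambda>s. yl s t) \<in> borel_measurable S" and ys: "\<And>t. (\<lambda>s. ys s t) \<in> borel_measurable S"
  shows "{s\<in>space S. right_stop \<epsilon> (yl s) (ys s) j} \<in> sets S" "{s\<in>space S. left_stop \<epsilon> (yl s) (ys s) j} \<in> sets S"
proof -
  have l: "(\<lambda>s. loc_index (yl s) j) \<in> measurable S (count_space UNIV)"
    by (rule measurable_loc_index[OF yl])
  have b: "(\<lambda>s. block_incr (ys s) j (loc_index (yl s) j + c)) \<in> borel_measurable S" for c
    by (rule measurable_block_incr_at[OF ys measurable_compose[OF l]]) simp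
  have p: "{s\<in>space S. Q (loc_index (yl s) j)} \<in> sets S" for Q
    using measurable_compose[OF l, of Q "count_space UNIV"] by (simp add: pred_def)
  show "{s\<in>space S. right_stop \<epsilon> (yl s) (ys s) j} \<in> sets S"
    unfolding right_stop_def
    by (intro sets.sets_Collect_conj p[of "\<lambda>i. i + 6 \<le> 2 ^ j"] borel_measurable_le borel_measurable_diff b borel_measurable_const)
  show "{s\<in>space S. left_stop \<epsilon> (yl s) (ys s) j} \<in> sets S"
    unfolding left_stop_def
    by (intro sets.sets_Collect_conj p[of "\<lambda>i. 1 \<le> i - 6"] borel_measurable_le borel_measurable_diff
        b[of "- 6", simplified] b[of "- 5", simplified] borel_measurable_const)
qed

text \<open>Telescoping, by 1 / (d + 2)^2 <= 1 / (d + 1) - 1 / (d + 2).\<close>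

lemma sum_inverse_squares_le: "(\<Sum>d = 15..<15 + n. 256 / (real d + 2)\<^sup>2) \<le> 16 - 256 / (real n + 16)"
proof (induction n)
  case (Suc n)
  have a: "256 / (real n + 17)\<^sup>2 \<le> 256 / (real n + 16) - 256 / (real n + 17)"
  proof -
    have "256 / (real n + 16) - 256 / (real n + 17) = 256 / ((real n + 16) * (real n + 17))"
      by (simp add: divide_simps)
    moreover have "256 / (real n + 17)\<^sup>2 \<le> 256 / ((real n + 16) * (real n + 17))"
      unfolding power2_eq_square by (intro divide_left_mono mult_right_mono) auto
    ultimately show ?thesis by linarith
  qed
  have b: "(\<Sum>d = 15..<15 + Suc n. 256 / (real d + 2)\<^sup>2) =
      (\<Sum>d = 15..<15 + n. 256 / (real d + 2)\<^sup>2) + 256 / (real n + 17)\<^sup>2"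
  proof -
    have e: "{15..<15 + Suc n} = insert (15 + n) {15..<15 + n}" by auto
    show ?thesis unfolding e by (simp add: add.commute)
  qed
  have c: "real (Suc n) + 16 = real n + 17" by simp
  have "x \<le> p - q \<Longrightarrow> s \<le> 16 - p \<Longrightarrow> s + x \<le> 16 - q" for x p q s :: real by linarith
  from this[OF a Suc] show ?case unfolding b c .
qed simp

text \<open>A bound for the chance of still running at offset d, justified by
  \<open>easy_weight_far\<close>; 256 is the square of the 16 in
  \<open>offset_growth\<close>.\<close>

definition far_weight :: "int \<Rightarrow> real" where
  "far_weight d = min 1 (256 / (of_int \<bar>d\<bar> + 2)\<^sup>2)"

text \<open>The quotient is below 1 from d = 15 on: the 13 earlier terms count 1 each, and the tail
  is at most 16.\<close>

lemma sum_far_weight_nat: "(\<Sum>d\<in>{2..<2 + n}. far_weight (int d)) \<le> 29"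
proof -
  have "(\<Sum>d\<in>{2..<2 + n}. far_weight (int d)) \<le> (\<Sum>d\<in>{2..<15 + n}. far_weight (int d))"
    by (intro sum_mono2) (auto simp: far_weight_def)
  also have "{2..<15 + n} = {2..<15} \<union> {15..<15 + n}" by auto
  also have "(\<Sum>d\<in>{2..<15} \<union> {15..<15 + n}. far_weight (int d)) =
      (\<Sum>d\<in>{2..<15}. far_weight (int d)) + (\<Sum>d\<in>{15..<15 + n}. far_weight (int d))"
    by (rule sum.union_disjoint) auto
  also have "(\<Sum>d\<in>{2..<15::nat}. far_weight (int d)) \<le> (\<Sum>d\<in>{2..<15::nat}. 1)"
    by (intro sum_mono) (auto simp: far_weight_def)
  also have "(\<Sum>d\<in>{15..<15 + n}. far_weight (int d)) \<le> (\<Sum>d\<in>{15..<15 + n}. 256 / (real d + 2)\<^sup>2)"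
    by (intro sum_mono) (auto simp: far_weight_def)
  also have "\<dots> \<le> 16 - 256 / (real n + 16)" by (rule sum_inverse_squares_le)
  also have "\<dots> \<le> 16" by simp
  finally show ?thesis by simp
qed

lemma sum_far_weight: "(\<Sum>b\<in>{b\<in>{1..N}. 2 \<le> \<bar>b - k\<bar>}. far_weight (b - k)) \<le> 58"
proof -
  define n where "n = nat (\<bar>N\<bar> + \<bar>k\<bar>)"
  let ?R = "(\<lambda>d. k + int d) ` {2..<2 + n}" and ?L = "(\<lambda>d. k - int d) ` {2..<2 + n}"
  have sub: "{b\<in>{1..N}. 2 \<le> \<bar>b - k\<bar>} \<subseteq> ?R \<union> ?L"
  proof
    fix b assume b: "b \<in> {b\<in>{1..N}. 2 \<le> \<bar>b - k\<bar>}"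
    show "b \<in> ?R \<union> ?L"
    proof (cases "b \<ge> k")
      case True
      then have "b = k + int (nat (b - k))" "nat (b - k) \<in> {2..<2 + n}" using b by (auto simp: n_def)
      then show ?thesis by blast
    next
      case False
      then have "b = k - int (nat (k - b))" "nat (k - b) \<in> {2..<2 + n}" using b by (auto simp: n_def)
      then show ?thesis by blast
    qed
  qed
  have "(\<Sum>b\<in>{b\<in>{1..N}. 2 \<le> \<bar>b - k\<bar>}. far_weight (b - k)) \<le> (\<Sum>b\<in>?R \<union> ?L. far_weight (b - k))"
    by (rule sum_mono2[OF _ sub]) (auto simp: far_weight_def)
  also have "\<dots> \<le> (\<Sum>b\<in>?R. far_weight (b - k)) + (\<Sum>b\<in>?L. far_weight (b - k))"
    by (subst sum_Un) (auto simp: far_weight_def intro!: sum_nonneg)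
  also have "(\<Sum>b\<in>?R. far_weight (b - k)) = (\<Sum>d\<in>{2..<2 + n}. far_weight (int d))"
    by (subst sum.reindex) (auto simp: inj_on_def)
  also have "(\<Sum>b\<in>?L. far_weight (b - k)) = (\<Sum>d\<in>{2..<2 + n}. far_weight (int d))"
    by (subst sum.reindex) (auto simp: inj_on_def far_weight_def)
  finally show ?thesis using sum_far_weight_nat[of n] by linarith
qed

section \<open>The probability of still running\<close>

locale estimation = split_noise P \<epsilon> w + convex_min f
  for P :: "'a measure" and \<epsilon> :: real and w :: "nat \<Rightarrow> real \<Rightarrow> 'a \<Rightarrow> real" and f :: "real \<Rightarrow> real"
begin

declare One_nat_def [simp del]

abbreviation "obs c \<omega> \<equiv> (\<lambda>t. drift f t + w c t \<omega>)"
abbreviation "vobs n v \<equiv> (\<lambda>t. drift f t + rebuild n v t)"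
abbreviation "\<rho> \<equiv> rho_m \<epsilon> f"

definition no_stop :: "nat \<Rightarrow> (real \<Rightarrow> real) \<Rightarrow> (real \<Rightarrow> real) \<Rightarrow> bool" where
  "no_stop n yl ys \<longleftrightarrow> (\<forall>j<n. \<not> right_stop \<epsilon> yl ys j \<and> \<not> left_stop \<epsilon> yl ys j)"

lemma vobs_block: "j \<le> n \<Longrightarrow> in_range j i \<Longrightarrow> block_incr (vobs n (V c n \<omega>)) j i = block_incr (obs c \<omega>) j i"
  by (simp add: block_incr_plus V_block)

lemma vobs_loc: "j \<le> n \<Longrightarrow> loc_index (vobs n (V c n \<omega>)) j = loc_index (obs c \<omega>) j"
  by (rule loc_index_cong[OF vobs_block])

lemma vobs_offset: "j \<le> n \<Longrightarrow> offset f (vobs n (V c n \<omega>)) j = offset f (obs c \<omega>) j"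
  by (simp add: offset_def vobs_loc)

lemma vobs_stop:
  assumes "j \<le> n"
  shows "right_stop \<epsilon> (vobs n (V 0 n \<omega>)) (vobs n (V 1 n \<omega>)) j \<longleftrightarrow> right_stop \<epsilon> (obs 0 \<omega>) (obs 1 \<omega>) j"
    "left_stop \<epsilon> (vobs n (V 0 n \<omega>)) (vobs n (V 1 n \<omega>)) j \<longleftrightarrow> left_stop \<epsilon> (obs 0 \<omega>) (obs 1 \<omega>) j"
  by (rule right_stop_cong[OF vobs_block vobs_block assms]; assumption)+

lemma vobs_no_stop: "no_stop n (vobs n (V 0 n \<omega>)) (vobs n (V 1 n \<omega>)) \<longleftrightarrow> no_stop n (obs 0 \<omega>) (obs 1 \<omega>)"
  by (simp add: no_stop_def vobs_stop)

lemma vobs_meas: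
  "v \<in> measurable S (E n) \<Longrightarrow> (\<lambda>s. vobs n (v s) t) \<in> borel_measurable S"
  by (intro borel_measurable_add borel_measurable_const measurable_rebuild)

lemma no_stop_meas:
  assumes "u \<in> measurable S (E n)" "v \<in> measurable S (E n)"
  shows "{s\<in>space S. no_stop m (vobs n (u s)) (vobs n (v s))} \<in> sets S"
proof -
  let ?R = "\<lambda>j s. right_stop \<epsilon> (vobs n (u s)) (vobs n (v s)) j"
  let ?L = "\<lambda>j s. left_stop \<epsilon> (vobs n (u s)) (vobs n (v s)) j"
  have R: "{s\<in>space S. ?R j s} \<in> sets S" and L: "{s\<in>space S. ?L j s} \<in> sets S" for j
    by (rule measurable_right_stop; rule vobs_meas; fact assms)+
  have "{s\<in>space S. no_stop m (vobs n (u s)) (vobs n (v s))} =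
      space S - (\<Union>j\<in>{..<m}. {s\<in>space S. ?R j s} \<union> {s\<in>space S. ?L j s})"
    by (auto simp: no_stop_def)
  also have "\<dots> \<in> sets S"
    using R L by (intro sets.Diff sets.top sets.finite_UN sets.Un) auto
  finally show ?thesis .
qed

definition running :: "nat \<Rightarrow> 'a set" where
  "running n = {\<omega>\<in>space P. no_stop n (obs 0 \<omega>) (obs 1 \<omega>)}"

lemma running_sets: "running n \<in> sets P"
  using no_stop_meas[where n = n and m = n, OF V_meas V_meas, of 0 1] by (simp add: running_def vobs_no_stop)

text \<open>A bound, given the localization path, for the probability of no stop before level
  n.\<close>

definition easy_weight :: "nat \<Rightarrow> (real \<Rightarrow> real) \<Rightarrow> real" where
  "easy_weight n y = (\<Prod>j<n. if easy_right \<epsilon> f j (loc_index y j) \<or> easy_left \<epsilon> f j (loc_index y j) then 1/16 else 1)"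

lemma easy_weight_meas:
  assumes "v \<in> measurable S (E n)"
  shows "(\<lambda>s. easy_weight m (vobs n (v s))) \<in> borel_measurable S"
  unfolding easy_weight_def
proof (rule borel_measurable_prod)
  fix j
  have "(\<lambda>i. if easy_right \<epsilon> f j i \<or> easy_left \<epsilon> f j i then 1/16 else 1 :: real) \<in> measurable (count_space UNIV) borel"
    by simp
  from measurable_compose[OF measurable_loc_index[OF vobs_meas[OF assms]] this]
  show "(\<lambda>s. if easy_right \<epsilon> f j (loc_index (vobs n (v s)) j) \<or> easy_left \<epsilon> f j (loc_index (vobs n (v s)) j)
      then 1/16 else 1 :: real) \<in> borel_measurable S" by simp
qed

lemma easy_weight_range: "0 \<le> easy_weight n y" "easy_weight n y \<le> 1"
  unfolding easy_weight_def by (auto intro!: prod_nonneg prod_le_1)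

text \<open>Freezing the localization noise makes the path deterministic, and still running then
  forces the watched stopping noise to be large at every easy level of that path. The factor Q, an
  arbitrary function of the localization noise, is carried along so that the decay can be combined
  with moments of the same noise.\<close>

lemma weighted_running:
  assumes Q: "Q \<in> borel_measurable (E n)"
  shows "(\<integral>\<^sup>+\<omega>. Q (V 0 n \<omega>) * indicator (running n) \<omega> \<partial>P) \<le>
    (\<integral>\<^sup>+\<omega>. Q (V 0 n \<omega>) * ennreal (easy_weight n (obs 0 \<omega>)) \<partial>P)"
proof -
  let ?F = "\<lambda>p. Q (fst p) * indicator {p\<in>space (E n \<Otimes>\<^sub>M E n). no_stop n (vobs n (fst p)) (vobs n (snd p))} p"
  have sp: "(V 0 n \<omega>, V 1 n \<omega>) \<in> space (E n \<Otimes>\<^sub>M E n)" for \<omega>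
    by (auto simp: V_def space_pair_measure space_PiM)
  have "(\<integral>\<^sup>+\<omega>. Q (V 0 n \<omega>) * indicator (running n) \<omega> \<partial>P) = (\<integral>\<^sup>+\<omega>. ?F (V 0 n \<omega>, V 1 n \<omega>) \<partial>P)"
    using sp by (intro nn_integral_cong) (auto simp: running_def vobs_no_stop indicator_def)
  also have "\<dots> \<le> (\<integral>\<^sup>+\<omega>. (\<lambda>v. Q v * ennreal (easy_weight n (vobs n v))) (V 0 n \<omega>) \<partial>P)"
  proof (rule nn_integral_indep_le[OF ind01])
    show "?F \<in> borel_measurable (E n \<Otimes>\<^sub>M E n)"
      by (intro borel_measurable_times_ennreal measurable_compose[OF measurable_fst Q] borel_measurable_indicator
          no_stop_meas measurable_fst measurable_snd)
    show "(\<lambda>v. Q v * ennreal (easy_weight n (vobs n v))) \<in> borel_measurable (E n)"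
      by (intro borel_measurable_times_ennreal Q measurable_compose[OF easy_weight_meas measurable_ennreal] measurable_ident_sets refl)
  next
    fix x assume "x \<in> space (E n)"
    define \<pi> where "\<pi> j = loc_index (vobs n x) j" for j
    define H where "H = {j. j < n \<and> (easy_right \<epsilon> f j (\<pi> j) \<or> easy_left \<epsilon> f j (\<pi> j))}"
    have finH: "finite H" "H \<subseteq> {..<n}" by (auto simp: H_def)
    define T where "T = {\<omega>\<in>space P. \<forall>j\<in>H. easy_noise \<epsilon> f (traj 1 \<omega>) j (\<pi> j) > 9/5 * sigma_level \<epsilon> j}"
    have T: "T \<in> sets P"
      unfolding T_def
    proof (rule sets.sets_Collect_finite_All[OF _ finH(1)])
      fix j assume "j \<in> H"
      then have "(\<lambda>\<omega>. easy_noise \<epsilon> f (traj 1 \<omega>) j (\<pi> j)) \<in> borel_measurable P"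
        by (intro easy_noise_tail(2)) (auto simp: H_def \<pi>_def loc_index_in_range simp del: loc_index.simps)
      then show "{\<omega>\<in>space P. 9/5 * sigma_level \<epsilon> j < easy_noise \<epsilon> f (traj 1 \<omega>) j (\<pi> j)} \<in> sets P"
        by measurable
    qed
    have "prob T \<le> (1/16) ^ card H"
      unfolding T_def
    proof (rule easy_noise_path_tail[OF _ _ finH(2)])
      show "in_range j (\<pi> j)" for j unfolding \<pi>_def by (rule loc_index_in_range)
      show "2 * \<pi> j - 2 \<le> \<pi> (Suc j) \<and> \<pi> (Suc j) \<le> 2 * \<pi> j + 1" for j
        unfolding \<pi>_def using loc_index_bounds by blast
    qed (auto simp: H_def)
    also have "\<dots> = easy_weight n (vobs n x)"
    proof -
      have "easy_weight n (vobs n x) = (\<Prod>j\<in>{..<n}. if j \<in> H then 1/16 else 1)"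
        unfolding easy_weight_def by (intro prod.cong) (auto simp: H_def \<pi>_def)
      also have "\<dots> = (\<Prod>j\<in>{..<n} \<inter> H. 1/16)" by (simp add: prod.If_cases Int_def)
      also have "{..<n} \<inter> H = H" using finH by auto
      finally show ?thesis by simp
    qed
    finally have pT: "prob T \<le> easy_weight n (vobs n x)" .
    have "(\<integral>\<^sup>+\<omega>. ?F (x, V 1 n \<omega>) \<partial>P) \<le> (\<integral>\<^sup>+\<omega>. Q x * indicator T \<omega> \<partial>P)"
    proof (rule nn_integral_mono)
      fix \<omega> assume \<omega>: "\<omega> \<in> space P"
      have "\<omega> \<in> T" if ns: "no_stop n (vobs n x) (vobs n (V 1 n \<omega>))"
      proof -
        have "easy_noise \<epsilon> f (traj 1 \<omega>) j (\<pi> j) > 9/5 * sigma_level \<epsilon> j" if j: "j \<in> H" for j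
        proof -
          have jn: "j < n" and e: "easy_right \<epsilon> f j (\<pi> j) \<or> easy_left \<epsilon> f j (\<pi> j)" using j by (auto simp: H_def)
          have "easy_noise \<epsilon> f (rebuild n (V 1 n \<omega>)) j (\<pi> j) > 9/5 * sigma_level \<epsilon> j"
            unfolding \<pi>_def
            by (rule easy_not_stopped[OF \<epsilon> refl]) (use ns jn e in \<open>auto simp: no_stop_def \<pi>_def\<close>)
          moreover have "easy_noise \<epsilon> f (rebuild n (V 1 n \<omega>)) j (\<pi> j) = easy_noise \<epsilon> f (traj 1 \<omega>) j (\<pi> j)"
            using e loc_index_in_range[of j "vobs n x", folded \<pi>_def] jn
            by (auto simp: easy_noise_def easy_right_def easy_left_def in_range_def V_block less_imp_le)
          ultimately show ?thesis by simp
        qed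
        then show ?thesis using \<omega> by (simp add: T_def)
      qed
      then show "?F (x, V 1 n \<omega>) \<le> Q x * indicator T \<omega>" by (auto simp: indicator_def)
    qed
    also have "\<dots> = Q x * emeasure P T" using T by (simp add: nn_integral_cmult_indicator)
    also have "\<dots> \<le> Q x * ennreal (easy_weight n (vobs n x))"
      using pT by (intro mult_left_mono) (auto simp: emeasure_eq_measure intro: ennreal_leI)
    finally show "(\<integral>\<^sup>+\<omega>. ?F (x, V 1 n \<omega>) \<partial>P) \<le> Q x * ennreal (easy_weight n (vobs n x))" .
  qed
  also have "\<dots> = (\<integral>\<^sup>+\<omega>. Q (V 0 n \<omega>) * ennreal (easy_weight n (obs 0 \<omega>)) \<partial>P)"
  proof -
    have "easy_weight n (vobs n (V 0 n \<omega>)) = easy_weight n (obs 0 \<omega>)" for \<omega>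
      unfolding easy_weight_def by (intro prod.cong refl) (simp add: vobs_loc del: loc_index.simps)
    then show ?thesis by simp
  qed
  finally show ?thesis .
qed

text \<open>From J on every level is easy, whatever the path.\<close>

lemma emeasure_running:
  assumes J: "\<And>j. j \<ge> J \<Longrightarrow> 13 * mesh j * \<rho>\<^sup>2 < \<epsilon>\<^sup>2"
  shows "emeasure P (running n) \<le> ennreal ((1/16) ^ (n - J))"
proof -
  have "emeasure P (running n) = (\<integral>\<^sup>+\<omega>. 1 * indicator (running n) \<omega> \<partial>P)" using running_sets by simp
  also have "\<dots> \<le> (\<integral>\<^sup>+\<omega>. 1 * ennreal (easy_weight n (obs 0 \<omega>)) \<partial>P)"
    using weighted_running[of "\<lambda>_. 1" n] by simp
  also have "\<dots> \<le> (\<integral>\<^sup>+\<omega>. ennreal ((1/16) ^ (n - J)) \<partial>P)"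
  proof (intro nn_integral_mono)
    fix \<omega>
    have "easy_weight n (obs 0 \<omega>) \<le> (\<Prod>j<n. if j \<in> {J..} then 1/16 else 1)"
      unfolding easy_weight_def using easy_fine[OF \<epsilon> J loc_index_in_range]
      by (intro prod_mono) auto
    also have "\<dots> = (\<Prod>j\<in>{..<n} \<inter> {J..}. 1/16)" by (simp add: prod.If_cases Int_def)
    also have "{..<n} \<inter> {J..} = {J..<n}" by auto
    also have "(\<Prod>j\<in>{J..<n}. 1/16 :: real) = (1/16) ^ (n - J)" by simp
    finally show "1 * ennreal (easy_weight n (obs 0 \<omega>)) \<le> ennreal ((1/16) ^ (n - J))"
      by (simp add: ennreal_leI)
  qed
  also have "\<dots> = ennreal ((1/16) ^ (n - J))" by (simp add: emeasure_space_1)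
  finally show ?thesis .
qed

text \<open>Passing from the observed to the true average of a far block costs at most the negative
  part of its noise.\<close>

definition bad_noise :: "nat \<Rightarrow> (real \<Rightarrow> real) \<Rightarrow> (real \<Rightarrow> real) \<Rightarrow> real" where
  "bad_noise n y v = (if 2 \<le> \<bar>offset f y n\<bar> then max 0 (- noise_avg v n (loc_index y n)) else 0)"

text \<open>With c far levels the weight is at most (1/16)^c <= (1/4)^c, the inverse square of 2^c,
  and \<open>offset_growth\<close> compares 2^c with the offset.\<close>

lemma easy_weight_far: "easy_weight n y \<le> far_weight (offset f y n)"
proof -
  let ?c = "far_count f y n"
  have "easy_weight n y \<le> (\<Prod>j<n. if 7 \<le> \<bar>offset f y j\<bar> then 1/16 else 1)"
    unfolding easy_weight_def using easy_far[OF \<epsilon>, of y] by (intro prod_mono) auto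
  also have "\<dots> = (\<Prod>j\<in>{..<n} \<inter> {j. 7 \<le> \<bar>offset f y j\<bar>}. 1/16)" by (simp add: prod.If_cases)
  also have "{..<n} \<inter> {j. 7 \<le> \<bar>offset f y j\<bar>} = {j. j < n \<and> 7 \<le> \<bar>offset f y j\<bar>}" by auto
  also have "(\<Prod>j\<in>{j. j < n \<and> 7 \<le> \<bar>offset f y j\<bar>}. 1/16 :: real) = (1/16) ^ ?c" by (simp add: far_count_def)
  also have "\<dots> \<le> (1/4) ^ ?c" by (intro power_mono) auto
  also have "\<dots> \<le> 256 / (of_int \<bar>offset f y n\<bar> + 2)\<^sup>2"
  proof -
    have "of_int (\<bar>offset f y n\<bar> + 2) \<le> (of_int (16 * 2 ^ ?c) :: real)"
      using offset_growth[OF minimizer(1)[OF f], of y n] by (simp only: of_int_le_iff)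
    then have "(of_int \<bar>offset f y n\<bar> + 2)\<^sup>2 \<le> (16 * 2 ^ ?c :: real)\<^sup>2"
      by (intro power_mono) auto
    also have "\<dots> = 256 * 4 ^ ?c" by (simp add: power_mult_distrib power_mult[symmetric] mult.commute[of _ 2] power_mult[of 2 2])
    finally have "(of_int \<bar>offset f y n\<bar> + 2)\<^sup>2 \<le> 256 * (4 :: real) ^ ?c" .
    then show ?thesis by (simp add: power_one_over divide_simps)
  qed
  finally show ?thesis using easy_weight_range(2) by (simp add: far_weight_def)
qed

text \<open>The selected block depends on the very noise in question, so its noise is replaced by a
  weighted sum over all far blocks. The weights add up to at most 58 and each negative part has half
  a variance as second moment, whence 29.\<close>

lemma bad_noise_second_moment:
  "(\<integral>\<^sup>+\<omega>. ennreal ((bad_noise n (obs 0 \<omega>) (traj 0 \<omega>))\<^sup>2) * indicator (running n) \<omega> \<partial>P) \<le> ennreal (29 * (\<tau> n)\<^sup>2)"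
proof -
  let ?k = "min_block f n"
  let ?S = "{b\<in>{1..2 ^ n}. 2 \<le> \<bar>b - ?k\<bar>}"
  define Q where "Q v = ennreal ((bad_noise n (vobs n v) (rebuild n v))\<^sup>2)" for v
  have id: "(\<lambda>v. v) \<in> measurable (E n) (E n)" by (rule measurable_ident_sets) simp
  have bm: "(\<lambda>v. bad_noise n (vobs n v) (rebuild n v)) \<in> borel_measurable (E n)"
  proof -
    have l: "(\<lambda>v. loc_index (vobs n v) n) \<in> measurable (E n) (count_space UNIV)"
      by (rule measurable_loc_index[OF vobs_meas[OF id]])
    have [measurable]: "(\<lambda>v. block_incr (rebuild n v) n (loc_index (vobs n v) n)) \<in> borel_measurable (E n)"
      by (rule measurable_block_incr_at[OF measurable_rebuild[OF id] l])
    have [measurable]: "Measurable.pred (E n) (\<lambda>v. 2 \<le> \<bar>offset f (vobs n v) n\<bar>)"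
      unfolding offset_def by (rule measurable_compose[OF l]) simp
    show ?thesis unfolding bad_noise_def noise_avg_def by measurable
  qed
  have Q: "Q \<in> borel_measurable (E n)"
    unfolding Q_def using bm by measurable
  have QV: "Q (V 0 n \<omega>) = ennreal ((bad_noise n (obs 0 \<omega>) (traj 0 \<omega>))\<^sup>2)" for \<omega>
    using loc_index_in_range[of n "obs 0 \<omega>"]
    by (simp add: Q_def bad_noise_def vobs_offset vobs_loc V_noise_avg del: loc_index.simps)
  have "(\<integral>\<^sup>+\<omega>. ennreal ((bad_noise n (obs 0 \<omega>) (traj 0 \<omega>))\<^sup>2) * indicator (running n) \<omega> \<partial>P) \<le>
      (\<integral>\<^sup>+\<omega>. ennreal ((bad_noise n (obs 0 \<omega>) (traj 0 \<omega>))\<^sup>2) * ennreal (easy_weight n (obs 0 \<omega>)) \<partial>P)"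
    using weighted_running[OF Q] by (simp add: QV)
  also have "\<dots> \<le> (\<integral>\<^sup>+\<omega>. (\<Sum>b\<in>?S. ennreal (far_weight (b - ?k)) * ennreal ((max 0 (- noise_avg (traj 0 \<omega>) n b))\<^sup>2)) \<partial>P)"
  proof (rule nn_integral_mono)
    fix \<omega>
    let ?y = "obs 0 \<omega>" and ?i = "loc_index (obs 0 \<omega>) n"
    show "ennreal ((bad_noise n ?y (traj 0 \<omega>))\<^sup>2) * ennreal (easy_weight n ?y) \<le>
      (\<Sum>b\<in>?S. ennreal (far_weight (b - ?k)) * ennreal ((max 0 (- noise_avg (traj 0 \<omega>) n b))\<^sup>2))"
    proof (cases "2 \<le> \<bar>offset f ?y n\<bar>")
      case True
      have iS: "?i \<in> ?S"
        using True loc_index_in_range[of n ?y] by (auto simp: offset_def in_range_def simp del: loc_index.simps)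
      have "ennreal ((bad_noise n ?y (traj 0 \<omega>))\<^sup>2) * ennreal (easy_weight n ?y) \<le>
          ennreal (far_weight (?i - ?k)) * ennreal ((max 0 (- noise_avg (traj 0 \<omega>) n ?i))\<^sup>2)"
        using True easy_weight_far[of n ?y] unfolding offset_def
        by (subst mult.commute, intro mult_mono ennreal_leI) (auto simp: bad_noise_def offset_def simp del: loc_index.simps)
      also have "\<dots> \<le> (\<Sum>b\<in>?S. ennreal (far_weight (b - ?k)) * ennreal ((max 0 (- noise_avg (traj 0 \<omega>) n b))\<^sup>2))"
        by (rule member_le_sum[OF iS]) (auto intro: finite_subset[of _ "{1..2 ^ n}"])
      finally show ?thesis .
    qed (simp add: bad_noise_def)
  qed
  also have "\<dots> = (\<Sum>b\<in>?S. ennreal (far_weight (b - ?k)) * (\<integral>\<^sup>+\<omega>. ennreal ((max 0 (- noise_avg (traj 0 \<omega>) n b))\<^sup>2) \<partial>P))"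
  proof -
    have m: "(\<lambda>\<omega>. ennreal ((max 0 (- noise_avg (traj 0 \<omega>) n b))\<^sup>2)) \<in> borel_measurable P" if "b \<in> ?S" for b
      using avg_measurable[of 0 n b] that by (auto simp: in_range_def)
    then show ?thesis
      by (subst nn_integral_sum) (auto intro!: sum.cong nn_integral_cmult borel_measurable_times_ennreal)
  qed
  also have "\<dots> = (\<Sum>b\<in>?S. ennreal (far_weight (b - ?k)) * ennreal ((\<tau> n)\<^sup>2 / 2))"
    by (intro sum.cong refl) (auto simp: avg_neg_second_moment in_range_def)
  also have "\<dots> = ennreal ((\<Sum>b\<in>?S. far_weight (b - ?k)) * ((\<tau> n)\<^sup>2 / 2))"
  proof -
    have w0: "0 \<le> far_weight d" for d by (simp add: far_weight_def)
    have "(\<Sum>b\<in>?S. ennreal (far_weight (b - ?k)) * ennreal ((\<tau> n)\<^sup>2 / 2)) =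
        (\<Sum>b\<in>?S. ennreal (far_weight (b - ?k) * ((\<tau> n)\<^sup>2 / 2)))"
      by (intro sum.cong refl ennreal_mult[symmetric] w0) simp
    also have "\<dots> = ennreal (\<Sum>b\<in>?S. far_weight (b - ?k) * ((\<tau> n)\<^sup>2 / 2))"
      by (rule sum_ennreal) (simp add: w0)
    finally show ?thesis by (simp only: sum_distrib_right)
  qed
  also have "\<dots> \<le> ennreal (58 * ((\<tau> n)\<^sup>2 / 2))"
    by (intro ennreal_leI mult_right_mono sum_far_weight) auto
  finally show ?thesis by simp
qed

end

section \<open>A maximal inequality over the levels\<close>

lemma le_square_bound:
  fixes y c :: real
  assumes "c > 0" shows "y \<le> c + y\<^sup>2 / (4 * c)"
proof -
  have "0 \<le> (y - 2 * c)\<^sup>2" by simp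
  then have "4 * c * y \<le> 4 * c * c + y\<^sup>2" by (simp add: power2_eq_square algebra_simps)
  then show ?thesis using assms by (simp add: field_simps power2_eq_square)
qed

text \<open>The levels up to \<open>J\<close> are bounded through the sum of the second moments; beyond \<open>J\<close> the growth
  of the second moments is beaten by the decay of the probabilities.\<close>

lemma (in prob_space) maximal_bound:
  fixes y :: "nat \<Rightarrow> 'a \<Rightarrow> real"
  assumes s: "s > 0" and y[measurable]: "\<And>n. y n \<in> borel_measurable M" and A[measurable]: "\<And>n. A n \<in> sets M"
    and m: "\<And>n. (\<integral>\<^sup>+\<omega>. ennreal ((y n \<omega>)\<^sup>2) * indicator (A n) \<omega> \<partial>M) \<le> ennreal (s\<^sup>2 * (2 ^ n / 2 ^ J))"
    and p: "\<And>n. emeasure M (A n) \<le> ennreal ((1/16) ^ (n - J))"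
  obtains X where "X \<in> borel_measurable M" "\<And>n \<omega>. \<omega> \<in> A n \<Longrightarrow> ennreal (y n \<omega>) \<le> X \<omega>"
    "(\<integral>\<^sup>+\<omega>. X \<omega> \<partial>M) \<le> ennreal (2 * s)"
proof -
  \<comment> \<open>Thresholds for y <= c + y^2 / (4 c). Up to J a common threshold is paid once, as
    the constant part of X, so \<open>e\<close> vanishes there. Beyond J the factor 6 lies between
    the growth 2 of the moments and the decay 1/16 of the probabilities, giving the ratios 6/16 and
    2/6.\<close>
  define c where "c n = (if n \<le> J then 7/10 * s else s / 2 * 6 ^ (n - J))" for n
  define e where "e n = (if n \<le> J then 0 else c n)" for n
  define Z where "Z n \<omega> = ennreal (e n) * indicator (A n) \<omega> +
    ennreal (1 / (4 * c n)) * (ennreal ((y n \<omega>)\<^sup>2) * indicator (A n) \<omega>)" for n \<omega>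
  define k where "k n = e n * (1/16) ^ (n - J) + 1 / (4 * c n) * (s\<^sup>2 * (2 ^ n / 2 ^ J))" for n
  define X where "X \<omega> = ennreal (7/10 * s) + (\<Sum>n. Z n \<omega>)" for \<omega>
  have c: "c n > 0" for n using s by (simp add: c_def)
  have e: "e n \<ge> 0" for n using c[of n] by (simp add: e_def)
  have Zm[measurable]: "Z n \<in> borel_measurable M" for n unfolding Z_def by measurable
  have Xm: "X \<in> borel_measurable M" unfolding X_def by measurable
  have k0: "k n \<ge> 0" for n using c[of n] e[of n] by (simp add: k_def)
  have IZ: "(\<integral>\<^sup>+\<omega>. Z n \<omega> \<partial>M) \<le> ennreal (k n)" for n
  proof -
    have "(\<integral>\<^sup>+\<omega>. Z n \<omega> \<partial>M) = ennreal (e n) * emeasure M (A n) +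
        ennreal (1 / (4 * c n)) * (\<integral>\<^sup>+\<omega>. ennreal ((y n \<omega>)\<^sup>2) * indicator (A n) \<omega> \<partial>M)"
      unfolding Z_def by (simp add: nn_integral_add nn_integral_cmult)
    also have "\<dots> \<le> ennreal (e n) * ennreal ((1/16) ^ (n - J)) + ennreal (1 / (4 * c n)) * ennreal (s\<^sup>2 * (2 ^ n / 2 ^ J))"
      by (intro add_mono mult_left_mono p m) auto
    also have "\<dots> = ennreal (k n)"
      using e[of n] c[of n] by (simp add: k_def ennreal_mult[symmetric] ennreal_plus[symmetric] del: ennreal_plus)
    finally show ?thesis .
  qed
  \<comment> \<open>5/14 = 1 / (4 * 7/10); the sum of the doubling moments is at most twice its last
    term.\<close>
  have below: "(\<Sum>n<N. k n) \<le> s * (5/14) * (2 ^ N / 2 ^ J)" if "N \<le> Suc J" for N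
    using that
  proof (induction N)
    case (Suc N)
    have "k N = s * (5/14) * (2 ^ N / 2 ^ J)"
      using Suc(2) s by (simp add: k_def e_def c_def power2_eq_square divide_simps)
    then show ?case using Suc by (simp add: field_simps)
  qed (use s in simp)
  \<comment> \<open>5/7 bounds the levels up to J; 3/10 and 1/4 are half the totals of the geometric
    series with ratios 3/8 and 1/3. Since 5/7 + 11/20 <= 13/10, adding the constant part 7/10 gives
    the factor 2.\<close>
  have above: "(\<Sum>n<Suc J + R. k n) \<le> s * (5/7 + 11/20 - 3/10 * (3/8) ^ R - 1/4 * (1/3) ^ R)" for R
  proof (induction R)
    case 0
    show ?case using below[of "Suc J"] s by simp
  next
    case (Suc R)
    have q: "(3/8 :: real) ^ r = (6/16) ^ r" "(1/3 :: real) ^ r = 2 ^ r / 6 ^ r" for r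
      by (simp_all flip: power_divide)
    have "k (Suc J + R) = s / 2 * (3/8) ^ Suc R + s / 2 * (1/3) ^ Suc R"
    proof -
      have d: "Suc J + R - J = Suc R" "\<not> Suc J + R \<le> J" by auto
      have "2 ^ (Suc J + R) / 2 ^ J = (2 :: real) ^ Suc R" by (simp add: power_add)
      then have "k (Suc J + R) = s / 2 * (6 ^ Suc R * (1/16) ^ Suc R) + 1 / (4 * (s / 2 * 6 ^ Suc R)) * (s\<^sup>2 * 2 ^ Suc R)"
        unfolding k_def e_def c_def d by (simp only: d if_False mult.assoc)
      also have "6 ^ Suc R * (1/16) ^ Suc R = (3/8 :: real) ^ Suc R"
        unfolding q power_mult_distrib[symmetric] by simp
      also have "1 / (4 * (s / 2 * 6 ^ Suc R)) * (s\<^sup>2 * 2 ^ Suc R) = s / 2 * (1/3) ^ Suc R"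
        unfolding q using s by (simp add: power2_eq_square field_simps)
      finally show ?thesis .
    qed
    moreover have "(\<Sum>n<Suc J + Suc R. k n) = (\<Sum>n<Suc J + R. k n) + k (Suc J + R)" by simp
    ultimately show ?case using Suc by (simp add: algebra_simps)
  qed
  have "(\<Sum>n<N. k n) \<le> s * (13/10)" for N
  proof (cases "N \<le> Suc J")
    case True
    have "s * (5/14) * (2 ^ N / 2 ^ J) \<le> s * (5/14) * 2"
    proof -
      have "(2 :: real) ^ N \<le> 2 ^ Suc J" using True by (intro power_increasing) auto
      then have "2 ^ N / 2 ^ J \<le> (2 :: real)" by (simp add: divide_le_eq)
      then show ?thesis using s by (intro mult_left_mono) auto
    qed
    also have "\<dots> \<le> s * (13/10)" using s by simp
    finally show ?thesis using below[OF True] by linarith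
  next
    case False
    then obtain R where R: "N = Suc J + R" using le_Suc_ex nat_le_linear by blast
    have "s * (5/7 + 11/20 - 3/10 * (3/8) ^ R - 1/4 * (1/3) ^ R) \<le> s * (13/10)"
    proof (intro mult_left_mono)
      have "0 \<le> 3/10 * (3/8 :: real) ^ R" "0 \<le> 1/4 * (1/3 :: real) ^ R" by auto
      then show "5/7 + 11/20 - 3/10 * (3/8) ^ R - 1/4 * (1/3) ^ R \<le> (13/10 :: real)" by linarith
    qed (use s in simp)
    then show ?thesis unfolding R by (rule order_trans[OF above])
  qed
  then have "(\<Sum>n<N. ennreal (k n)) \<le> ennreal (s * (13/10))" for N
    by (subst sum_ennreal) (auto simp: k0 intro: ennreal_leI)
  then have sk: "(\<Sum>n. ennreal (k n)) \<le> ennreal (s * (13/10))"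
    by (intro suminf_le_const summableI)
  have "(\<integral>\<^sup>+\<omega>. X \<omega> \<partial>M) = ennreal (7/10 * s) + (\<Sum>n. \<integral>\<^sup>+\<omega>. Z n \<omega> \<partial>M)"
    unfolding X_def by (subst nn_integral_add) (simp_all add: nn_integral_suminf emeasure_space_1)
  also have "\<dots> \<le> ennreal (7/10 * s) + ennreal (s * (13/10))"
    by (intro add_left_mono order_trans[OF suminf_le[OF IZ] sk] summableI)
  also have "\<dots> = ennreal (2 * s)"
    using s by (subst ennreal_plus[symmetric]) auto
  finally have IX: "(\<integral>\<^sup>+\<omega>. X \<omega> \<partial>M) \<le> ennreal (2 * s)" .
  have "ennreal (y n \<omega>) \<le> X \<omega>" if "\<omega> \<in> A n" for n \<omega>
  proof -
    have "ennreal (y n \<omega>) \<le> ennreal (c n + 1 / (4 * c n) * (y n \<omega>)\<^sup>2)"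
      using le_square_bound[OF c, of "y n \<omega>" n] by (intro ennreal_leI) simp
    also have "\<dots> = ennreal (c n) + ennreal (1 / (4 * c n)) * ennreal ((y n \<omega>)\<^sup>2)"
      using c[of n] by (simp add: ennreal_mult[symmetric] ennreal_plus[symmetric] del: ennreal_plus)
    also have "\<dots> \<le> ennreal (7/10 * s) + Z n \<omega>"
      using that by (auto simp: Z_def e_def c_def add.assoc intro: add_right_mono add_increasing)
    also have "Z n \<omega> \<le> (\<Sum>n. Z n \<omega>)"
      using sum_le_suminf[OF summableI, of "{n}" "\<lambda>n. Z n \<omega>"] by simp
    finally show ?thesis by (simp add: X_def)
  qed
  then show thesis by (rule that[OF Xm _ IX])
qed

lemma noise_sd_sq: "(noise_sd \<epsilon> n)\<^sup>2 = (noise_sd \<epsilon> J)\<^sup>2 * (2 ^ n / 2 ^ J)"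
  by (simp add: noise_sd_def power_divide power_mult_distrib less_imp_le) (simp add: mesh_def)

section \<open>Measurability and moments at the selected block\<close>

context estimation begin

lemma loc_meas:
  assumes "c \<in> {0, 1, 2}"
  shows "(\<lambda>\<omega>. loc_index (obs c \<omega>) n) \<in> measurable P (count_space UNIV)"
proof -
  have "(\<lambda>\<omega>. loc_index (vobs n (V c n \<omega>)) n) \<in> measurable P (count_space UNIV)"
    by (rule measurable_loc_index[OF vobs_meas[OF V_meas[OF assms]]])
  then show ?thesis by (simp add: vobs_loc del: loc_index.simps)
qed

lemma noise_avg_rebuild_meas:
  assumes "v \<in> measurable S (E n)" shows "(\<lambda>s. noise_avg (rebuild n (v s)) j i) \<in> borel_measurable S"
  unfolding noise_avg_def by (intro borel_measurable_divide measurable_block_incr measurable_rebuild assms borel_measurable_const)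

lemma gap_deviation_meas:
  assumes "v \<in> measurable S (E n)" shows "(\<lambda>s. gap_deviation (rebuild n (v s)) j i) \<in> borel_measurable S"
proof -
  note [measurable] = noise_avg_rebuild_meas[OF assms]
  show ?thesis unfolding gap_deviation_def by measurable
qed

lemma V_gap_deviation:
  assumes "in_range n i"
  shows "gap_deviation (rebuild n (V c n \<omega>)) n i = gap_deviation (traj c \<omega>) n i"
  using assms V_noise_avg[of n n _ c \<omega>] by (auto simp: gap_deviation_def in_range_def)

lemma selected_gap_deviation_meas:
  "(\<lambda>\<omega>. gap_deviation (traj 1 \<omega>) n (loc_index (obs 0 \<omega>) n)) \<in> borel_measurable P"
proof -
  have "(\<lambda>\<omega>. gap_deviation (rebuild n (V 1 n \<omega>)) n (loc_index (obs 0 \<omega>) n)) \<in> borel_measurable P"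
    by (rule measurable_compose_countable[OF gap_deviation_meas[OF V_meas] loc_meas]) auto
  then show ?thesis by (simp add: V_gap_deviation loc_index_in_range del: loc_index.simps)
qed

lemma gap_deviation_second_moment_at:
  assumes "in_range n i"
  shows "(\<integral>\<^sup>+\<omega>. ennreal ((gap_deviation (traj 1 \<omega>) n i)\<^sup>2) \<partial>P) \<le> ennreal (2 * (\<tau> n)\<^sup>2)"
proof -
  let ?r = "\<lambda>\<omega>. if i + 6 \<le> 2 ^ n then (max 0 (noise_avg (traj 1 \<omega>) n (i + 5) - noise_avg (traj 1 \<omega>) n (i + 6)))\<^sup>2 else 0"
  let ?l = "\<lambda>\<omega>. if 1 \<le> i - 6 then (max 0 (noise_avg (traj 1 \<omega>) n (i - 5) - noise_avg (traj 1 \<omega>) n (i - 6)))\<^sup>2 else 0"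
  have r: "?r \<in> borel_measurable P \<and> (\<integral>\<^sup>+\<omega>. ennreal (?r \<omega>) \<partial>P) \<le> ennreal ((\<tau> n)\<^sup>2)"
  proof (cases "i + 6 \<le> 2 ^ n")
    case True
    then have "in_range n (i + 5)" "in_range n (i + 6)" using assms by (auto simp: in_range_def)
    then show ?thesis using True avg_comb_second_moment[of 1 n "i + 5" "i + 6" 1 1]
      by (auto intro!: borel_measurable_power borel_measurable_max borel_measurable_diff avg_measurable)
  qed simp
  have l: "?l \<in> borel_measurable P \<and> (\<integral>\<^sup>+\<omega>. ennreal (?l \<omega>) \<partial>P) \<le> ennreal ((\<tau> n)\<^sup>2)"
  proof (cases "1 \<le> i - 6")
    case True
    then have "in_range n (i - 5)" "in_range n (i - 6)" using assms by (auto simp: in_range_def)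
    then show ?thesis using True avg_comb_second_moment[of 1 n "i - 5" "i - 6" 1 1]
      by (auto intro!: borel_measurable_power borel_measurable_max borel_measurable_diff avg_measurable)
  qed simp
  have r0: "0 \<le> ?r \<omega>" and l0: "0 \<le> ?l \<omega>" for \<omega> by simp_all
  have "(\<integral>\<^sup>+\<omega>. ennreal ((gap_deviation (traj 1 \<omega>) n i)\<^sup>2) \<partial>P) = (\<integral>\<^sup>+\<omega>. ennreal (?r \<omega>) + ennreal (?l \<omega>) \<partial>P)"
    by (intro nn_integral_cong)
       (simp only: gap_deviation_def real_sqrt_pow2[OF add_nonneg_nonneg[OF r0 l0]] ennreal_plus[OF r0 l0])
  also have "\<dots> = (\<integral>\<^sup>+\<omega>. ennreal (?r \<omega>) \<partial>P) + (\<integral>\<^sup>+\<omega>. ennreal (?l \<omega>) \<partial>P)"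
    using r l by (intro nn_integral_add) simp_all
  also have "\<dots> \<le> ennreal ((\<tau> n)\<^sup>2) + ennreal ((\<tau> n)\<^sup>2)"
    using r l by (intro add_mono) simp_all
  also have "\<dots> = ennreal (2 * (\<tau> n)\<^sup>2)" by (simp add: ennreal_plus[symmetric] del: ennreal_plus)
  finally show ?thesis .
qed

text \<open>The position comes from the localization noise, the deviation from the independent
  stopping noise. Freezing the former leaves the moment bound for a fixed block, without selection
  bias.\<close>

lemma gap_deviation_second_moment:
  "(\<integral>\<^sup>+\<omega>. ennreal ((gap_deviation (traj 1 \<omega>) n (loc_index (obs 0 \<omega>) n))\<^sup>2) \<partial>P) \<le> ennreal (2 * (\<tau> n)\<^sup>2)"
proof -
  let ?F = "\<lambda>p. ennreal ((gap_deviation (rebuild n (snd p)) n (loc_index (vobs n (fst p)) n))\<^sup>2)"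
  have "(\<lambda>p. gap_deviation (rebuild n (snd p)) n (loc_index (vobs n (fst p)) n)) \<in> borel_measurable (E n \<Otimes>\<^sub>M E n)"
    by (rule measurable_compose_countable[OF gap_deviation_meas[OF measurable_snd] measurable_loc_index[OF vobs_meas[OF measurable_fst]]])
  then have F: "?F \<in> borel_measurable (E n \<Otimes>\<^sub>M E n)" by measurable
  have "(\<integral>\<^sup>+\<omega>. ?F (V 0 n \<omega>, V 1 n \<omega>) \<partial>P) \<le> (\<integral>\<^sup>+\<omega>. (\<lambda>x. ennreal (2 * (\<tau> n)\<^sup>2)) (V 0 n \<omega>) \<partial>P)"
  proof (rule nn_integral_indep_le[OF ind01 F])
    fix x
    show "(\<integral>\<^sup>+\<omega>. ?F (x, V 1 n \<omega>) \<partial>P) \<le> ennreal (2 * (\<tau> n)\<^sup>2)"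
      using gap_deviation_second_moment_at[OF loc_index_in_range]
      by (simp add: V_gap_deviation loc_index_in_range del: loc_index.simps)
  qed simp
  then show ?thesis
    by (simp add: vobs_loc V_gap_deviation loc_index_in_range emeasure_space_1 del: loc_index.simps)
qed

lemma bad_noise_meas: "(\<lambda>\<omega>. bad_noise n (obs 0 \<omega>) (traj 0 \<omega>)) \<in> borel_measurable P"
proof -
  have "(\<lambda>\<omega>. noise_avg (rebuild n (V 0 n \<omega>)) n (loc_index (obs 0 \<omega>) n)) \<in> borel_measurable P"
    by (rule measurable_compose_countable[OF noise_avg_rebuild_meas[OF V_meas] loc_meas]) auto
  then have [measurable]: "(\<lambda>\<omega>. noise_avg (traj 0 \<omega>) n (loc_index (obs 0 \<omega>) n)) \<in> borel_measurable P"
    by (simp add: V_noise_avg loc_index_in_range del: loc_index.simps)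
  have [measurable]: "Measurable.pred P (\<lambda>\<omega>. 2 \<le> \<bar>offset f (obs 0 \<omega>) n\<bar>)"
    unfolding offset_def by (rule measurable_compose[OF loc_meas]) auto
  show ?thesis unfolding bad_noise_def by measurable
qed

end

section \<open>The stopping level and the estimation noise\<close>

lemma selected_in_range: "in_range j (selected \<epsilon> yl ys j)"
  using loc_index_in_range[of j yl]
  by (auto simp: selected_def right_stop_def left_stop_def in_range_def simp del: loc_index.simps)

lemma selected_cong:
  assumes "\<And>j i. j \<le> n \<Longrightarrow> in_range j i \<Longrightarrow> block_incr yl j i = block_incr yl' j i"
    and "\<And>j i. j \<le> n \<Longrightarrow> in_range j i \<Longrightarrow> block_incr ys j i = block_incr ys' j i"
  shows "selected \<epsilon> yl ys n = selected \<epsilon> yl' ys' n"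
proof -
  have "right_stop \<epsilon> yl ys n \<longleftrightarrow> right_stop \<epsilon> yl' ys' n" "left_stop \<epsilon> yl ys n \<longleftrightarrow> left_stop \<epsilon> yl' ys' n"
    by (rule right_stop_cong[OF assms order_refl]; assumption)+
  moreover have "loc_index yl n = loc_index yl' n" by (rule loc_index_cong[OF assms(1) order_refl])
  ultimately show ?thesis by (simp only: selected_def)
qed

lemma min_estimate_stopped:
  assumes \<epsilon>: "\<epsilon> > 0" and s: "right_stop \<epsilon> yl ys n \<or> left_stop \<epsilon> yl ys n"
    and r: "\<And>j. j < n \<Longrightarrow> \<not> right_stop \<epsilon> yl ys j \<and> \<not> left_stop \<epsilon> yl ys j"
  shows "min_estimate \<epsilon> yl ys ye = block_incr ye n (selected \<epsilon> yl ys n) / mesh n"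
proof -
  have "stop_level \<epsilon> yl ys = n"
    unfolding stop_level_def stop_iff[OF \<epsilon>] using s r by (intro Least_equality) (auto simp: not_less[symmetric])
  then show ?thesis
    by (simp add: min_estimate_def final_index_def selected_def right_gap_le_iff left_gap_le_iff del: loc_index.simps)
qed

text \<open>3/32 is 1/16 times 3/2 >= sqrt 2, the latter bounding the growth of the noise level;
  3/29 is the value of the whole series, and subtracting its remainder lets the induction
  close.\<close>

lemma sum_geometric_tail:
  "(\<Sum>n<N. if n \<le> J then 0 else (3/32) ^ (n - J)) \<le> 3/29 * (1 - (3/32) ^ (N - 1 - J) :: real)"
proof (induction N)
  case (Suc N)
  show ?case
  proof (cases "N \<le> J")
    case False
    then obtain r where r: "N - J = Suc r" by (metis diff_is_0_eq not0_implies_Suc)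
    then have "N - 1 - J = r" by simp
    then show ?thesis using Suc False r by simp
  qed (use Suc in simp)
qed simp

context estimation begin

definition stopped :: "nat \<Rightarrow> 'a set" where
  "stopped n = {\<omega>\<in>running n. right_stop \<epsilon> (obs 0 \<omega>) (obs 1 \<omega>) n \<or> left_stop \<epsilon> (obs 0 \<omega>) (obs 1 \<omega>) n}"

abbreviation "stops n yl ys \<equiv> no_stop n yl ys \<and> (right_stop \<epsilon> yl ys n \<or> left_stop \<epsilon> yl ys n)"

lemma vobs_stops: "stops n (vobs n (V 0 n \<omega>)) (vobs n (V 1 n \<omega>)) \<longleftrightarrow> stops n (obs 0 \<omega>) (obs 1 \<omega>)"
  by (simp add: vobs_no_stop vobs_stop)

lemma stops_meas:
  assumes "u \<in> measurable S (E n)" "v \<in> measurable S (E n)"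
  shows "{s\<in>space S. stops n (vobs n (u s)) (vobs n (v s))} \<in> sets S"
proof -
  have R: "{s\<in>space S. right_stop \<epsilon> (vobs n (u s)) (vobs n (v s)) n} \<in> sets S"
    and L: "{s\<in>space S. left_stop \<epsilon> (vobs n (u s)) (vobs n (v s)) n} \<in> sets S"
    by (rule measurable_right_stop; rule vobs_meas; fact assms)+
  have "{s\<in>space S. stops n (vobs n (u s)) (vobs n (v s))} =
      {s\<in>space S. no_stop n (vobs n (u s)) (vobs n (v s))} \<inter>
      ({s\<in>space S. right_stop \<epsilon> (vobs n (u s)) (vobs n (v s)) n} \<union>
       {s\<in>space S. left_stop \<epsilon> (vobs n (u s)) (vobs n (v s)) n})" by auto
  then show ?thesis using R L no_stop_meas[OF assms] by auto
qed

lemma stopped_alt: "stopped n = {\<omega>\<in>space P. stops n (obs 0 \<omega>) (obs 1 \<omega>)}"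
  by (auto simp: stopped_def running_def)

lemma stopped_sets: "stopped n \<in> sets P"
proof -
  have "{\<omega>\<in>space P. stops n (vobs n (V 0 n \<omega>)) (vobs n (V 1 n \<omega>))} \<in> sets P"
    by (rule stops_meas[OF V_meas V_meas]) auto
  then show ?thesis by (simp add: stopped_alt vobs_stops)
qed

lemma stopped_disjoint: "disjoint_family stopped"
  unfolding disjoint_family_on_def
proof (intro ballI impI)
  fix m n :: nat assume "m \<noteq> n"
  then have "m < n \<or> n < m" by auto
  then show "stopped m \<inter> stopped n = {}" by (auto simp: stopped_def running_def no_stop_def)
qed

lemma running_mono: "m \<le> n \<Longrightarrow> running n \<subseteq> running m"
  by (auto simp: running_def no_stop_def)

lemma not_running_stopped: "\<omega> \<in> space P \<Longrightarrow> \<omega> \<notin> running n \<Longrightarrow> \<exists>m. \<omega> \<in> stopped m"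
proof (induction n)
  case (Suc n)
  then show ?case by (cases "\<omega> \<in> running n") (auto simp: stopped_def running_def no_stop_def less_Suc_eq)
qed (simp add: running_def no_stop_def)

lemma selected_meas:
  assumes "u \<in> measurable S (E n)" "v \<in> measurable S (E n)"
  shows "(\<lambda>s. selected \<epsilon> (vobs n (u s)) (vobs n (v s)) n) \<in> measurable S (count_space UNIV)"
proof -
  have R: "{s\<in>space S. right_stop \<epsilon> (vobs n (u s)) (vobs n (v s)) n} \<in> sets S"
    and L: "{s\<in>space S. left_stop \<epsilon> (vobs n (u s)) (vobs n (v s)) n} \<in> sets S"
    by (rule measurable_right_stop; rule vobs_meas; fact assms)+
  have l: "(\<lambda>s. loc_index (vobs n (u s)) n + c) \<in> measurable S (count_space UNIV)" for c
    by (rule measurable_compose[OF measurable_loc_index[OF vobs_meas[OF assms(1)]]]) simp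
  have "(\<lambda>s. if right_stop \<epsilon> (vobs n (u s)) (vobs n (v s)) n
      then if left_stop \<epsilon> (vobs n (u s)) (vobs n (v s)) n then loc_index (vobs n (u s)) n + 0 else loc_index (vobs n (u s)) n + 2
      else if left_stop \<epsilon> (vobs n (u s)) (vobs n (v s)) n then loc_index (vobs n (u s)) n + (- 2) else loc_index (vobs n (u s)) n + 0)
    \<in> measurable S (count_space UNIV)"
    by (intro measurable_If l R L)
  also have "(\<lambda>s. if right_stop \<epsilon> (vobs n (u s)) (vobs n (v s)) n
      then if left_stop \<epsilon> (vobs n (u s)) (vobs n (v s)) n then loc_index (vobs n (u s)) n + 0 else loc_index (vobs n (u s)) n + 2
      else if left_stop \<epsilon> (vobs n (u s)) (vobs n (v s)) n then loc_index (vobs n (u s)) n + (- 2) else loc_index (vobs n (u s)) n + 0)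
    = (\<lambda>s. selected \<epsilon> (vobs n (u s)) (vobs n (v s)) n)"
    by (auto simp: selected_def fun_eq_iff simp del: loc_index.simps)
  finally show ?thesis .
qed

definition final_noise :: "nat \<Rightarrow> 'a \<Rightarrow> real" where
  "final_noise n \<omega> = noise_avg (traj 2 \<omega>) n (selected \<epsilon> (obs 0 \<omega>) (obs 1 \<omega>) n)"

lemma V_final_noise:
  "noise_avg (rebuild n (V 2 n \<omega>)) n (selected \<epsilon> (vobs n (V 0 n \<omega>)) (vobs n (V 1 n \<omega>)) n) = final_noise n \<omega>"
proof -
  have "selected \<epsilon> (vobs n (V 0 n \<omega>)) (vobs n (V 1 n \<omega>)) n = selected \<epsilon> (obs 0 \<omega>) (obs 1 \<omega>) n"
    by (rule selected_cong[OF vobs_block vobs_block])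
  then show ?thesis by (simp add: final_noise_def V_noise_avg selected_in_range)
qed

lemma final_noise_meas: "final_noise n \<in> borel_measurable P"
proof -
  have "(\<lambda>\<omega>. noise_avg (rebuild n (V 2 n \<omega>)) n (selected \<epsilon> (vobs n (V 0 n \<omega>)) (vobs n (V 1 n \<omega>)) n)) \<in> borel_measurable P"
    by (rule measurable_compose_countable[OF noise_avg_rebuild_meas[OF V_meas] selected_meas[OF V_meas V_meas]]) auto
  then show ?thesis by (simp add: V_final_noise)
qed

text \<open>The estimation noise is independent of the other two noises, hence of the stopping event
  and of the chosen block. With these frozen it is a centred normal average over a fixed
  block.\<close>

lemma final_noise_moment:
  "(\<integral>\<^sup>+\<omega>. ennreal \<bar>final_noise n \<omega>\<bar> * indicator (stopped n) \<omega> \<partial>P) \<le> ennreal (\<tau> n) * emeasure P (stopped n)"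
proof -
  let ?S = "PiM {0, 1 :: nat} (\<lambda>_. E n)" and ?T = "PiM {2 :: nat} (\<lambda>_. E n)"
  let ?st = "\<lambda>x. stops n (vobs n (x 0)) (vobs n (x 1))"
  let ?sel = "\<lambda>x. selected \<epsilon> (vobs n (x 0)) (vobs n (x 1)) n"
  let ?X = "\<lambda>\<omega>. \<lambda>c\<in>{0, 1}. V c n \<omega>" and ?Y = "\<lambda>\<omega>. \<lambda>c\<in>{2}. V c n \<omega>"
  define A where "A = {x\<in>space ?S. ?st x}"
  let ?F = "\<lambda>p. ennreal \<bar>noise_avg (rebuild n (snd p 2)) n (?sel (fst p))\<bar> * indicator A (fst p)"
  have c: "(\<lambda>x. x 0) \<in> measurable ?S (E n)" "(\<lambda>x. x 1) \<in> measurable ?S (E n)" "(\<lambda>y. y 2) \<in> measurable ?T (E n)"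
    by (intro measurable_component_singleton; simp)+
  have A: "A \<in> sets ?S" unfolding A_def by (rule stops_meas[OF c(1,2)])
  have [measurable]: "(\<lambda>p. noise_avg (rebuild n (snd p 2)) n (?sel (fst p))) \<in> borel_measurable (?S \<Otimes>\<^sub>M ?T)"
    by (rule measurable_compose_countable[OF noise_avg_rebuild_meas[OF measurable_compose[OF measurable_snd c(3)]]
        measurable_compose[OF measurable_fst selected_meas[OF c(1,2)]]])
  have [measurable]: "(\<lambda>p. indicator A (fst p) :: ennreal) \<in> borel_measurable (?S \<Otimes>\<^sub>M ?T)"
    by (rule measurable_compose[OF measurable_fst borel_measurable_indicator[OF A]])
  have F: "?F \<in> borel_measurable (?S \<Otimes>\<^sub>M ?T)" by measurable
  have XA: "indicator A (?X \<omega>) = (indicator (stopped n) \<omega> :: ennreal)" if "\<omega> \<in> space P" for \<omega>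
  proof -
    have "?X \<omega> \<in> space ?S" using that measurable_space[OF V_meas] by (auto simp: space_PiM)
    then show ?thesis using that vobs_stops[of n \<omega>] by (simp add: A_def stopped_alt indicator_def)
  qed
  have "(\<integral>\<^sup>+\<omega>. ennreal \<bar>final_noise n \<omega>\<bar> * indicator (stopped n) \<omega> \<partial>P) = (\<integral>\<^sup>+\<omega>. ?F (?X \<omega>, ?Y \<omega>) \<partial>P)"
    by (intro nn_integral_cong) (simp add: V_final_noise XA)
  also have "\<dots> \<le> (\<integral>\<^sup>+\<omega>. (\<lambda>x. ennreal (\<tau> n) * indicator A x) (?X \<omega>) \<partial>P)"
  proof (rule nn_integral_indep_le[OF ind012 F])
    fix x assume "x \<in> space ?S"
    have "(\<integral>\<^sup>+\<omega>. ?F (x, ?Y \<omega>) \<partial>P) = (\<integral>\<^sup>+\<omega>. ennreal \<bar>noise_avg (traj 2 \<omega>) n (?sel x)\<bar> \<partial>P) * indicator A x"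
      by (cases "x \<in> A") (simp_all add: V_noise_avg selected_in_range)
    also have "\<dots> \<le> ennreal (\<tau> n) * indicator A x"
      by (intro mult_right_mono normal_abs_moment_le[OF avg_law \<tau>] selected_in_range) auto
    finally show "(\<integral>\<^sup>+\<omega>. ?F (x, ?Y \<omega>) \<partial>P) \<le> ennreal (\<tau> n) * indicator A x" .
  next
    show "(\<lambda>x. ennreal (\<tau> n) * indicator A x) \<in> borel_measurable ?S"
      using A by (intro borel_measurable_times_ennreal borel_measurable_const borel_measurable_indicator)
  qed
  also have "\<dots> = (\<integral>\<^sup>+\<omega>. ennreal (\<tau> n) * indicator (stopped n) \<omega> \<partial>P)"
    by (intro nn_integral_cong) (simp add: XA)
  also have "\<dots> = ennreal (\<tau> n) * emeasure P (stopped n)"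
    using stopped_sets by (simp add: nn_integral_cmult_indicator)
  finally show ?thesis .
qed

context
  fixes J :: nat
  assumes J: "\<And>j. j \<ge> J \<Longrightarrow> 13 * mesh j * \<rho>\<^sup>2 < \<epsilon>\<^sup>2"
begin

text \<open>The stopping events are disjoint, so the levels up to J together contribute at most the
  noise level at J. Beyond J the probabilities (1/16)^r outweigh the growth (3/2)^r, which adds
  3/29.\<close>

lemma stopped_noise_sum: "(\<Sum>n. ennreal (\<tau> n) * emeasure P (stopped n)) \<le> ennreal (32/29 * \<tau> J)"
proof (intro suminf_le_const summableI)
  fix N
  let ?p = "\<lambda>n. measure P (stopped n)"
  let ?g = "\<lambda>n. if n \<le> J then 0 else (3/32) ^ (n - J) :: real"
  have p: "?p n \<le> (1/16) ^ (n - J)" for n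
  proof -
    have "emeasure P (stopped n) \<le> emeasure P (running n)"
      by (rule emeasure_mono[OF _ running_sets]) (auto simp: stopped_def)
    also have "\<dots> \<le> ennreal ((1/16) ^ (n - J))" by (rule emeasure_running[OF J])
    finally show ?thesis by (simp add: emeasure_eq_measure)
  qed
  have step: "\<tau> n * ?p n \<le> \<tau> J * (?p n + ?g n)" for n
  proof (cases "n \<le> J")
    case True
    have "\<tau> n \<le> \<tau> J"
    proof (rule power2_le_imp_le)
      have "(2 :: real) ^ n / 2 ^ J \<le> 1" using True by (simp add: divide_le_eq power_increasing)
      then have "(\<tau> J)\<^sup>2 * (2 ^ n / 2 ^ J) \<le> (\<tau> J)\<^sup>2 * 1" by (intro mult_left_mono) auto
      then show "(\<tau> n)\<^sup>2 \<le> (\<tau> J)\<^sup>2" by (simp only: noise_sd_sq[of \<epsilon> n J] mult_1_right)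
    qed (use \<tau>[of J] in simp)
    then show ?thesis using True by (simp add: mult_right_mono)
  next
    case False
    then have nJ: "2 ^ n / 2 ^ J = (2 :: real) ^ (n - J)" by (simp add: power_diff)
    have "\<tau> n \<le> \<tau> J * (3/2) ^ (n - J)"
    proof (rule power2_le_imp_le)
      have "(\<tau> n)\<^sup>2 = (\<tau> J)\<^sup>2 * 2 ^ (n - J)" by (simp only: noise_sd_sq[of \<epsilon> n J] nJ)
      also have "\<dots> \<le> (\<tau> J)\<^sup>2 * (9/4) ^ (n - J)" by (intro mult_left_mono power_mono) auto
      also have "(9/4 :: real) ^ (n - J) = ((3/2) ^ (n - J))\<^sup>2"
        by (simp add: power_mult[symmetric] mult.commute[of _ 2]) (simp add: power_mult power_divide)
      finally show "(\<tau> n)\<^sup>2 \<le> (\<tau> J * (3/2) ^ (n - J))\<^sup>2" by (simp add: power_mult_distrib)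
    qed (use \<tau>[of J] in simp)
    then have "\<tau> n * ?p n \<le> \<tau> J * (3/2) ^ (n - J) * (1/16) ^ (n - J)"
      using p[of n] \<tau>[of n] \<tau>[of J] by (intro mult_mono) auto
    also have "\<dots> = \<tau> J * (3/32) ^ (n - J)" by (simp add: mult.assoc flip: power_mult_distrib)
    also have "\<dots> \<le> \<tau> J * (?p n + ?g n)" using False \<tau>[of J] by simp
    finally show ?thesis .
  qed
  have "(\<Sum>n<N. \<tau> n * ?p n) \<le> (\<Sum>n<N. \<tau> J * (?p n + ?g n))" by (intro sum_mono step)
  also have "\<dots> = \<tau> J * ((\<Sum>n<N. ?p n) + (\<Sum>n<N. ?g n))" by (simp only: sum_distrib_left[symmetric] sum.distrib)
  also have "\<dots> \<le> \<tau> J * (1 + 3/29)"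
  proof (intro mult_left_mono add_mono)
    have "(\<Sum>n<N. ?p n) = measure P (\<Union>n<N. stopped n)"
      using stopped_sets disjoint_family_on_mono[OF subset_UNIV stopped_disjoint]
      by (intro finite_measure_finite_Union[symmetric]) auto
    then show "(\<Sum>n<N. ?p n) \<le> 1" by simp
    have "0 \<le> (3/32 :: real) ^ (N - 1 - J)" by simp
    then show "(\<Sum>n<N. ?g n) \<le> 3/29" using sum_geometric_tail[of J N] by argo
  qed (use \<tau>[of J] in simp)
  finally have "(\<Sum>n<N. \<tau> n * ?p n) \<le> 32/29 * \<tau> J" by argo
  moreover have "(\<Sum>n<N. ennreal (\<tau> n) * emeasure P (stopped n)) = ennreal (\<Sum>n<N. \<tau> n * ?p n)"
    using \<tau> by (subst sum_ennreal[symmetric]) (auto simp: emeasure_eq_measure ennreal_mult less_imp_le)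
  ultimately show "(\<Sum>n<N. ennreal (\<tau> n) * emeasure P (stopped n)) \<le> ennreal (32/29 * \<tau> J)"
    by (simp add: ennreal_leI)
qed

lemma AE_stopped: "AE \<omega> in P. \<exists>n. \<omega> \<in> stopped n"
proof (rule AE_I)
  show "{\<omega>\<in>space P. \<not> (\<exists>n. \<omega> \<in> stopped n)} \<subseteq> (\<Inter>n. running n)"
    using not_running_stopped by blast
  show s: "(\<Inter>n. running n) \<in> sets P" using running_sets by auto
  have le: "measure P (\<Inter>n. running n) \<le> (1/16) ^ r" for r
  proof -
    have "emeasure P (\<Inter>n. running n) \<le> emeasure P (running (J + r))" by (rule emeasure_mono[OF _ running_sets]) auto
    also have "\<dots> \<le> ennreal ((1/16) ^ r)" using emeasure_running[where n = "J + r" and J = J, OF J] by simp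
    finally show ?thesis by (simp add: emeasure_eq_measure)
  qed
  have "(\<lambda>r. (1/16 :: real) ^ r) \<longlonglongrightarrow> 0" by (rule LIMSEQ_power_zero) simp
  then have "measure P (\<Inter>n. running n) \<le> 0" by (rule LIMSEQ_le_const) (use le in blast)
  then show "emeasure P (\<Inter>n. running n) = 0" by (simp add: emeasure_eq_measure measure_le_0_iff)
qed

text \<open>Pathwise decomposition into noise on moving away from the minimizer, localization noise
  of the last block, noise of the gaps, and threshold plus estimation noise. Block averages never
  fall below the minimum, so the bias is one-sided and equals the loss.\<close>

lemma stopped_error:
  assumes \<omega>: "\<omega> \<in> stopped n"
  shows "\<exists>e\<le>n. \<bar>min_estimate \<epsilon> (obs 0 \<omega>) (obs 1 \<omega>) (obs 2 \<omega>) - M\<bar> \<le>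
    entry_excess f (traj 0 \<omega>) e + bad_noise n (obs 0 \<omega>) (traj 0 \<omega>) +
    4 * gap_deviation (traj 1 \<omega>) n (loc_index (obs 0 \<omega>) n) + (8 * sqrt 2 * \<tau> n + \<bar>final_noise n \<omega>\<bar>)"
proof -
  let ?sel = "selected \<epsilon> (obs 0 \<omega>) (obs 1 \<omega>) n" and ?i = "loc_index (obs 0 \<omega>) n"
  have stop: "right_stop \<epsilon> (obs 0 \<omega>) (obs 1 \<omega>) n \<or> left_stop \<epsilon> (obs 0 \<omega>) (obs 1 \<omega>) n"
    and run: "\<And>j. j < n \<Longrightarrow> \<not> right_stop \<epsilon> (obs 0 \<omega>) (obs 1 \<omega>) j \<and> \<not> left_stop \<epsilon> (obs 0 \<omega>) (obs 1 \<omega>) j"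
    using \<omega> by (auto simp: stopped_def running_def no_stop_def)
  obtain e where e: "e \<le> n" "(if 2 \<le> \<bar>offset f (obs 0 \<omega>) n\<bar> then block_avg f n ?i - M else 0) \<le>
      entry_excess f (traj 0 \<omega>) e + bad_noise n (obs 0 \<omega>) (traj 0 \<omega>)"
  proof (cases "2 \<le> \<bar>offset f (obs 0 \<omega>) n\<bar>")
    case True
    then show ?thesis using bad_block_excess[of "obs 0 \<omega>" "traj 0 \<omega>" n] that
      by (auto simp: bad_noise_def simp del: loc_index.simps)
  next
    case False
    then show ?thesis using that[of 0] entry_excess_nonneg by (simp add: bad_noise_def)
  qed
  have "min_estimate \<epsilon> (obs 0 \<omega>) (obs 1 \<omega>) (obs 2 \<omega>) = block_avg f n ?sel + final_noise n \<omega>"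
    unfolding final_noise_def block_incr_observation[OF selected_in_range refl, symmetric]
    by (rule min_estimate_stopped[OF \<epsilon> stop run])
  moreover have "M \<le> block_avg f n ?sel" by (rule M_le_block_avg[OF selected_in_range])
  moreover have "block_avg f n ?sel - M \<le>
      (if 2 \<le> \<bar>offset f (obs 0 \<omega>) n\<bar> then block_avg f n ?i - M else 0) +
      8 * sqrt 2 * \<tau> n + 4 * gap_deviation (traj 1 \<omega>) n ?i"
    by (rule selected_loss(2)[OF \<epsilon> refl stop])
  ultimately have "\<bar>min_estimate \<epsilon> (obs 0 \<omega>) (obs 1 \<omega>) (obs 2 \<omega>) - M\<bar> \<le>
    entry_excess f (traj 0 \<omega>) e + bad_noise n (obs 0 \<omega>) (traj 0 \<omega>) +
    4 * gap_deviation (traj 1 \<omega>) n ?i + (8 * sqrt 2 * \<tau> n + \<bar>final_noise n \<omega>\<bar>)"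
    using e(2) by linarith
  with e(1) show ?thesis by blast
qed

text \<open>The stopping level is random, so three of the terms are dominated by variables that
  serve all levels at once, from \<open>maximal_bound\<close> with second moments 39, 29 and 32 =
  4^2 * 2. The last term is summed over the disjoint stopping events.\<close>

lemma risk_bound:
  "(\<integral>\<^sup>+\<omega>. ennreal \<bar>min_estimate \<epsilon> (obs 0 \<omega>) (obs 1 \<omega>) (obs 2 \<omega>) - M\<bar> \<partial>P) \<le> ennreal (50 * \<tau> J)"
proof -
  have tJ: "\<tau> J > 0" by (rule \<tau>)
  have sq: "(sqrt B * \<tau> J)\<^sup>2 * (2 ^ n / 2 ^ J) = B * (\<tau> n)\<^sup>2" if "B > 0" for B n
    using that by (simp only: power_mult_distrib real_sqrt_pow2 less_imp_le noise_sd_sq[of \<epsilon> n J] mult.assoc)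
  have drop: "(\<integral>\<^sup>+\<omega>. g \<omega> * indicator A \<omega> \<partial>P) \<le> (\<integral>\<^sup>+\<omega>. g \<omega> \<partial>P)" for g :: "'a \<Rightarrow> ennreal" and A
    by (intro nn_integral_mono) (auto simp: indicator_def)
  note run = running_sets emeasure_running[OF J]
  obtain X2 where X2: "X2 \<in> borel_measurable P"
    "\<And>n \<omega>. \<omega> \<in> running n \<Longrightarrow> ennreal (entry_excess f (traj 0 \<omega>) n) \<le> X2 \<omega>"
    "(\<integral>\<^sup>+\<omega>. X2 \<omega> \<partial>P) \<le> ennreal (2 * (sqrt 39 * \<tau> J))"
  proof (rule maximal_bound[where y = "\<lambda>n \<omega>. entry_excess f (traj 0 \<omega>) n" and A = running and s = "sqrt 39 * \<tau> J" and J = J])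
    show "(\<integral>\<^sup>+\<omega>. ennreal ((entry_excess f (traj 0 \<omega>) n)\<^sup>2) * indicator (running n) \<omega> \<partial>P) \<le>
        ennreal ((sqrt 39 * \<tau> J)\<^sup>2 * (2 ^ n / 2 ^ J))" for n
      by (subst sq, simp) (rule order_trans[OF drop entry_excess_second_moment])
  qed (use run entry_excess_measurable tJ in auto)
  obtain X3 where X3: "X3 \<in> borel_measurable P"
    "\<And>n \<omega>. \<omega> \<in> running n \<Longrightarrow> ennreal (bad_noise n (obs 0 \<omega>) (traj 0 \<omega>)) \<le> X3 \<omega>"
    "(\<integral>\<^sup>+\<omega>. X3 \<omega> \<partial>P) \<le> ennreal (2 * (sqrt 29 * \<tau> J))"
  proof (rule maximal_bound[where y = "\<lambda>n \<omega>. bad_noise n (obs 0 \<omega>) (traj 0 \<omega>)" and A = running and s = "sqrt 29 * \<tau> J" and J = J])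
    show "(\<integral>\<^sup>+\<omega>. ennreal ((bad_noise n (obs 0 \<omega>) (traj 0 \<omega>))\<^sup>2) * indicator (running n) \<omega> \<partial>P) \<le>
        ennreal ((sqrt 29 * \<tau> J)\<^sup>2 * (2 ^ n / 2 ^ J))" for n
      by (subst sq, simp) (rule bad_noise_second_moment)
  qed (use run bad_noise_meas tJ in auto)
  let ?gd = "\<lambda>n \<omega>. gap_deviation (traj 1 \<omega>) n (loc_index (obs 0 \<omega>) n)"
  obtain X4 where X4: "X4 \<in> borel_measurable P"
    "\<And>n \<omega>. \<omega> \<in> running n \<Longrightarrow> ennreal (4 * ?gd n \<omega>) \<le> X4 \<omega>"
    "(\<integral>\<^sup>+\<omega>. X4 \<omega> \<partial>P) \<le> ennreal (2 * (sqrt 32 * \<tau> J))"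
  proof (rule maximal_bound[where y = "\<lambda>n \<omega>. 4 * ?gd n \<omega>" and A = running and s = "sqrt 32 * \<tau> J" and J = J])
    show "(\<integral>\<^sup>+\<omega>. ennreal ((4 * ?gd n \<omega>)\<^sup>2) * indicator (running n) \<omega> \<partial>P) \<le>
        ennreal ((sqrt 32 * \<tau> J)\<^sup>2 * (2 ^ n / 2 ^ J))" for n
    proof (subst sq)
      have "(\<integral>\<^sup>+\<omega>. ennreal ((4 * ?gd n \<omega>)\<^sup>2) * indicator (running n) \<omega> \<partial>P) \<le> (\<integral>\<^sup>+\<omega>. ennreal 16 * ennreal ((?gd n \<omega>)\<^sup>2) \<partial>P)"
        by (rule order_trans[OF drop]) (simp add: power_mult_distrib ennreal_mult)
      also have "\<dots> = ennreal 16 * (\<integral>\<^sup>+\<omega>. ennreal ((?gd n \<omega>)\<^sup>2) \<partial>P)"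
        using selected_gap_deviation_meas by (intro nn_integral_cmult) simp
      also have "\<dots> \<le> ennreal 16 * ennreal (2 * (\<tau> n)\<^sup>2)" by (intro mult_left_mono gap_deviation_second_moment) simp
      also have "\<dots> = ennreal (32 * (\<tau> n)\<^sup>2)" by (subst ennreal_mult[symmetric]) auto
      finally show "(\<integral>\<^sup>+\<omega>. ennreal ((4 * ?gd n \<omega>)\<^sup>2) * indicator (running n) \<omega> \<partial>P) \<le> ennreal (32 * (\<tau> n)\<^sup>2)" .
    qed simp
  qed (use run selected_gap_deviation_meas tJ in auto)
  define R where "R \<omega> = (\<Sum>n. ennreal (8 * sqrt 2 * \<tau> n) * indicator (stopped n) \<omega> +
    ennreal \<bar>final_noise n \<omega>\<bar> * indicator (stopped n) \<omega>)" for \<omega>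
  note [measurable] = stopped_sets final_noise_meas X2(1) X3(1) X4(1)
  have Rm[measurable]: "R \<in> borel_measurable P" unfolding R_def by measurable
  have IR: "(\<integral>\<^sup>+\<omega>. R \<omega> \<partial>P) \<le> ennreal ((8 * sqrt 2 + 1) * (32/29 * \<tau> J))"
  proof -
    have "(\<integral>\<^sup>+\<omega>. R \<omega> \<partial>P) = (\<Sum>n. \<integral>\<^sup>+\<omega>. ennreal (8 * sqrt 2 * \<tau> n) * indicator (stopped n) \<omega> +
        ennreal \<bar>final_noise n \<omega>\<bar> * indicator (stopped n) \<omega> \<partial>P)"
      unfolding R_def by (rule nn_integral_suminf) measurable
    also have "\<dots> \<le> (\<Sum>n. ennreal (8 * sqrt 2 + 1) * (ennreal (\<tau> n) * emeasure P (stopped n)))"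
    proof (intro suminf_le summableI)
      fix n
      have "(\<integral>\<^sup>+\<omega>. ennreal (8 * sqrt 2 * \<tau> n) * indicator (stopped n) \<omega> +
          ennreal \<bar>final_noise n \<omega>\<bar> * indicator (stopped n) \<omega> \<partial>P) =
          ennreal (8 * sqrt 2 * \<tau> n) * emeasure P (stopped n) +
          (\<integral>\<^sup>+\<omega>. ennreal \<bar>final_noise n \<omega>\<bar> * indicator (stopped n) \<omega> \<partial>P)"
        by (subst nn_integral_add) (simp_all add: nn_integral_cmult_indicator)
      also have "\<dots> \<le> ennreal (8 * sqrt 2 * \<tau> n) * emeasure P (stopped n) + ennreal (\<tau> n) * emeasure P (stopped n)"
        by (intro add_left_mono final_noise_moment)
      also have "\<dots> = ennreal (8 * sqrt 2 + 1) * (ennreal (\<tau> n) * emeasure P (stopped n))"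
      proof -
        have "ennreal (8 * sqrt 2 + 1) * ennreal (\<tau> n) = ennreal (8 * sqrt 2 * \<tau> n) + ennreal (\<tau> n)"
          using \<tau>[of n] by (subst ennreal_mult[symmetric], simp, simp, subst ennreal_plus[symmetric]) (auto simp: algebra_simps)
        then show ?thesis by (simp only: mult.assoc[symmetric] distrib_right)
      qed
      finally show "(\<integral>\<^sup>+\<omega>. ennreal (8 * sqrt 2 * \<tau> n) * indicator (stopped n) \<omega> +
          ennreal \<bar>final_noise n \<omega>\<bar> * indicator (stopped n) \<omega> \<partial>P) \<le>
          ennreal (8 * sqrt 2 + 1) * (ennreal (\<tau> n) * emeasure P (stopped n))" .
    qed
    also have "\<dots> = ennreal (8 * sqrt 2 + 1) * (\<Sum>n. ennreal (\<tau> n) * emeasure P (stopped n))" by simp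
    also have "\<dots> \<le> ennreal (8 * sqrt 2 + 1) * ennreal (32/29 * \<tau> J)" by (intro mult_left_mono stopped_noise_sum) simp
    also have "\<dots> = ennreal ((8 * sqrt 2 + 1) * (32/29 * \<tau> J))" using tJ by (intro ennreal_mult[symmetric]) auto
    finally show ?thesis .
  qed
  have "(\<integral>\<^sup>+\<omega>. ennreal \<bar>min_estimate \<epsilon> (obs 0 \<omega>) (obs 1 \<omega>) (obs 2 \<omega>) - M\<bar> \<partial>P) \<le>
      (\<integral>\<^sup>+\<omega>. X2 \<omega> + X3 \<omega> + X4 \<omega> + R \<omega> \<partial>P)"
  proof (rule nn_integral_mono_AE, use AE_stopped in eventually_elim)
    fix \<omega> assume "\<exists>n. \<omega> \<in> stopped n"
    then obtain n where n: "\<omega> \<in> stopped n" by blast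
    then have rn: "\<omega> \<in> running n" by (simp add: stopped_def)
    obtain e where e: "e \<le> n" and le: "\<bar>min_estimate \<epsilon> (obs 0 \<omega>) (obs 1 \<omega>) (obs 2 \<omega>) - M\<bar> \<le>
      entry_excess f (traj 0 \<omega>) e + bad_noise n (obs 0 \<omega>) (traj 0 \<omega>) + 4 * ?gd n \<omega> + (8 * sqrt 2 * \<tau> n + \<bar>final_noise n \<omega>\<bar>)"
      using stopped_error[OF n] by blast
    have b0: "0 \<le> bad_noise n (obs 0 \<omega>) (traj 0 \<omega>)" by (simp add: bad_noise_def)
    have R: "ennreal (8 * sqrt 2 * \<tau> n + \<bar>final_noise n \<omega>\<bar>) \<le> R \<omega>"
    proof -
      have "ennreal (8 * sqrt 2 * \<tau> n + \<bar>final_noise n \<omega>\<bar>) = ennreal (8 * sqrt 2 * \<tau> n) * indicator (stopped n) \<omega> +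
          ennreal \<bar>final_noise n \<omega>\<bar> * indicator (stopped n) \<omega>"
        using n \<tau>[of n] by (simp add: less_imp_le)
      also have "\<dots> \<le> R \<omega>"
        unfolding R_def
        using sum_le_suminf[OF summableI, of "{n}" "\<lambda>n. ennreal (8 * sqrt 2 * \<tau> n) * indicator (stopped n) \<omega> +
          ennreal \<bar>final_noise n \<omega>\<bar> * indicator (stopped n) \<omega>"] by simp
      finally show ?thesis .
    qed
    have "ennreal \<bar>min_estimate \<epsilon> (obs 0 \<omega>) (obs 1 \<omega>) (obs 2 \<omega>) - M\<bar> \<le>
        ennreal (entry_excess f (traj 0 \<omega>) e) + ennreal (bad_noise n (obs 0 \<omega>) (traj 0 \<omega>)) + ennreal (4 * ?gd n \<omega>) +
        ennreal (8 * sqrt 2 * \<tau> n + \<bar>final_noise n \<omega>\<bar>)"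
      using ennreal_leI[OF le] \<tau>[of n] gap_deviation_ge(3)[of "traj 1 \<omega>" n "loc_index (obs 0 \<omega>) n"]
        entry_excess_nonneg[of f "traj 0 \<omega>" e] b0
      by (simp add: ennreal_plus[symmetric] add_nonneg_nonneg del: ennreal_plus loc_index.simps)
    \<comment> \<open>The entry level e is at most n, so the procedure was still running there as
      well.\<close>
    also have "\<dots> \<le> X2 \<omega> + X3 \<omega> + X4 \<omega> + R \<omega>"
      using running_mono[OF e] rn by (intro add_mono X2(2) X3(2) X4(2) R) auto
    finally show "ennreal \<bar>min_estimate \<epsilon> (obs 0 \<omega>) (obs 1 \<omega>) (obs 2 \<omega>) - M\<bar> \<le> X2 \<omega> + X3 \<omega> + X4 \<omega> + R \<omega>" .
  qed
  also have "\<dots> = (\<integral>\<^sup>+\<omega>. X2 \<omega> \<partial>P) + (\<integral>\<^sup>+\<omega>. X3 \<omega> \<partial>P) + (\<integral>\<^sup>+\<omega>. X4 \<omega> \<partial>P) + (\<integral>\<^sup>+\<omega>. R \<omega> \<partial>P)"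
    by (simp add: nn_integral_add)
  also have "\<dots> \<le> ennreal (2 * (sqrt 39 * \<tau> J)) + ennreal (2 * (sqrt 29 * \<tau> J)) + ennreal (2 * (sqrt 32 * \<tau> J)) +
      ennreal ((8 * sqrt 2 + 1) * (32/29 * \<tau> J))"
    by (intro add_mono X2(3) X3(3) X4(3) IR)
  also have "\<dots> = ennreal ((2 * sqrt 39 + 2 * sqrt 29 + 2 * sqrt 32 + (8 * sqrt 2 + 1) * (32/29)) * \<tau> J)"
    using tJ by (simp add: ennreal_plus[symmetric] add_nonneg_nonneg algebra_simps del: ennreal_plus)
  also have "\<dots> \<le> ennreal (50 * \<tau> J)"
  proof (intro ennreal_leI mult_right_mono)
    have "sqrt 39 \<le> 25/4" "sqrt 29 \<le> 27/5" "sqrt 32 \<le> 57/10" "sqrt 2 \<le> 71/50"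
      by (rule real_le_lsqrt; simp add: power2_eq_square)+
    then show "2 * sqrt 39 + 2 * sqrt 29 + 2 * sqrt 32 + (8 * sqrt 2 + 1) * (32/29) \<le> 50" by argo
  qed (use tJ in simp)
  finally show ?thesis .
qed

end

end

section \<open>Comparison of the noise level with the modulus\<close>

context estimation begin

lemma risk_less:
  "(\<integral>\<^sup>+\<omega>. ennreal \<bar>min_estimate \<epsilon> (obs 0 \<omega>) (obs 1 \<omega>) (obs 2 \<omega>) - M\<bar> \<partial>P) < ennreal (449 * \<rho>)"
proof -
  note \<rho> = rho_m_facts[OF \<epsilon>]
  let ?fine = "\<lambda>n. 13 * mesh n * \<rho>\<^sup>2 < \<epsilon>\<^sup>2"
  obtain n where "(1/2) ^ n < \<epsilon>\<^sup>2 / (13 * \<rho>\<^sup>2)"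
    using real_arch_pow_inv[of "\<epsilon>\<^sup>2 / (13 * \<rho>\<^sup>2)" "1/2"] \<epsilon> \<rho>(2) by auto
  then have "?fine n" using \<rho>(2) by (simp add: mesh_def power_one_over field_simps)
  define J where "J = (LEAST n. ?fine n)"
  have fJ: "?fine J" unfolding J_def by (rule LeastI) fact
  have fine: "?fine j" if "j \<ge> J" for j
  proof -
    have "mesh j \<le> mesh J" using that by (simp add: mesh_def frac_le power_increasing)
    then have "13 * mesh j * \<rho>\<^sup>2 \<le> 13 * mesh J * \<rho>\<^sup>2" by (intro mult_right_mono mult_left_mono) auto
    with fJ show ?thesis by simp
  qed
  have le1: "measure lborel {t\<in>{0..1}. f t < M + \<rho>} \<le> 1"
  proof (cases "{t\<in>{0..1}. f t < M + \<rho>} \<in> sets lborel")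
    case True
    then have "measure lborel {t\<in>{0..1}. f t < M + \<rho>} \<le> measure lborel {0..1::real}"
      by (intro measure_mono_fmeasurable) (auto simp: fmeasurable_def)
    then show ?thesis by simp
  qed (simp add: measure_notin_sets)
  \<comment> \<open>Hence level J - 1 exists and violates the inequality, which gives the reverse
    estimate with 26 = 2 * 13 at level J.\<close>
  have "J \<noteq> 0"
  proof
    assume "J = 0"
    then have "13 * \<rho>\<^sup>2 < \<epsilon>\<^sup>2" using fJ by (simp add: mesh_def)
    also have "\<epsilon>\<^sup>2 \<le> \<rho>\<^sup>2 * 1" by (rule order_trans[OF \<rho>(1)]) (intro mult_left_mono le1, simp)
    finally show False by (simp add: not_less)
  qed
  then obtain i where i: "J = Suc i" using not0_implies_Suc by blast
  then have "\<not> ?fine i" using not_less_Least[of i ?fine] by (simp add: J_def)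
  then have "\<epsilon>\<^sup>2 \<le> 26 * mesh J * \<rho>\<^sup>2" by (simp add: i mesh_Suc)
  then have "(\<tau> J)\<^sup>2 \<le> 78 * \<rho>\<^sup>2"
    using mesh_pos[of J] by (simp add: noise_sd_def power_divide power_mult_distrib field_simps)
  moreover have "\<rho>\<^sup>2 > 0" using \<rho>(2) by simp
  \<comment> \<open>2500 * 78 = 195000 < 201601 = 449^2.\<close>
  ultimately have "2500 * (\<tau> J)\<^sup>2 < 201601 * \<rho>\<^sup>2" by linarith
  then have "(50 * \<tau> J)\<^sup>2 < (449 * \<rho>)\<^sup>2" by (simp add: power_mult_distrib)
  then have "50 * \<tau> J < 449 * \<rho>" by (rule power2_less_imp_less) (use \<rho>(2) in simp)
  then have "ennreal (50 * \<tau> J) < ennreal (449 * \<rho>)" using \<tau>[of J] by (simp add: ennreal_less_iff)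
  with risk_bound[of J, OF fine] show ?thesis by (rule order_le_less_trans)
qed

end

section \<open>Independence of the split noises\<close>

lemma (in prob_space) indep_vars_transform_pair:
  fixes x :: "nat \<Rightarrow> 'a \<Rightarrow> real" and u v :: "real \<times> real \<Rightarrow> real"
  assumes x: "indep_vars (\<lambda>_. borel) x {0, 1, 2}"
    and uv: "u \<in> borel_measurable borel" "v \<in> borel_measurable borel"
    and ind: "indep_var borel (\<lambda>\<omega>. u (x 0 \<omega>, x 1 \<omega>)) borel (\<lambda>\<omega>. v (x 0 \<omega>, x 1 \<omega>))"
  shows "indep_vars (\<lambda>_. borel)
    (\<lambda>k \<omega>. if k = 0 then u (x 0 \<omega>, x 1 \<omega>) else if k = 1 then x 2 \<omega> else v (x 0 \<omega>, x 1 \<omega>)) {0, 1, 2 :: nat}"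
proof -
  define K where "K j = (if j = 0 then {0, 1} else {2 :: nat})" for j :: nat
  \<comment> \<open>The group of the third variable is padded with the constant 0, so that both
    groups have the index set {0, 1} that ungrouping expects.\<close>
  define Y where "Y j c = (if j = 0 then if c = 0 then (\<lambda>\<omega>. u (x 0 \<omega>, x 1 \<omega>)) else (\<lambda>\<omega>. v (x 0 \<omega>, x 1 \<omega>))
    else if c = 0 then x 2 else (\<lambda>\<omega>. 0))" for j c :: nat
  define g where "g j z = (\<lambda>c\<in>{0, 1 :: nat}. if j = 0 then if c = 0 then u (z 0, z 1) else v (z 0, z 1)
    else if c = 0 then z 2 else (0 :: real))" for j :: nat and z :: "nat \<Rightarrow> real"
  have res: "indep_vars (\<lambda>j. PiM (K j) (\<lambda>_. borel)) (\<lambda>j \<omega>. restrict (\<lambda>k. x k \<omega>) (K j)) {0, 1}"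
    by (rule indep_vars_restrict[OF x]) (auto simp: K_def disjoint_family_on_def)
  have g: "g j \<in> measurable (PiM (K j) (\<lambda>_. borel)) (PiM {0, 1} (\<lambda>_. borel))" if "j \<in> {0, 1}" for j
  proof (cases "j = 0")
    case True
    have c: "(\<lambda>z. (z 0, z 1)) \<in> borel_measurable (PiM {0, 1 :: nat} (\<lambda>_. borel :: real measure))"
      unfolding borel_prod[symmetric] by (intro measurable_Pair measurable_component_singleton) auto
    have "g j = (\<lambda>z. \<lambda>c\<in>{0, 1 :: nat}. if c = 0 then u (z 0, z 1) else v (z 0, z 1))"
      using True by (auto simp: g_def fun_eq_iff)
    moreover have "(\<lambda>z. if c = 0 then u (z 0, z 1) else v (z 0, z 1)) \<in> borel_measurable (PiM {0, 1 :: nat} (\<lambda>_. borel))" for c :: nat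
      using measurable_compose[OF c uv(1)] measurable_compose[OF c uv(2)] by (cases "c = 0") auto
    ultimately show ?thesis using True by (auto simp: K_def intro: measurable_restrict)
  next
    case False
    have "g j = (\<lambda>z. \<lambda>c\<in>{0, 1 :: nat}. if c = 0 then z 2 else 0)"
      using False by (auto simp: g_def fun_eq_iff)
    moreover have "(\<lambda>z. if c = 0 then z 2 else 0) \<in> borel_measurable (PiM {2 :: nat} (\<lambda>_. borel :: real measure))" for c :: nat
      by (cases "c = 0") auto
    ultimately show ?thesis using False by (auto simp: K_def intro: measurable_restrict)
  qed
  have groups: "indep_vars (\<lambda>j. PiM {0, 1} (\<lambda>_. borel)) (\<lambda>j \<omega>. \<lambda>c\<in>{0, 1}. Y j c \<omega>) {0, 1}"
    by (rule indep_vars_cong[THEN iffD1, OF _ _ _ indep_vars_compose2[OF res g]])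
       (auto simp: g_def Y_def K_def fun_eq_iff)
  have within: "indep_vars (\<lambda>_. borel) (Y j) {0, 1}" if "j \<in> {0, 1}" for j
  proof (cases "j = 0")
    case True
    show ?thesis using indep_vars_two[OF ind, where i = "0 :: nat" and j = 1] True by (simp add: Y_def[abs_def])
  next
    case False
    have "indep_var borel (x 2) borel (x 0)" by (rule indep_var_of_indep_vars[OF x]) auto
    from indep_var_compose[OF this, of "\<lambda>y. y" borel "\<lambda>y. 0" borel]
    have "indep_var borel (x 2) borel (\<lambda>\<omega>. 0)" by (simp add: comp_def)
    from indep_vars_two[OF this, where i = "0 :: nat" and j = 1] False show ?thesis by (simp add: Y_def[abs_def])
  qed
  have full: "indep_vars (\<lambda>_. borel) (\<lambda>p. Y (fst p) (snd p)) ({0, 1} \<times> {0, 1})"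
    using indep_vars_ungroup[OF _ _ groups within] by simp
  \<comment> \<open>The order u, \<open>x 2\<close>, v puts the next pair to be rotated at the
    positions 0 and 1.\<close>
  define r where "r k = (if k = 0 then (0, 0) else if k = 1 then (1, 0) else (0 :: nat, 1 :: nat))" for k :: nat
  have "indep_vars (\<lambda>_. borel) (\<lambda>p. Y (fst p) (snd p)) (r ` {0, 1, 2})"
    by (rule indep_vars_subset[OF full]) (auto simp: r_def)
  then have "indep_vars (\<lambda>_. borel) (\<lambda>k. Y (fst (r k)) (snd (r k))) {0, 1, 2}"
    using indep_vars_reindex[of "\<lambda>_. borel" _ r "{0, 1, 2}"] by (auto simp: r_def inj_on_def)
  moreover have "(\<lambda>k. Y (fst (r k)) (snd (r k))) =
      (\<lambda>k \<omega>. if k = 0 then u (x 0 \<omega>, x 1 \<omega>) else if k = 1 then x 2 \<omega> else v (x 0 \<omega>, x 1 \<omega>))"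
    by (auto simp: r_def Y_def fun_eq_iff)
  ultimately show ?thesis by simp
qed

text \<open>The coefficients of the sample splitting make three independent copies of the noise.\<close>

definition split_noises :: "real \<Rightarrow> (nat \<Rightarrow> real) \<Rightarrow> nat \<Rightarrow> real" where
  "split_noises \<epsilon> x d = (if d = 0 then \<epsilon> * (x 0 + sqrt 2 / 2 * x 1 + sqrt 6 / 2 * x 2)
     else if d = 1 then \<epsilon> * (x 0 + sqrt 2 / 2 * x 1 - sqrt 6 / 2 * x 2)
     else \<epsilon> * (x 0 - sqrt 2 * x 1))"

text \<open>Two rotations, in units of a^2. First \<open>x 0\<close> and \<open>x 1\<close> / sqrt
  2, with c = 2, give U of variance 3/2 and V = \<open>x 0\<close> - sqrt 2 \<open>x 1\<close> of
  variance 3. Then U and sqrt 6 / 2 times \<open>x 2\<close>, both of variance 3/2, give with c = 1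
  their sum and difference, each of variance 3.\<close>

lemma (in prob_space) split_noises_indep:
  fixes x :: "nat \<Rightarrow> 'a \<Rightarrow> real"
  assumes x: "indep_vars (\<lambda>_. borel) x {0, 1, 2}" and a: "a > 0" and \<epsilon>: "\<epsilon> > 0"
    and D: "\<And>k. k \<in> {0, 1, 2} \<Longrightarrow> distributed M lborel (x k) (normal_density 0 a)"
  shows "indep_vars (\<lambda>_. borel) (\<lambda>d \<omega>. split_noises \<epsilon> (\<lambda>k. x k \<omega>) d) {0, 1, 2}"
    and "d \<in> {0, 1, 2} \<Longrightarrow> distributed M lborel (\<lambda>\<omega>. split_noises \<epsilon> (\<lambda>k. x k \<omega>) d) (normal_density 0 (sqrt 3 * a * \<epsilon>))"
proof -
  have scale: "distributed M lborel (\<lambda>\<omega>. c * X \<omega>) (normal_density 0 (c * s))"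
    if "distributed M lborel X (normal_density 0 s)" "s > 0" "c > 0" for X c s
    using normal_density_affine[OF that(1,2), of c 0] that by simp
  have scale_ind: "indep_var borel X borel (\<lambda>\<omega>. c * Y \<omega>)" if "indep_var borel X borel Y" for c :: real and X Y
    using indep_var_compose[OF that, of "\<lambda>y. y" borel "\<lambda>y. c * y" borel] by (simp add: comp_def)
  let ?r = "sqrt 2 / 2" and ?q = "sqrt 6 / 2"
  let ?U = "\<lambda>\<omega>. x 0 \<omega> + ?r * x 1 \<omega>" and ?V = "\<lambda>\<omega>. x 0 \<omega> - sqrt 2 * x 1 \<omega>"
  have i01: "indep_var borel (x 0) borel (x 1)" by (rule indep_var_of_indep_vars[OF x]) auto
  have b: "?r * a > 0" "(?r * a)\<^sup>2 = a\<^sup>2 / 2" using a by (auto simp: power_mult_distrib power_divide)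
  have c1: "a\<^sup>2 / (?r * a)\<^sup>2 = 2" unfolding b(2) using a by simp
  have c2: "2 * (?r * y) = sqrt 2 * y" for y :: real by simp
  have s1: "sqrt (a\<^sup>2 + (?r * a)\<^sup>2) = ?q * a" "sqrt (a\<^sup>2 + (sqrt 2 * a)\<^sup>2) = sqrt 3 * a"
    by (rule real_sqrt_unique; use a in \<open>simp add: power_mult_distrib power_divide\<close>)+
  have D1: "distributed M lborel (x 0) (normal_density 0 a)"
    "distributed M lborel (\<lambda>\<omega>. ?r * x 1 \<omega>) (normal_density 0 (?r * a))"
    by (rule D, simp) (rule scale[OF D a], simp_all)
  have lin: "(\<lambda>p. fst p + c * snd p) \<in> borel_measurable borel" "(\<lambda>p. fst p - c * snd p) \<in> borel_measurable borel" for c :: real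
    by (intro borel_measurable_continuous_onI continuous_intros)+
  note rot = indep_normal_rotation[OF scale_ind[OF i01] a b(1) D1, unfolded c1 c2 s1]
  define y where "y k \<omega> = (if k = 0 then ?U \<omega> else if k = 1 then x 2 \<omega> else ?V \<omega>)" for k :: nat and \<omega>
  have y: "indep_vars (\<lambda>_. borel) y {0, 1, 2}"
    unfolding y_def[abs_def]
    by (rule indep_vars_transform_pair[OF x lin, unfolded fst_conv snd_conv, OF rot(1)])
  have y_simps: "y 0 = ?U" "y 1 = x 2" "y 2 = ?V" by (simp_all add: y_def[abs_def])
  have j01: "indep_var borel ?U borel (x 2)"
    using indep_var_of_indep_vars[OF y, of 0 1] by (simp add: y_simps[unfolded One_nat_def])
  have q: "?q * a > 0" using a by simp
  have D2: "distributed M lborel (\<lambda>\<omega>. ?q * x 2 \<omega>) (normal_density 0 (?q * a))"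
    by (rule scale[OF D a]) simp_all
  have c3: "(?q * a)\<^sup>2 / (?q * a)\<^sup>2 = 1" using a by simp
  have s2: "sqrt ((?q * a)\<^sup>2 + (?q * a)\<^sup>2) = sqrt 3 * a"
    by (rule real_sqrt_unique; use a in \<open>simp add: power_mult_distrib power_divide\<close>)+
  note rot2 = indep_normal_rotation[OF scale_ind[OF j01] q q rot(2) D2, unfolded c3 mult_1 s2]
  define z where "z k \<omega> = (if k = 0 then ?U \<omega> + ?q * x 2 \<omega> else if k = 1 then ?V \<omega> else ?U \<omega> - ?q * x 2 \<omega>)" for k :: nat and \<omega>
  have z: "indep_vars (\<lambda>_. borel) z {0, 1, 2}"
    unfolding z_def[abs_def]
    by (rule indep_vars_transform_pair[OF y lin, unfolded fst_conv snd_conv y_simps, OF rot2(1)])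
  have zD: "distributed M lborel (z k) (normal_density 0 (sqrt 3 * a))" if "k \<in> {0, 1, 2}" for k
    using that rot(3) rot2(2,3) by (auto simp: z_def[abs_def])
  \<comment> \<open>The family z lists the noises for localization, estimation and stopping; r
    restores the order of \<open>split_noises\<close>.\<close>
  define r where "r d = (if d = 0 then 0 else if d = 1 then 2 else 1 :: nat)" for d :: nat
  have zr: "split_noises \<epsilon> (\<lambda>k. x k \<omega>) d = \<epsilon> * z (r d) \<omega>" if "d \<in> {0, 1, 2}" for d \<omega>
    using that by (auto simp: split_noises_def z_def r_def)
  have "r ` {0, 1, 2} = {0, 1, 2}" by (auto simp: r_def)
  then have "indep_vars (\<lambda>_. borel) z (r ` {0, 1, 2})" using z by (simp only:)
  from indep_vars_reindex[OF this] have "indep_vars (\<lambda>_. borel) (\<lambda>d. z (r d)) {0, 1, 2}"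
    by (auto simp: r_def inj_on_def)
  from indep_vars_compose2[OF this, of "\<lambda>_ y. \<epsilon> * y" "\<lambda>_. borel"]
  have "indep_vars (\<lambda>_. borel) (\<lambda>d \<omega>. \<epsilon> * z (r d) \<omega>) {0, 1, 2}" by simp
  then show "indep_vars (\<lambda>_. borel) (\<lambda>d \<omega>. split_noises \<epsilon> (\<lambda>k. x k \<omega>) d) {0, 1, 2}"
    by (rule indep_vars_cong[THEN iffD1, rotated -1]) (auto simp: zr fun_eq_iff simp del: One_nat_def)
  show "distributed M lborel (\<lambda>\<omega>. split_noises \<epsilon> (\<lambda>k. x k \<omega>) d) (normal_density 0 (sqrt 3 * a * \<epsilon>))" if "d \<in> {0, 1, 2}"
  proof -
    have rd: "r d \<in> {0, 1, 2}" by (simp add: r_def)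
    have sd: "sqrt 3 * a * \<epsilon> = \<epsilon> * (sqrt 3 * a)" by (rule mult.commute)
    show ?thesis unfolding zr[OF that] sd by (rule scale[OF zD[OF rd] _ \<epsilon>]) (use a in simp)
  qed
qed

lemma brownian_block_incr:
  assumes D: "brownian_fdd P D"
  shows "prob_space.indep_vars P (\<lambda>_. borel) (\<lambda>b \<omega>. block_incr (\<lambda>t. D t \<omega>) n b) {1..2 ^ n}"
    and "b \<in> {1..2 ^ n} \<Longrightarrow> distributed P lborel (\<lambda>\<omega>. block_incr (\<lambda>t. D t \<omega>) n b) (normal_density 0 (sqrt (mesh n)))"
proof -
  interpret prob_space P using D by (simp add: brownian_fdd_def)
  let ?\<tau> = "\<lambda>i. real i * mesh n"
  have "real i * mesh n \<in> {0..1}" if "i \<le> 2 ^ n" for i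
  proof -
    have "real i \<le> 2 ^ n" using that by (metis of_nat_le_iff of_nat_numeral of_nat_power)
    then show ?thesis by (simp add: mesh_def)
  qed
  then have "?\<tau> ` {..2 ^ n} \<subseteq> {0..1}" by blast
  moreover have "strict_mono_on {..2 ^ n} ?\<tau>" by (auto simp: strict_mono_on_def)
  ultimately have "indep_vars (\<lambda>_. borel) (\<lambda>i \<omega>. D (?\<tau> (Suc i)) \<omega> - D (?\<tau> i) \<omega>) {..<2 ^ n}"
    using D unfolding brownian_fdd_def by blast
  also have "{..<2 ^ n} = (\<lambda>b. nat (b - 1)) ` {1..2 ^ n}"
  proof (intro equalityI subsetI)
    fix i :: nat assume "i \<in> {..<2 ^ n}"
    then have "int i < int (2 ^ n)" by (simp only: lessThan_iff of_nat_less_iff)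
    then have "int i < 2 ^ n" by (simp only: of_nat_power of_nat_numeral)
    then have "int i + 1 \<in> {1..2 ^ n}" unfolding atLeastAtMost_iff by linarith
    moreover have "i = nat (int i + 1 - 1)" by simp
    ultimately show "i \<in> (\<lambda>b. nat (b - 1)) ` {1..2 ^ n}" by blast
  qed (auto simp: nat_less_iff)
  finally have "indep_vars (\<lambda>_. borel) (\<lambda>b \<omega>. D (?\<tau> (Suc (nat (b - 1)))) \<omega> - D (?\<tau> (nat (b - 1))) \<omega>) {1..2 ^ n}"
    by (rule indep_vars_reindex) (auto simp: inj_on_def)
  then show "indep_vars (\<lambda>_. borel) (\<lambda>b \<omega>. block_incr (\<lambda>t. D t \<omega>) n b) {1..2 ^ n}"
    by (rule indep_vars_cong[THEN iffD1, rotated -1]) (auto simp: block_incr_def fun_eq_iff algebra_simps)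
  assume b: "b \<in> {1..2 ^ n}"
  then have "0 \<le> of_int (b - 1) * mesh n" "of_int b * mesh n \<le> 1" using of_int_mesh_le_one[of b n] by auto
  moreover have "of_int (b - 1) * mesh n < of_int b * mesh n" by simp
  ultimately have "distributed P lborel (\<lambda>\<omega>. D (of_int b * mesh n) \<omega> - D (of_int (b - 1) * mesh n) \<omega>)
      (normal_density 0 (sqrt (of_int b * mesh n - of_int (b - 1) * mesh n)))"
    using D unfolding brownian_fdd_def by blast
  then show "distributed P lborel (\<lambda>\<omega>. block_incr (\<lambda>t. D t \<omega>) n b) (normal_density 0 (sqrt (mesh n)))"
    by (simp add: block_incr_def algebra_simps)
qed

lemma block_incr_split_noises:
  "block_incr (\<lambda>t. split_noises \<epsilon> (\<lambda>k. D k t) d) n b = split_noises \<epsilon> (\<lambda>k. block_incr (D k) n b) d"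
  by (simp add: block_incr_def split_noises_def algebra_simps)

text \<open>Independence across the three motions and across the increments of each is first merged
  into one family; the splitting is then applied separately on every block.\<close>

lemma split_noise_brownian:
  assumes \<epsilon>: "\<epsilon> > 0" and ibm: "independent_brownian_motions P W B1 B2"
  shows "split_noise P \<epsilon> (\<lambda>d t \<omega>. split_noises \<epsilon> (\<lambda>k. ([W, B1, B2] ! k) t \<omega>) d)"
proof -
  define D where "D k = [W, B1, B2] ! k" for k
  have fdd: "brownian_fdd P (D k)" if "k \<in> {0, 1, 2}" for k
    using ibm that by (auto simp: independent_brownian_motions_def standard_brownian_motion_def D_def)
  interpret prob_space P using fdd[of 0] by (simp add: brownian_fdd_def)
  have three: "{..<3} = {0, 1, 2 :: nat}" by auto
  have paths: "indep_vars (\<lambda>_. path_space) (\<lambda>k \<omega>. \<lambda>t\<in>{0..1}. D k t \<omega>) {0, 1, 2}"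
    using ibm by (simp only: independent_brownian_motions_def D_def three)
  let ?X = "\<lambda>n k b \<omega>. block_incr (\<lambda>t. D k t \<omega>) n b"
  have bt: "of_int b * mesh n \<in> {0..1}" "of_int (b - 1) * mesh n \<in> {0..1}" if "b \<in> {1..2 ^ n}" for b :: int and n
    using that of_int_mesh_le_one[of b n] of_int_mesh_le_one[of "b - 1" n] by auto
  have ind: "indep_vars (\<lambda>_. borel) (\<lambda>p. ?X n (snd p) (fst p)) ({1..2 ^ n} \<times> {0, 1, 2})" for n
  proof -
    have "(\<lambda>y. \<lambda>b\<in>{1..2 ^ n}. block_incr y n b) \<in> measurable path_space (PiM {1..2 ^ n} (\<lambda>_. borel))"
      unfolding block_incr_def using bt by (intro measurable_restrict borel_measurable_diff measurable_component_singleton) auto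
    from indep_vars_compose2[OF paths this]
    have "indep_vars (\<lambda>_. PiM {1..2 ^ n} (\<lambda>_. borel)) (\<lambda>k \<omega>. \<lambda>b\<in>{1..2 ^ n}. ?X n k b \<omega>) {0, 1, 2}"
      by (rule indep_vars_cong[THEN iffD1, rotated -1])
         (use bt in \<open>auto simp: block_incr_def fun_eq_iff restrict_def simp del: of_int_diff\<close>)
    then have "indep_vars (\<lambda>_. borel) (\<lambda>p. ?X n (fst p) (snd p)) ({0, 1, 2} \<times> {1..2 ^ n})"
      using indep_vars_ungroup[where I = "{0, 1, 2}" and C = "{1..2 ^ n}" and Y = "\<lambda>k b. ?X n k b" and N = "\<lambda>_. borel"]
        brownian_block_incr(1)[OF fdd] by simp
    also have "{0, 1, 2} \<times> {1..2 ^ n} = prod.swap ` ({1..2 ^ n} \<times> {0, 1, 2 :: nat})" by (simp add: product_swap)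
    finally show ?thesis by (rule indep_vars_reindex[of "\<lambda>_. borel" "\<lambda>p. ?X n (fst p) (snd p)" prod.swap, simplified])
  qed
  have law: "distributed P lborel (?X n k b) (normal_density 0 (sqrt (mesh n)))" if "k \<in> {0, 1, 2}" "b \<in> {1..2 ^ n}" for n k b
    by (rule brownian_block_incr(2)[OF fdd[OF that(1)] that(2)])
  have within: "indep_vars (\<lambda>_. borel) (\<lambda>k. ?X n k b) {0, 1, 2}" if "b \<in> {1..2 ^ n}" for n b
  proof -
    have "indep_vars (\<lambda>_. borel) (\<lambda>p. ?X n (snd p) (fst p)) ((\<lambda>k. (b, k)) ` {0, 1, 2})"
      by (rule indep_vars_subset[OF ind]) (use that in auto)
    from indep_vars_reindex[OF this] show ?thesis by (simp add: inj_on_def)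
  qed
  note sp = split_noises_indep[OF within _ \<epsilon> law]
  have mp: "sqrt (mesh n) > 0" for n by simp
  show ?thesis
    unfolding D_def[symmetric]
  proof (rule split_noise.intro[OF prob_space_axioms], unfold_locales)
    show "\<epsilon> > 0" by fact
    fix n
    let ?h = "\<lambda>b d v. split_noises \<epsilon> v d" and ?C = "{0, 1, 2 :: nat}"
    have restr: "split_noises \<epsilon> (\<lambda>k\<in>?C. g k) d = split_noises \<epsilon> g d" for g d by (simp add: split_noises_def)
    have "indep_vars (\<lambda>_. borel) (\<lambda>p \<omega>. ?h (fst p) (snd p) (\<lambda>k\<in>?C. ?X n k (fst p) \<omega>)) ({1..2 ^ n} \<times> ?C)"
    proof (rule indep_vars_blockwise[where X = "\<lambda>p. ?X n (snd p) (fst p)" and N = "\<lambda>_. borel" and N' = "\<lambda>_. borel" and h = ?h, unfolded fst_conv snd_conv])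
      fix d
      have "(\<lambda>v. v k) \<in> borel_measurable (PiM ?C (\<lambda>_. borel :: real measure))" if "k \<in> ?C" for k
        using that by (rule measurable_component_singleton)
      then show "?h b d \<in> borel_measurable (PiM ?C (\<lambda>_. borel))" for b :: int
        unfolding split_noises_def by (cases "d = 0"; cases "d = 1") (auto simp del: One_nat_def)
    next
      fix b :: int assume "b \<in> {1..2 ^ n}"
      then show "indep_vars (\<lambda>_. borel) (\<lambda>d \<omega>. ?h b d (\<lambda>k\<in>?C. ?X n k b \<omega>)) ?C"
        unfolding restr by (intro sp(1) mp)
    qed (use ind in auto)
    then show "indep_vars (\<lambda>_. borel) (\<lambda>p \<omega>. block_incr (\<lambda>t. split_noises \<epsilon> (\<lambda>k. D k t \<omega>) (snd p)) n (fst p)) ({1..2 ^ n} \<times> ?C)"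
      unfolding restr block_incr_split_noises .
  next
    fix c :: nat and n :: nat and b :: int assume "c \<in> {0, 1, 2}" "b \<in> {1..2 ^ n}"
    then have "distributed P lborel (\<lambda>\<omega>. split_noises \<epsilon> (\<lambda>k. ?X n k b \<omega>) c) (normal_density 0 (sqrt 3 * sqrt (mesh n) * \<epsilon>))"
      by (intro sp(2) mp)
    then show "distributed P lborel (\<lambda>\<omega>. block_incr (\<lambda>t. split_noises \<epsilon> (\<lambda>k. D k t \<omega>) c) n b)
        (normal_density 0 (sqrt (3 * mesh n) * \<epsilon>))"
      by (simp only: block_incr_split_noises real_sqrt_mult)
  qed
qed

theorem theorem3p3:
  "\<exists>C :: real. C > 0 \<and> (\<forall>\<epsilon> :: real. \<epsilon> > 0 \<longrightarrow> (\<forall>f \<in> convex_unique_min.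
     (\<forall>(P :: 'a measure) W B1 B2. independent_brownian_motions P W B1 B2 \<longrightarrow>
        (\<integral>\<^sup>+ \<omega>. ennreal \<bar>M_hat \<epsilon> (observation \<epsilon> f W) B1 B2 \<omega> - minval f\<bar> \<partial>P)
          < ennreal (449 * rho_m \<epsilon> f)) \<and>
     ennreal (449 * rho_m \<epsilon> f) \<le> ennreal C * R_m \<epsilon> f))"
proof (intro exI[of _ "449 * (32 * exp 4)"] conjI allI impI ballI)
  fix \<epsilon> :: real and f and P :: "'a measure" and W B1 B2
  assume \<epsilon>: "\<epsilon> > 0" and f: "f \<in> convex_unique_min" and ibm: "independent_brownian_motions P W B1 B2"
  let ?w = "\<lambda>d t \<omega>. split_noises \<epsilon> (\<lambda>k. ([W, B1, B2] ! k) t \<omega>) d"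
  interpret split_noise P \<epsilon> ?w by (rule split_noise_brownian[OF \<epsilon> ibm])
  interpret convex_min f by (rule convex_min.intro[OF f])
  interpret estimation P \<epsilon> ?w f by unfold_locales
  have "M_hat \<epsilon> (observation \<epsilon> f W) B1 B2 \<omega> =
      min_estimate \<epsilon> (\<lambda>t. drift f t + ?w 0 t \<omega>) (\<lambda>t. drift f t + ?w 1 t \<omega>) (\<lambda>t. drift f t + ?w 2 t \<omega>)" for \<omega>
    by (simp add: M_hat_def observation_def drift_def split_noises_def algebra_simps)
  then show "(\<integral>\<^sup>+ \<omega>. ennreal \<bar>M_hat \<epsilon> (observation \<epsilon> f W) B1 B2 \<omega> - minval f\<bar> \<partial>P) < ennreal (449 * rho_m \<epsilon> f)"
    using risk_less by simp
next
  fix \<epsilon> :: real and f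
  assume "\<epsilon> > 0" "f \<in> convex_unique_min"
  then show "ennreal (449 * rho_m \<epsilon> f) \<le> ennreal (449 * (32 * exp 4)) * R_m \<epsilon> f" by (rule rho_m_le_R_m)
qed simp

end
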